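(* Let $\mathcal{G}$ be a class of graphs and let $\mathcal{G}^*$ be the class of all prime induced subgraphs of graphs in $\mathcal{G}$. Assume that for each graph $G$ in $\mathcal{G}^*$ with $n$ vertices and $m\ge 1$ edges one can compute in time $f(n,m)$ a rational (resp. integer or unit) well-covering system of $G$ with size at most $n$, where $f$ is a superadditive function. Then for any graph $G$ in $\mathcal{G}$ with $n$ vertices and $m$ edges, one can compute in time $\mathcal{O}\big(f(2n,m)+n^{\omega+1}\big)$ a rational (resp. integer or unit) well-covering system of $G$ with size at most $n$.
   Context: All graphs are finite, simple, and undirected. A module in a graph $G$ is a nonempty set $M\subseteq V(G)$ such that every vertex not in $M$ is adjacent either to all vertices of $M$ or to none of them. A module $M$ is strong if for every other module $M'$ of $G$ we have $M\cap M'=\emptyset$, $M\subseteq M'$, or $M'\subseteq M$. A maximal strong module is an inclusion-maximal one among the strong modules properly contained in $V(G)$. A graph is prime if each of its maximal strong modules is a singleton. An independent set is a set of pairwise nonadjacent vertices; it is maximal if it is not contained in any larger independent set. A weight function $w:V(G)\to\mathbb{R}$ is a well-covered weighting of $G$ if all maximal independent sets $I$ of $G$ have the same weight $w(I)=\sum_{v\in I}w(v)$. A well-covering system of $G$ is a system $\mathcal{S}$ of homogeneous linear equations with real coefficients over the variables $\{x_v: v\in V(G)\}$ such that $w:V(G)\to\mathbb{R}$ is a well-covered weighting of $G$ if and only if setting $x_v=w(v)$ for all $v\in V(G)$ satisfies all equations of $\mathcal{S}$. Its size $|\mathcal{S}|$ is its number of equations. It is rational (resp. integer, unit) if all its coefficients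 are rational (resp. integers, in $\{-1,0,1\}$). A function $f:\mathbb{R}^+\times\mathbb{R}^+\to\mathbb{R}^+$ (with $\mathbb{R}^+$ the nonnegative reals) is superadditive if $f(x_1,y_1)+f(x_2,y_2)\le f(x_1+x_2,y_1+y_2)$ for all $x_1,y_1,x_2,y_2\in\mathbb{R}^+$. The symbol $\omega<2.373$ denotes the matrix multiplication exponent. *)

theory Defs
  imports "HOL-Analysis.Analysis" "HOL-Library.Ramsey"
begin

section \<open>Graphs and modules\<close>

type_synonym 'a ugraph = "'a set \<times> 'a set set"

abbreviation verts :: "'a ugraph \<Rightarrow> 'a set" where "verts G \<equiv> fst G"
abbreviation edges :: "'a ugraph \<Rightarrow> 'a set set" where "edges G \<equiv> snd G"

definition simple_graph :: "'a ugraph \<Rightarrow> bool" where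
  "simple_graph G \<longleftrightarrow> finite (verts G) \<and> edges G \<subseteq> [verts G]\<^bsup>2\<^esup>"

definition adjacent :: "'a ugraph \<Rightarrow> 'a \<Rightarrow> 'a \<Rightarrow> bool" where
  "adjacent G u v \<longleftrightarrow> {u, v} \<in> edges G"

definition induced_subgraph :: "'a ugraph \<Rightarrow> 'a ugraph \<Rightarrow> bool" where
  "induced_subgraph H G \<longleftrightarrow>
     verts H \<subseteq> verts G \<and> edges H = {e \<in> edges G. e \<subseteq> verts H}"

definition graph_module :: "'a ugraph \<Rightarrow> 'a set \<Rightarrow> bool" where
  "graph_module G M \<longleftrightarrow> M \<noteq> {} \<and> M \<subseteq> verts G \<and>
     (\<forall>u \<in> verts G - M. (\<forall>v\<in>M. adjacent G u v) \<or> (\<forall>v\<in>M. \<not> adjacent G u v))"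

definition strong_module :: "'a ugraph \<Rightarrow> 'a set \<Rightarrow> bool" where
  "strong_module G M \<longleftrightarrow> graph_module G M \<and>
     (\<forall>M'. graph_module G M' \<and> M' \<noteq> M \<longrightarrow> M \<inter> M' = {} \<or> M \<subseteq> M' \<or> M' \<subseteq> M)"

definition maximal_strong_module :: "'a ugraph \<Rightarrow> 'a set \<Rightarrow> bool" where
  "maximal_strong_module G M \<longleftrightarrow> strong_module G M \<and> M \<subset> verts G \<and>
     \<not> (\<exists>M'. strong_module G M' \<and> M' \<subset> verts G \<and> M \<subset> M')"

definition prime_graph :: "'a ugraph \<Rightarrow> bool" where
  "prime_graph G \<longleftrightarrow> (\<forall>M. maximal_strong_module G M \<longrightarrow> is_singleton M)"

definition prime_induced_subgraphs :: "'a ugraph set \<Rightarrow> 'a ugraph set" where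
  "prime_induced_subgraphs \<G> = {H. prime_graph H \<and> (\<exists>G\<in>\<G>. induced_subgraph H G)}"

section \<open>Well-covered weightings and well-covering systems\<close>

definition independent_set :: "'a ugraph \<Rightarrow> 'a set \<Rightarrow> bool" where
  "independent_set G I \<longleftrightarrow> I \<subseteq> verts G \<and> indep I (edges G)"

definition maximal_independent_set :: "'a ugraph \<Rightarrow> 'a set \<Rightarrow> bool" where
  "maximal_independent_set G I \<longleftrightarrow> independent_set G I \<and>
     \<not> (\<exists>J. independent_set G J \<and> I \<subset> J)"

text \<open>Weightings, and coefficients of equations, are functions on the whole vertex type;
  only their values on \<^term>\<open>verts G\<close> matter.\<close>

definition well_covered_weighting :: "'a ugraph \<Rightarrow> ('a \<Rightarrow> real) \<Rightarrow> bool" where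
  "well_covered_weighting G w \<longleftrightarrow>
     (\<forall>I J. maximal_independent_set G I \<and> maximal_independent_set G J \<longrightarrow> sum w I = sum w J)"

text \<open>The coefficient function \<^term>\<open>a\<close> stands for the homogeneous equation
  \<^term>\<open>(\<Sum>v\<in>verts G. a v * x v) = 0\<close>. The size of a system is its \<^const>\<open>length\<close>.\<close>

type_synonym 'a lin_system = "('a \<Rightarrow> real) list"

definition well_covering_system :: "'a ugraph \<Rightarrow> 'a lin_system \<Rightarrow> bool" where
  "well_covering_system G S \<longleftrightarrow>
     (\<forall>w. well_covered_weighting G w \<longleftrightarrow> (\<forall>a \<in> set S. (\<Sum>v\<in>verts G. a v * w v) = 0))"

definition rational_system :: "'a ugraph \<Rightarrow> 'a lin_system \<Rightarrow> bool" where
  "rational_system G S \<longleftrightarrow> (\<forall>a \<in> set S. \<forall>v \<in> verts G. a v \<in> \<rat>)"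

definition integer_system :: "'a ugraph \<Rightarrow> 'a lin_system \<Rightarrow> bool" where
  "integer_system G S \<longleftrightarrow> (\<forall>a \<in> set S. \<forall>v \<in> verts G. a v \<in> \<int>)"

definition unit_system :: "'a ugraph \<Rightarrow> 'a lin_system \<Rightarrow> bool" where
  "unit_system G S \<longleftrightarrow> (\<forall>a \<in> set S. \<forall>v \<in> verts G. a v \<in> {-1, 0, 1})"

definition superadditive :: "(real \<Rightarrow> real \<Rightarrow> real) \<Rightarrow> bool" where
  "superadditive f \<longleftrightarrow> (\<forall>x1\<ge>0. \<forall>y1\<ge>0. \<forall>x2\<ge>0. \<forall>y2\<ge>0.
     f x1 y1 + f x2 y2 \<le> f (x1 + x2) (y1 + y2))"

section \<open>Unit-cost arithmetic RAM\<close>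

text \<open>
  The machine model is the random access machine with exact rational arithmetic at unit cost
  (the model in which the arithmetic complexity of matrix multiplication and of Gaussian
  elimination is counted), with structured control flow. There is no rounding operation, and
  \<^term>\<open>Load\<close> and \<^term>\<open>Store\<close> are defined only if the cell used as a pointer holds a natural
  number; otherwise the program gets stuck. Division by zero yields zero, as in HOL.
\<close>

type_synonym memory = "nat \<Rightarrow> rat"

datatype arith_op = Plus | Minus | Times | Divide

fun arith :: "arith_op \<Rightarrow> rat \<Rightarrow> rat \<Rightarrow> rat" where
  "arith Plus x y = x + y"
| "arith Minus x y = x - y"
| "arith Times x y = x * y"
| "arith Divide x y = x / y"

datatype ram_test = Equal nat nat | Less nat nat

fun test :: "ram_test \<Rightarrow> memory \<Rightarrow> bool" where
  "test (Equal i j) s \<longleftrightarrow> s i = s j"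
| "test (Less i j) s \<longleftrightarrow> s i < s j"

datatype program =
    Skip
  | Const nat rat
  | Arith arith_op nat nat nat
  | Load nat nat
  | Store nat nat
  | Seq program program
  | Branch ram_test program program
  | While ram_test program

text \<open>\<^term>\<open>exec p s t s'\<close>: started in memory \<^term>\<open>s\<close>, the program \<^term>\<open>p\<close> halts after exactly
  \<^term>\<open>t\<close> elementary steps (instructions and tests) in memory \<^term>\<open>s'\<close>.\<close>

inductive exec :: "program \<Rightarrow> memory \<Rightarrow> nat \<Rightarrow> memory \<Rightarrow> bool" where
  exec_Skip: "exec Skip s 1 s"
| exec_Const: "exec (Const i q) s 1 (s(i := q))"
| exec_Arith: "exec (Arith b i j k) s 1 (s(i := arith b (s j) (s k)))"
| exec_Load: "s j = of_nat a \<Longrightarrow> exec (Load i j) s 1 (s(i := s a))"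
| exec_Store: "s i = of_nat a \<Longrightarrow> exec (Store i j) s 1 (s(a := s j))"
| exec_Seq: "exec p s t s' \<Longrightarrow> exec q s' t' s'' \<Longrightarrow> exec (Seq p q) s (t + t') s''"
| exec_BranchTrue: "test c s \<Longrightarrow> exec p s t s' \<Longrightarrow> exec (Branch c p q) s (Suc t) s'"
| exec_BranchFalse: "\<not> test c s \<Longrightarrow> exec q s t s' \<Longrightarrow> exec (Branch c p q) s (Suc t) s'"
| exec_WhileFalse: "\<not> test c s \<Longrightarrow> exec (While c p) s 1 s"
| exec_WhileTrue: "test c s \<Longrightarrow> exec p s t s' \<Longrightarrow> exec (While c p) s' t' s'' \<Longrightarrow>
    exec (While c p) s (Suc (t + t')) s''"

inductive_cases exec_SkipE: "exec Skip s t s'"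
inductive_cases exec_ConstE: "exec (Const i q) s t s'"
inductive_cases exec_ArithE: "exec (Arith b i j k) s t s'"
inductive_cases exec_LoadE: "exec (Load i j) s t s'"
inductive_cases exec_StoreE: "exec (Store i j) s t s'"
inductive_cases exec_SeqE: "exec (Seq p q) s t s'"
inductive_cases exec_BranchE: "exec (Branch c p q) s t s'"
inductive_cases exec_WhileE: "exec (While c p) s t s'"

lemma exec_deterministic:
  assumes "exec p s t s'" and "exec p s u s''"
  shows "t = u \<and> s' = s''"
  using assms
proof (induction arbitrary: u s'' rule: exec.induct)
  case (exec_Seq p s t s' q t' s2)
  from exec_Seq.prems obtain v v' r where
    "exec p s v r" "exec q r v' s''" "u = v + v'" by (rule exec_SeqE)
  with exec_Seq.IH show ?case by metis
next
  case (exec_WhileTrue c s p t s' t' s2)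
  from exec_WhileTrue.prems exec_WhileTrue.hyps(1) obtain v v' r where
    "exec p s v r" "exec (While c p) r v' s''" "u = Suc (v + v')" by (auto elim: exec_WhileE)
  with exec_WhileTrue.IH show ?case by metis
next
  case (exec_BranchTrue c s p t s' q)
  from exec_BranchTrue.prems exec_BranchTrue.hyps(1) obtain v where
    "exec p s v s''" "u = Suc v" by (auto elim: exec_BranchE)
  with exec_BranchTrue.IH show ?case by metis
next
  case (exec_BranchFalse c s q t s' p)
  from exec_BranchFalse.prems exec_BranchFalse.hyps(1) obtain v where
    "exec q s v s''" "u = Suc v" by (auto elim: exec_BranchE)
  with exec_BranchFalse.IH show ?case by metis
next
  case (exec_WhileFalse c s p)
  then show ?case by (auto elim: exec_WhileE)
next
  case (exec_Load s j a i)
  from exec_Load.prems exec_Load.hyps show ?case by (elim exec_LoadE) auto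
next
  case (exec_Store s i a j)
  from exec_Store.prems exec_Store.hyps show ?case by (elim exec_StoreE) auto
next
  case (exec_Skip s)
  then show ?case by (rule exec_SkipE) simp
next
  case (exec_Const i q s)
  then show ?case by (rule exec_ConstE) simp
next
  case (exec_Arith b i j k s)
  then show ?case by (rule exec_ArithE) simp
qed

definition initial_memory :: "rat list \<Rightarrow> memory" where
  "initial_memory xs = (\<lambda>a. if a < length xs then xs ! a else 0)"

definition memory_starts_with :: "memory \<Rightarrow> rat list \<Rightarrow> bool" where
  "memory_starts_with s xs \<longleftrightarrow> (\<forall>a < length xs. s a = xs ! a)"

section \<open>Encoding of graphs and systems\<close>

text \<open>A presentation of a graph numbers its vertices, \<^term>\<open>vs ! i\<close> having number \<^term>\<open>i\<close>, and
  lists every edge exactly once, in any order and in either orientation.\<close>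

definition presents :: "'a list \<Rightarrow> (nat \<times> nat) list \<Rightarrow> 'a ugraph \<Rightarrow> bool" where
  "presents vs es G \<longleftrightarrow>
     distinct vs \<and> set vs = verts G \<and>
     (\<forall>(i, j) \<in> set es. i < length vs \<and> j < length vs) \<and>
     distinct (map (\<lambda>(i, j). {vs ! i, vs ! j}) es) \<and>
     set (map (\<lambda>(i, j). {vs ! i, vs ! j}) es) = edges G"

definition encode_graph :: "'a list \<Rightarrow> (nat \<times> nat) list \<Rightarrow> rat list" where
  "encode_graph vs es =
     of_nat (length vs) # of_nat (length es) # concat (map (\<lambda>(i, j). [of_nat i, of_nat j]) es)"

text \<open>Systems are output in sparse form: an equation is a list of pairs of a vertex number and the
  coefficient at that vertex; vertices that are not listed have coefficient zero. Both the system
  and each of its equations are preceded by their length.\<close>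

type_synonym sparse_system = "(nat \<times> rat) list list"

definition sparse_for :: "nat \<Rightarrow> sparse_system \<Rightarrow> bool" where
  "sparse_for n E \<longleftrightarrow> (\<forall>e \<in> set E. distinct (map fst e) \<and> fst ` set e \<subseteq> {..<n})"

definition encode_system :: "sparse_system \<Rightarrow> rat list" where
  "encode_system E =
     of_nat (length E) #
     concat (map (\<lambda>e. of_nat (length e) # concat (map (\<lambda>(i, q). [of_nat i, q]) e)) E)"

definition denoted_system :: "'a list \<Rightarrow> sparse_system \<Rightarrow> 'a lin_system" where
  "denoted_system vs E =
     map (\<lambda>e v. \<Sum>(i, q) \<leftarrow> e. if vs ! i = v then of_rat q else 0) E"

text \<open>One program handles all graphs of the class \<^term>\<open>\<G>\<close>, for all presentations, in time at most
  \<^term>\<open>T n m\<close> on graphs with \<^term>\<open>n\<close> vertices and \<^term>\<open>m\<close> edges; its output is a well-covering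
  system of size at most \<^term>\<open>n\<close> whose coefficients are of the given kind.\<close>

definition computes_well_covering_systems ::
  "program \<Rightarrow> 'a ugraph set \<Rightarrow> ('a ugraph \<Rightarrow> 'a lin_system \<Rightarrow> bool) \<Rightarrow> (nat \<Rightarrow> nat \<Rightarrow> real) \<Rightarrow> bool"
where
  "computes_well_covering_systems p \<G> kind T \<longleftrightarrow>
     (\<forall>G \<in> \<G>. \<forall>vs es. presents vs es G \<longrightarrow>
       (\<exists>t s E. exec p (initial_memory (encode_graph vs es)) t s \<and>
          real t \<le> T (card (verts G)) (card (edges G)) \<and>
          sparse_for (card (verts G)) E \<and>
          memory_starts_with s (encode_system E) \<and>
          well_covering_system G (denoted_system vs E) \<and>
          kind G (denoted_system vs E) \<and>
          length (denoted_system vs E) \<le> card (verts G)))"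

section \<open>The matrix multiplication exponent\<close>

text \<open>Straight-line programs over the reals: every instruction appends one value to the list of
  values computed so far, which initially consists of the inputs.\<close>

datatype slp_instr = SConst real | SAdd nat nat | SSub nat nat | SMul nat nat

definition slp_arg :: "real list \<Rightarrow> nat \<Rightarrow> real" where
  "slp_arg xs i = (if i < length xs then xs ! i else 0)"

fun slp_value :: "slp_instr \<Rightarrow> real list \<Rightarrow> real" where
  "slp_value (SConst c) xs = c"
| "slp_value (SAdd i j) xs = slp_arg xs i + slp_arg xs j"
| "slp_value (SSub i j) xs = slp_arg xs i - slp_arg xs j"
| "slp_value (SMul i j) xs = slp_arg xs i * slp_arg xs j"

definition slp_run :: "slp_instr list \<Rightarrow> real list \<Rightarrow> real list" where
  "slp_run P xs = fold (\<lambda>c ys. ys @ [slp_value c ys]) P xs"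

text \<open>Matrices are functions of the row and column index; only the indices below \<^term>\<open>n\<close> matter.\<close>

definition matrix_entries :: "nat \<Rightarrow> (nat \<Rightarrow> nat \<Rightarrow> real) \<Rightarrow> real list" where
  "matrix_entries n A = concat (map (\<lambda>i. map (A i) [0..<n]) [0..<n])"

definition slp_multiplies :: "slp_instr list \<Rightarrow> nat \<Rightarrow> bool" where
  "slp_multiplies P n \<longleftrightarrow> (\<exists>out. \<forall>A B. \<forall>i<n. \<forall>j<n.
     slp_arg (slp_run P (matrix_entries n A @ matrix_entries n B)) (out i j) =
       (\<Sum>k<n. A i k * B k j))"

definition matrix_mult_exponent :: real (\<open>\<omega>\<close>) where
  "\<omega> = Inf {\<tau>. \<exists>C. \<forall>n\<ge>1. \<exists>P. slp_multiplies P n \<and> real (length P) \<le> C * real n powr \<tau>}"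

end

(* Let M be a module of G and contract it to one of its vertices. A weighting w of G is well covered
   iff its restriction to M is and the contracted graph is well covered when the new vertex gets the
   weight of some maximal independent set of M, which is linear in w. Splitting repeatedly leaves
   pieces without proper nontrivial modules; they are prime induced subgraphs of G with pairwise
   disjoint edge sets, and the numbers of their vertices minus one add up to n - 1, so that the sum
   of the numbers of vertices is at most 2n and superadditivity bounds the total time of the given
   program by f(2n, m). Substituting the linear expressions into the systems of the pieces gives a
   system of at most 2n equations for G, and a maximal independent subset of them (found by Gaussian
   elimination, but kept in their original form) has size at most n. Every coefficient is zero or a
   coefficient of one of the given systems, since every vertex occurs in at most one of the
   substituted expressions of a piece.

   The modules containing a vertex u are the sets {u} + S where S is closed under stepping from y to
   every x that distinguishes u from y. Hence, for an arbitrary w, the vertex u lies in a nontrivial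
   module iff not every vertex is reachable from w or w is not reachable from every vertex. Such a
   search takes quadratic time and either splits a piece or settles a vertex, so that linearly many
   searches suffice. Everything apart from the runs of the given program takes O(n^3) steps, and
   \<omega> is at least 2 because the product of two n x n matrices has n^2 different entries. *)

theory Submission
  imports Defs
begin

section \<open>Lower and upper bounds for straight-line matrix multiplication\<close>

subsection \<open>The exponent of matrix multiplication is at least two\<close>

text \<open>The obstacle that shapes the proof is the machine. Input, registers and output share one
  flat memory, and pointers can only be computed by exact arithmetic. Everything except the runs of
  the given program is therefore written in a small loop language in which all loops have the common
  bound \<open>4 * n\<close>, so that the time is a constant times
  \<open>(4 * n + 1) ^ depth\<close>; the programs are arranged so that the depth never exceeds
  three. The given program is a black box that may use arbitrarily large addresses. Each of its runs
  gets an unbounded memory of its own, a row of a two-dimensional array that an injective polynomial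
  folds into the flat memory; this multiplies its time by at most 60. The hypothesis covers only
  pieces with at least one edge. A graph without edges has a single maximal independent set, so the
  empty system is right for it, and such pieces and inputs are answered without a run. Pieces
  consist of numbered copies of vertices rather than of vertices, because one vertex may represent
  several nested modules and then occurs in several pieces.\<close>

lemma slp_run_Nil [simp]: "slp_run [] xs = xs"
  by (simp add: slp_run_def)

lemma slp_run_append: "slp_run (P @ Q) xs = slp_run Q (slp_run P xs)"
  by (simp add: slp_run_def)

lemma slp_run_snoc: "slp_run (P @ [c]) xs = slp_run P xs @ [slp_value c (slp_run P xs)]"
  by (simp add: slp_run_def)

lemma length_slp_run [simp]: "length (slp_run P xs) = length xs + length P"
  by (induction P rule: rev_induct) (auto simp: slp_run_snoc)

lemma slp_arg_run: "i < length xs \<Longrightarrow> slp_arg (slp_run P xs) i = slp_arg xs i"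
proof (induction P rule: rev_induct)
  case (snoc c P)
  then show ?case by (auto simp: slp_run_snoc slp_arg_def nth_append)
qed simp

lemma concat_uniform:
  assumes "\<And>l. l \<in> set ls \<Longrightarrow> length l = n"
  shows "length (concat ls) = length ls * n"
    and "i < length ls \<Longrightarrow> k < n \<Longrightarrow> concat ls ! (i * n + k) = ls ! i ! k"
proof -
  show "length (concat ls) = length ls * n"
    using assms by (induction ls) auto
  show "i < length ls \<Longrightarrow> k < n \<Longrightarrow> concat ls ! (i * n + k) = ls ! i ! k"
    using assms
  proof (induction ls arbitrary: i)
    case (Cons l ls)
    then show ?case by (cases i) (auto simp: nth_append)
  qed simp
qed

lemma length_matrix_entries [simp]: "length (matrix_entries n A) = n * n"
  unfolding matrix_entries_def by (subst concat_uniform(1)[where n = n]) auto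

lemma nth_matrix_entries:
  "i < n \<Longrightarrow> k < n \<Longrightarrow> matrix_entries n A ! (i * n + k) = A i k"
  unfolding matrix_entries_def by (subst concat_uniform(2)[where n = n]) auto

lemma index_less_square:
  fixes i k n :: nat
  assumes "i < n" "k < n"
  shows "i * n + k < n * n"
proof -
  have "i * n + k < i * n + n" using assms by simp
  also have "\<dots> = Suc i * n" by simp
  also have "\<dots> \<le> n * n" using assms by (intro mult_le_mono1) simp
  finally show ?thesis .
qed

lemma slp_arg_entries_constant:
  assumes "i < n * n + n * n"
  shows "slp_arg (matrix_entries n (\<lambda>_ _. c) @ matrix_entries n (\<lambda>_ _. c)) i = c"
proof -
  let ?L = "matrix_entries n (\<lambda>_ _. c) @ matrix_entries n (\<lambda>_ _. c)"
  have "?L ! i \<in> set ?L"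
    using assms by (intro nth_mem) simp
  moreover have "set ?L \<subseteq> {c}"
    by (auto simp: matrix_entries_def)
  ultimately have "?L ! i = c" by blast
  then show ?thesis using assms by (simp add: slp_arg_def)
qed

text \<open>Distinct entries of the product are distinct functions of the input, and none of them is
  an input, so they need \<open>n * n\<close> different instructions. The injection
  \<open>out\<close> into the positions after the inputs makes this a cardinality bound.\<close>

lemma slp_multiplies_length:
  assumes "slp_multiplies P n"
  shows "n * n \<le> length P"
proof -
  from assms obtain out where out: "\<And>A B i j. i < n \<Longrightarrow> j < n \<Longrightarrow>
     slp_arg (slp_run P (matrix_entries n A @ matrix_entries n B)) (out i j) =
       (\<Sum>k<n. A i k * B k j)"
    unfolding slp_multiplies_def by blast
  let ?g = "\<lambda>(i, j). out i j"
  have inj: "inj_on ?g ({..<n} \<times> {..<n})"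
  proof (rule inj_onI, clarsimp)
    fix i j i' j'
    assume h: "i < n" "j < n" "i' < n" "j' < n" "out i j = out i' j'"
    \<comment> \<open>With ones exactly in row i of the first factor and in column j of the second
      one, the product is n at (i, j) and zero elsewhere; equal positions therefore force equal
      indices.\<close>
    let ?A = "\<lambda>a k. if a = i then 1 else 0 :: real" and ?B = "\<lambda>k b. if b = j then 1 else 0 :: real"
    have "(\<Sum>k<n. ?A i' k * ?B k j') = (\<Sum>k<n. ?A i k * ?B k j)"
      using out[OF h(1,2), of ?A ?B] out[OF h(3,4), of ?A ?B] h(5) by simp
    then show "i = i' \<and> j = j'"
      using h by (auto split: if_splits)
  qed
  have "?g ` ({..<n} \<times> {..<n}) \<subseteq> {n * n + n * n ..< n * n + n * n + length P}"
  proof clarsimp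
    fix i j assume h: "i < n" "j < n"
    \<comment> \<open>Constant matrices show that an output is not an input: the entry is n c^2
      while every input is c, and c = n c^2 cannot hold for both c = 1 and c = 2. A position beyond
      the last value would read the default zero.\<close>
    have eq: "slp_arg (slp_run P (matrix_entries n (\<lambda>_ _. c) @ matrix_entries n (\<lambda>_ _. c))) (out i j)
        = real n * (c * c)" for c
      using out[OF h, of "\<lambda>_ _. c" "\<lambda>_ _. c"] by simp
    have "out i j < n * n + n * n + length P"
    proof (rule ccontr)
      assume "\<not> ?thesis"
      then have "real n * (1 * 1) = 0"
        using eq[of 1] by (simp add: slp_arg_def)
      then show False using h by simp
    qed
    moreover have "n * n + n * n \<le> out i j"
    proof (rule ccontr)
      assume "\<not> ?thesis"
      then have "c = real n * (c * c)" for c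
        using eq[of c] slp_arg_entries_constant[of "out i j" n c] by (simp add: slp_arg_run)
      from this[of 1] this[of 2] have "1 = real n" "2 = real n * 4" by simp_all
      then show False by linarith
    qed
    ultimately show "n * n + n * n \<le> out i j \<and> out i j < n * n + n * n + length P" by simp
  qed
  then have "card ({..<n} \<times> {..<n}) \<le> card {n * n + n * n ..< n * n + n * n + length P}"
    using card_inj_on_le[OF inj] by blast
  then show ?thesis by simp
qed

text \<open>After a constant zero, every term adds two instructions, the product and the new partial
  sum; hence the length \<open>2 * k + 1\<close> and the result at the last position
  \<open>L + 2 * k\<close>.\<close>

lemma slp_inner_product:
  assumes "\<And>t. t < k \<Longrightarrow> a t < L" "\<And>t. t < k \<Longrightarrow> b t < L"
  shows "\<exists>Q. length Q = 2 * k + 1 \<and> (\<forall>ys. length ys = L \<longrightarrow>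
     slp_arg (slp_run Q ys) (L + 2 * k) = (\<Sum>t<k. slp_arg ys (a t) * slp_arg ys (b t)))"
  using assms
proof (induction k)
  case 0
  show ?case
    by (rule exI[of _ "[SConst 0]"]) (auto simp: slp_run_def slp_arg_def nth_append)
next
  case (Suc k)
  then obtain Q where Q: "length Q = 2 * k + 1"
    "\<And>ys. length ys = L \<Longrightarrow>
     slp_arg (slp_run Q ys) (L + 2 * k) = (\<Sum>t<k. slp_arg ys (a t) * slp_arg ys (b t))"
    by (metis less_SucI)
  let ?Q = "(Q @ [SMul (a k) (b k)]) @ [SAdd (L + 2 * k) (L + 2 * k + 1)]"
  have "slp_arg (slp_run ?Q ys) (L + 2 * Suc k) = (\<Sum>t<Suc k. slp_arg ys (a t) * slp_arg ys (b t))"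
    if "length ys = L" for ys
  proof -
    let ?r = "slp_run Q ys" and ?p = "slp_arg ys (a k) * slp_arg ys (b k)"
    have r: "length ?r = L + 2 * k + 1" using that Q(1) by simp
    have p: "slp_value (SMul (a k) (b k)) ?r = ?p"
      using Suc.prems that by (simp add: slp_arg_run)
    have s: "slp_value (SAdd (L + 2 * k) (L + 2 * k + 1)) (?r @ [?p]) = slp_arg ?r (L + 2 * k) + ?p"
      using r by (simp add: slp_arg_def nth_append)
    show ?thesis
      unfolding slp_run_snoc p s using r Q(2)[OF that]
      by (simp add: slp_arg_def nth_append)
  qed
  then show ?case using Q(1) by (intro exI[of _ ?Q]) simp
qed

text \<open>The entry with row-major number r is computed by the r-th block of
  \<open>2 * n + 1\<close> instructions and stands at the end of that block. Later blocks only
  append, so earlier results keep their positions.\<close>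

lemma naive_slp_rows:
  assumes "n \<ge> 1" "q \<le> n * n"
  shows "\<exists>P. length P = q * (2 * n + 1) \<and> (\<forall>A B. \<forall>r<q.
     slp_arg (slp_run P (matrix_entries n A @ matrix_entries n B)) (2 * n * n + r * (2 * n + 1) + 2 * n) =
       (\<Sum>k<n. A (r div n) k * B k (r mod n)))"
  using assms(2)
proof (induction q)
  case (Suc q)
  then obtain P where P: "length P = q * (2 * n + 1)" "\<And>A B r. r < q \<Longrightarrow>
     slp_arg (slp_run P (matrix_entries n A @ matrix_entries n B)) (2 * n * n + r * (2 * n + 1) + 2 * n) =
       (\<Sum>k<n. A (r div n) k * B k (r mod n))" by auto
  let ?L = "2 * n * n + q * (2 * n + 1)"
  let ?a = "\<lambda>t. (q div n) * n + t" and ?b = "\<lambda>t. n * n + (t * n + q mod n)"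
  have qn: "q div n < n" "q mod n < n"
    using Suc.prems assms(1) by (auto intro: less_mult_imp_div_less)
  have ab: "?a t < n * n" "?b t < n * n + n * n" if "t < n" for t
    using index_less_square[OF qn(1) that] index_less_square[OF that qn(2)] by auto
  have "2 * n * n = n * n + n * n" by simp
  then have "?a t < ?L" "?b t < ?L" if "t < n" for t
    using ab[OF that] by linarith+
  from slp_inner_product[of n ?a ?L ?b, OF this]
  obtain Q where Q: "length Q = 2 * n + 1" "\<And>ys. length ys = ?L \<Longrightarrow>
     slp_arg (slp_run Q ys) (?L + 2 * n) = (\<Sum>t<n. slp_arg ys (?a t) * slp_arg ys (?b t))"
    by blast
  have "slp_arg (slp_run (P @ Q) (matrix_entries n A @ matrix_entries n B))
          (2 * n * n + r * (2 * n + 1) + 2 * n) = (\<Sum>k<n. A (r div n) k * B k (r mod n))"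
    if r: "r < Suc q" for A B r
  proof -
    let ?E = "matrix_entries n A @ matrix_entries n B"
    have l: "length (slp_run P ?E) = ?L" using P(1) by simp
    show ?thesis
    proof (cases "r = q")
      case True
      have "slp_arg (slp_run P ?E) (?a t) * slp_arg (slp_run P ?E) (?b t)
          = A (q div n) t * B t (q mod n)" if "t < n" for t
      proof -
        have "slp_arg (slp_run P ?E) (?a t) = A (q div n) t"
          using ab[OF that] qn that
          by (subst slp_arg_run) (auto simp: slp_arg_def nth_append nth_matrix_entries)
        moreover have "slp_arg (slp_run P ?E) (?b t) = B t (q mod n)"
          using ab[OF that] qn that
          by (subst slp_arg_run) (auto simp: slp_arg_def nth_append nth_matrix_entries)
        ultimately show ?thesis by simp
      qed
      then show ?thesis
        unfolding True slp_run_append using Q(2)[OF l] by simp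
    next
      case False
      then have rq: "r < q" using r by simp
      have "Suc r * (2 * n + 1) \<le> q * (2 * n + 1)"
        using rq by (intro mult_le_mono1) simp
      then have "2 * n * n + r * (2 * n + 1) + 2 * n < length (slp_run P ?E)"
        unfolding l by simp
      then show ?thesis
        unfolding slp_run_append using P(2)[OF rq, of A B] by (simp add: slp_arg_run)
    qed
  qed
  then show ?case using P(1) Q(1) by (intro exI[of _ "P @ Q"]) simp
qed simp

text \<open>Shows that 3 is an admissible exponent. Without such a witness the infimum that defines
  \<omega> might be one of the empty set.\<close>

lemma naive_slp_multiplies:
  assumes "n \<ge> 1"
  shows "\<exists>P. slp_multiplies P n \<and> length P \<le> 3 * n ^ 3"
proof -
  from naive_slp_rows[OF assms le_refl] obtain P where P: "length P = n * n * (2 * n + 1)"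
    "\<And>A B r. r < n * n \<Longrightarrow>
     slp_arg (slp_run P (matrix_entries n A @ matrix_entries n B)) (2 * n * n + r * (2 * n + 1) + 2 * n) =
       (\<Sum>k<n. A (r div n) k * B k (r mod n))" by blast
  have "slp_multiplies P n"
    unfolding slp_multiplies_def
  proof (intro exI allI impI)
    fix A B i j assume "i < n" "j < n"
    then show "slp_arg (slp_run P (matrix_entries n A @ matrix_entries n B))
        (2 * n * n + (i * n + j) * (2 * n + 1) + 2 * n) = (\<Sum>k<n. A i k * B k j)"
      using P(2)[OF index_less_square[of i n j], of A B] by simp
  qed
  moreover have "n * n * (2 * n + 1) \<le> n * n * (3 * n)"
    using assms by (intro mult_le_mono2) simp
  ultimately show ?thesis using P(1) by (auto simp: power3_eq_cube algebra_simps)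
qed

text \<open>If some \<tau> < 2 were admissible with constant C, the n^2 necessary instructions would
  bound n^(2 - \<tau>) by C for all n.\<close>

lemma matrix_mult_exponent_ge_2: "2 \<le> \<omega>"
proof -
  let ?S = "{\<tau>. \<exists>C. \<forall>n\<ge>1. \<exists>P. slp_multiplies P n \<and> real (length P) \<le> C * real n powr \<tau>}"
  have "3 \<in> ?S"
  proof (intro CollectI exI[of _ 3] allI impI)
    fix n :: nat assume n: "n \<ge> 1"
    then obtain P where "slp_multiplies P n" "length P \<le> 3 * n ^ 3"
      using naive_slp_multiplies by blast
    moreover from this have "real (length P) \<le> real (3 * n ^ 3)"
      using of_nat_le_iff by blast
    ultimately show "\<exists>P. slp_multiplies P n \<and> real (length P) \<le> 3 * real n powr 3"
      using n by (auto simp: powr_numeral)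
  qed
  moreover have "2 \<le> \<tau>" if "\<tau> \<in> ?S" for \<tau>
  proof (rule ccontr)
    assume t: "\<not> 2 \<le> \<tau>"
    from that obtain C where C: "\<And>n. n \<ge> 1 \<Longrightarrow> \<exists>P. slp_multiplies P n \<and> real (length P) \<le> C * real n powr \<tau>"
      by auto
    have bound: "real n powr (2 - \<tau>) \<le> C" if n: "n \<ge> 1" for n
    proof -
      obtain P where P: "slp_multiplies P n" "real (length P) \<le> C * real n powr \<tau>"
        using C[OF n] by blast
      have "real n powr 2 = real (n * n)" using n by (simp add: powr_numeral power2_eq_square)
      also have "\<dots> \<le> C * real n powr \<tau>"
        using slp_multiplies_length[OF P(1)] P(2) by linarith
      finally show ?thesis using n by (simp add: powr_diff field_simps)
    qed
    have "1 \<le> C" using bound[of 1] by simp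
    \<comment> \<open>Chosen so that \<open>x powr (2 - \<tau>)\<close> is \<open>C + 1\<close>;
      every n above x then violates the bound.\<close>
    define x where "x = (C + 1) powr (1 / (2 - \<tau>))"
    obtain n :: nat where n: "x < real n" using reals_Archimedean2 by blast
    have "x powr (2 - \<tau>) = C + 1"
      using t \<open>1 \<le> C\<close> by (simp add: x_def powr_powr)
    moreover have "0 < x" using \<open>1 \<le> C\<close> by (simp add: x_def)
    ultimately have "C + 1 \<le> real n powr (2 - \<tau>)"
      using powr_mono2[of "2 - \<tau>" x "real n"] n t by simp
    moreover have "n \<ge> 1" using n \<open>0 < x\<close> by (cases n) auto
    ultimately show False using bound[of n] by simp
  qed
  ultimately show ?thesis
    unfolding matrix_mult_exponent_def by (intro cInf_greatest) blast+
qed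

text \<open>Pays for the cubic overhead with the second term of the claimed running time.\<close>

lemma cube_le_powr_exponent:
  assumes "n \<ge> 1"
  shows "real n ^ 3 \<le> real n powr (\<omega> + 1)"
proof -
  have "real n ^ 3 = real n powr 3" using assms by (simp add: powr_numeral)
  also have "\<dots> \<le> real n powr (\<omega> + 1)"
    using assms matrix_mult_exponent_ge_2 by (intro powr_mono) auto
  finally show ?thesis .
qed

section \<open>Loop programs, their addresses and their compilation with running times\<close>

subsection \<open>A structured language with two-dimensional arrays\<close>

text \<open>A state has natural and rational variables and arrays; \<open>raw\<close> is the part of the memory between
  the registers and the arrays, which holds the input and later the output. All loops run equally
  often, so that the running time of a command depends on its text only; shorter loops test their
  bound in the body.\<close>

record hl_state =
  nv :: "nat \<Rightarrow> nat"
  qv :: "nat \<Rightarrow> rat"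
  arr :: "nat \<Rightarrow> nat \<Rightarrow> nat \<Rightarrow> rat"
  raw :: "nat \<Rightarrow> rat"

datatype hl_test = NLess nat nat | NEq nat nat | QLess nat nat | QEq nat nat

datatype cmd =
    Nop
  | NSet nat nat
  | NAdd nat nat nat
  | QSet nat rat
  | QOf nat nat
  | QArith arith_op nat nat nat
  | Read nat nat nat nat
  | Write nat nat nat nat
  | RawRead nat nat
  | RawWrite nat nat
  | Then cmd cmd  (infixr \<open>;;\<close> 60)
  | Cond hl_test cmd cmd
  | For nat cmd

fun hl_holds :: "hl_test \<Rightarrow> hl_state \<Rightarrow> bool" where
  "hl_holds (NLess x y) s \<longleftrightarrow> nv s x < nv s y"
| "hl_holds (NEq x y) s \<longleftrightarrow> nv s x = nv s y"
| "hl_holds (QLess x y) s \<longleftrightarrow> qv s x < qv s y"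
| "hl_holds (QEq x y) s \<longleftrightarrow> qv s x = qv s y"

definition set_nv :: "nat \<Rightarrow> nat \<Rightarrow> hl_state \<Rightarrow> hl_state" where
  "set_nv x k s = s\<lparr>nv := (nv s)(x := k)\<rparr>"

definition set_qv :: "nat \<Rightarrow> rat \<Rightarrow> hl_state \<Rightarrow> hl_state" where
  "set_qv x q s = s\<lparr>qv := (qv s)(x := q)\<rparr>"

definition set_arr :: "nat \<Rightarrow> nat \<Rightarrow> nat \<Rightarrow> rat \<Rightarrow> hl_state \<Rightarrow> hl_state" where
  "set_arr k i j q s = s\<lparr>arr := (arr s)(k := (arr s k)(i := (arr s k i)(j := q)))\<rparr>"

definition set_raw :: "nat \<Rightarrow> rat \<Rightarrow> hl_state \<Rightarrow> hl_state" where
  "set_raw a q s = s\<lparr>raw := (raw s)(a := q)\<rparr>"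

lemma select_set [simp]:
  "nv (set_nv x k s) y = (if y = x then k else nv s y)"
  "qv (set_nv x k s) = qv s" "arr (set_nv x k s) = arr s" "raw (set_nv x k s) = raw s"
  "qv (set_qv x q s) y = (if y = x then q else qv s y)"
  "nv (set_qv x q s) = nv s" "arr (set_qv x q s) = arr s" "raw (set_qv x q s) = raw s"
  "arr (set_arr l i j q s) l' = (if l' = l then (arr s l)(i := (arr s l i)(j := q)) else arr s l')"
  "nv (set_arr l i j q s) = nv s" "qv (set_arr l i j q s) = qv s" "raw (set_arr l i j q s) = raw s"
  "raw (set_raw a q s) b = (if b = a then q else raw s b)"
  "nv (set_raw a q s) = nv s" "qv (set_raw a q s) = qv s" "arr (set_raw a q s) = arr s"
  by (auto simp: set_nv_def set_qv_def set_arr_def set_raw_def)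

text \<open>Ten special cells followed by 40 integer and 40 rational variables, which occupy the
  even and the odd cells from 10 on.\<close>

definition reg_count :: nat where "reg_count = 90"

primrec written_nv :: "cmd \<Rightarrow> nat set" where
  "written_nv Nop = {}"
| "written_nv (NSet x k) = {x}"
| "written_nv (NAdd x y z) = {x}"
| "written_nv (QSet x q) = {}"
| "written_nv (QOf x y) = {}"
| "written_nv (QArith b x y z) = {}"
| "written_nv (Read x k i j) = {}"
| "written_nv (Write k i j x) = {}"
| "written_nv (RawRead x i) = {}"
| "written_nv (RawWrite i x) = {}"
| "written_nv (c ;; d) = written_nv c \<union> written_nv d"
| "written_nv (Cond t c d) = written_nv c \<union> written_nv d"
| "written_nv (For x c) = insert x (written_nv c)"

primrec written_qv :: "cmd \<Rightarrow> nat set" where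
  "written_qv Nop = {}"
| "written_qv (NSet x k) = {}"
| "written_qv (NAdd x y z) = {}"
| "written_qv (QSet x q) = {x}"
| "written_qv (QOf x y) = {x}"
| "written_qv (QArith b x y z) = {x}"
| "written_qv (Read x k i j) = {x}"
| "written_qv (Write k i j x) = {}"
| "written_qv (RawRead x i) = {x}"
| "written_qv (RawWrite i x) = {}"
| "written_qv (c ;; d) = written_qv c \<union> written_qv d"
| "written_qv (Cond t c d) = written_qv c \<union> written_qv d"
| "written_qv (For x c) = written_qv c"

primrec written_arr :: "cmd \<Rightarrow> nat set" where
  "written_arr Nop = {}"
| "written_arr (NSet x k) = {}"
| "written_arr (NAdd x y z) = {}"
| "written_arr (QSet x q) = {}"
| "written_arr (QOf x y) = {}"
| "written_arr (QArith b x y z) = {}"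
| "written_arr (Read x k i j) = {}"
| "written_arr (Write k i j x) = {k}"
| "written_arr (RawRead x i) = {}"
| "written_arr (RawWrite i x) = {}"
| "written_arr (c ;; d) = written_arr c \<union> written_arr d"
| "written_arr (Cond t c d) = written_arr c \<union> written_arr d"
| "written_arr (For x c) = written_arr c"

primrec writes_raw :: "cmd \<Rightarrow> bool" where
  "writes_raw Nop = False"
| "writes_raw (NSet x k) = False"
| "writes_raw (NAdd x y z) = False"
| "writes_raw (QSet x q) = False"
| "writes_raw (QOf x y) = False"
| "writes_raw (QArith b x y z) = False"
| "writes_raw (Read x k i j) = False"
| "writes_raw (Write k i j x) = False"
| "writes_raw (RawRead x i) = False"
| "writes_raw (RawWrite i x) = True"
| "writes_raw (c ;; d) = (writes_raw c \<or> writes_raw d)"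
| "writes_raw (Cond t c d) = (writes_raw c \<or> writes_raw d)"
| "writes_raw (For x c) = writes_raw c"

abbreviation var_ok :: "nat \<Rightarrow> bool" where "var_ok x \<equiv> x < 40"
abbreviation arr_ok :: "nat \<Rightarrow> bool" where "arr_ok k \<equiv> k < 16"

fun test_ok :: "hl_test \<Rightarrow> bool" where
  "test_ok (NLess x y) \<longleftrightarrow> var_ok x \<and> var_ok y"
| "test_ok (NEq x y) \<longleftrightarrow> var_ok x \<and> var_ok y"
| "test_ok (QLess x y) \<longleftrightarrow> var_ok x \<and> var_ok y"
| "test_ok (QEq x y) \<longleftrightarrow> var_ok x \<and> var_ok y"

primrec cmd_ok :: "cmd \<Rightarrow> bool" where
  "cmd_ok Nop \<longleftrightarrow> True"
| "cmd_ok (NSet x k) \<longleftrightarrow> var_ok x"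
| "cmd_ok (NAdd x y z) \<longleftrightarrow> var_ok x \<and> var_ok y \<and> var_ok z"
| "cmd_ok (QSet x q) \<longleftrightarrow> var_ok x"
| "cmd_ok (QOf x y) \<longleftrightarrow> var_ok x \<and> var_ok y"
| "cmd_ok (QArith b x y z) \<longleftrightarrow> var_ok x \<and> var_ok y \<and> var_ok z"
| "cmd_ok (Read x k i j) \<longleftrightarrow> var_ok x \<and> arr_ok k \<and> var_ok i \<and> var_ok j"
| "cmd_ok (Write k i j x) \<longleftrightarrow> var_ok x \<and> arr_ok k \<and> var_ok i \<and> var_ok j"
| "cmd_ok (RawRead x i) \<longleftrightarrow> var_ok x \<and> var_ok i"
| "cmd_ok (RawWrite i x) \<longleftrightarrow> var_ok x \<and> var_ok i"
| "cmd_ok (c ;; d) \<longleftrightarrow> cmd_ok c \<and> cmd_ok d"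
| "cmd_ok (Cond t c d) \<longleftrightarrow> test_ok t \<and> cmd_ok c \<and> cmd_ok d"
| "cmd_ok (For x c) \<longleftrightarrow> var_ok x \<and> x \<notin> written_nv c \<and> cmd_ok c"

text \<open>Twelve bounds the machine steps of every atomic command; the longest ones, the array
  accesses, take ten. The 2 of a loop covers the test and the increment in each round.\<close>

primrec cost :: "cmd \<Rightarrow> nat" where
  "cost Nop = 12"
| "cost (NSet x k) = 12"
| "cost (NAdd x y z) = 12"
| "cost (QSet x q) = 12"
| "cost (QOf x y) = 12"
| "cost (QArith b x y z) = 12"
| "cost (Read x k i j) = 12"
| "cost (Write k i j x) = 12"
| "cost (RawRead x i) = 12"
| "cost (RawWrite i x) = 12"
| "cost (c ;; d) = cost c + cost d"
| "cost (Cond t c d) = 1 + cost c + cost d"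
| "cost (For x c) = 2 + cost c"

primrec depth :: "cmd \<Rightarrow> nat" where
  "depth Nop = 0"
| "depth (NSet x k) = 0"
| "depth (NAdd x y z) = 0"
| "depth (QSet x q) = 0"
| "depth (QOf x y) = 0"
| "depth (QArith b x y z) = 0"
| "depth (Read x k i j) = 0"
| "depth (Write k i j x) = 0"
| "depth (RawRead x i) = 0"
| "depth (RawWrite i x) = 0"
| "depth (c ;; d) = max (depth c) (depth d)"
| "depth (Cond t c d) = max (depth c) (depth d)"
| "depth (For x c) = Suc (depth c)"

text \<open>Cell 1 holds the first address of the array area, cell 5 the common bound of all loops and
  cell 6 the number one; cells 0, 2, 3, 4 are scratch cells.\<close>

definition ncell :: "nat \<Rightarrow> nat" where "ncell x = 10 + 2 * x"
definition qcell :: "nat \<Rightarrow> nat" where "qcell x = 11 + 2 * x"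

fun seqs :: "program list \<Rightarrow> program" where
  "seqs [] = Skip"
| "seqs (p # ps) = Seq p (seqs ps)"

definition addr_code :: "nat \<Rightarrow> nat \<Rightarrow> nat \<Rightarrow> program" where
  "addr_code k ci cj = seqs [Arith Plus 2 ci cj, Arith Times 2 2 2, Arith Plus 2 2 cj,
     Const 3 16, Arith Times 2 2 3, Const 3 (of_nat k), Arith Plus 2 2 3, Arith Plus 2 2 1]"

fun compile_test :: "hl_test \<Rightarrow> ram_test" where
  "compile_test (NLess x y) = Less (ncell x) (ncell y)"
| "compile_test (NEq x y) = Equal (ncell x) (ncell y)"
| "compile_test (QLess x y) = Less (qcell x) (qcell y)"
| "compile_test (QEq x y) = Equal (qcell x) (qcell y)"

text \<open>The machine has no copy instruction, so \<open>QOf\<close> adds zero. Raw accesses are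
  checked against both ends of the raw area, so that they can never hit a register or an array
  cell.\<close>

primrec compile :: "cmd \<Rightarrow> program" where
  "compile Nop = Skip"
| "compile (NSet x k) = Const (ncell x) (of_nat k)"
| "compile (NAdd x y z) = Arith Plus (ncell x) (ncell y) (ncell z)"
| "compile (QSet x q) = Const (qcell x) q"
| "compile (QOf x y) = Seq (Const 2 0) (Arith Plus (qcell x) 2 (ncell y))"
| "compile (QArith b x y z) = Arith b (qcell x) (qcell y) (qcell z)"
| "compile (Read x k i j) = Seq (addr_code k (ncell i) (ncell j)) (Load (qcell x) 2)"
| "compile (Write k i j x) = Seq (addr_code k (ncell i) (ncell j)) (Store 2 (qcell x))"
| "compile (RawRead x i) = Seq (Const 2 (of_nat reg_count))
     (Branch (Less (ncell i) 2) (Const (qcell x) 0)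
       (Branch (Less (ncell i) 1) (Load (qcell x) (ncell i)) (Const (qcell x) 0)))"
| "compile (RawWrite i x) = Seq (Const 2 (of_nat reg_count))
     (Branch (Less (ncell i) 2) Skip
       (Branch (Less (ncell i) 1) (Store (ncell i) (qcell x)) Skip))"
| "compile (c ;; d) = Seq (compile c) (compile d)"
| "compile (Cond t c d) = Branch (compile_test t) (compile c) (compile d)"
| "compile (For x c) = Seq (Const (ncell x) 0)
     (While (Less (ncell x) 5) (Seq (compile c) (Arith Plus (ncell x) (ncell x) 6)))"

fun step1 :: "program \<Rightarrow> memory \<Rightarrow> memory" where
  "step1 (Const i q) s = s(i := q)"
| "step1 (Arith b i j k) s = s(i := arith b (s j) (s k))"
| "step1 p s = s"

fun is_step1 :: "program \<Rightarrow> bool" where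
  "is_step1 (Const i q) = True"
| "is_step1 (Arith b i j k) = True"
| "is_step1 p = False"

lemma exec_step1: "is_step1 p \<Longrightarrow> exec p s 1 (step1 p s)"
  using exec_Const exec_Arith by (cases p) auto

lemma exec_step1s:
  "\<forall>p\<in>set ps. is_step1 p \<Longrightarrow> exec (seqs ps) s (Suc (length ps)) (fold step1 ps s)"
proof (induction ps arbitrary: s)
  case Nil
  then show ?case using exec_Skip by simp
next
  case (Cons p ps)
  have "exec (seqs (p # ps)) s (1 + Suc (length ps)) (fold step1 ps (step1 p s))"
    unfolding seqs.simps using Cons by (intro exec_Seq[OF exec_step1]) auto
  then show ?case by simp
qed

text \<open>The value lies between the square of i + j and the next square, which determines i + j
  and then j. This pairing costs only two additions and one multiplication.\<close>

lemma pairing_inject: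
  fixes i j i' j' :: nat
  assumes "(i + j)\<^sup>2 + j = (i' + j')\<^sup>2 + j'"
  shows "i = i' \<and> j = j'"
proof -
  have mono: "(a + b)\<^sup>2 + b < (c + d)\<^sup>2 + d" if "a + b < c + d" for a b c d :: nat
  proof -
    have "(a + b)\<^sup>2 + b < (Suc (a + b))\<^sup>2" by (simp add: power2_eq_square)
    also have "\<dots> \<le> (c + d)\<^sup>2" using that by (intro power_mono) auto
    finally show ?thesis by simp
  qed
  have "i + j = i' + j'"
    using mono[of i j i' j'] mono[of i' j' i j] assms by (metis less_irrefl linorder_neqE_nat)
  then show ?thesis using assms by simp
qed

text \<open>\<open>B\<close> is the number of rounds of every loop and \<open>D\<close> the first
  address of the array area; the cells from \<open>reg_count\<close> up to but excluding
  \<open>D\<close> are the raw memory.\<close>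

locale machine =
  fixes B D :: nat
  assumes reg_count_le_D: "reg_count \<le> D"
begin

primrec run :: "cmd \<Rightarrow> hl_state \<Rightarrow> hl_state" where
  "run Nop s = s"
| "run (NSet x k) s = set_nv x k s"
| "run (NAdd x y z) s = set_nv x (nv s y + nv s z) s"
| "run (QSet x q) s = set_qv x q s"
| "run (QOf x y) s = set_qv x (of_nat (nv s y)) s"
| "run (QArith b x y z) s = set_qv x (arith b (qv s y) (qv s z)) s"
| "run (Read x k i j) s = set_qv x (arr s k (nv s i) (nv s j)) s"
| "run (Write k i j x) s = set_arr k (nv s i) (nv s j) (qv s x) s"
| "run (RawRead x i) s =
     set_qv x (if reg_count \<le> nv s i \<and> nv s i < D then raw s (nv s i) else 0) s"
| "run (RawWrite i x) s =
     (if reg_count \<le> nv s i \<and> nv s i < D then set_raw (nv s i) (qv s x) s else s)"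
| "run (c ;; d) s = run d (run c s)"
| "run (Cond t c d) s = (if hl_holds t s then run c s else run d s)"
| "run (For x c) s = ((\<lambda>t. set_nv x (Suc (nv t x)) (run c t)) ^^ B) (set_nv x 0 s)"

text \<open>Relative to \<open>D\<close>, the array number is the residue of the address modulo 16
  and the quotient is the pairing of the two indices. All sixteen arrays are thus unbounded in both
  dimensions.\<close>

definition addr :: "nat \<Rightarrow> nat \<Rightarrow> nat \<Rightarrow> nat" where
  "addr k i j = D + (16 * ((i + j)\<^sup>2 + j) + k)"

definition rel :: "hl_state \<Rightarrow> memory \<Rightarrow> bool" where
  "rel h s \<longleftrightarrow> s 1 = of_nat D \<and> s 5 = of_nat B \<and> s 6 = 1 \<and>
     (\<forall>x. var_ok x \<longrightarrow> s (ncell x) = of_nat (nv h x) \<and> s (qcell x) = qv h x) \<and>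
     (\<forall>k i j. arr_ok k \<longrightarrow> s (addr k i j) = arr h k i j) \<and>
     (\<forall>a. reg_count \<le> a \<and> a < D \<longrightarrow> s a = raw h a)"

lemma addr_inject:
  assumes "arr_ok k" "arr_ok k'" "addr k i j = addr k' i' j'"
  shows "k = k' \<and> i = i' \<and> j = j'"
proof -
  have e: "16 * ((i + j)\<^sup>2 + j) + k = 16 * ((i' + j')\<^sup>2 + j') + k'"
    using assms(3) by (simp add: addr_def)
  then have "(k + ((i + j)\<^sup>2 + j) * 16) mod 16 = (k' + ((i' + j')\<^sup>2 + j') * 16) mod 16"
    by (simp add: algebra_simps)
  then have "k = k'" using assms(1,2) unfolding mod_mult_self1 by simp
  then show ?thesis using e pairing_inject[of i j i' j'] by simp
qed

lemma D_ge: "90 \<le> D" using reg_count_le_D by (simp add: reg_count_def)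

lemma addr_ge: "D \<le> addr k i j" by (simp add: addr_def)

lemma addr_neq_reg: "a < 90 \<Longrightarrow> addr k i j \<noteq> a" "a < 90 \<Longrightarrow> a \<noteq> addr k i j"
  using addr_ge[of k i j] D_ge by auto

lemma cells_less: "var_ok x \<Longrightarrow> ncell x < 90" "var_ok x \<Longrightarrow> qcell x < 90"
  by (auto simp: ncell_def qcell_def)

lemma cells_neq:
  "a < 10 \<Longrightarrow> ncell x \<noteq> a" "a < 10 \<Longrightarrow> qcell x \<noteq> a"
  "a < 10 \<Longrightarrow> a \<noteq> ncell x" "a < 10 \<Longrightarrow> a \<noteq> qcell x"
  "ncell x \<noteq> qcell y" "qcell y \<noteq> ncell x"
  "ncell x = ncell y \<longleftrightarrow> x = y" "qcell x = qcell y \<longleftrightarrow> x = y"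
  unfolding ncell_def qcell_def by presburger+

lemma relD:
  assumes "rel h s"
  shows "s 1 = of_nat D" "s 5 = of_nat B" "s 6 = 1"
    "var_ok x \<Longrightarrow> s (ncell x) = of_nat (nv h x)" "var_ok x \<Longrightarrow> s (qcell x) = qv h x"
    "arr_ok k \<Longrightarrow> s (addr k i j) = arr h k i j"
    "reg_count \<le> a \<Longrightarrow> a < D \<Longrightarrow> s a = raw h a"
  using assms by (auto simp: rel_def)

text \<open>\<open>rel\<close> leaves the scratch cells free, so that address computations never
  disturb the represented state.\<close>

lemma rel_temp:
  assumes "rel h s" "c \<in> {0, 2, 3, 4}"
  shows "rel h (s(c := v))"
proof -
  have "c < 10" "c \<noteq> 1" "c \<noteq> 5" "c \<noteq> 6" using assms(2) by auto
  then show ?thesis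
    using assms(1) D_ge unfolding rel_def
    by (auto simp: cells_neq addr_neq_reg reg_count_def)
qed

lemma rel_nv:
  assumes "rel h s" "var_ok x" "v = of_nat k"
  shows "rel (set_nv x k h) (s(ncell x := v))"
  using assms D_ge cells_less[of x] unfolding rel_def
  by (auto simp: cells_neq addr_neq_reg reg_count_def)

lemma rel_qv:
  assumes "rel h s" "var_ok x"
  shows "rel (set_qv x v h) (s(qcell x := v))"
  using assms D_ge cells_less[of x] unfolding rel_def
  by (auto simp: cells_neq addr_neq_reg reg_count_def)

lemma rel_arr:
  assumes "rel h s" "arr_ok k"
  shows "rel (set_arr k i j v h) (s(addr k i j := v))"
  using assms D_ge cells_less addr_ge[of k i j] unfolding rel_def
  by (auto simp: addr_neq_reg dest: addr_inject)

lemma rel_raw: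
  assumes "rel h s" "reg_count \<le> a" "a < D"
  shows "rel (set_raw a v h) (s(a := v))"
proof -
  have "a \<noteq> addr k i j" for k i j using assms(3) addr_ge[of k i j] by simp
  moreover have "ncell x \<noteq> a" "qcell x \<noteq> a" if "var_ok x" for x
    using cells_less[OF that] assms(2) by (auto simp: reg_count_def)
  ultimately show ?thesis
    using assms unfolding rel_def by (auto simp: reg_count_def)
qed

lemma exec_addr_code:
  assumes "s ci = of_nat i" "s cj = of_nat j" "s 1 = of_nat D" "ci \<notin> {2, 3}" "cj \<notin> {2, 3}"
  shows "\<exists>v. exec (addr_code k ci cj) s 9 (s(2 := of_nat (addr k i j), 3 := v))"
proof -
  let ?ps = "[Arith Plus 2 ci cj, Arith Times 2 2 2, Arith Plus 2 2 cj,
     Const 3 16, Arith Times 2 2 3, Const 3 (of_nat k), Arith Plus 2 2 3, Arith Plus 2 2 1]"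
  have "exec (addr_code k ci cj) s (Suc (length ?ps)) (fold step1 ?ps s)"
    unfolding addr_code_def by (rule exec_step1s) simp
  moreover have "fold step1 ?ps s = s(2 := of_nat (addr k i j), 3 := of_nat k)"
  proof -
    have "rat_of_nat (addr k i j)
        = ((of_nat i + of_nat j) * (of_nat i + of_nat j) + of_nat j) * 16 + of_nat k + of_nat D"
      by (simp add: addr_def power2_eq_square)
    moreover have "ci \<noteq> 2" "cj \<noteq> 2" "ci \<noteq> 3" "cj \<noteq> 3" using assms by auto
    ultimately show ?thesis using assms(1-3) by (simp add: fun_upd_twist)
  qed
  moreover have "Suc (length ?ps) = 9" by simp
  ultimately show ?thesis by metis
qed

lemma exec_read:
  assumes r: "rel h s" and "s ci = of_nat i" "s cj = of_nat j" "ci \<notin> {2, 3}" "cj \<notin> {2, 3}"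
    and "var_ok x" "arr_ok k"
  shows "\<exists>s'. exec (Seq (addr_code k ci cj) (Load (qcell x) 2)) s 10 s' \<and>
    rel (set_qv x (arr h k i j) h) s'"
proof -
  obtain v where v: "exec (addr_code k ci cj) s 9 (s(2 := of_nat (addr k i j), 3 := v))"
    using exec_addr_code[of s ci i cj j k] assms relD(1)[OF r] by blast
  let ?s = "s(2 := of_nat (addr k i j), 3 := v)"
  have rr: "rel h ?s" using r by (simp add: rel_temp)
  have a: "?s (addr k i j) = arr h k i j" using relD(6)[OF rr] assms by blast
  have "exec (Load (qcell x) 2) ?s 1 (?s(qcell x := arr h k i j))"
    by (subst a[symmetric], rule exec_Load) simp
  from exec_Seq[OF v this]
  have "exec (Seq (addr_code k ci cj) (Load (qcell x) 2)) s 10 (?s(qcell x := arr h k i j))"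
    by (simp only: numeral_plus_one semiring_norm)
  then show ?thesis using rel_qv[OF rr assms(6)] by blast
qed

lemma exec_write:
  assumes r: "rel h s" and "s ci = of_nat i" "s cj = of_nat j" "ci \<notin> {2, 3}" "cj \<notin> {2, 3}"
    and "var_ok x" "arr_ok k"
  shows "\<exists>s'. exec (Seq (addr_code k ci cj) (Store 2 (qcell x))) s 10 s' \<and>
    rel (set_arr k i j (qv h x) h) s'"
proof -
  obtain v where v: "exec (addr_code k ci cj) s 9 (s(2 := of_nat (addr k i j), 3 := v))"
    using exec_addr_code[of s ci i cj j k] assms relD(1)[OF r] by blast
  let ?s = "s(2 := of_nat (addr k i j), 3 := v)"
  have rr: "rel h ?s" using r by (simp add: rel_temp)
  have a: "?s (qcell x) = qv h x" using relD(5)[OF rr] assms by blast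
  have "exec (Store 2 (qcell x)) ?s 1 (?s(addr k i j := qv h x))"
    by (subst a[symmetric], rule exec_Store) simp
  from exec_Seq[OF v this]
  have "exec (Seq (addr_code k ci cj) (Store 2 (qcell x))) s 10 (?s(addr k i j := qv h x))"
    by (simp only: numeral_plus_one semiring_norm)
  then show ?thesis using rel_arr[OF rr assms(7)] by blast
qed

lemma test_compile:
  "rel h s \<Longrightarrow> test_ok t \<Longrightarrow> test (compile_test t) s = hl_holds t h"
  by (cases t) (auto simp: relD)

lemma run_nv: "x \<notin> written_nv c \<Longrightarrow> nv (run c h) x = nv h x"
proof (induction c arbitrary: h)
  case (For y c)
  have "nv (((\<lambda>t. set_nv y (Suc (nv t y)) (run c t)) ^^ k) (set_nv y 0 h)) x = nv h x" for k
    using For by (induction k) auto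
  then show ?case by simp
qed auto

lemma run_qv: "x \<notin> written_qv c \<Longrightarrow> qv (run c h) x = qv h x"
proof (induction c arbitrary: h)
  case (For y c)
  have "qv (((\<lambda>t. set_nv y (Suc (nv t y)) (run c t)) ^^ k) (set_nv y 0 h)) x = qv h x" for k
    using For by (induction k) auto
  then show ?case by simp
qed auto

lemma run_arr: "k \<notin> written_arr c \<Longrightarrow> arr (run c h) k = arr h k"
proof (induction c arbitrary: h)
  case (For y c)
  have "arr (((\<lambda>t. set_nv y (Suc (nv t y)) (run c t)) ^^ l) (set_nv y 0 h)) k = arr h k" for l
    using For by (induction l) auto
  then show ?case by simp
qed auto

lemma run_raw: "\<not> writes_raw c \<Longrightarrow> raw (run c h) = raw h"
proof (induction c arbitrary: h)
  case (For y c)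
  have "raw (((\<lambda>t. set_nv y (Suc (nv t y)) (run c t)) ^^ l) (set_nv y 0 h)) = raw h" for l
    using For by (induction l) auto
  then show ?case by simp
qed auto

lemma exec_loop:
  assumes body: "\<And>h s. rel h s \<Longrightarrow> \<exists>t s'. exec p s t s' \<and> rel (run c h) s' \<and> t \<le> T"
    and x: "var_ok x" "x \<notin> written_nv c"
    and "rel h s" "nv h x + k = B"
  shows "\<exists>t s'. exec (While (Less (ncell x) 5) (Seq p (Arith Plus (ncell x) (ncell x) 6))) s t s' \<and>
     rel (((\<lambda>t. set_nv x (Suc (nv t x)) (run c t)) ^^ k) h) s' \<and> t \<le> 1 + k * (T + 2)"
  using assms(4,5)
proof (induction k arbitrary: h s)
  case 0
  then have "\<not> test (Less (ncell x) 5) s" using x by (auto simp: relD)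
  from exec_WhileFalse[OF this] show ?case using 0 by auto
next
  case (Suc k)
  then have tst: "test (Less (ncell x) 5) s" using x by (auto simp: relD)
  obtain t s1 where s1: "exec p s t s1" "rel (run c h) s1" "t \<le> T" using body[OF Suc.prems(1)] by blast
  let ?h = "set_nv x (Suc (nv h x)) (run c h)"
  have "exec (Arith Plus (ncell x) (ncell x) 6) s1 1 (s1(ncell x := arith Plus (s1 (ncell x)) (s1 6)))"
    by (rule exec_Arith)
  moreover have "rel ?h (s1(ncell x := arith Plus (s1 (ncell x)) (s1 6)))"
    using s1(2) x by (intro rel_nv) (auto simp: relD run_nv)
  ultimately obtain s2 where s2: "exec (Seq p (Arith Plus (ncell x) (ncell x) 6)) s (t + 1) s2" "rel ?h s2"
    using exec_Seq s1(1) by blast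
  have "nv ?h x + k = B" using Suc.prems(2) by simp
  from Suc.IH[OF s2(2) this] obtain u s3 where s3:
    "exec (While (Less (ncell x) 5) (Seq p (Arith Plus (ncell x) (ncell x) 6))) s2 u s3"
    "rel (((\<lambda>t. set_nv x (Suc (nv t x)) (run c t)) ^^ k) ?h) s3" "u \<le> 1 + k * (T + 2)" by blast
  have "rel (((\<lambda>t. set_nv x (Suc (nv t x)) (run c t)) ^^ Suc k) h) s3"
    using s3(2) unfolding funpow_Suc_right comp_apply by (simp add: x run_nv)
  moreover have "Suc (t + 1 + u) \<le> 1 + Suc k * (T + 2)" using s3(3) s1(3) by simp
  ultimately show ?case using exec_WhileTrue[OF tst s2(1) s3(1)] by blast
qed

lemma atomic:
  assumes "exec p s t s'" "rel h s'" "t \<le> 12"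
  shows "\<exists>t s'. exec p s t s' \<and> rel h s' \<and> t \<le> 12"
  using assms by blast

lemma atomic3:
  assumes "exec p s t s'" "rel h s'" "t \<le> 3"
  shows "\<exists>t s'. exec p s t s' \<and> rel h s' \<and> t \<le> 3"
  using assms by blast

text \<open>Each level of loops multiplies the time by at most \<open>B + 1\<close>, and smaller
  depths are raised to the maximum; the remaining factor depends on the text of the command
  only.\<close>

theorem compile_correct:
  assumes "cmd_ok c" "rel h s"
  shows "\<exists>t s'. exec (compile c) s t s' \<and> rel (run c h) s' \<and> t \<le> cost c * (B + 1) ^ depth c"
  using assms
proof (induction c arbitrary: h s)
  case Nop
  show ?case using atomic[OF exec_Skip Nop(2)] by simp
next
  case (NSet x k)
  then show ?case using atomic[OF exec_Const rel_nv, of h s x "of_nat k" k] by simp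
next
  case (NAdd x y z)
  then have "rel (run (NAdd x y z) h) (s(ncell x := arith Plus (s (ncell y)) (s (ncell z))))"
    unfolding run.simps by (intro rel_nv) (auto simp: relD)
  then show ?case using atomic[OF exec_Arith] by simp
next
  case (QSet x q)
  then show ?case using atomic[OF exec_Const rel_qv, of h s x q] by simp
next
  case (QOf x y)
  let ?s = "s(2 := 0)"
  have r: "rel h ?s" using QOf by (simp add: rel_temp)
  have "exec (compile (QOf x y)) s (1 + 1) (?s(qcell x := arith Plus (?s 2) (?s (ncell y))))"
    unfolding compile.simps by (rule exec_Seq[OF exec_Const exec_Arith])
  moreover have "arith Plus (?s 2) (?s (ncell y)) = of_nat (nv h y)"
    using r QOf by (simp add: relD cells_neq)
  moreover have "rel (run (QOf x y) h) (?s(qcell x := of_nat (nv h y)))"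
    using rel_qv[OF r] QOf by simp
  ultimately show ?case using atomic[of "compile (QOf x y)" s "1 + 1"] by simp
next
  case (QArith b x y z)
  then have "rel (run (QArith b x y z) h) (s(qcell x := arith b (s (qcell y)) (s (qcell z))))"
    unfolding run.simps using rel_qv by (auto simp: relD)
  then show ?case using atomic[OF exec_Arith] by simp
next
  case (Read x k i j)
  then obtain s' where "exec (compile (Read x k i j)) s 10 s'" "rel (run (Read x k i j) h) s'"
    using exec_read[of h s "ncell i" "nv h i" "ncell j" "nv h j" x k] by (auto simp: relD cells_neq)
  from atomic[OF this] show ?case by simp
next
  case (Write k i j x)
  then obtain s' where "exec (compile (Write k i j x)) s 10 s'" "rel (run (Write k i j x) h) s'"
    using exec_write[of h s "ncell i" "nv h i" "ncell j" "nv h j" x k] by (auto simp: relD cells_neq)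
  from atomic[OF this] show ?case by simp
next
  case (RawRead x i)
  let ?s = "s(2 := of_nat reg_count)"
  have r: "rel h ?s" using RawRead by (simp add: rel_temp)
  have i: "?s (ncell i) = of_nat (nv h i)" "?s 1 = of_nat D"
    using relD(4)[OF r, of i] relD(1)[OF r] RawRead.prems by auto
  have ok: "var_ok x" using RawRead by simp
  let ?b = "Branch (Less (ncell i) 1) (Load (qcell x) (ncell i)) (Const (qcell x) 0)"
  have "\<exists>t s'. exec (Branch (Less (ncell i) 2) (Const (qcell x) 0) ?b) ?s t s' \<and>
      rel (run (RawRead x i) h) s' \<and> t \<le> 3"
  proof (cases "nv h i < reg_count")
    case True
    then have tst: "test (Less (ncell i) 2) ?s" using i by simp
    have "rel (run (RawRead x i) h) (?s(qcell x := 0))"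
      using rel_qv[OF r ok, of 0] True by simp
    from atomic3[OF exec_BranchTrue[OF tst exec_Const] this] show ?thesis by simp
  next
    case False
    then have f: "\<not> test (Less (ncell i) 2) ?s" using i by simp
    show ?thesis
    proof (cases "nv h i < D")
      case True
      then have t: "test (Less (ncell i) 1) ?s" using i by simp
      have "?s (nv h i) = raw h (nv h i)"
        using relD(7)[OF r] False True by simp
      then have "rel (run (RawRead x i) h) (?s(qcell x := ?s (nv h i)))"
        using rel_qv[OF r ok, of "raw h (nv h i)"] False True by simp
      from atomic3[OF exec_BranchFalse[OF f exec_BranchTrue[OF t exec_Load[of ?s "ncell i" "nv h i" "qcell x", OF i(1)]]] this] show ?thesis by simp
    next
      case D: False
      then have t: "\<not> test (Less (ncell i) 1) ?s" using i by simp
      have "rel (run (RawRead x i) h) (?s(qcell x := 0))"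
        using rel_qv[OF r ok, of 0] D by simp
      from atomic3[OF exec_BranchFalse[OF f exec_BranchFalse[OF t exec_Const]] this] show ?thesis by simp
    qed
  qed
  then obtain t s' where ex: "exec (Branch (Less (ncell i) 2) (Const (qcell x) 0) ?b) ?s t s'"
    and r': "rel (run (RawRead x i) h) s'" "t \<le> 3" by blast
  have "exec (compile (RawRead x i)) s (1 + t) s'"
    unfolding compile.simps by (rule exec_Seq[OF exec_Const ex])
  from atomic[OF this \<open>rel (run (RawRead x i) h) s'\<close>] show ?case
    using \<open>t \<le> 3\<close> by (simp only: cost.simps depth.simps power_0 mult_1_right)
next
  case (RawWrite i x)
  let ?s = "s(2 := of_nat reg_count)"
  have r: "rel h ?s" using RawWrite by (simp add: rel_temp)
  have i: "?s (ncell i) = of_nat (nv h i)" "?s 1 = of_nat D"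
    using relD(4)[OF r, of i] relD(1)[OF r] RawWrite.prems by auto
  let ?b = "Branch (Less (ncell i) 1) (Store (ncell i) (qcell x)) Skip"
  have "\<exists>t s'. exec (Branch (Less (ncell i) 2) Skip ?b) ?s t s' \<and>
      rel (run (RawWrite i x) h) s' \<and> t \<le> 3"
  proof (cases "nv h i < reg_count")
    case True
    then have tst: "test (Less (ncell i) 2) ?s" using i by simp
    have "rel (run (RawWrite i x) h) ?s" using r True by simp
    from atomic3[OF exec_BranchTrue[OF tst exec_Skip] this] show ?thesis by simp
  next
    case False
    then have f: "\<not> test (Less (ncell i) 2) ?s" using i by simp
    show ?thesis
    proof (cases "nv h i < D")
      case True
      then have t: "test (Less (ncell i) 1) ?s" using i by simp
      have "?s (qcell x) = qv h x"
        using relD(5)[OF r] RawWrite by simp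
      then have "rel (run (RawWrite i x) h) (?s(nv h i := ?s (qcell x)))"
        using rel_raw[OF r, of "nv h i" "qv h x"] False True by simp
      from atomic3[OF exec_BranchFalse[OF f exec_BranchTrue[OF t exec_Store[of ?s "ncell i" "nv h i" "qcell x", OF i(1)]]] this] show ?thesis by simp
    next
      case D: False
      then have t: "\<not> test (Less (ncell i) 1) ?s" using i by simp
      have "rel (run (RawWrite i x) h) ?s" using r D by simp
      from atomic3[OF exec_BranchFalse[OF f exec_BranchFalse[OF t exec_Skip]] this] show ?thesis by simp
    qed
  qed
  then obtain t s' where ex: "exec (Branch (Less (ncell i) 2) Skip ?b) ?s t s'"
    and r': "rel (run (RawWrite i x) h) s'" "t \<le> 3" by blast
  have "exec (compile (RawWrite i x)) s (1 + t) s'"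
    unfolding compile.simps by (rule exec_Seq[OF exec_Const ex])
  from atomic[OF this \<open>rel (run (RawWrite i x) h) s'\<close>] show ?case
    using \<open>t \<le> 3\<close> by (simp only: cost.simps depth.simps power_0 mult_1_right)
next
  case (Then c d)
  have ok: "cmd_ok c" "cmd_ok d" using Then.prems(1) by auto
  obtain t s1 where 1: "exec (compile c) s t s1" "rel (run c h) s1" "t \<le> cost c * (B + 1) ^ depth c"
    using Then.IH(1)[OF ok(1) Then.prems(2)] by blast
  obtain u s2 where 2: "exec (compile d) s1 u s2" "rel (run d (run c h)) s2"
    "u \<le> cost d * (B + 1) ^ depth d"
    using Then.IH(2)[OF ok(2) 1(2)] by blast
  have "cost c * (B + 1) ^ depth c \<le> cost c * (B + 1) ^ max (depth c) (depth d)"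
    "cost d * (B + 1) ^ depth d \<le> cost d * (B + 1) ^ max (depth c) (depth d)"
    by (intro mult_le_mono2 power_increasing; simp)+
  then have "t + u \<le> cost (c ;; d) * (B + 1) ^ depth (c ;; d)"
    using 1(3) 2(3) unfolding cost.simps depth.simps distrib_right by linarith
  then show ?case using exec_Seq[OF 1(1) 2(1)] 2(2) by auto
next
  case (Cond b c d)
  have "cost c * (B + 1) ^ depth c \<le> cost c * (B + 1) ^ max (depth c) (depth d)"
    "cost d * (B + 1) ^ depth d \<le> cost d * (B + 1) ^ max (depth c) (depth d)"
    by (intro mult_le_mono2 power_increasing; simp)+
  moreover have "1 \<le> (B + 1) ^ max (depth c) (depth d)" by simp
  ultimately have *: "Suc t \<le> cost (Cond b c d) * (B + 1) ^ depth (Cond b c d)"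
    if "t \<le> cost c * (B + 1) ^ depth c \<or> t \<le> cost d * (B + 1) ^ depth d" for t
    using that unfolding cost.simps depth.simps distrib_right mult_1 by linarith
  show ?case
  proof (cases "hl_holds b h")
    case True
    then have tst: "test (compile_test b) s" using test_compile Cond by auto
    from Cond obtain t s1 where 1: "exec (compile c) s t s1" "rel (run c h) s1"
      "t \<le> cost c * (B + 1) ^ depth c" by (meson cmd_ok.simps)
    have "exec (compile (Cond b c d)) s (Suc t) s1"
      unfolding compile.simps by (rule exec_BranchTrue[OF tst 1(1)])
    then show ?thesis using 1(2) *[of t] 1(3) True by auto
  next
    case False
    then have tst: "\<not> test (compile_test b) s" using test_compile Cond by auto
    from Cond obtain t s1 where 1: "exec (compile d) s t s1" "rel (run d h) s1"
      "t \<le> cost d * (B + 1) ^ depth d" by (meson cmd_ok.simps)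
    have "exec (compile (Cond b c d)) s (Suc t) s1"
      unfolding compile.simps by (rule exec_BranchFalse[OF tst 1(1)])
    then show ?thesis using 1(2) *[of t] 1(3) False by auto
  qed
next
  case (For x c)
  let ?T = "cost c * (B + 1) ^ depth c"
  have r: "rel (set_nv x 0 h) (s(ncell x := 0))" using For.prems by (intro rel_nv) auto
  have "\<exists>t s'. exec (While (Less (ncell x) 5) (Seq (compile c) (Arith Plus (ncell x) (ncell x) 6)))
       (s(ncell x := 0)) t s' \<and> rel (run (For x c) h) s' \<and> t \<le> 1 + B * (?T + 2)"
    unfolding run.simps
    by (rule exec_loop[OF _ _ _ r]) (use For in auto)
  then obtain t s' where *: "exec (While (Less (ncell x) 5) (Seq (compile c) (Arith Plus (ncell x) (ncell x) 6)))
       (s(ncell x := 0)) t s'" "rel (run (For x c) h) s'" "t \<le> 1 + B * (?T + 2)" by blast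
  have "1 \<le> (B + 1) ^ depth c" by simp
  \<comment> \<open>The two additional steps per round are absorbed because the power is at least
    1.\<close>
  then have "?T + 2 \<le> (2 + cost c) * (B + 1) ^ depth c"
    unfolding distrib_right by linarith
  then have "(B + 1) * (?T + 2) \<le> (B + 1) * ((2 + cost c) * (B + 1) ^ depth c)"
    by (rule mult_le_mono2)
  also have "\<dots> = cost (For x c) * (B + 1) ^ depth (For x c)" by (simp add: algebra_simps)
  finally have "1 + t \<le> cost (For x c) * (B + 1) ^ depth (For x c)" using *(3) by (simp add: distrib_right)
  then show ?case using exec_Seq[OF exec_Const *(1)] *(2) by auto
qed

end

section \<open>Invariant rules for bounded loops\<close>

subsection \<open>Loop invariants\<close>

text \<open>Frame condition for a loop: since its start, only what the body may write has changed.
  If \<open>r\<close> is true, nothing is claimed about the raw memory.\<close>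

definition agree :: "nat set \<Rightarrow> nat set \<Rightarrow> nat set \<Rightarrow> bool \<Rightarrow> hl_state \<Rightarrow> hl_state \<Rightarrow> bool" where
  "agree N Q A r s t \<longleftrightarrow> (\<forall>x. x \<notin> N \<longrightarrow> nv t x = nv s x) \<and> (\<forall>x. x \<notin> Q \<longrightarrow> qv t x = qv s x) \<and>
     (\<forall>k. k \<notin> A \<longrightarrow> arr t k = arr s k) \<and> (r \<or> raw t = raw s)"

definition ForLess :: "nat \<Rightarrow> nat \<Rightarrow> cmd \<Rightarrow> cmd" where
  "ForLess x b c = For x (Cond (NLess x b) c Nop)"

lemma ForLess_simps [simp]:
  "written_nv (ForLess x b c) = insert x (written_nv c)"
  "written_qv (ForLess x b c) = written_qv c"
  "written_arr (ForLess x b c) = written_arr c"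
  "writes_raw (ForLess x b c) = writes_raw c"
  by (auto simp: ForLess_def)

context machine
begin

text \<open>The counter is set outside of the body, so an invariant has to be stable under changes
  of \<open>x\<close>; the number of finished rounds is its explicit argument instead. The step may
  use the counter value and the frame condition, which keeps constants and untouched arrays out of
  the invariants.\<close>

lemma For_inv:
  assumes x: "x \<notin> written_nv c"
    and ins: "\<And>k t v. I k t \<Longrightarrow> I k (set_nv x v t)"
    and init: "I 0 s"
    and step: "\<And>k t. k < B \<Longrightarrow> nv t x = k \<Longrightarrow>
      agree (insert x (written_nv c)) (written_qv c) (written_arr c) (writes_raw c) s t \<Longrightarrow>
      I k t \<Longrightarrow> I (Suc k) (run c t)"
  shows "I B (run (For x c) s)"
proof -
  let ?f = "\<lambda>t. set_nv x (Suc (nv t x)) (run c t)"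
  have "k \<le> B \<longrightarrow> I k ((?f ^^ k) (set_nv x 0 s)) \<and> nv ((?f ^^ k) (set_nv x 0 s)) x = k \<and>
    agree (insert x (written_nv c)) (written_qv c) (written_arr c) (writes_raw c) s ((?f ^^ k) (set_nv x 0 s))" for k
  proof (induction k)
    case 0
    then show ?case using ins[OF init, of 0] by (simp add: agree_def)
  next
    case (Suc k)
    let ?t = "(?f ^^ k) (set_nv x 0 s)"
    have "I (Suc k) (?f ?t) \<and> nv (?f ?t) x = Suc k \<and>
      agree (insert x (written_nv c)) (written_qv c) (written_arr c) (writes_raw c) s (?f ?t)" if "Suc k \<le> B"
    proof -
      from Suc that have *: "I k ?t" "nv ?t x = k"
        "agree (insert x (written_nv c)) (written_qv c) (written_arr c) (writes_raw c) s ?t" by auto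
      have "agree (insert x (written_nv c)) (written_qv c) (written_arr c) (writes_raw c) s (?f ?t)"
        using *(3) unfolding agree_def by (auto simp: run_nv run_qv run_arr run_raw)
      then show ?thesis using step[of k ?t] ins * that by auto
    qed
    then show ?case unfolding funpow.simps comp_apply by blast
  qed
  then show ?thesis by simp
qed

lemma ForLess_inv:
  assumes x: "x \<notin> written_nv c" "b \<notin> written_nv c" "x \<noteq> b" "nv s b \<le> B"
    and ins: "\<And>k t v. I k t \<Longrightarrow> I k (set_nv x v t)"
    and init: "I 0 s"
    and step: "\<And>k t. k < nv s b \<Longrightarrow> nv t x = k \<Longrightarrow>
      agree (insert x (written_nv c)) (written_qv c) (written_arr c) (writes_raw c) s t \<Longrightarrow>
      I k t \<Longrightarrow> I (Suc k) (run c t)"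
  shows "I (nv s b) (run (ForLess x b c) s)"
proof -
  have "I (min B (nv s b)) (run (ForLess x b c) s)"
    unfolding ForLess_def
  \<comment> \<open>The rounds beyond the smaller bound do nothing, so the invariant stays at
    \<open>min k (nv s b)\<close>.\<close>
  proof (rule For_inv[where I = "\<lambda>k. I (min k (nv s b))"], goal_cases)
    case (4 k t)
    have b: "nv t b = nv s b" using 4(3) x by (simp add: agree_def)
    show ?case
    proof (cases "k < nv s b")
      case True
      then show ?thesis using step[of k t] 4 b by (simp add: min_absorb1)
    next
      case False
      then show ?thesis using 4 b by (simp add: min_absorb2)
    qed
  qed (use x ins init in auto)
  then show ?thesis using x(4) by (simp add: min_absorb2)
qed

end

section \<open>Relocation of the cells that input and output share with the registers\<close>

subsection \<open>Moving the input and the output\<close>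

text \<open>A home for the input and output cells that lie in the register area: d, 2 d, 4 d and so
  on can be visited in order by doubling a single pointer.\<close>

definition slot :: "nat \<Rightarrow> nat \<Rightarrow> nat" where
  "slot d a = (if a < reg_count then d * 2 ^ a else a)"

primrec save_code :: "nat \<Rightarrow> nat \<Rightarrow> program" where
  "save_code a 0 = Skip"
| "save_code a (Suc k) = Seq (Seq (Store 1 a) (Arith Plus 1 1 1)) (save_code (Suc a) k)"

primrec restore_code :: "nat \<Rightarrow> nat \<Rightarrow> program" where
  "restore_code a 0 = Skip"
| "restore_code a (Suc k) = Seq (Seq (Load a 1) (Arith Plus 1 1 1)) (restore_code (Suc a) k)"

text \<open>With \<open>n\<close> and \<open>m \<ge> 1\<close> in cells 0 and 1, the pointer in cell 1 becomes a multiple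
  \<open>d * 2 ^ a\<close> of \<open>d = m * n * n * 2 ^ reg_count\<close>, which lies beyond the input, so that the input
  cells in the register area can be saved without any free register.\<close>

definition prologue :: program where
  "prologue = Seq (seqs ([Arith Times 1 1 0, Arith Times 1 1 0] @ replicate (reg_count + 2) (Arith Plus 1 1 1)))
     (Seq (save_code 2 (reg_count - 2))
       (seqs (map (\<lambda>i. Const i 0) [2..<reg_count] @
         [Const 2 4, Arith Times 5 0 2, Const 6 1, Const 2 0, Arith Plus (ncell 1) 0 2,
          Const 2 (2 ^ reg_count), Arith Divide (ncell 2) 1 2])))"

definition epilogue :: program where
  "epilogue = Seq (seqs [Const 0 0, Arith Plus 0 0 (ncell 2), Arith Plus 1 0 0, Arith Plus 1 1 1])
     (Seq (restore_code 2 (reg_count - 2)) (Seq (Arith Plus 1 0 0) (Seq (Load 1 1) (Load 0 0))))"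

text \<open>The targets are distinct and lie beyond the registers since
  \<open>reg_count \<le> d\<close>, so no source is overwritten before it is saved. The final
  pointer \<open>d * 2 ^ (a + k)\<close> is worth keeping: for \<open>a + k = reg_count\<close> it
  is the base of the array area.\<close>

lemma save_code_correct:
  assumes "s 1 = of_nat (d * 2 ^ a)" "2 \<le> a" "a + k \<le> reg_count" "reg_count \<le> d"
  shows "\<exists>s'. exec (save_code a k) s (2 * k + 1) s' \<and> s' 1 = of_nat (d * 2 ^ (a + k)) \<and>
    (\<forall>i. a \<le> i \<and> i < a + k \<longrightarrow> s' (d * 2 ^ i) = s i) \<and>
    (\<forall>b. b \<noteq> 1 \<and> (\<forall>i. a \<le> i \<and> i < a + k \<longrightarrow> b \<noteq> d * 2 ^ i) \<longrightarrow> s' b = s b)"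
  using assms
proof (induction k arbitrary: a s)
  case 0
  then show ?case using exec_Skip by fastforce
next
  case (Suc k)
  have big: "reg_count \<le> d * 2 ^ i" for i
    using Suc.prems(4) by (metis le_trans mult_le_mono2 nat_mult_1_right one_le_numeral one_le_power)
  have d0: "0 < d" using Suc.prems(4) by (simp add: reg_count_def)
  let ?s1 = "s(d * 2 ^ a := s a)"
  let ?s2 = "?s1(1 := arith Plus (?s1 1) (?s1 1))"
  have "d * 2 ^ a \<noteq> 1" using big[of a] unfolding reg_count_def by linarith
  have e1: "?s1 1 = s 1" using \<open>d * 2 ^ a \<noteq> 1\<close> by (metis fun_upd_other)
  have s21: "?s2 1 = of_nat (d * 2 ^ Suc a)"
    unfolding fun_upd_same arith.simps e1 Suc.prems(1) by simp
  have e: "exec (Seq (Store 1 a) (Arith Plus 1 1 1)) s (1 + 1) ?s2"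
    by (intro exec_Seq[OF exec_Store exec_Arith] Suc.prems(1))
  have le1: "2 \<le> Suc a" and le2: "Suc a + k \<le> reg_count" using Suc.prems(2,3) by auto
  obtain s' where s': "exec (save_code (Suc a) k) ?s2 (2 * k + 1) s'" "s' 1 = of_nat (d * 2 ^ (Suc a + k))"
    "\<And>i. Suc a \<le> i \<and> i < Suc a + k \<Longrightarrow> s' (d * 2 ^ i) = ?s2 i"
    "\<And>b. b \<noteq> 1 \<and> (\<forall>i. Suc a \<le> i \<and> i < Suc a + k \<longrightarrow> b \<noteq> d * 2 ^ i) \<Longrightarrow> s' b = ?s2 b"
    using Suc.IH[of ?s2 "Suc a", OF s21 le1 le2 Suc.prems(4)] by blast
  have inj: "d * 2 ^ i = d * 2 ^ j \<longleftrightarrow> i = j" for i j using d0 by simp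
  have "exec (save_code a (Suc k)) s (1 + 1 + (2 * k + 1)) s'"
    unfolding save_code.simps by (rule exec_Seq[OF e s'(1)])
  moreover have "s' (d * 2 ^ i) = s i" if "a \<le> i \<and> i < a + Suc k" for i
  proof (cases "i = a")
    case True
    have "d * 2 ^ a \<noteq> 1 \<and> (\<forall>i. Suc a \<le> i \<and> i < Suc a + k \<longrightarrow> d * 2 ^ a \<noteq> d * 2 ^ i)"
      using \<open>d * 2 ^ a \<noteq> 1\<close> inj by auto
    from s'(4)[OF this] show ?thesis
      unfolding True fun_upd_other[OF \<open>d * 2 ^ a \<noteq> 1\<close>] fun_upd_same .
  next
    case False
    then have "i \<noteq> 1" "i \<noteq> d * 2 ^ a" using that Suc.prems(2,3) big[of a] by auto
    then show ?thesis using s'(3)[of i] False that by simp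
  qed
  moreover have "s' b = s b" if "b \<noteq> 1 \<and> (\<forall>i. a \<le> i \<and> i < a + Suc k \<longrightarrow> b \<noteq> d * 2 ^ i)" for b
    using s'(4)[of b] that by auto
  ultimately show ?case using s'(2) by (intro exI[of _ s']) simp
qed

lemma restore_code_correct:
  assumes "s 1 = of_nat (d * 2 ^ a)" "2 \<le> a" "a + k \<le> reg_count" "reg_count \<le> d"
  shows "\<exists>s'. exec (restore_code a k) s (2 * k + 1) s' \<and>
    (\<forall>i. a \<le> i \<and> i < a + k \<longrightarrow> s' i = s (d * 2 ^ i)) \<and>
    (\<forall>b. b \<noteq> 1 \<and> (b < a \<or> a + k \<le> b) \<longrightarrow> s' b = s b)"
  using assms
proof (induction k arbitrary: a s)
  case 0
  then show ?case using exec_Skip by fastforce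
next
  case (Suc k)
  have big: "reg_count \<le> d * 2 ^ i" for i
    using Suc.prems(4) by (metis le_trans mult_le_mono2 nat_mult_1_right one_le_numeral one_le_power)
  let ?s1 = "s(a := s (d * 2 ^ a))"
  let ?s2 = "?s1(1 := arith Plus (?s1 1) (?s1 1))"
  have s21: "?s2 1 = of_nat (d * 2 ^ Suc a)" using Suc.prems(1,2) by simp
  have e: "exec (Seq (Load a 1) (Arith Plus 1 1 1)) s (1 + 1) ?s2"
    by (intro exec_Seq[OF exec_Load exec_Arith] Suc.prems(1))
  have le1: "2 \<le> Suc a" and le2: "Suc a + k \<le> reg_count" using Suc.prems(2,3) by auto
  obtain s' where s': "exec (restore_code (Suc a) k) ?s2 (2 * k + 1) s'"
    "\<And>i. Suc a \<le> i \<and> i < Suc a + k \<Longrightarrow> s' i = ?s2 (d * 2 ^ i)"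
    "\<And>b. b \<noteq> 1 \<and> (b < Suc a \<or> Suc a + k \<le> b) \<Longrightarrow> s' b = ?s2 b"
    using Suc.IH[of ?s2 "Suc a", OF s21 le1 le2 Suc.prems(4)] by blast
  have "exec (restore_code a (Suc k)) s (1 + 1 + (2 * k + 1)) s'"
    unfolding restore_code.simps by (rule exec_Seq[OF e s'(1)])
  moreover have "s' i = s (d * 2 ^ i)" if "a \<le> i \<and> i < a + Suc k" for i
  proof (cases "i = a")
    case True
    then show ?thesis using s'(3)[of a] Suc.prems(2) by simp
  next
    case False
    have "d * 2 ^ i \<noteq> 1" "d * 2 ^ i \<noteq> a"
      using big[of i] Suc.prems(3) unfolding reg_count_def by linarith+
    then show ?thesis using s'(2)[of i] False that by simp
  qed
  moreover have "s' b = s b" if "b \<noteq> 1 \<and> (b < a \<or> a + Suc k \<le> b)" for b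
    using s'(3)[of b] that by auto
  ultimately show ?case by (intro exI[of _ s']) simp
qed

lemma fold_double: "fold step1 (replicate k (Arith Plus 1 1 1)) s = s(1 := 2 ^ k * s 1)"
proof (induction k arbitrary: s)
  case (Suc k)
  then show ?case by (simp add: fun_eq_iff)
qed simp

lemma fold_clear: "fold step1 (map (\<lambda>i. Const i 0) is) s = (\<lambda>b. if b \<in> set is then 0 else s b)"
  by (induction "is" arbitrary: s) (auto simp: fun_eq_iff)

lemma prologue_correct:
  assumes s0: "s0 0 = of_nat n" "s0 1 = of_nat m" "\<And>a. 2 * m + 2 \<le> a \<Longrightarrow> s0 a = 0"
    and "1 \<le> n" "1 \<le> m" and d: "d = m * n * n * 2 ^ reg_count"
  defines "D \<equiv> d * 2 ^ reg_count"
  shows "machine D"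
    and "\<exists>t s. exec prologue s0 t s \<and> t \<le> 500 \<and>
      machine.rel (4 * n) D \<lparr>nv = (\<lambda>_. 0)(1 := n, 2 := d), qv = \<lambda>_. 0, arr = \<lambda>_ _ _. 0, raw = s\<rparr> s \<and>
      (\<forall>a. 2 \<le> a \<and> a < d \<longrightarrow> s (slot d a) = s0 a)"
proof -
  have "1 * (1 * 1) \<le> m * (n * n)" using assms(4,5) by (intro mult_le_mono) auto
  then have "1 * 2 ^ reg_count \<le> d" unfolding d by (simp add: mult.assoc)
  then have dR: "reg_count \<le> d" by (simp add: reg_count_def)
  have "m * 1 \<le> m * (n * n)" using assms(4) by (intro mult_le_mono) auto
  then have "m * 1 * 2 ^ reg_count \<le> d" unfolding d mult.assoc using assms(4) by (intro mult_le_mono) auto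
  then have dm: "2 * m + 2 \<le> d" using assms(5) by (simp add: reg_count_def)
  have d0: "0 < d" using dm by simp
  have "d * 1 \<le> D" unfolding D_def by (intro mult_le_mono2) simp
  then have dD: "d \<le> D" by simp
  then have RD: "reg_count \<le> D" using dR by simp
  then show mach: "machine D" by unfold_locales
  \<comment> \<open>Two multiplications and \<open>reg_count + 2\<close> doublings turn m into
    \<open>d * 2 ^ 2\<close>, the slot of cell 2, which is the first one to be saved.\<close>
  let ?A = "[Arith Times 1 1 0, Arith Times 1 1 0] @ replicate (reg_count + 2) (Arith Plus 1 1 1)"
  let ?s1 = "s0(1 := of_nat (d * 2 ^ 2))"
  have "fold step1 ?A s0 = ?s1"
    unfolding fold_append comp_apply fold_double using s0 by (simp add: d fun_eq_iff power_add)
  moreover have "exec (seqs ?A) s0 (Suc (length ?A)) (fold step1 ?A s0)"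
    by (rule exec_step1s) auto
  ultimately have A: "exec (seqs ?A) s0 (Suc (length ?A)) ?s1" by simp
  obtain s2 where s2: "exec (save_code 2 (reg_count - 2)) ?s1 (2 * (reg_count - 2) + 1) s2"
    "s2 1 = of_nat (d * 2 ^ (2 + (reg_count - 2)))"
    "\<And>i. 2 \<le> i \<and> i < 2 + (reg_count - 2) \<Longrightarrow> s2 (d * 2 ^ i) = ?s1 i"
    "\<And>b. b \<noteq> 1 \<and> (\<forall>i. 2 \<le> i \<and> i < 2 + (reg_count - 2) \<longrightarrow> b \<noteq> d * 2 ^ i) \<Longrightarrow> s2 b = ?s1 b"
    using save_code_correct[of ?s1 d 2 "reg_count - 2"] dR by (auto simp: reg_count_def)
  have R2: "2 + (reg_count - 2) = reg_count" by (simp add: reg_count_def)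
  note s2 = s2[unfolded R2]
  \<comment> \<open>After the saving, cell 1 holds \<open>D\<close>, and \<open>d\<close> is
    recovered by an exact division. Cell 5 receives the loop bound 4 n; instances and pieces
    together never exceed 3 n.\<close>
  let ?Z = "map (\<lambda>i. Const i 0) [2..<reg_count] @
         [Const 2 4, Arith Times 5 0 2, Const 6 1, Const 2 0, Arith Plus (ncell 1) 0 2,
          Const 2 (2 ^ reg_count), Arith Divide (ncell 2) 1 2]"
  define s3 where "s3 = fold step1 ?Z s2"
  have Z: "exec (seqs ?Z) s2 (Suc (length ?Z)) s3" unfolding s3_def by (rule exec_step1s) auto
  have small: "b \<noteq> d * 2 ^ i" if "b < d" for b i
  proof -
    have "d * 1 \<le> d * 2 ^ i" by (intro mult_le_mono2) simp
    then show ?thesis using that by linarith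
  qed
  have s20: "s2 0 = of_nat n" using s2(4)[of 0] small[of 0] d0 s0(1) by simp
  have s21: "s2 1 = of_nat D" using s2(2) by (simp add: D_def)
  define g where "g = (\<lambda>b. if 2 \<le> b \<and> b < reg_count then 0 else s2 b)"
  have g: "fold step1 (map (\<lambda>i. Const i 0) [2..<reg_count]) s2 = g"
    unfolding fold_clear g_def by simp
  have g01: "g 0 = of_nat n" "g 1 = of_nat D" using s20 s21 by (simp_all add: g_def)
  have "rat_of_nat D / 2 ^ reg_count = of_nat d" by (simp add: D_def)
  then have s3_eq: "s3 = g(5 := of_nat (4 * n), 6 := 1, 12 := of_nat n, 14 := of_nat d, 2 := 2 ^ reg_count)"
    unfolding s3_def fold_append comp_apply g using g01 by (simp add: fun_eq_iff ncell_def)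
  have s3R: "s3 b = s2 b" if "reg_count \<le> b" for b
    unfolding s3_eq unfolding g_def using that by (simp add: reg_count_def)
  have ex: "exec prologue s0 (Suc (length ?A) + ((2 * (reg_count - 2) + 1) + Suc (length ?Z))) s3"
    unfolding prologue_def by (intro exec_Seq[OF A] exec_Seq[OF s2(1)] Z)
  have time: "Suc (length ?A) + ((2 * (reg_count - 2) + 1) + Suc (length ?Z)) \<le> 500"
    by (simp add: reg_count_def)
  have "machine.rel (4 * n) D \<lparr>nv = (\<lambda>_. 0)(1 := n, 2 := d), qv = \<lambda>_. 0, arr = \<lambda>_ _ _. 0, raw = s3\<rparr> s3"
    unfolding machine.rel_def[OF mach]
  proof (intro conjI allI impI)
    show "s3 1 = of_nat D" "s3 5 = of_nat (4 * n)" "s3 6 = 1"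
      unfolding s3_eq unfolding g_def using s21 by (simp_all add: reg_count_def)
    show "s3 (ncell x) = of_nat (nv \<lparr>nv = (\<lambda>_. 0)(1 := n, 2 := d), qv = \<lambda>_. 0, arr = \<lambda>_ _ _. 0, raw = s3\<rparr> x)"
      if "var_ok x" for x
      unfolding s3_eq unfolding g_def ncell_def using that by (simp add: reg_count_def)
    show "s3 (qcell x) = qv \<lparr>nv = (\<lambda>_. 0)(1 := n, 2 := d), qv = \<lambda>_. 0, arr = \<lambda>_ _ _. 0, raw = s3\<rparr> x"
      if "var_ok x" for x
      unfolding s3_eq unfolding g_def qcell_def using that by (simp add: reg_count_def) presburger
    fix k i j
    \<comment> \<open>Array cells lie beyond the input and beyond all slots, hence they are still
      zero.\<close>
    have aD: "D \<le> machine.addr D k i j" by (simp add: machine.addr_def[OF mach])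
    have "machine.addr D k i j \<noteq> d * 2 ^ l" if "l < reg_count" for l
    proof -
      have "(2::nat) ^ l < 2 ^ reg_count" using that by simp
      then have "d * 2 ^ l < D" unfolding D_def using d0 by simp
      then show ?thesis using aD by simp
    qed
    moreover have "machine.addr D k i j \<noteq> 1" using aD RD by (simp add: reg_count_def)
    ultimately have "s2 (machine.addr D k i j) = s0 (machine.addr D k i j)" using s2(4) by simp
    also have "\<dots> = 0" using s0(3) aD dD dm by simp
    finally show "s3 (machine.addr D k i j)
      = arr \<lparr>nv = (\<lambda>_. 0)(1 := n, 2 := d), qv = \<lambda>_. 0, arr = \<lambda>_ _ _. 0, raw = s3\<rparr> k i j"
      using s3R aD RD by simp
  qed simp
  moreover have "s3 (slot d a) = s0 a" if a: "2 \<le> a \<and> a < d" for a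
  proof (cases "a < reg_count")
    case True
    have "d * 1 \<le> d * 2 ^ a" by (intro mult_le_mono2) simp
    then have "reg_count \<le> d * 2 ^ a" using dR by linarith
    from s3R[OF this] show ?thesis using True s2(3)[of a] a by (simp add: slot_def)
  next
    case False
    then show ?thesis using s3R[of a] s2(4)[of a] small[of a] a by (simp add: slot_def)
  qed
  ultimately show "\<exists>t s. exec prologue s0 t s \<and> t \<le> 500 \<and>
      machine.rel (4 * n) D \<lparr>nv = (\<lambda>_. 0)(1 := n, 2 := d), qv = \<lambda>_. 0, arr = \<lambda>_ _ _. 0, raw = s\<rparr> s \<and>
      (\<forall>a. 2 \<le> a \<and> a < d \<longrightarrow> s (slot d a) = s0 a)"
    using ex time by blast
qed

text \<open>Cells 0 and 1 serve as pointers until the very end: cell 1 is loaded through its own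
  content 2 d, and finally cell 0 through its own content d.\<close>

lemma epilogue_correct:
  assumes "s (ncell 2) = of_nat d" "reg_count \<le> d"
  shows "\<exists>t s'. exec epilogue s t s' \<and> t \<le> 500 \<and> (\<forall>a. s' a = s (slot d a))"
proof -
  let ?A = "[Const 0 0, Arith Plus 0 0 (ncell 2), Arith Plus 1 0 0, Arith Plus 1 1 1]"
  let ?s1 = "s(0 := of_nat d, 1 := of_nat (d * 2 ^ 2))"
  have big: "reg_count \<le> d * 2 ^ i" for i
    using assms(2) by (metis le_trans mult_le_mono2 nat_mult_1_right one_le_numeral one_le_power)
  have "fold step1 ?A s = ?s1" using assms(1) by (simp add: fun_eq_iff ncell_def)
  moreover have "exec (seqs ?A) s (Suc (length ?A)) (fold step1 ?A s)"
    by (rule exec_step1s) auto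
  ultimately have A: "exec (seqs ?A) s (Suc (length ?A)) ?s1" by simp
  obtain s2 where s2: "exec (restore_code 2 (reg_count - 2)) ?s1 (2 * (reg_count - 2) + 1) s2"
    "\<And>i. 2 \<le> i \<and> i < 2 + (reg_count - 2) \<Longrightarrow> s2 i = ?s1 (d * 2 ^ i)"
    "\<And>b. b \<noteq> 1 \<and> (b < 2 \<or> 2 + (reg_count - 2) \<le> b) \<Longrightarrow> s2 b = ?s1 b"
    using restore_code_correct[of ?s1 d 2 "reg_count - 2"] assms(2) by (auto simp: reg_count_def)
  have R2: "2 + (reg_count - 2) = reg_count" by (simp add: reg_count_def)
  note s2 = s2[unfolded R2]
  let ?s3 = "s2(1 := arith Plus (s2 0) (s2 0))"
  have s20: "s2 0 = of_nat d" using s2(3)[of 0] by simp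
  then have s31: "?s3 1 = of_nat (d * 2 ^ 1)" by simp
  let ?s4 = "?s3(1 := ?s3 (d * 2 ^ 1))"
  have s40: "?s4 0 = of_nat (d * 2 ^ 0)" using s20 by simp
  let ?s5 = "?s4(0 := ?s4 (d * 2 ^ 0))"
  have ex: "exec epilogue s (Suc (length ?A) + ((2 * (reg_count - 2) + 1) + (1 + (1 + 1)))) ?s5"
    unfolding epilogue_def
    by (intro exec_Seq[OF A] exec_Seq[OF s2(1)] exec_Seq[OF exec_Arith]
        exec_Seq[OF exec_Load[of ?s3 1 "d * 2 ^ 1" 1, OF s31]] exec_Load[of ?s4 0 "d * 2 ^ 0" 0, OF s40])
  have nr: "d * 2 ^ i \<noteq> 0" "d * 2 ^ i \<noteq> 1" for i
    using big[of i] unfolding reg_count_def by linarith+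
  have s1: "?s1 (d * 2 ^ i) = s (d * 2 ^ i)" for i
    by (simp only: fun_upd_other nr not_False_eq_True)
  have s2big: "s2 (d * 2 ^ i) = s (d * 2 ^ i)" for i
    using s2(3)[of "d * 2 ^ i"] big[of i] nr[of i] s1 by simp
  have "?s5 a = s (slot d a)" for a
  proof -
    consider "a = 0" | "a = 1" | "2 \<le> a" "a < reg_count" | "reg_count \<le> a" by linarith
    then show ?thesis
    proof cases
      case 1
      then show ?thesis using nr[of 0] s2big[of 0] by (simp add: slot_def reg_count_def)
    next
      case 2
      then show ?thesis using nr[of 1] s2big[of 1] by (simp add: slot_def reg_count_def)
    next
      case 3
      then show ?thesis using s2(2)[of a] s1[of a] by (simp add: slot_def)
    next
      case 4
      then show ?thesis using s2(3)[of a] by (simp add: slot_def reg_count_def)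
    qed
  qed
  moreover have "Suc (length ?A) + ((2 * (reg_count - 2) + 1) + (1 + (1 + 1))) \<le> 500"
    by (simp add: reg_count_def)
  ultimately show ?thesis using ex by blast
qed

section \<open>Simulation of a machine on a row of an array\<close>

subsection \<open>Running a given program inside a row of an array\<close>

text \<open>Row \<open>c\<close> of array 0 is the memory of the \<open>c\<close>-th run; integer variable 3 holds \<open>c\<close>.\<close>

definition rd_code :: "nat \<Rightarrow> nat \<Rightarrow> program" where
  "rd_code x i = Seq (Const 4 (of_nat i)) (Seq (addr_code 0 (ncell 3) 4) (Load (qcell x) 2))"

definition wr_code :: "nat \<Rightarrow> nat \<Rightarrow> program" where
  "wr_code i x = Seq (Const 4 (of_nat i)) (Seq (addr_code 0 (ncell 3) 4) (Store 2 (qcell x)))"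

fun rd_test :: "ram_test \<Rightarrow> program" where
  "rd_test (Equal i j) = Seq (rd_code 0 i) (rd_code 1 j)"
| "rd_test (Less i j) = Seq (rd_code 0 i) (rd_code 1 j)"

fun tr_test :: "ram_test \<Rightarrow> ram_test" where
  "tr_test (Equal i j) = Equal (qcell 0) (qcell 1)"
| "tr_test (Less i j) = Less (qcell 0) (qcell 1)"

text \<open>Every access of the given program is redirected to the current row. A test can only
  compare cells of the machine, so the operands of a loop test are fetched before the loop and again
  at the end of each round.\<close>

primrec tr :: "program \<Rightarrow> program" where
  "tr Skip = Skip"
| "tr (Const i q) = Seq (Const (qcell 0) q) (wr_code i 0)"
| "tr (Arith b i j k) =
     Seq (rd_code 0 j) (Seq (rd_code 1 k) (Seq (Arith b (qcell 0) (qcell 0) (qcell 1)) (wr_code i 0)))"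
| "tr (Load i j) = Seq (rd_code 0 j)
     (Seq (Seq (addr_code 0 (ncell 3) (qcell 0)) (Load (qcell 0) 2)) (wr_code i 0))"
| "tr (Store i j) = Seq (rd_code 0 i) (Seq (rd_code 1 j)
     (Seq (addr_code 0 (ncell 3) (qcell 0)) (Store 2 (qcell 1))))"
| "tr (Seq p q) = Seq (tr p) (tr q)"
| "tr (Branch c p q) = Seq (rd_test c) (Branch (tr_test c) (tr p) (tr q))"
| "tr (While c p) = Seq (rd_test c) (While (tr_test c) (Seq (tr p) (rd_test c)))"

text \<open>Cell 1 of a presented graph is its number of edges. The given program is specified only
  for graphs with edges; otherwise the answer 0, which encodes the empty system, is written
  directly.\<close>

definition calls_body :: "program \<Rightarrow> program" where
  "calls_body p = Seq (rd_code 0 1) (Seq (Const (qcell 1) 0)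
     (Branch (Equal (qcell 0) (qcell 1)) (wr_code 0 1) (tr p)))"

text \<open>Written directly for the machine and not as a \<open>For\<close>, because the times of
  the rounds depend on the given program and have to be added up individually.\<close>

definition calls :: "program \<Rightarrow> program" where
  "calls p = Seq (Const (ncell 3) 0)
     (While (Less (ncell 3) (ncell 4)) (Seq (calls_body p) (Arith Plus (ncell 3) (ncell 3) 6)))"

definition call_result :: "program \<Rightarrow> memory \<Rightarrow> nat \<Rightarrow> memory \<Rightarrow> bool" where
  "call_result p \<mu> t \<mu>' \<longleftrightarrow> (if \<mu> 1 = 0 then \<mu>' = \<mu>(0 := 0) else exec p \<mu> t \<mu>')"

context machine
begin

text \<open>The rational variables are left free, since they hold the operands of the simulated
  instructions.\<close>

definition run_frame :: "hl_state \<Rightarrow> memory \<Rightarrow> hl_state \<Rightarrow> bool" where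
  "run_frame h \<mu> H \<longleftrightarrow> nv H = nv h \<and> raw H = raw h \<and> (\<forall>k. k \<noteq> 0 \<longrightarrow> arr H k = arr h k) \<and>
     (\<forall>i. i \<noteq> nv h 3 \<longrightarrow> arr H 0 i = arr h 0 i) \<and> arr H 0 (nv h 3) = \<mu>"

lemma rd_exec:
  assumes "rel H s" "var_ok x"
  shows "\<exists>s'. exec (rd_code x i) s 11 s' \<and> rel (set_qv x (arr H 0 (nv H 3) i) H) s'"
proof -
  let ?s = "s(4 := of_nat i)"
  have r: "rel H ?s" using assms by (simp add: rel_temp)
  obtain s' where s': "exec (Seq (addr_code 0 (ncell 3) 4) (Load (qcell x) 2)) ?s 10 s'"
    "rel (set_qv x (arr H 0 (nv H 3) i) H) s'"
    using exec_read[OF r, of "ncell 3" "nv H 3" 4 i x 0] relD(4)[OF r, of 3] assms(2)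
    by (auto simp: cells_neq)
  have "exec (rd_code x i) s (1 + 10) s'"
    unfolding rd_code_def by (rule exec_Seq[OF exec_Const s'(1)])
  then show ?thesis using s'(2) by auto
qed

lemma wr_exec:
  assumes "rel H s" "var_ok x"
  shows "\<exists>s'. exec (wr_code i x) s 11 s' \<and> rel (set_arr 0 (nv H 3) i (qv H x) H) s'"
proof -
  let ?s = "s(4 := of_nat i)"
  have r: "rel H ?s" using assms by (simp add: rel_temp)
  obtain s' where s': "exec (Seq (addr_code 0 (ncell 3) 4) (Store 2 (qcell x))) ?s 10 s'"
    "rel (set_arr 0 (nv H 3) i (qv H x) H) s'"
    using exec_write[OF r, of "ncell 3" "nv H 3" 4 i x 0] relD(4)[OF r, of 3] assms(2)
    by (auto simp: cells_neq)
  have "exec (wr_code i x) s (1 + 10) s'"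
    unfolding wr_code_def by (rule exec_Seq[OF exec_Const s'(1)])
  then show ?thesis using s'(2) by auto
qed

lemma rd2_exec:
  assumes "rel H s"
  shows "\<exists>s'. exec (Seq (rd_code 0 i) (rd_code 1 j)) s 22 s' \<and>
    rel (set_qv 1 (arr H 0 (nv H 3) j) (set_qv 0 (arr H 0 (nv H 3) i) H)) s'"
proof -
  obtain s1 where s1: "exec (rd_code 0 i) s 11 s1" "rel (set_qv 0 (arr H 0 (nv H 3) i) H) s1"
    using rd_exec[OF assms, of 0] by auto
  obtain s2 where s2: "exec (rd_code 1 j) s1 11 s2"
    "rel (set_qv 1 (arr H 0 (nv H 3) j) (set_qv 0 (arr H 0 (nv H 3) i) H)) s2"
    using rd_exec[OF s1(2), of 1 j] by auto
  then show ?thesis using exec_Seq[OF s1(1) s2(1)] by auto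
qed

lemma rd_test_exec:
  assumes "rel H s" "run_frame h \<mu> H"
  shows "\<exists>s' H'. exec (rd_test c) s 22 s' \<and> rel H' s' \<and> run_frame h \<mu> H' \<and>
    (test (tr_test c) s' \<longleftrightarrow> test c \<mu>)"
proof -
  obtain i j where ij: "rd_test c = Seq (rd_code 0 i) (rd_code 1 j)"
    "c = Equal i j \<or> c = Less i j" by (cases c) auto
  let ?H = "set_qv 1 (arr H 0 (nv H 3) j) (set_qv 0 (arr H 0 (nv H 3) i) H)"
  obtain s' where s': "exec (rd_test c) s 22 s'" "rel ?H s'"
    unfolding ij(1) using rd2_exec[OF assms(1)] by blast
  moreover have "run_frame h \<mu> ?H" using assms(2) by (simp add: run_frame_def)
  moreover have "s' (qcell 0) = \<mu> i" "s' (qcell 1) = \<mu> j"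
    using relD(5)[OF s'(2), of 0] relD(5)[OF s'(2), of 1] assms(2) by (simp_all add: run_frame_def)
  ultimately show ?thesis using ij(2) by (intro exI[of _ s'] exI[of _ ?H]) auto
qed

text \<open>An instruction reads at most two operands and writes one result, each access taking at
  most 11 steps, so 60 steps per instruction are enough; they also pay for fetching the operands of
  tests.\<close>

theorem tr_correct:
  assumes "exec p \<mu> t \<mu>'" "rel H s" "run_frame h \<mu> H"
  shows "\<exists>t' s' H'. exec (tr p) s t' s' \<and> rel H' s' \<and> run_frame h \<mu>' H' \<and> t' \<le> 60 * t"
  using assms
proof (induction arbitrary: H s rule: exec.induct)
  case (exec_Skip \<mu>)
  then show ?case using exec.exec_Skip[of s] by fastforce
next
  case (exec_Const i q \<mu>)
  have 1: "rel (set_qv 0 q H) (s(qcell 0 := q))" using exec_Const by (intro rel_qv) auto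
  obtain s' where s': "exec (wr_code i 0) (s(qcell 0 := q)) 11 s'"
    "rel (set_arr 0 (nv H 3) i q (set_qv 0 q H)) s'" using wr_exec[OF 1, of 0 i] by auto
  have "exec (tr (Const i q)) s (1 + 11) s'"
    unfolding tr.simps by (rule exec_Seq[OF exec.exec_Const s'(1)])
  moreover have "run_frame h (\<mu>(i := q)) (set_arr 0 (nv H 3) i q (set_qv 0 q H))"
    using exec_Const(2) by (auto simp: run_frame_def)
  ultimately show ?case using s'(2) by fastforce
next
  case (exec_Arith b i j k \<mu>)
  let ?q = "arith b (\<mu> j) (\<mu> k)"
  have f: "nv H 3 = nv h 3" "arr H 0 (nv h 3) = \<mu>" using exec_Arith(2) by (auto simp: run_frame_def)
  obtain s1 where s1: "exec (rd_code 0 j) s 11 s1" "rel (set_qv 0 (\<mu> j) H) s1"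
    using rd_exec[OF exec_Arith(1), of 0 j] f by auto
  obtain s2 where s2: "exec (rd_code 1 k) s1 11 s2" "rel (set_qv 1 (\<mu> k) (set_qv 0 (\<mu> j) H)) s2"
    using rd_exec[OF s1(2), of 1 k] f by auto
  let ?H3 = "set_qv 0 ?q (set_qv 1 (\<mu> k) (set_qv 0 (\<mu> j) H))"
  let ?s3 = "s2(qcell 0 := arith b (s2 (qcell 0)) (s2 (qcell 1)))"
  have s3: "rel ?H3 ?s3"
    using rel_qv[OF s2(2), of 0 ?q] relD(5)[OF s2(2), of 0] relD(5)[OF s2(2), of 1] by simp
  obtain s4 where s4: "exec (wr_code i 0) ?s3 11 s4" "rel (set_arr 0 (nv H 3) i ?q ?H3) s4"
    using wr_exec[OF s3, of 0 i] by auto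
  have "exec (tr (Arith b i j k)) s (11 + (11 + (1 + 11))) s4"
    unfolding tr.simps
    by (intro exec_Seq[OF s1(1)] exec_Seq[OF s2(1)] exec_Seq[OF exec.exec_Arith] s4(1))
  moreover have "run_frame h (\<mu>(i := ?q)) (set_arr 0 (nv H 3) i ?q ?H3)"
    using exec_Arith(2) by (auto simp: run_frame_def)
  ultimately show ?case using s4(2) by fastforce
next
  case (exec_Load \<mu> j a i)
  have f: "nv H 3 = nv h 3" "arr H 0 (nv h 3) = \<mu>" using exec_Load(3) by (auto simp: run_frame_def)
  obtain s1 where s1: "exec (rd_code 0 j) s 11 s1" "rel (set_qv 0 (\<mu> j) H) s1"
    using rd_exec[OF exec_Load(2), of 0 j] f by auto
  let ?H2 = "set_qv 0 (\<mu> a) (set_qv 0 (\<mu> j) H)"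
  obtain s2 where s2: "exec (Seq (addr_code 0 (ncell 3) (qcell 0)) (Load (qcell 0) 2)) s1 10 s2" "rel ?H2 s2"
    using exec_read[OF s1(2), of "ncell 3" "nv H 3" "qcell 0" a 0 0]
      relD(4)[OF s1(2), of 3] relD(5)[OF s1(2), of 0] exec_Load(1) f by (auto simp: cells_neq)
  obtain s4 where s4: "exec (wr_code i 0) s2 11 s4" "rel (set_arr 0 (nv H 3) i (\<mu> a) ?H2) s4"
    using wr_exec[OF s2(2), of 0 i] by auto
  have "exec (tr (Load i j)) s (11 + (10 + 11)) s4"
    unfolding tr.simps by (intro exec_Seq[OF s1(1)] exec_Seq[OF s2(1)] s4(1))
  moreover have "run_frame h (\<mu>(i := \<mu> a)) (set_arr 0 (nv H 3) i (\<mu> a) ?H2)"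
    using exec_Load(3) by (auto simp: run_frame_def)
  ultimately show ?case using s4(2) by fastforce
next
  case (exec_Store \<mu> i a j)
  have f: "nv H 3 = nv h 3" "arr H 0 (nv h 3) = \<mu>" using exec_Store(3) by (auto simp: run_frame_def)
  obtain s1 where s1: "exec (rd_code 0 i) s 11 s1" "rel (set_qv 0 (\<mu> i) H) s1"
    using rd_exec[OF exec_Store(2), of 0 i] f by auto
  let ?H2 = "set_qv 1 (\<mu> j) (set_qv 0 (\<mu> i) H)"
  obtain s2 where s2: "exec (rd_code 1 j) s1 11 s2" "rel ?H2 s2"
    using rd_exec[OF s1(2), of 1 j] f by auto
  obtain s4 where s4: "exec (Seq (addr_code 0 (ncell 3) (qcell 0)) (Store 2 (qcell 1))) s2 10 s4"
    "rel (set_arr 0 (nv H 3) a (\<mu> j) ?H2) s4"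
    using exec_write[OF s2(2), of "ncell 3" "nv H 3" "qcell 0" a 1 0]
      relD(4)[OF s2(2), of 3] relD(5)[OF s2(2), of 0] exec_Store(1) f by (auto simp: cells_neq)
  have "exec (tr (Store i j)) s (11 + (11 + 10)) s4"
    unfolding tr.simps by (intro exec_Seq[OF s1(1)] exec_Seq[OF s2(1)] s4(1))
  moreover have "run_frame h (\<mu>(a := \<mu> j)) (set_arr 0 (nv H 3) a (\<mu> j) ?H2)"
    using exec_Store(3) by (auto simp: run_frame_def)
  ultimately show ?case using s4(2) by fastforce
next
  case (exec_Seq p \<mu> t \<mu>1 q t' \<mu>2)
  obtain t1 s1 H1 where 1: "exec (tr p) s t1 s1" "rel H1 s1" "run_frame h \<mu>1 H1" "t1 \<le> 60 * t"
    using exec_Seq.IH(1)[OF exec_Seq.prems] by blast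
  obtain t2 s2 H2 where 2: "exec (tr q) s1 t2 s2" "rel H2 s2" "run_frame h \<mu>2 H2" "t2 \<le> 60 * t'"
    using exec_Seq.IH(2)[OF 1(2,3)] by blast
  have "exec (tr (Seq p q)) s (t1 + t2) s2" unfolding tr.simps by (rule exec.exec_Seq[OF 1(1) 2(1)])
  moreover have "t1 + t2 \<le> 60 * (t + t')" using 1(4) 2(4) by simp
  ultimately show ?case using 2(2,3) by blast
next
  case (exec_BranchTrue c \<mu> p t \<mu>' q)
  obtain s1 H1 where 1: "exec (rd_test c) s 22 s1" "rel H1 s1" "run_frame h \<mu> H1" "test (tr_test c) s1"
    using rd_test_exec[OF exec_BranchTrue.prems, of c] exec_BranchTrue.hyps(1) by blast
  obtain t2 s2 H2 where 2: "exec (tr p) s1 t2 s2" "rel H2 s2" "run_frame h \<mu>' H2" "t2 \<le> 60 * t"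
    using exec_BranchTrue.IH[OF 1(2,3)] by blast
  have "exec (tr (Branch c p q)) s (22 + Suc t2) s2"
    unfolding tr.simps by (intro exec_Seq[OF 1(1)] exec.exec_BranchTrue 1(4) 2(1))
  moreover have "22 + Suc t2 \<le> 60 * Suc t" using 2(4) by simp
  ultimately show ?case using 2(2,3) by blast
next
  case (exec_BranchFalse c \<mu> q t \<mu>' p)
  obtain s1 H1 where 1: "exec (rd_test c) s 22 s1" "rel H1 s1" "run_frame h \<mu> H1" "\<not> test (tr_test c) s1"
    using rd_test_exec[OF exec_BranchFalse.prems, of c] exec_BranchFalse.hyps(1) by blast
  obtain t2 s2 H2 where 2: "exec (tr q) s1 t2 s2" "rel H2 s2" "run_frame h \<mu>' H2" "t2 \<le> 60 * t"
    using exec_BranchFalse.IH[OF 1(2,3)] by blast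
  have "exec (tr (Branch c p q)) s (22 + Suc t2) s2"
    unfolding tr.simps by (intro exec_Seq[OF 1(1)] exec.exec_BranchFalse 1(4) 2(1))
  moreover have "22 + Suc t2 \<le> 60 * Suc t" using 2(4) by simp
  ultimately show ?case using 2(2,3) by blast
next
  case (exec_WhileFalse c \<mu> p)
  obtain s1 H1 where 1: "exec (rd_test c) s 22 s1" "rel H1 s1" "run_frame h \<mu> H1" "\<not> test (tr_test c) s1"
    using rd_test_exec[OF exec_WhileFalse.prems, of c] exec_WhileFalse.hyps(1) by blast
  have "exec (tr (While c p)) s (22 + 1) s1"
    unfolding tr.simps by (intro exec_Seq[OF 1(1)] exec.exec_WhileFalse 1(4))
  moreover have "22 + 1 \<le> 60 * (1 :: nat)" by simp
  ultimately show ?case using 1(2,3) by blast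
next
  case (exec_WhileTrue c \<mu> p t \<mu>1 t' \<mu>2)
  let ?W = "While (tr_test c) (Seq (tr p) (rd_test c))"
  obtain s1 H1 where 1: "exec (rd_test c) s 22 s1" "rel H1 s1" "run_frame h \<mu> H1" "test (tr_test c) s1"
    using rd_test_exec[OF exec_WhileTrue.prems, of c] exec_WhileTrue.hyps(1) by blast
  obtain t2 s2 H2 where 2: "exec (tr p) s1 t2 s2" "rel H2 s2" "run_frame h \<mu>1 H2" "t2 \<le> 60 * t"
    using exec_WhileTrue.IH(1)[OF 1(2,3)] by blast
  obtain t3 s3 H3 where 3: "exec (tr (While c p)) s2 t3 s3" "rel H3 s3" "run_frame h \<mu>2 H3" "t3 \<le> 60 * t'"
    using exec_WhileTrue.IH(2)[OF 2(2,3)] by blast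
  \<comment> \<open>The simulation of the remaining rounds starts with its own fetch of the test
    operands; this fetch is split off and becomes the end of the first round.\<close>
  from 3(1) obtain t4 t5 s4 where 4: "exec (rd_test c) s2 t4 s4" "exec ?W s4 t5 s3" "t3 = t4 + t5"
    unfolding tr.simps by (rule exec_SeqE)
  have "exec (tr (While c p)) s (22 + Suc ((t2 + t4) + t5)) s3"
    unfolding tr.simps
    by (rule exec_Seq[OF 1(1) exec.exec_WhileTrue[OF 1(4) exec.exec_Seq[OF 2(1) 4(1)] 4(2)]])
  moreover have "22 + Suc ((t2 + t4) + t5) \<le> 60 * Suc (t + t')" using 2(4) 3(4) 4(3) by simp
  ultimately show ?case using 3(2,3) by blast
qed

lemma calls_body_correct:
  assumes "call_result p (arr H 0 (nv H 3)) t \<mu>'" "rel H s"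
  shows "\<exists>t' s' H'. exec (calls_body p) s t' s' \<and> rel H' s' \<and> run_frame H \<mu>' H' \<and> t' \<le> 60 * t + 30"
proof -
  let ?\<mu> = "arr H 0 (nv H 3)"
  obtain s1 where s1: "exec (rd_code 0 1) s 11 s1" "rel (set_qv 0 (?\<mu> 1) H) s1"
    using rd_exec[OF assms(2), of 0 1] by auto
  let ?H = "set_qv 1 0 (set_qv 0 (?\<mu> 1) H)"
  have r: "rel ?H (s1(qcell 1 := 0))" using rel_qv[OF s1(2)] by simp
  have t: "test (Equal (qcell 0) (qcell 1)) (s1(qcell 1 := 0)) \<longleftrightarrow> ?\<mu> 1 = 0"
    using relD(5)[OF r, of 0] relD(5)[OF r, of 1] by simp
  have fr: "run_frame H ?\<mu> ?H" by (auto simp: run_frame_def)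
  show ?thesis
  proof (cases "?\<mu> 1 = 0")
    case True
    obtain s2 where s2: "exec (wr_code 0 1) (s1(qcell 1 := 0)) 11 s2" "rel (set_arr 0 (nv H 3) 0 0 ?H) s2"
      using wr_exec[OF r, of 1 0] by auto
    have "exec (calls_body p) s (11 + (1 + Suc 11)) s2"
      unfolding calls_body_def
      by (intro exec_Seq[OF s1(1)] exec_Seq[OF exec_Const] exec_BranchTrue s2(1)) (use t True in blast)
    moreover have "run_frame H \<mu>' (set_arr 0 (nv H 3) 0 0 ?H)"
      using assms(1) True by (auto simp: run_frame_def call_result_def)
    moreover have "11 + (1 + Suc 11) \<le> 60 * t + 30" by simp
    ultimately show ?thesis using s2(2) by blast
  next
    case False
    then have "exec p ?\<mu> t \<mu>'" using assms(1) by (simp add: call_result_def)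
    from tr_correct[OF this r fr] obtain t2 s2 H2 where 2: "exec (tr p) (s1(qcell 1 := 0)) t2 s2"
      "rel H2 s2" "run_frame H \<mu>' H2" "t2 \<le> 60 * t" by blast
    have "exec (calls_body p) s (11 + (1 + Suc t2)) s2"
      unfolding calls_body_def
      by (intro exec_Seq[OF s1(1)] exec_Seq[OF exec_Const] exec_BranchFalse 2(1)) (use t False in blast)
    moreover have "11 + (1 + Suc t2) \<le> 60 * t + 30" using 2(4) by simp
    ultimately show ?thesis using 2(2,3) by blast
  qed
qed

text \<open>Rows below the counter hold results and the others are still inputs. Each run touches
  only its own row, so the runs do not interfere and their times add up.\<close>

lemma calls_loop_correct:
  assumes res: "\<And>c. c < P \<Longrightarrow> call_result p (arr h 0 c) (t c) (\<mu> c)"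
    and "rel H s" "nv h 4 = P" "nv H 3 + k = P"
    and "\<And>x. x \<noteq> 3 \<Longrightarrow> nv H x = nv h x" "raw H = raw h" "\<And>l. l \<noteq> 0 \<Longrightarrow> arr H l = arr h l"
    and "\<And>c. c < nv H 3 \<Longrightarrow> arr H 0 c = \<mu> c" "\<And>c. nv H 3 \<le> c \<Longrightarrow> arr H 0 c = arr h 0 c"
  shows "\<exists>t' s' H'. exec (While (Less (ncell 3) (ncell 4)) (Seq (calls_body p) (Arith Plus (ncell 3) (ncell 3) 6))) s t' s' \<and>
    rel H' s' \<and> (\<forall>x. x \<noteq> 3 \<longrightarrow> nv H' x = nv h x) \<and> raw H' = raw h \<and> (\<forall>l. l \<noteq> 0 \<longrightarrow> arr H' l = arr h l) \<and>
    (\<forall>c<P. arr H' 0 c = \<mu> c) \<and> t' \<le> 60 * (\<Sum>c=nv H 3..<P. t c) + 40 * k + 1"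
  using assms(2-)
proof (induction k arbitrary: H s)
  case 0
  then have "\<not> test (Less (ncell 3) (ncell 4)) s"
    using relD(4)[OF 0(1), of 3] relD(4)[OF 0(1), of 4] by simp
  from exec_WhileFalse[OF this] show ?case
    using 0 by (intro exI[of _ 1] exI[of _ s] exI[of _ H]) auto
next
  case (Suc k)
  note r = Suc.prems(1)
  let ?c = "nv H 3"
  have c: "?c < P" using Suc.prems(3) by simp
  have tst: "test (Less (ncell 3) (ncell 4)) s"
    using relD(4)[OF r, of 3] relD(4)[OF r, of 4] Suc.prems(2,4) c by simp
  have "arr H 0 ?c = arr h 0 ?c" using Suc.prems(8) by simp
  then have "call_result p (arr H 0 ?c) (t ?c) (\<mu> ?c)" using res[OF c] by simp
  from calls_body_correct[OF this r] obtain t1 s1 H1 where 1: "exec (calls_body p) s t1 s1"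
    "rel H1 s1" "run_frame H (\<mu> ?c) H1" "t1 \<le> 60 * t ?c + 30" by blast
  let ?H2 = "set_nv 3 (Suc ?c) H1"
  let ?s2 = "s1(ncell 3 := arith Plus (s1 (ncell 3)) (s1 6))"
  have f: "nv H1 = nv H" "raw H1 = raw H" "\<And>k. k \<noteq> 0 \<Longrightarrow> arr H1 k = arr H k"
    "\<And>i. i \<noteq> ?c \<Longrightarrow> arr H1 0 i = arr H 0 i" "arr H1 0 ?c = \<mu> ?c"
    using 1(3) by (auto simp: run_frame_def)
  have r2: "rel ?H2 ?s2"
    using relD(3)[OF 1(2)] relD(4)[OF 1(2), of 3] f(1) by (intro rel_nv[OF 1(2)]) auto
  have e: "exec (Seq (calls_body p) (Arith Plus (ncell 3) (ncell 3) 6)) s (t1 + 1) ?s2"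
    by (rule exec_Seq[OF 1(1) exec_Arith])
  have i1: "arr ?H2 0 i = \<mu> i" if "i < nv ?H2 3" for i
    using that f Suc.prems(7)[of i] by (cases "i = ?c") auto
  have i2: "arr ?H2 0 i = arr h 0 i" if "nv ?H2 3 \<le> i" for i
    using that f Suc.prems(8)[of i] by (cases "i = ?c") auto
  have n3: "nv ?H2 3 = Suc ?c" by simp
  have "nv ?H2 3 + k = P" using Suc.prems(3) by simp
  moreover have "nv ?H2 x = nv h x" if "x \<noteq> 3" for x using that f Suc.prems(4) by simp
  moreover have "raw ?H2 = raw h" using f Suc.prems(5) by simp
  moreover have "arr ?H2 l = arr h l" if "l \<noteq> 0" for l using that f Suc.prems(6) by simp
  ultimately obtain t3 s3 H3 where 3:
    "exec (While (Less (ncell 3) (ncell 4)) (Seq (calls_body p) (Arith Plus (ncell 3) (ncell 3) 6))) ?s2 t3 s3"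
    "rel H3 s3" "\<forall>x. x \<noteq> 3 \<longrightarrow> nv H3 x = nv h x" "raw H3 = raw h" "\<forall>l. l \<noteq> 0 \<longrightarrow> arr H3 l = arr h l"
    "\<forall>c<P. arr H3 0 c = \<mu> c" "t3 \<le> 60 * (\<Sum>c=Suc ?c..<P. t c) + 40 * k + 1"
    using Suc.IH[OF r2 Suc.prems(2) _ _ _ _ i1 i2, unfolded n3] unfolding n3 by blast
  have "(\<Sum>c=?c..<P. t c) = t ?c + (\<Sum>c=Suc ?c..<P. t c)"
    using c by (simp add: sum.atLeast_Suc_lessThan)
  then have "Suc (t1 + 1 + t3) \<le> 60 * (\<Sum>c=?c..<P. t c) + 40 * Suc k + 1"
    using 1(4) 3(7) by simp
  then show ?case using exec_WhileTrue[OF tst e 3(1)] 3(2-6) by blast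
qed

lemma calls_correct:
  assumes res: "\<And>c. c < nv h 4 \<Longrightarrow> call_result p (arr h 0 c) (t c) (\<mu> c)"
    and "rel h s"
  shows "\<exists>t' s' h'. exec (calls p) s t' s' \<and> rel h' s' \<and> (\<forall>x. x \<noteq> 3 \<longrightarrow> nv h' x = nv h x) \<and>
    raw h' = raw h \<and> (\<forall>l. l \<noteq> 0 \<longrightarrow> arr h' l = arr h l) \<and> (\<forall>c < nv h 4. arr h' 0 c = \<mu> c) \<and>
    t' \<le> 60 * (\<Sum>c<nv h 4. t c) + 40 * nv h 4 + 2"
proof -
  have r: "rel (set_nv 3 0 h) (s(ncell 3 := 0))" using assms(2) by (intro rel_nv) auto
  obtain t' s' h' where 1: "exec (While (Less (ncell 3) (ncell 4)) (Seq (calls_body p)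
      (Arith Plus (ncell 3) (ncell 3) 6))) (s(ncell 3 := 0)) t' s'"
    "rel h' s'" "\<forall>x. x \<noteq> 3 \<longrightarrow> nv h' x = nv h x" "raw h' = raw h" "\<forall>l. l \<noteq> 0 \<longrightarrow> arr h' l = arr h l"
    "\<forall>c < nv h 4. arr h' 0 c = \<mu> c" "t' \<le> 60 * (\<Sum>c=0..<nv h 4. t c) + 40 * nv h 4 + 1"
    using calls_loop_correct[of "nv h 4" p h t \<mu>, OF res r refl, of "nv h 4"] by auto
  have "exec (calls p) s (1 + t') s'"
    unfolding calls_def by (rule exec_Seq[OF exec_Const 1(1)])
  moreover have "1 + t' \<le> 60 * (\<Sum>c<nv h 4. t c) + 40 * nv h 4 + 2"
    using 1(7) by (simp add: atLeast0LessThan)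
  ultimately show ?thesis using 1(2-6) by blast
qed

end

section \<open>Contraction of a module and its effect on weightings and on other modules\<close>

subsection \<open>Modules and well-covered weightings of relations\<close>

text \<open>Stated for arbitrary relations, because the elements of a piece are numbers that stand
  for vertices. Maximality is expressed as domination of the remaining elements.\<close>

definition mis :: "('v \<Rightarrow> 'v \<Rightarrow> bool) \<Rightarrow> 'v set \<Rightarrow> 'v set \<Rightarrow> bool" where
  "mis A X I \<longleftrightarrow> I \<subseteq> X \<and> (\<forall>x\<in>I. \<forall>y\<in>I. \<not> A x y) \<and> (\<forall>x\<in>X - I. \<exists>y\<in>I. A x y)"

definition wc :: "('v \<Rightarrow> 'v \<Rightarrow> bool) \<Rightarrow> 'v set \<Rightarrow> ('v \<Rightarrow> real) \<Rightarrow> bool" where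
  "wc A X w \<longleftrightarrow> (\<forall>I J. mis A X I \<and> mis A X J \<longrightarrow> sum w I = sum w J)"

definition mdl :: "('v \<Rightarrow> 'v \<Rightarrow> bool) \<Rightarrow> 'v set \<Rightarrow> 'v set \<Rightarrow> bool" where
  "mdl A X M \<longleftrightarrow> M \<noteq> {} \<and> M \<subseteq> X \<and> (\<forall>x\<in>X - M. \<forall>y\<in>M. \<forall>z\<in>M. A x y = A x z)"

definition only_trivial_modules_at :: "('v \<Rightarrow> 'v \<Rightarrow> bool) \<Rightarrow> 'v set \<Rightarrow> 'v \<Rightarrow> bool" where
  "only_trivial_modules_at A X v \<longleftrightarrow> (\<forall>M. mdl A X M \<and> v \<in> M \<and> M \<noteq> X \<longrightarrow> M = {v})"

text \<open>A set containing \<open>u\<close> is a module iff the rest of it contains every vertex that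
  distinguishes \<open>u\<close> from one of its members.\<close>

definition closed_at :: "('v \<Rightarrow> 'v \<Rightarrow> bool) \<Rightarrow> 'v set \<Rightarrow> 'v \<Rightarrow> 'v set \<Rightarrow> bool" where
  "closed_at A X u S \<longleftrightarrow> S \<subseteq> X - {u} \<and> (\<forall>y\<in>S. \<forall>x\<in>X - {u}. A x u \<noteq> A x y \<longrightarrow> x = y \<or> x \<in> S)"

lemma closed_at_imp_mdl:
  assumes "closed_at A X u S" "u \<in> X"
  shows "mdl A X (insert u S)"
proof -
  have "A x y = A x u" if "x \<in> X - insert u S" "y \<in> insert u S" for x y
    using assms(1) that unfolding closed_at_def by (cases "y = u") auto
  then have "\<forall>x\<in>X - insert u S. \<forall>y\<in>insert u S. \<forall>z\<in>insert u S. A x y = A x z"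
    by (intro ballI) metis
  moreover have "insert u S \<subseteq> X" using assms by (auto simp: closed_at_def)
  ultimately show ?thesis unfolding mdl_def by blast
qed

lemma mdl_imp_closed_at:
  assumes "mdl A X M" "u \<in> M"
  shows "closed_at A X u (M - {u})"
proof -
  have "x \<in> M" if "y \<in> M" "x \<in> X" "A x u \<noteq> A x y" for x y
    using assms that unfolding mdl_def by (metis DiffI)
  moreover have "M \<subseteq> X" using assms by (simp add: mdl_def)
  ultimately show ?thesis unfolding closed_at_def by auto
qed

lemma mis_cong:
  assumes "\<And>x y. x \<in> X \<Longrightarrow> y \<in> X \<Longrightarrow> A x y = A' x y"
  shows "mis A X I = mis A' X I"
  unfolding mis_def
  by (intro conj_cong ball_cong bex_cong arg_cong[where f = Not] refl assms) auto

lemma wc_cong: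
  assumes A: "\<And>x y. x \<in> X \<Longrightarrow> y \<in> X \<Longrightarrow> A x y = A' x y" and w: "\<And>x. x \<in> X \<Longrightarrow> w x = w' x"
  shows "wc A X w = wc A' X w'"
proof -
  have "sum w I = sum w' I" if "mis A' X I" for I
    using that w unfolding mis_def by (intro sum.cong) auto
  moreover have "mis A X I = mis A' X I" for I using mis_cong[of X A A', OF A] by blast
  ultimately show ?thesis unfolding wc_def by metis
qed

lemma mdl_cong:
  assumes "\<And>x y. x \<in> X \<Longrightarrow> y \<in> X \<Longrightarrow> A x y = A' x y"
  shows "mdl A X M = mdl A' X M"
  unfolding mdl_def
  by (intro conj_cong ball_cong arg_cong2[where f = "(=)"] refl assms) auto

lemma only_trivial_modules_at_cong:
  assumes "\<And>x y. x \<in> X \<Longrightarrow> y \<in> X \<Longrightarrow> A x y = A' x y"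
  shows "only_trivial_modules_at A X v = only_trivial_modules_at A' X v"
  using mdl_cong[of X A A', OF assms] by (simp add: only_trivial_modules_at_def)

lemma mis_extend:
  assumes "finite X" "I \<subseteq> X" "\<forall>x\<in>I. \<forall>y\<in>I. \<not> A x y"
    and irr: "\<And>x. \<not> A x x" and sym: "\<And>x y. A x y \<Longrightarrow> A y x"
  shows "\<exists>K. I \<subseteq> K \<and> mis A X K"
proof -
  define F where "F = {K. I \<subseteq> K \<and> K \<subseteq> X \<and> (\<forall>x\<in>K. \<forall>y\<in>K. \<not> A x y)}"
  have "finite F"
    unfolding F_def using assms(1) by (auto intro: finite_subset[where B = "Pow X"])
  moreover have "I \<in> F" using assms by (simp add: F_def)
  ultimately obtain K where K: "K \<in> F" "\<And>L. L \<in> F \<Longrightarrow> K \<subseteq> L \<Longrightarrow> K = L"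
    using finite_has_maximal2[of F I] by blast
  have "\<exists>y\<in>K. A x y" if "x \<in> X - K" for x
  proof (rule ccontr)
    assume "\<not> ?thesis"
    then have "insert x K \<in> F" using K(1) that irr sym unfolding F_def by blast
    then have "K = insert x K" using K(2) by blast
    then show False using that by blast
  qed
  then show ?thesis using K(1) unfolding mis_def F_def by blast
qed

text \<open>Contraction of the module \<open>M\<close> to a point \<open>r\<close> that sees the
  rest of X as \<open>u\<close> does. The point may be new, since it only has to lie outside of
  \<open>X - M\<close>; \<open>J\<close> is the set whose weight it will receive.\<close>

locale module_split =
  fixes A :: "'v \<Rightarrow> 'v \<Rightarrow> bool" and X M :: "'v set" and u r :: 'v and J :: "'v set"
  assumes irr: "\<And>x. \<not> A x x" and sym: "\<And>x y. A x y \<Longrightarrow> A y x"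
    and fin: "finite X" and M: "mdl A X M" and u: "u \<in> M"
    and r: "r \<notin> X - M" and copy: "\<And>x. x \<in> X - M \<Longrightarrow> A x r = A x u"
    and J: "mis A M J"
begin

lemma MX: "M \<subseteq> X" using M by (simp add: mdl_def)

lemma uniform: "x \<in> X - M \<Longrightarrow> y \<in> M \<Longrightarrow> z \<in> M \<Longrightarrow> A x y = A x z"
  using M unfolding mdl_def by blast

lemma mis_nonempty: "mis A M I \<Longrightarrow> I \<noteq> {}"
  using u by (auto simp: mis_def)

lemma finM: "finite M" using fin MX finite_subset by blast

lemma mis_finite: "mis A M I \<Longrightarrow> finite I" "mis A X I \<Longrightarrow> finite I"
  using fin finM finite_subset unfolding mis_def by blast+

text \<open>From outside, all members of \<open>M\<close> look alike: an element of
  \<open>K - M\<close> is adjacent to no member of \<open>M\<close>, and an element dominated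
  through \<open>M\<close> is dominated by any member of \<open>I\<close>.\<close>

lemma mis_exchange:
  assumes K: "mis A X K" "K \<inter> M \<noteq> {}" and I: "mis A M I"
  shows "mis A X (K - M \<union> I)"
proof -
  obtain k where k: "k \<in> K" "k \<in> M" using K(2) by blast
  obtain i where i: "i \<in> I" "i \<in> M" using mis_nonempty[OF I] I by (auto simp: mis_def)
  have KX: "K \<subseteq> X" "\<And>x y. x \<in> K \<Longrightarrow> y \<in> K \<Longrightarrow> \<not> A x y"
    and Kd: "\<And>x. x \<in> X \<Longrightarrow> x \<notin> K \<Longrightarrow> \<exists>y\<in>K. A x y"
    using K(1) by (auto simp: mis_def)
  have IM: "I \<subseteq> M" "\<And>x y. x \<in> I \<Longrightarrow> y \<in> I \<Longrightarrow> \<not> A x y"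
    and Id: "\<And>x. x \<in> M \<Longrightarrow> x \<notin> I \<Longrightarrow> \<exists>y\<in>I. A x y"
    using I by (auto simp: mis_def)
  have nadj: "\<not> A x y" if "x \<in> K - M" "y \<in> M" for x y
    using uniform[of x y k] that k KX by blast
  have "\<not> A x y" if "x \<in> K - M \<union> I" "y \<in> K - M \<union> I" for x y
    using that nadj KX(2) IM sym by blast
  moreover have "\<exists>y\<in>K - M \<union> I. A x y" if x: "x \<in> X - (K - M \<union> I)" for x
  proof (cases "x \<in> M")
    case True
    then show ?thesis using Id[of x] x by blast
  next
    case False
    then obtain y where y: "y \<in> K" "A x y" using Kd[of x] x by blast
    then show ?thesis using uniform[of x y i] i False x by blast
  qed
  moreover have "K - M \<union> I \<subseteq> X" using KX IM MX by blast
  ultimately show ?thesis unfolding mis_def by blast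
qed

lemma mis_inter:
  assumes K: "mis A X K" "K \<inter> M \<noteq> {}"
  shows "mis A M (K \<inter> M)"
proof -
  obtain k where k: "k \<in> K" "k \<in> M" using K(2) by blast
  have "\<exists>y\<in>K \<inter> M. A x y" if x: "x \<in> M - K \<inter> M" for x
  proof -
    obtain y where y: "y \<in> K" "A x y" using K(1) x MX unfolding mis_def by blast
    have "y \<in> M"
    proof (rule ccontr)
      assume "y \<notin> M"
      then have "A y k" using uniform[of y x k] y k x K(1) sym unfolding mis_def by blast
      then show False using y(1) k(1) K(1) by (auto simp: mis_def)
    qed
    then show ?thesis using y by blast
  qed
  then show ?thesis using K(1) unfolding mis_def by blast
qed

lemma lift_mis:
  assumes L: "mis A (insert r (X - M)) L"
  shows "mis A X (if r \<in> L then L - {r} \<union> J else L)"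
proof -
  have LX: "L \<subseteq> insert r (X - M)" "\<And>x y. x \<in> L \<Longrightarrow> y \<in> L \<Longrightarrow> \<not> A x y"
    and Ld: "\<And>x. x \<in> insert r (X - M) \<Longrightarrow> x \<notin> L \<Longrightarrow> \<exists>y\<in>L. A x y"
    using L by (auto simp: mis_def)
  have JM: "J \<subseteq> M" "\<And>x y. x \<in> J \<Longrightarrow> y \<in> J \<Longrightarrow> \<not> A x y"
    and Jd: "\<And>x. x \<in> M \<Longrightarrow> x \<notin> J \<Longrightarrow> \<exists>y\<in>J. A x y"
    using J by (auto simp: mis_def)
  obtain j where j: "j \<in> J" "j \<in> M" using mis_nonempty[OF J] JM by blast
  show ?thesis
  proof (cases "r \<in> L")
    case True
    have nadj: "\<not> A x y" if "x \<in> L - {r}" "y \<in> M" for x y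
      using LX True that copy[of x] uniform[of x y u] u by blast
    have "\<not> A x y" if "x \<in> L - {r} \<union> J" "y \<in> L - {r} \<union> J" for x y
      using that nadj LX(2) JM sym by blast
    moreover have "\<exists>y\<in>L - {r} \<union> J. A x y" if x: "x \<in> X - (L - {r} \<union> J)" for x
    proof (cases "x \<in> M")
      case True
      then show ?thesis using Jd[of x] x by blast
    next
      case False
      then have "x \<noteq> r" using x r by blast
      then obtain y where y: "y \<in> L" "A x y" using Ld[of x] x False by blast
      then show ?thesis using uniform[of x u j] copy[of x] j u False x by blast
    qed
    moreover have "L - {r} \<union> J \<subseteq> X" using LX JM MX by blast
    ultimately show ?thesis using True unfolding mis_def by simp
  next
    case False
    then have LX': "L \<subseteq> X - M" using LX by blast
    \<comment> \<open>The neighbour that keeps \<open>r\<close> out of \<open>L\<close> is adjacent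
      to all of \<open>M\<close>, so it dominates the whole module.\<close>
    obtain y where y: "y \<in> L" "A r y" using Ld[of r] False by blast
    then have yu: "A y u" using copy[of y] LX' sym by blast
    have "\<exists>y\<in>L. A x y" if x: "x \<in> X - L" for x
    proof (cases "x \<in> M")
      case True
      then show ?thesis using uniform[of y x u] u yu y LX' sym by blast
    next
      case False
      then show ?thesis using Ld[of x] x by blast
    qed
    then show ?thesis using False LX LX' unfolding mis_def by auto
  qed
qed

lemma project_mis:
  assumes K: "mis A X K"
  shows "mis A (insert r (X - M)) (if K \<inter> M = {} then K else insert r (K - M))"
proof -
  have KX: "K \<subseteq> X" "\<And>x y. x \<in> K \<Longrightarrow> y \<in> K \<Longrightarrow> \<not> A x y"
    and Kd: "\<And>x. x \<in> X \<Longrightarrow> x \<notin> K \<Longrightarrow> \<exists>y\<in>K. A x y"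
    using K(1) by (auto simp: mis_def)
  show ?thesis
  proof (cases "K \<inter> M = {}")
    case True
    obtain y where y: "y \<in> K" "A u y" using Kd[of u] u True MX by blast
    then have "A r y" using copy[of y] True KX sym by blast
    then have "\<exists>y\<in>K. A x y" if "x \<in> insert r (X - M) - K" for x
      using that Kd[of x] y by blast
    then show ?thesis using True KX unfolding mis_def by auto
  next
    case False
    then obtain k where k: "k \<in> K" "k \<in> M" by blast
    have nadj: "\<not> A x r" if "x \<in> K - M" for x
      using uniform[of x u k] that k u KX copy[of x] by blast
    have "\<not> A x y" if "x \<in> insert r (K - M)" "y \<in> insert r (K - M)" for x y
      using that nadj KX(2) irr sym by blast
    moreover have "\<exists>y\<in>insert r (K - M). A x y" if x: "x \<in> insert r (X - M) - insert r (K - M)" for x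
    proof -
      obtain y where y: "y \<in> K" "A x y" using Kd[of x] x by blast
      then show ?thesis using uniform[of x y u] copy[of x] u x by blast
    qed
    moreover have "insert r (K - M) \<subseteq> insert r (X - M)" using KX by blast
    ultimately show ?thesis unfolding mis_def if_not_P[OF False] by blast
  qed
qed

text \<open>The maximal independent sets of X arise from those of the contraction by replacing
  \<open>r\<close>, where it occurs, by an arbitrary maximal independent set of \<open>M\<close>.
  Varying the replacement yields the condition on \<open>M\<close>; fixing it to \<open>J\<close>
  yields the condition on the contraction.\<close>

theorem wc_split:
  assumes w': "\<And>x. x \<in> X - M \<Longrightarrow> w' x = w x" "w' r = sum w J"
  shows "wc A X w \<longleftrightarrow> wc A M w \<and> wc A (insert r (X - M)) w'"
proof
  assume wX: "wc A X w"
  have "sum w I1 = sum w I2" if I: "mis A M I1" "mis A M I2" for I1 I2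
  proof -
    have I1: "I1 \<subseteq> M" "\<forall>x\<in>I1. \<forall>y\<in>I1. \<not> A x y" using I(1) by (auto simp: mis_def)
    obtain K where K: "I1 \<subseteq> K" "mis A X K"
      using mis_extend[OF fin order.trans[OF I1(1) MX] I1(2) irr sym] by blast
    have KM: "K \<inter> M \<noteq> {}" using K(1) I1(1) mis_nonempty[OF I(1)] by blast
    have "sum w (K - M \<union> I1) = sum w (K - M \<union> I2)"
      using wX mis_exchange[OF K(2) KM] I unfolding wc_def by blast
    moreover have "sum w (K - M \<union> I) = sum w (K - M) + sum w I" if "mis A M I" for I
      using that mis_finite K(2) by (intro sum.union_disjoint) (auto simp: mis_def)
    ultimately show ?thesis using I by simp
  qed
  moreover have "sum w' L1 = sum w' L2" if L: "mis A (insert r (X - M)) L1" "mis A (insert r (X - M)) L2" for L1 L2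
  proof -
    have lift: "sum w (if r \<in> L then L - {r} \<union> J else L) = sum w' L" if "mis A (insert r (X - M)) L" for L
    proof -
      have LX: "L \<subseteq> insert r (X - M)" and fL: "finite L"
        using that fin finite_subset[of L "insert r (X - M)"] by (auto simp: mis_def)
      have "sum w (L - {r}) = sum w' (L - {r})" using LX w'(1) by (intro sum.cong) auto
      moreover have "sum w (L - {r} \<union> J) = sum w (L - {r}) + sum w J"
        using fL LX J mis_finite(1)[OF J] by (intro sum.union_disjoint) (auto simp: mis_def)
      ultimately show ?thesis using fL w'(2) by (cases "r \<in> L") (auto simp: sum.remove)
    qed
    have "sum w (if r \<in> L1 then L1 - {r} \<union> J else L1) = sum w (if r \<in> L2 then L2 - {r} \<union> J else L2)"
      using wX lift_mis[OF L(1)] lift_mis[OF L(2)] unfolding wc_def by blast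
    then show ?thesis unfolding lift[OF L(1)] lift[OF L(2)] .
  qed
  ultimately show "wc A M w \<and> wc A (insert r (X - M)) w'" unfolding wc_def by blast
next
  assume w: "wc A M w \<and> wc A (insert r (X - M)) w'"
  have proj: "sum w K = sum w' (if K \<inter> M = {} then K else insert r (K - M))" if K: "mis A X K" for K
  proof (cases "K \<inter> M = {}")
    case True
    have "x \<in> X - M" if "x \<in> K" for x using that True K unfolding mis_def by blast
    then have "w x = w' x" if "x \<in> K" for x using w'(1) that by simp
    then show ?thesis using True by (simp cong: sum.cong)
  next
    case False
    have "sum w (K \<inter> M) = sum w J" using w J mis_inter[OF K False] unfolding wc_def by blast
    moreover have "sum w K = sum w (K \<inter> M) + sum w (K - M)"
      using mis_finite(2)[OF K] by (metis sum.Int_Diff)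
    moreover have "sum w (K - M) = sum w' (K - M)"
      using w'(1) K unfolding mis_def by (intro sum.cong refl) (simp add: subset_iff)
    moreover have "r \<notin> K - M" using r K by (auto simp: mis_def)
    ultimately show ?thesis using False w'(2) mis_finite(2)[OF K] by simp
  qed
  have "sum w K = sum w L" if KL: "mis A X K" "mis A X L" for K L
    unfolding proj[OF KL(1)] proj[OF KL(2)]
    using w project_mis[OF KL(1)] project_mis[OF KL(2)] unfolding wc_def by blast
  then show "wc A X w" unfolding wc_def by blast
qed

text \<open>Modules of a module are modules. Together with \<open>trivial_modules_outside\<close>
  this keeps a settled vertex settled through all later splits.\<close>

lemma trivial_modules_inside:
  assumes "only_trivial_modules_at A X v" "v \<in> M"
  shows "only_trivial_modules_at A M v"
  unfolding only_trivial_modules_at_def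
proof (intro allI impI, elim conjE)
  fix N assume N: "mdl A M N" "v \<in> N" "N \<noteq> M"
  have "mdl A X N" using N(1) M unfolding mdl_def by blast
  moreover have "N \<noteq> X" using N MX unfolding mdl_def by blast
  ultimately show "N = {v}" using assms N(2) unfolding only_trivial_modules_at_def by blast
qed

text \<open>Undoing the contraction turns a module of it into a module of X: if \<open>r\<close> is
  a member it is replaced by \<open>M\<close>, and otherwise every element of \<open>M\<close> is as
  indifferent to the module as \<open>r\<close> is.\<close>

lemma trivial_modules_outside:
  assumes v: "only_trivial_modules_at A X v" "v \<in> X - M"
  shows "only_trivial_modules_at A (insert r (X - M)) v"
  unfolding only_trivial_modules_at_def
proof (intro allI impI, elim conjE)
  fix N assume N: "mdl A (insert r (X - M)) N" "v \<in> N" "N \<noteq> insert r (X - M)"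
  have NX: "N \<subseteq> insert r (X - M)" using N(1) by (simp add: mdl_def)
  have Nu: "A x y = A x z" if "x \<in> insert r (X - M) - N" "y \<in> N" "z \<in> N" for x y z
    using N(1) that unfolding mdl_def by blast
  show "N = {v}"
  proof (cases "r \<in> N")
    case False
    have eq: "A x y = A r y" if "x \<in> M" "y \<in> N" for x y
      using uniform[of y x u] u copy[of y] sym that NX False by blast
    have "mdl A X N"
      unfolding mdl_def
    proof (intro conjI ballI)
      fix x y z assume xyz: "x \<in> X - N" "y \<in> N" "z \<in> N"
      show "A x y = A x z"
      proof (cases "x \<in> M")
        case True
        then show ?thesis using eq[of x y] eq[of x z] Nu[of r y z] xyz False by blast
      next
        case False
        then show ?thesis using Nu[of x y z] xyz by blast
      qed
    qed (use N(2) NX False in auto)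
    moreover have "N \<noteq> X" using u MX NX False by blast
    ultimately show ?thesis using v N(2) unfolding only_trivial_modules_at_def by blast
  next
    case True
    let ?N = "N - {r} \<union> M"
    have "A x y = A x u" if "x \<in> X - ?N" "y \<in> ?N" for x y
    proof -
      have x: "x \<in> X - M" "x \<in> insert r (X - M) - N" using that(1) r by auto
      show ?thesis
        using Nu[OF x(2) _ True] copy[OF x(1)] uniform[OF x(1) _ u] that(2) by blast
    qed
    then have "mdl A X ?N" unfolding mdl_def using u NX MX by blast
    moreover obtain y where "y \<in> X - M" "y \<notin> N" using N(3) NX True by blast
    then have "?N \<noteq> X" by blast
    \<comment> \<open>This case is impossible, as u is a member of \<open>M\<close> and v is
      not.\<close>
    ultimately have "?N = {v}" using v N(2) r unfolding only_trivial_modules_at_def by blast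
    then have "u = v" using u by (metis UnI2 singletonD)
    then show ?thesis using u v(2) by simp
  qed
qed

end

section \<open>Return from relations to graphs, and transport along injections\<close>

subsection \<open>Induced subgraphs\<close>

definition induced :: "'a ugraph \<Rightarrow> 'a set \<Rightarrow> 'a ugraph" where
  "induced G X = (X, {e \<in> edges G. e \<subseteq> X})"

lemma induced_simps [simp]: "verts (induced G X) = X" "edges (induced G X) = {e \<in> edges G. e \<subseteq> X}"
  by (simp_all add: induced_def)

lemma induced_subgraph_induced: "X \<subseteq> verts G \<Longrightarrow> induced_subgraph (induced G X) G"
  by (simp add: induced_subgraph_def)

lemma adjacent_induced: "adjacent (induced G X) u v \<longleftrightarrow> adjacent G u v \<and> u \<in> X \<and> v \<in> X"
  by (auto simp: adjacent_def)

lemma induced_verts: "simple_graph G \<Longrightarrow> induced G (verts G) = G"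
  by (cases G) (auto simp: induced_def simple_graph_def nsets_def)

lemma adjacent_sym: "adjacent G u v \<Longrightarrow> adjacent G v u"
  by (simp add: adjacent_def insert_commute)

lemma adjacent_irrefl: "simple_graph G \<Longrightarrow> \<not> adjacent G u u"
  by (auto simp: simple_graph_def adjacent_def nsets_def)

lemma simple_edgeE:
  assumes "simple_graph G" "e \<in> edges G"
  obtains u v where "e = {u, v}" "u \<noteq> v" "u \<in> verts G" "v \<in> verts G"
proof -
  have "card e = 2" "e \<subseteq> verts G" using assms by (auto simp: simple_graph_def nsets_def)
  then show ?thesis using that by (auto simp: card_2_iff)
qed

lemma independent_set_induced:
  assumes "simple_graph G"
  shows "independent_set (induced G X) I \<longleftrightarrow> I \<subseteq> X \<and> (\<forall>x\<in>I. \<forall>y\<in>I. \<not> adjacent G x y)"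
proof
  assume I: "independent_set (induced G X) I"
  then have IX: "I \<subseteq> X" by (simp add: independent_set_def)
  have "\<not> adjacent G x y" if "x \<in> I" "y \<in> I" for x y
  proof
    assume xy: "adjacent G x y"
    then have "x \<noteq> y" using adjacent_irrefl[OF assms] by blast
    moreover have "{x, y} \<in> edges (induced G X)" using xy that IX by (auto simp: adjacent_def)
    ultimately show False using I that unfolding independent_set_def indep_def by blast
  qed
  then show "I \<subseteq> X \<and> (\<forall>x\<in>I. \<forall>y\<in>I. \<not> adjacent G x y)" using IX by blast
qed (auto simp: independent_set_def indep_def adjacent_def)

lemma maximal_independent_set_induced:
  assumes "simple_graph G"
  shows "maximal_independent_set (induced G X) I \<longleftrightarrow> mis (adjacent G) X I"
proof
  assume I: "maximal_independent_set (induced G X) I"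
  then have ind: "I \<subseteq> X" "\<And>x y. x \<in> I \<Longrightarrow> y \<in> I \<Longrightarrow> \<not> adjacent G x y"
    by (auto simp: maximal_independent_set_def independent_set_induced[OF assms])
  have "\<exists>y\<in>I. adjacent G x y" if "x \<in> X - I" for x
  proof (rule ccontr)
    assume "\<not> ?thesis"
    then have "independent_set (induced G X) (insert x I)"
      using ind that adjacent_irrefl[OF assms] adjacent_sym[of G]
      unfolding independent_set_induced[OF assms] by blast
    then show False using I that unfolding maximal_independent_set_def by blast
  qed
  then show "mis (adjacent G) X I" using ind unfolding mis_def by blast
next
  assume "mis (adjacent G) X I"
  then show "maximal_independent_set (induced G X) I"
    unfolding maximal_independent_set_def independent_set_induced[OF assms] mis_def by blast
qed

lemma wc_induced:
  assumes "simple_graph G"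
  shows "well_covered_weighting (induced G X) w \<longleftrightarrow> wc (adjacent G) X w"
  unfolding well_covered_weighting_def wc_def maximal_independent_set_induced[OF assms] ..

lemma graph_module_induced:
  assumes "X \<subseteq> verts G"
  shows "graph_module (induced G X) M \<longleftrightarrow> mdl (adjacent G) X M"
  unfolding graph_module_def mdl_def adjacent_induced induced_simps by blast

text \<open>If every proper module is a singleton, so is in particular every maximal strong
  one.\<close>

lemma prime_graph_induced:
  assumes "X \<subseteq> verts G" "\<And>x. x \<in> X \<Longrightarrow> only_trivial_modules_at (adjacent G) X x"
  shows "prime_graph (induced G X)"
  unfolding prime_graph_def
proof (intro allI impI)
  fix M assume "maximal_strong_module (induced G X) M"
  then have M: "mdl (adjacent G) X M" "M \<noteq> X"
    using graph_module_induced[OF assms(1)]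
    by (auto simp: maximal_strong_module_def strong_module_def)
  then obtain x where "x \<in> M" "x \<in> X" unfolding mdl_def by blast
  then have "M = {x}" using assms(2) M unfolding only_trivial_modules_at_def by blast
  then show "is_singleton M" by simp
qed

text \<open>This and the following lemmas carry the notions over from the instances of a piece to
  the vertices they copy; the map between them is injective on each piece.\<close>

lemma mis_image:
  assumes "inj_on f X" "I \<subseteq> X"
  shows "mis A (f ` X) (f ` I) \<longleftrightarrow> mis (\<lambda>x y. A (f x) (f y)) X I"
proof -
  have "f ` X - f ` I = f ` (X - I)" using assms by (simp add: inj_on_image_set_diff)
  then show ?thesis using assms unfolding mis_def by auto
qed

lemma wc_image:
  assumes "inj_on f X"
  shows "wc A (f ` X) w \<longleftrightarrow> wc (\<lambda>x y. A (f x) (f y)) X (\<lambda>x. w (f x))"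
proof -
  have s: "sum w (f ` I) = sum (\<lambda>x. w (f x)) I" if "I \<subseteq> X" for I
    using inj_on_subset[OF assms that] by (simp add: sum.reindex)
  have sub: "mis A (f ` X) K \<Longrightarrow> \<exists>I\<subseteq>X. K = f ` I" for K
    by (auto simp: mis_def subset_image_iff)
  have sub': "mis B X I \<Longrightarrow> I \<subseteq> X" for B I
    by (simp add: mis_def)
  show ?thesis
  proof
    assume L: "wc A (f ` X) w"
    show "wc (\<lambda>x y. A (f x) (f y)) X (\<lambda>x. w (f x))"
      unfolding wc_def
    proof (intro allI impI, elim conjE)
      fix I J assume IJ: "mis (\<lambda>x y. A (f x) (f y)) X I" "mis (\<lambda>x y. A (f x) (f y)) X J"
      then have "mis A (f ` X) (f ` I)" "mis A (f ` X) (f ` J)"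
        using mis_image[OF assms] sub' by blast+
      then have "sum w (f ` I) = sum w (f ` J)" using L unfolding wc_def by blast
      then show "(\<Sum>x\<in>I. w (f x)) = (\<Sum>x\<in>J. w (f x))" using s IJ sub' by metis
    qed
  next
    assume R: "wc (\<lambda>x y. A (f x) (f y)) X (\<lambda>x. w (f x))"
    show "wc A (f ` X) w"
      unfolding wc_def
    proof (intro allI impI, elim conjE)
      fix K L assume KL: "mis A (f ` X) K" "mis A (f ` X) L"
      then obtain I J where IJ: "I \<subseteq> X" "K = f ` I" "J \<subseteq> X" "L = f ` J" using sub by metis
      then have "mis (\<lambda>x y. A (f x) (f y)) X I" "mis (\<lambda>x y. A (f x) (f y)) X J"
        using KL mis_image[OF assms] by blast+
      then have "(\<Sum>x\<in>I. w (f x)) = (\<Sum>x\<in>J. w (f x))" using R unfolding wc_def by blast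
      then show "sum w K = sum w L" using s IJ by metis
    qed
  qed
qed

lemma mdl_image:
  assumes "inj_on f X" "I \<subseteq> X"
  shows "mdl A (f ` X) (f ` I) \<longleftrightarrow> mdl (\<lambda>x y. A (f x) (f y)) X I"
proof -
  have eq: "f ` X - f ` I = f ` (X - I)" using assms by (simp add: inj_on_image_set_diff)
  show ?thesis
    unfolding mdl_def eq ball_simps image_is_empty using image_mono[OF assms(2)] assms(2) by blast
qed

lemma only_trivial_modules_at_image:
  assumes "inj_on f X" "only_trivial_modules_at (\<lambda>x y. A (f x) (f y)) X v" "v \<in> X"
  shows "only_trivial_modules_at A (f ` X) (f v)"
  unfolding only_trivial_modules_at_def
proof (intro allI impI, elim conjE)
  fix M assume M: "mdl A (f ` X) M" "f v \<in> M" "M \<noteq> f ` X"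
  then obtain I where I: "I \<subseteq> X" "M = f ` I" by (metis mdl_def subset_image_iff)
  then have "mdl (\<lambda>x y. A (f x) (f y)) X I" using M(1) mdl_image[OF assms(1)] by blast
  moreover have "v \<in> I" using M(2) I assms(1,3) by (meson inj_on_image_mem_iff)
  moreover have "I \<noteq> X" using M(3) I by blast
  ultimately have "I = {v}" using assms(2) unfolding only_trivial_modules_at_def by blast
  then show "M = {f v}" using I by simp
qed

text \<open>An edge has two different ends, while two pieces share at most one vertex, so no edge is
  counted twice.\<close>

lemma sum_card_edges_pieces:
  assumes G: "simple_graph G" and "finite C"
    and share: "\<And>c c' x y. c \<in> C \<Longrightarrow> c' \<in> C \<Longrightarrow> c \<noteq> c' \<Longrightarrow> x \<in> V c \<inter> V c' \<Longrightarrow> y \<in> V c \<inter> V c' \<Longrightarrow> x = y"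
  shows "(\<Sum>c\<in>C. card (edges (induced G (V c)))) \<le> card (edges G)"
proof -
  have fin: "finite (edges G)"
  proof -
    have "edges G \<subseteq> Pow (verts G)" "finite (verts G)" using G by (auto simp: simple_graph_def nsets_def)
    then show ?thesis using finite_subset by blast
  qed
  let ?E = "\<lambda>c. edges (induced G (V c))"
  have "?E c \<inter> ?E c' = {}" if "c \<in> C" "c' \<in> C" "c \<noteq> c'" for c c'
  proof (rule ccontr)
    assume "?E c \<inter> ?E c' \<noteq> {}"
    then obtain e where e: "e \<in> edges G" "e \<subseteq> V c" "e \<subseteq> V c'" by auto
    obtain x y where "e = {x, y}" "x \<noteq> y" using simple_edgeE[OF G e(1)] by metis
    then show False using share[OF that, of x y] e by auto
  qed
  then have "(\<Sum>c\<in>C. card (?E c)) = card (\<Union>c\<in>C. ?E c)"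
    using fin assms(2) by (subst card_UN_disjoint) auto
  also have "\<dots> \<le> card (edges G)" using fin by (intro card_mono) auto
  finally show ?thesis .
qed

section \<open>From the edge list to the adjacency matrix\<close>

subsection \<open>Reading the input\<close>

text \<open>Integer variables: 0 the number zero, 1 the number \<open>n\<close> of vertices, 2 the base \<open>d\<close> of the
  save area, 3 a piece, 4 the number of pieces, 5 the number of instances, 6 the current instance,
  7 the number one, 8 \<^const>\<open>reg_count\<close>, 9 and 10 position and address in the input or output;
  the others are local. Rational variables 10 and 11 hold 0 and 1.

  Arrays: 0 the memories of the runs of the given program, 1 adjacency of instances, 2 pieces of
  instances, 3 expansions of instances, 4 and 5 reached and processed instances, 6 an independent
  set, 7 numbers of instances within their pieces, 8 and 9 the current equation over a piece and
  over the graph, 10 and 11 an echelon basis with pivots, 12 the selected equations.\<close>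

abbreviation only_if :: "hl_test \<Rightarrow> cmd \<Rightarrow> cmd" where "only_if t c \<equiv> Cond t c Nop"
abbreviation if_not :: "hl_test \<Rightarrow> cmd \<Rightarrow> cmd" where "if_not t c \<equiv> Cond t Nop c"

lemma ForLess_ok [simp]:
  "cmd_ok (ForLess x b c) \<longleftrightarrow> var_ok x \<and> var_ok b \<and> x \<notin> written_nv c \<and> cmd_ok c"
  "depth (ForLess x b c) = Suc (depth c)"
  by (auto simp: ForLess_def)

definition next_in :: "nat \<Rightarrow> cmd" where
  "next_in x = Cond (NLess 9 8) (RawRead x 10 ;; NAdd 10 10 10) (RawRead x 9) ;; NAdd 9 9 7"

definition emit :: "nat \<Rightarrow> cmd" where
  "emit x = Cond (NLess 9 8) (RawWrite 10 x ;; NAdd 10 10 10) (RawWrite 9 x) ;; NAdd 9 9 7"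

definition init_code :: cmd where
  "init_code = NSet 7 1 ;; NSet 8 reg_count ;; QSet 10 0 ;; QSet 11 1 ;; NSet 9 2 ;;
     NAdd 10 2 2 ;; NAdd 10 10 10 ;; NAdd 5 1 0 ;; NAdd 4 7 0"

text \<open>The loop language has no conversion from rational to integer variables; an index is
  found by comparing it with all values of a counter.\<close>

definition find_code :: cmd where
  "find_code = For 13 (QOf 2 13 ;; only_if (QEq 2 0) (NAdd 18 13 0) ;; only_if (QEq 2 1) (NAdd 19 13 0))"

definition read_edge :: cmd where
  "read_edge = next_in 0 ;; next_in 1 ;;
     if_not (QEq 0 1) (find_code ;; Write 1 18 19 11 ;; Write 1 19 18 11)"

text \<open>There are \<open>B * B\<close> rounds, more than there are edges. Beyond the input all
  cells are zero, and a pair of equal numbers is no edge and is skipped.\<close>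

definition read_code :: cmd where
  "read_code = For 11 (For 12 read_edge)"

definition rep_init :: cmd where
  "rep_init = ForLess 13 1 (Write 3 13 13 11)"

lemma written_next_in [simp]:
  "written_nv (next_in x) = {9, 10}" "written_qv (next_in x) = {x}"
  "written_arr (next_in x) = {}" "\<not> writes_raw (next_in x)"
  by (auto simp: next_in_def)

lemma written_emit [simp]:
  "written_nv (emit x) = {9, 10}" "written_qv (emit x) = {}" "written_arr (emit x) = {}"
  by (auto simp: emit_def)

lemma written_find_code [simp]:
  "written_nv find_code = {13, 18, 19}" "written_qv find_code = {2}"
  "written_arr find_code = {}" "\<not> writes_raw find_code"
  by (auto simp: find_code_def)

lemma written_read_edge [simp]:
  "written_nv read_edge = {9, 10, 13, 18, 19}" "written_qv read_edge = {0, 1, 2}"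
  "written_arr read_edge = {1}" "\<not> writes_raw read_edge"
  by (auto simp: read_edge_def)

lemma written_read_code [simp]:
  "written_nv read_code = {9, 10, 11, 12, 13, 18, 19}" "written_qv read_code = {0, 1, 2}"
  "written_arr read_code = {1}" "\<not> writes_raw read_code"
  by (auto simp: read_code_def)

lemma written_rep_init [simp]:
  "written_nv rep_init = {13}" "written_qv rep_init = {}"
  "written_arr rep_init = {3}" "\<not> writes_raw rep_init"
  by (auto simp: rep_init_def)

definition consts_ok :: "hl_state \<Rightarrow> bool" where
  "consts_ok h \<longleftrightarrow> nv h 0 = 0 \<and> nv h 7 = 1 \<and> nv h 8 = reg_count \<and> qv h 10 = 0 \<and> qv h 11 = 1"

text \<open>Variable 9 is the logical position. Variable 10 follows it with the slot address, and is
  meaningful only up to the end of the register area, where slots and cells start to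
  coincide.\<close>

definition at_cell :: "nat \<Rightarrow> nat \<Rightarrow> hl_state \<Rightarrow> bool" where
  "at_cell d a h \<longleftrightarrow> nv h 9 = a \<and> (a \<le> reg_count \<longrightarrow> nv h 10 = d * 2 ^ a)"

lemma slot_bounds:
  assumes "reg_count \<le> d" "a < d" "D = d * 2 ^ reg_count"
  shows "reg_count \<le> slot d a" "slot d a < D"
proof -
  have "d * 1 \<le> d * 2 ^ a" by (intro mult_le_mono2) simp
  then have "reg_count \<le> d * 2 ^ a" using assms(1) by linarith
  then show "reg_count \<le> slot d a" by (simp add: slot_def)
  have "0 < d" using assms(2) by simp
  then have small: "d * 2 ^ a < d * 2 ^ reg_count" if "a < reg_count" using that by simp
  have "d * 1 \<le> d * 2 ^ reg_count" by (intro mult_le_mono2) simp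
  then have "a < d * 2 ^ reg_count" using assms(2) by linarith
  then show "slot d a < D" using small by (simp add: slot_def assms(3))
qed

lemma slot_inject:
  assumes "a < d" "b < d" "slot d a = slot d b"
  shows "a = b"
proof -
  have "0 < d" using assms by simp
  have ge: "d * 1 \<le> d * 2 ^ i" for i by (intro mult_le_mono2) simp
  show ?thesis
    using assms ge[of a] ge[of b] \<open>0 < d\<close> by (auto simp: slot_def split: if_splits)
qed

context machine
begin

lemma next_in_correct:
  assumes "consts_ok h" "at_cell d a h" "reg_count \<le> d" "a < d" "D = d * 2 ^ reg_count"
  shows "qv (run (next_in x) h) x = raw h (slot d a)" "at_cell d (Suc a) (run (next_in x) h)"
  using assms(1-4) slot_bounds[OF assms(3-5)]
  by (auto simp: next_in_def consts_ok_def at_cell_def slot_def split: if_splits)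

lemma emit_correct:
  assumes "consts_ok h" "at_cell d a h" "reg_count \<le> d" "a < d" "D = d * 2 ^ reg_count"
  shows "raw (run (emit x) h) = (raw h)(slot d a := qv h x)" "at_cell d (Suc a) (run (emit x) h)"
  using assms(1-4) slot_bounds[OF assms(3-5)]
  by (auto simp: emit_def consts_ok_def at_cell_def slot_def fun_eq_iff split: if_splits)

lemma find_code_correct:
  assumes "i < B" "j < B" "qv h 0 = of_nat i" "qv h 1 = of_nat j" "nv h 0 = 0"
  shows "nv (run find_code h) 18 = i" "nv (run find_code h) 19 = j"
proof -
  define I where "I = (\<lambda>k (t :: hl_state). (i < k \<longrightarrow> nv t 18 = i) \<and> (j < k \<longrightarrow> nv t 19 = j))"
  have "I B (run find_code h)"
    unfolding find_code_def
  proof (rule For_inv, goal_cases)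
    case (4 k t)
    then show ?case using assms(3-5) by (auto simp: agree_def I_def less_Suc_eq)
  qed (auto simp: I_def)
  then show "nv (run find_code h) 18 = i" "nv (run find_code h) 19 = j"
    using assms by (auto simp: I_def)
qed

definition edge_adj :: "(nat \<times> nat) list \<Rightarrow> nat \<Rightarrow> nat \<Rightarrow> nat \<Rightarrow> rat" where
  "edge_adj es p i j = (if \<exists>q < p. q < length es \<and> (es ! q = (i, j) \<or> es ! q = (j, i)) then 1 else 0)"

definition reading :: "nat \<Rightarrow> (nat \<times> nat) list \<Rightarrow> nat \<Rightarrow> hl_state \<Rightarrow> bool" where
  "reading d es p h \<longleftrightarrow> consts_ok h \<and> at_cell d (2 + 2 * p) h \<and> (\<forall>i j. arr h 1 i j = edge_adj es p i j)"

lemma edge_adj_Suc: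
  "p < length es \<Longrightarrow> es ! p = (a, b) \<Longrightarrow>
     edge_adj es (Suc p) i j = (if (i = a \<and> j = b) \<or> (i = b \<and> j = a) then 1 else edge_adj es p i j)"
  "length es \<le> p \<Longrightarrow> edge_adj es (Suc p) i j = edge_adj es p i j"
proof -
  have *: "(\<exists>q < Suc p. Q q) \<longleftrightarrow> (\<exists>q < p. Q q) \<or> Q p" for Q
    by (metis less_Suc_eq)
  show "p < length es \<Longrightarrow> es ! p = (a, b) \<Longrightarrow>
     edge_adj es (Suc p) i j = (if (i = a \<and> j = b) \<or> (i = b \<and> j = a) then 1 else edge_adj es p i j)"
    unfolding edge_adj_def * by auto
  show "length es \<le> p \<Longrightarrow> edge_adj es (Suc p) i j = edge_adj es p i j"
    unfolding edge_adj_def * by simp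
qed

lemma read_edge_correct:
  assumes h: "reading d es p h" and d: "reg_count \<le> d" "D = d * 2 ^ reg_count" "3 + 2 * p < d"
    and es: "\<forall>(i, j) \<in> set es. i < B \<and> j < B \<and> i \<noteq> j"
    and inp: "\<And>q. q < length es \<Longrightarrow> raw h (slot d (2 + 2 * q)) = of_nat (fst (es ! q))"
      "\<And>q. q < length es \<Longrightarrow> raw h (slot d (3 + 2 * q)) = of_nat (snd (es ! q))"
      "\<And>a. 2 + 2 * length es \<le> a \<Longrightarrow> a < d \<Longrightarrow> raw h (slot d a) = 0"
  shows "reading d es (Suc p) (run read_edge h)"
proof -
  let ?h1 = "run (next_in 0) h"
  let ?h2 = "run (next_in 1) ?h1"
  have c: "consts_ok h" "at_cell d (2 + 2 * p) h" using h by (auto simp: reading_def)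
  have 1: "qv ?h1 0 = raw h (slot d (2 + 2 * p))" "at_cell d (Suc (2 + 2 * p)) ?h1"
    using next_in_correct[OF c d(1) _ d(2)] d(3) by auto
  have c1: "consts_ok ?h1" using c(1) by (simp add: consts_ok_def run_nv run_qv)
  have 2: "qv ?h2 1 = raw h (slot d (3 + 2 * p))" "at_cell d (2 + 2 * Suc p) ?h2"
    using next_in_correct[OF c1 1(2) d(1) _ d(2), of 1] d(3)
    by (auto simp: run_raw eval_nat_numeral)
  have 20: "qv ?h2 0 = raw h (slot d (2 + 2 * p))" using 1(1) by (simp add: run_qv)
  have c2: "consts_ok ?h2" using c1 by (simp add: consts_ok_def run_nv run_qv)
  have a2: "arr ?h2 = arr h" by (rule ext) (simp add: run_arr)
  show ?thesis
  proof (cases "p < length es")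
    case True
    obtain a b where ab: "es ! p = (a, b)" by fastforce
    have "(a, b) \<in> set es" using ab True by (metis nth_mem)
    then have ab': "a < B" "b < B" "a \<noteq> b" using es by auto
    have q: "qv ?h2 0 = of_nat a" "qv ?h2 1 = of_nat b" using inp(1,2)[OF True] ab 20 2(1) by auto
    let ?h3 = "run find_code ?h2"
    have 3: "nv ?h3 18 = a" "nv ?h3 19 = b"
      using find_code_correct[OF ab'(1,2) q] c2 by (auto simp: consts_ok_def)
    have r: "run read_edge h = set_arr 1 b a (qv ?h3 11) (set_arr 1 a b (qv ?h3 11) ?h3)"
      using q ab'(3) 3 by (simp add: read_edge_def)
    have "qv ?h3 11 = 1" using c2 by (simp add: run_qv consts_ok_def)
    moreover have "arr ?h3 = arr h" using a2 by (intro ext) (simp add: run_arr)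
    moreover have "consts_ok ?h3" using c2 by (simp add: consts_ok_def run_nv run_qv)
    moreover have "at_cell d (2 + 2 * Suc p) ?h3" using 2(2) by (simp add: at_cell_def run_nv)
    ultimately show ?thesis
      unfolding r reading_def edge_adj_Suc(1)[OF True ab]
      using h by (auto simp: reading_def consts_ok_def at_cell_def)
  next
    case False
    then have "qv ?h2 0 = 0" "qv ?h2 1 = 0" using inp(3) d(3) 20 2(1) by auto
    then have "run read_edge h = ?h2" by (simp add: read_edge_def)
    then show ?thesis
      using h c2 2(2) a2 False unfolding reading_def by (simp add: edge_adj_Suc(2))
  qed
qed

lemma read_code_correct:
  assumes h: "reading d es 0 h" and d: "reg_count \<le> d" "D = d * 2 ^ reg_count" "3 + 2 * (B * B) < d"
    and es: "\<forall>(i, j) \<in> set es. i < B \<and> j < B \<and> i \<noteq> j"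
    and inp: "\<And>q. q < length es \<Longrightarrow> raw h (slot d (2 + 2 * q)) = of_nat (fst (es ! q))"
      "\<And>q. q < length es \<Longrightarrow> raw h (slot d (3 + 2 * q)) = of_nat (snd (es ! q))"
      "\<And>a. 2 + 2 * length es \<le> a \<Longrightarrow> a < d \<Longrightarrow> raw h (slot d a) = 0"
  shows "reading d es (B * B) (run read_code h)"
  unfolding read_code_def
proof (rule For_inv[where I = "\<lambda>k. reading d es (k * B)"], goal_cases)
  case (4 k t)
  have raw: "raw t = raw h" using 4(3) by (simp add: agree_def)
  have "reading d es (k * B + B) (run (For 12 read_edge) t)"
  proof (rule For_inv[where I = "\<lambda>l. reading d es (k * B + l)"], goal_cases)
    case (4 l t')
    have "raw t' = raw h" using 4(3) raw by (simp add: agree_def)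
    moreover have "3 + 2 * (k * B + l) < d"
      using index_less_square[OF \<open>k < B\<close> \<open>l < B\<close>] d(3) by simp
    ultimately show ?case using read_edge_correct[OF 4(4) d(1,2) _ es] inp by simp
  qed (use 4 in \<open>auto simp: reading_def consts_ok_def at_cell_def\<close>)
  then show ?case by (simp add: add.commute)
qed (use h in \<open>auto simp: reading_def consts_ok_def at_cell_def\<close>)

lemma rep_init_correct:
  assumes "nv h 1 \<le> B" "qv h 11 = 1" "arr h 3 = (\<lambda>_ _. 0)"
  shows "arr (run rep_init h) 3 = (\<lambda>v z. if v = z \<and> v < nv h 1 then 1 else 0)"
  unfolding rep_init_def
proof (rule ForLess_inv[where I = "\<lambda>k t. arr t 3 = (\<lambda>v z. if v = z \<and> v < k then 1 else 0)"], goal_cases)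
  case (7 k t)
  then show ?case using assms(2) by (auto simp: agree_def fun_eq_iff)
qed (use assms in auto)

end

section \<open>Closed sets by forward and backward search\<close>

subsection \<open>Searching a module containing a given instance\<close>

definition choose_code :: cmd where
  "choose_code = ForLess 13 5 (Read 1 2 0 13 ;; only_if (QEq 1 5) (if_not (NEq 13 6) (NAdd 20 13 0)))"

definition pick_code :: cmd where
  "pick_code = NSet 22 0 ;; ForLess 13 5 (Read 1 4 0 13 ;; Read 2 5 0 13 ;;
     only_if (QEq 1 11) (only_if (QEq 2 10) (NAdd 15 13 0 ;; NSet 22 1)))"

definition edge_rd :: "bool \<Rightarrow> cmd" where
  "edge_rd b = (if b then Read 1 1 14 6 ;; Read 2 1 14 15 else Read 1 1 15 6 ;; Read 2 1 15 14)"

definition spread_code :: "bool \<Rightarrow> cmd" where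
  "spread_code b = ForLess 14 5 (Read 1 2 0 14 ;; only_if (QEq 1 5) (if_not (NEq 14 6)
     (edge_rd b ;; if_not (QEq 1 2) (Write 4 0 14 11))))"

definition clear_code :: cmd where
  "clear_code = ForLess 13 5 (Write 4 0 13 10 ;; Write 5 0 13 10)"

text \<open>Arrays 4 and 5 mark reached and processed instances. Each round of the outer loop
  processes one pending instance, so that a search has loop depth two; \<open>b\<close> selects the
  direction of the steps.\<close>

definition reach_code :: "bool \<Rightarrow> cmd" where
  "reach_code b = clear_code ;; Write 4 0 20 11 ;;
     For 27 (pick_code ;; only_if (NEq 22 7) (Write 5 0 15 11 ;; spread_code b))"

definition full_code :: cmd where
  "full_code = NSet 23 1 ;; ForLess 13 5 (Read 1 2 0 13 ;; only_if (QEq 1 5) (if_not (NEq 13 6)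
     (Read 2 4 0 13 ;; only_if (QEq 2 10) (NSet 23 0))))"

definition complement_code :: cmd where
  "complement_code = ForLess 13 5 (Read 1 2 0 13 ;; only_if (QEq 1 5) (if_not (NEq 13 6)
     (Read 2 4 0 13 ;; QArith Minus 2 11 2 ;; Write 4 0 13 2)))"

definition any_code :: cmd where
  "any_code = NSet 23 0 ;; ForLess 13 5 (Read 2 4 0 13 ;; only_if (QEq 2 11) (NSet 23 1))"

text \<open>A forward search from w yields a closed set that contains w. Only if it contains
  everything, a backward search follows: the instances that do not reach w form a closed set without
  w. Variable 23 tells whether array 4 finally holds a nonempty set.\<close>

definition find_module :: cmd where
  "find_module = Read 5 2 0 6 ;; choose_code ;; reach_code True ;; full_code ;;
     only_if (NEq 23 7) (reach_code False ;; complement_code) ;; any_code"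

lemma written_choose_code [simp]:
  "written_nv choose_code = {13, 20}" "written_qv choose_code = {1}"
  "written_arr choose_code = {}" "\<not> writes_raw choose_code"
  by (auto simp: choose_code_def)

lemma written_pick_code [simp]:
  "written_nv pick_code = {13, 15, 22}" "written_qv pick_code = {1, 2}"
  "written_arr pick_code = {}" "\<not> writes_raw pick_code"
  by (auto simp: pick_code_def)

lemma written_edge_rd [simp]:
  "written_nv (edge_rd b) = {}" "written_qv (edge_rd b) = {1, 2}"
  "written_arr (edge_rd b) = {}" "\<not> writes_raw (edge_rd b)"
  by (auto simp: edge_rd_def)

lemma written_spread_code [simp]:
  "written_nv (spread_code b) = {14}" "written_qv (spread_code b) = {1, 2}"
  "written_arr (spread_code b) = {4}" "\<not> writes_raw (spread_code b)"
  by (auto simp: spread_code_def)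

lemma written_clear_code [simp]:
  "written_nv clear_code = {13}" "written_qv clear_code = {}"
  "written_arr clear_code = {4, 5}" "\<not> writes_raw clear_code"
  by (auto simp: clear_code_def)

lemma written_reach_code [simp]:
  "written_nv (reach_code b) = {13, 14, 15, 22, 27}" "written_qv (reach_code b) = {1, 2}"
  "written_arr (reach_code b) = {4, 5}" "\<not> writes_raw (reach_code b)"
  by (auto simp: reach_code_def)

lemma written_full_code [simp]:
  "written_nv full_code = {13, 23}" "written_qv full_code = {1, 2}"
  "written_arr full_code = {}" "\<not> writes_raw full_code"
  by (auto simp: full_code_def)

lemma written_complement_code [simp]:
  "written_nv complement_code = {13}" "written_qv complement_code = {1, 2}"
  "written_arr complement_code = {4}" "\<not> writes_raw complement_code"
  by (auto simp: complement_code_def)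

lemma written_any_code [simp]:
  "written_nv any_code = {13, 23}" "written_qv any_code = {2}"
  "written_arr any_code = {}" "\<not> writes_raw any_code"
  by (auto simp: any_code_def)

lemma written_find_module [simp]:
  "written_nv find_module = {13, 14, 15, 20, 22, 23, 27}" "written_qv find_module = {1, 2, 5}"
  "written_arr find_module = {4, 5}" "\<not> writes_raw find_module"
  by (auto simp: find_module_def)

definition flagged :: "nat \<Rightarrow> nat \<Rightarrow> hl_state \<Rightarrow> nat set" where
  "flagged k N h = {v. v < N \<and> arr h k 0 v = 1}"

definition flags :: "nat \<Rightarrow> nat \<Rightarrow> hl_state \<Rightarrow> bool" where
  "flags k N h \<longleftrightarrow> (\<forall>v<N. arr h k 0 v = 0 \<or> arr h k 0 v = 1)"

definition members :: "nat \<Rightarrow> (nat \<Rightarrow> nat) \<Rightarrow> nat \<Rightarrow> nat set" where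
  "members N lab c = {v. v < N \<and> lab v = c}"

text \<open>A step from y to x. For \<open>b\<close> false the step is reversed: it is y that
  distinguishes u from x.\<close>

definition distinguishes :: "(nat \<Rightarrow> nat \<Rightarrow> bool) \<Rightarrow> nat \<Rightarrow> bool \<Rightarrow> nat \<Rightarrow> nat \<Rightarrow> bool" where
  "distinguishes A u b y x \<longleftrightarrow> (if b then A x u \<noteq> A x y else A y u \<noteq> A y x)"

definition instances :: "nat \<Rightarrow> (nat \<Rightarrow> nat \<Rightarrow> bool) \<Rightarrow> (nat \<Rightarrow> nat) \<Rightarrow> hl_state \<Rightarrow> bool" where
  "instances N A lab h \<longleftrightarrow> consts_ok h \<and> nv h 5 = N \<and> (\<forall>v<N. arr h 2 0 v = of_nat (lab v)) \<and>
     (\<forall>i<N. \<forall>j<N. arr h 1 i j = of_bool (A i j))"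

definition current :: "nat \<Rightarrow> (nat \<Rightarrow> nat) \<Rightarrow> nat \<Rightarrow> hl_state \<Rightarrow> bool" where
  "current N lab u h \<longleftrightarrow> nv h 6 = u \<and> u < N \<and> qv h 5 = of_nat (lab u)"

context machine
begin

lemma choose_code_correct:
  assumes h: "instances N A lab h" "current N lab u h" and "N \<le> B" "members N lab (lab u) - {u} \<noteq> {}"
  shows "nv (run choose_code h) 20 \<in> members N lab (lab u) - {u}"
proof -
  define I where "I = (\<lambda>k (t :: hl_state). (\<exists>v<k. v \<in> members N lab (lab u) - {u}) \<longrightarrow>
    nv t 20 \<in> members N lab (lab u) - {u})"
  have "I (nv h 5) (run choose_code h)"
    unfolding choose_code_def
  proof (rule ForLess_inv, goal_cases)
    case (7 k t)
    have "k < N" using 7(1) h by (simp add: instances_def)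
    moreover have "nv t 0 = 0" "nv t 6 = u" "qv t 5 = of_nat (lab u)" "arr t 2 0 k = of_nat (lab k)"
      using 7(3) h \<open>k < N\<close> by (auto simp: agree_def instances_def current_def consts_ok_def)
    ultimately show ?case
      using 7(2,4) unfolding I_def by (auto simp: members_def less_Suc_eq)
  qed (use assms in \<open>auto simp: I_def instances_def\<close>)
  moreover have "\<exists>v<nv h 5. v \<in> members N lab (lab u) - {u}"
    using assms(4) h(1) by (auto simp: members_def instances_def)
  ultimately show ?thesis by (simp add: I_def)
qed

lemma pick_code_correct:
  assumes h: "instances N A lab h" and "N \<le> B"
  defines "h' \<equiv> run pick_code h"
  shows "(nv h' 22 = 1 \<and> nv h' 15 < N \<and> arr h 4 0 (nv h' 15) = 1 \<and> arr h 5 0 (nv h' 15) = 0) \<or>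
    (nv h' 22 = 0 \<and> (\<forall>v<N. arr h 4 0 v = 1 \<longrightarrow> arr h 5 0 v \<noteq> 0))"
proof -
  define I where "I = (\<lambda>k (t :: hl_state).
    (nv t 22 = 1 \<and> nv t 15 < k \<and> arr h 4 0 (nv t 15) = 1 \<and> arr h 5 0 (nv t 15) = 0) \<or>
    (nv t 22 = 0 \<and> (\<forall>v<k. arr h 4 0 v = 1 \<longrightarrow> arr h 5 0 v \<noteq> 0)))"
  have n5: "nv (set_nv 22 0 h) 5 = N" using h by (simp add: instances_def)
  have "I (nv (set_nv 22 0 h) 5) (run pick_code h)"
    unfolding pick_code_def run.simps
  proof (rule ForLess_inv, goal_cases)
    case (7 k t)
    have "nv t 0 = 0" "qv t 10 = 0" "qv t 11 = 1" "arr t 4 0 k = arr h 4 0 k" "arr t 5 0 k = arr h 5 0 k"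
      using 7(3) h by (auto simp: agree_def instances_def consts_ok_def)
    then show ?case
      using 7(2,4) unfolding I_def by (auto simp: less_Suc_eq)
  qed (use assms n5 in \<open>auto simp: I_def\<close>)
  then show ?thesis unfolding n5 h'_def I_def by simp
qed

lemma edge_rd_correct:
  assumes "nv t 6 = u" "nv t 14 = x" "nv t 15 = y" "u < N" "x < N" "y < N"
    "\<And>i j. i < N \<Longrightarrow> j < N \<Longrightarrow> arr t 1 i j = of_bool (A i j)"
  shows "qv (run (edge_rd b) t) 1 = qv (run (edge_rd b) t) 2 \<longleftrightarrow> \<not> distinguishes A u b y x"
  using assms by (cases b) (simp_all add: edge_rd_def distinguishes_def)

lemma spread_code_correct:
  assumes h: "instances N A lab h" "current N lab u h" and "N \<le> B" "nv h 15 < N" and v: "v < N"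
  shows "arr (run (spread_code b) h) 4 0 v =
    (if v \<in> members N lab (lab u) - {u} \<and> distinguishes A u b (nv h 15) v then 1 else arr h 4 0 v)"
proof -
  define I where "I = (\<lambda>k (t :: hl_state). \<forall>v<N. arr t 4 0 v =
    (if v < k \<and> v \<in> members N lab (lab u) - {u} \<and> distinguishes A u b (nv h 15) v then 1 else arr h 4 0 v))"
  have n5: "nv h 5 = N" using h by (simp add: instances_def)
  have "I (nv h 5) (run (spread_code b) h)"
    unfolding spread_code_def
  proof (rule ForLess_inv, goal_cases)
    case (7 k t)
    have kN: "k < N" using 7(1) n5 by simp
    have f: "nv t 0 = 0" "nv t 6 = u" "nv t 15 = nv h 15" "qv t 5 = of_nat (lab u)" "qv t 11 = 1"
      "arr t 2 0 k = of_nat (lab k)" "u < N"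
      "\<And>i j. i < N \<Longrightarrow> j < N \<Longrightarrow> arr t 1 i j = of_bool (A i j)"
      using 7(3) h kN
      by (auto simp: agree_def instances_def consts_ok_def current_def)
    let ?t = "set_qv 1 (of_nat (lab k)) t"
    have e: "qv (run (edge_rd b) (set_qv 1 q t)) 1 = qv (run (edge_rd b) (set_qv 1 q t)) 2 \<longleftrightarrow>
        \<not> distinguishes A u b (nv h 15) k" for q
      using f 7(2) kN assms(4) by (intro edge_rd_correct) auto
    have r: "run (Read 1 2 0 14 ;; only_if (QEq 1 5) (if_not (NEq 14 6)
       (edge_rd b ;; if_not (QEq 1 2) (Write 4 0 14 11)))) t =
      (if k \<in> members N lab (lab u) - {u} then if distinguishes A u b (nv h 15) k
         then set_arr 4 0 k 1 (run (edge_rd b) ?t) else run (edge_rd b) ?t else ?t)"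
      using f(1-6) 7(2) kN e by (simp add: members_def run_nv run_qv)
    have "arr (run (Read 1 2 0 14 ;; only_if (QEq 1 5) (if_not (NEq 14 6)
       (edge_rd b ;; if_not (QEq 1 2) (Write 4 0 14 11)))) t) 4 0 v =
        (if v = k \<and> v \<in> members N lab (lab u) - {u} \<and> distinguishes A u b (nv h 15) v then 1 else arr t 4 0 v)"
      for v
      unfolding r by (simp add: run_arr)
    then show ?case
      using 7(4) unfolding I_def by (auto simp: less_Suc_eq)
  qed (use assms n5 in \<open>auto simp: I_def\<close>)
  then show ?thesis using v unfolding n5 I_def by (simp add: members_def)
qed

lemma clear_code_correct:
  assumes h: "instances N A lab h" and "N \<le> B" and v: "v < N"
  shows "arr (run clear_code h) 4 0 v = 0" "arr (run clear_code h) 5 0 v = 0"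
proof -
  define I where "I = (\<lambda>k (t :: hl_state). \<forall>v<k. arr t 4 0 v = 0 \<and> arr t 5 0 v = 0)"
  have n5: "nv h 5 = N" using h by (simp add: instances_def)
  have "I (nv h 5) (run clear_code h)"
    unfolding clear_code_def
  proof (rule ForLess_inv, goal_cases)
    case (7 k t)
    have "nv t 0 = 0" "qv t 10 = 0" using 7(3) h by (auto simp: agree_def instances_def consts_ok_def)
    then show ?case using 7(2,4) unfolding I_def by (auto simp: less_Suc_eq)
  qed (use assms n5 in \<open>auto simp: I_def\<close>)
  then show "arr (run clear_code h) 4 0 v = 0" "arr (run clear_code h) 5 0 v = 0"
    using v unfolding n5 I_def by auto
qed

lemma instances_run:
  assumes "instances N A lab h" "written_nv c \<inter> {0, 5, 7, 8} = {}" "written_qv c \<inter> {10, 11} = {}"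
    "written_arr c \<inter> {1, 2} = {}"
  shows "instances N A lab (run c h)"
proof -
  have "nv (run c h) x = nv h x" if "x \<in> {0, 5, 7, 8}" for x using assms(2) that by (intro run_nv) blast
  moreover have "qv (run c h) x = qv h x" if "x \<in> {10, 11}" for x using assms(3) that by (intro run_qv) blast
  moreover have "arr (run c h) k = arr h k" if "k \<in> {1, 2}" for k using assms(4) that by (intro run_arr) blast
  ultimately show ?thesis using assms(1) by (simp add: instances_def consts_ok_def)
qed

lemma current_run:
  assumes "current N lab u h" "6 \<notin> written_nv c" "5 \<notin> written_qv c"
  shows "current N lab u (run c h)"
  using assms by (simp add: current_def run_nv run_qv)

text \<open>Reachability without paths: \<open>S\<close> is contained in every set that contains w
  and is closed under the steps.\<close>

definition reached :: "nat \<Rightarrow> (nat \<Rightarrow> nat \<Rightarrow> bool) \<Rightarrow> (nat \<Rightarrow> nat) \<Rightarrow> nat \<Rightarrow> bool \<Rightarrow> nat \<Rightarrow> nat set \<Rightarrow> bool" where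
  "reached N A lab u b w S \<longleftrightarrow> S \<subseteq> members N lab (lab u) - {u} \<and> w \<in> S \<and>
     (\<forall>T. w \<in> T \<and> (\<forall>y\<in>T. \<forall>x\<in>members N lab (lab u) - {u}. distinguishes A u b y x \<longrightarrow> x \<in> T) \<longrightarrow> S \<subseteq> T)"

text \<open>As long as something is pending, each round adds an instance to the processed ones.
  These never include u, so there are fewer than \<open>N\<close> of them and \<open>B\<close>
  rounds exhaust the search.\<close>

lemma reach_code_correct:
  fixes b :: bool
  assumes h: "instances N A lab h" "current N lab u h" and "N \<le> B"
    and w: "nv h 20 = w" "w \<in> members N lab (lab u) - {u}"
  defines "S \<equiv> flagged 4 N (run (reach_code b) h)"
  shows "reached N A lab u b w S"
    and "\<forall>y\<in>S. \<forall>x\<in>members N lab (lab u) - {u}. distinguishes A u b y x \<longrightarrow> x \<in> S"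
    and "flags 4 N (run (reach_code b) h)"
proof -
  let ?U = "members N lab (lab u) - {u}" and ?E = "distinguishes A u b"
  define I where "I = (\<lambda>k (t :: hl_state). flags 4 N t \<and> flags 5 N t \<and>
     reached N A lab u b w (flagged 4 N t) \<and> flagged 5 N t \<subseteq> flagged 4 N t \<and>
     (\<forall>y\<in>flagged 5 N t. \<forall>x\<in>?U. ?E y x \<longrightarrow> x \<in> flagged 4 N t) \<and>
     (k \<le> card (flagged 5 N t) \<or> flagged 4 N t \<subseteq> flagged 5 N t))"
  let ?h1 = "run clear_code h"
  let ?h2 = "set_arr 4 (nv ?h1 0) (nv ?h1 20) (qv ?h1 11) ?h1"
  have wN: "w < N" using w(2) by (simp add: members_def)
  have h1: "instances N A lab ?h1" "current N lab u ?h1"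
    using instances_run[OF h(1)] current_run[OF h(2)] by auto
  have c1: "nv ?h1 0 = 0" "nv ?h1 20 = w" "qv ?h1 11 = 1"
    using h1(1) w(1) by (auto simp: instances_def consts_ok_def run_nv)
  have h2: "instances N A lab ?h2" "current N lab u ?h2"
    using h1 by (auto simp: instances_def consts_ok_def current_def)
  have f2: "flagged 4 N ?h2 = {w}" "flagged 5 N ?h2 = {}" "flags 4 N ?h2" "flags 5 N ?h2"
    using clear_code_correct[OF h(1) assms(3)] wN c1 by (auto simp: flagged_def flags_def)
  have init: "I 0 ?h2"
    unfolding I_def using f2 w(2) by (auto simp: reached_def)
  have "I B (run (For 27 (pick_code ;; only_if (NEq 22 7) (Write 5 0 15 11 ;; spread_code b))) ?h2)"
  proof (rule For_inv, goal_cases)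
    case (2 k t v)
    then show ?case by (simp add: I_def flagged_def flags_def)
  next
    case (4 k t)
    have ht: "instances N A lab t" "current N lab u t"
      using h2 4(3) by (auto simp: agree_def instances_def consts_ok_def current_def)
    let ?t1 = "run pick_code t"
    have t1: "instances N A lab ?t1" "current N lab u ?t1"
      using instances_run[OF ht(1)] current_run[OF ht(2)] by auto
    have a1: "arr ?t1 = arr t" by (rule ext) (simp add: run_arr)
    then have fl1: "flagged l N ?t1 = flagged l N t" "flags l N ?t1 = flags l N t" for l
      by (auto simp: flagged_def flags_def)
    have n7: "nv ?t1 7 = 1" using t1(1) by (simp add: instances_def consts_ok_def)
    note It = 4(4)[unfolded I_def]
    consider "nv ?t1 22 = 1" "nv ?t1 15 < N" "arr t 4 0 (nv ?t1 15) = 1" "arr t 5 0 (nv ?t1 15) = 0"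
      | "nv ?t1 22 = 0" "\<forall>v<N. arr t 4 0 v = 1 \<longrightarrow> arr t 5 0 v \<noteq> 0"
      using pick_code_correct[OF ht(1) assms(3)] by metis
    then show ?case
    proof cases
      case 1
      let ?y = "nv ?t1 15"
      let ?t2 = "set_arr 5 (nv ?t1 0) ?y (qv ?t1 11) ?t1"
      let ?t3 = "run (spread_code b) ?t2"
      have c: "nv ?t1 0 = 0" "qv ?t1 11 = 1" using t1(1) by (auto simp: instances_def consts_ok_def)
      have t2: "instances N A lab ?t2" "current N lab u ?t2"
        using t1 by (auto simp: instances_def consts_ok_def current_def)
      have y2: "nv ?t2 15 = ?y" by simp
      have r: "run (pick_code ;; only_if (NEq 22 7) (Write 5 0 15 11 ;; spread_code b)) t = ?t3"
        using 1(1) n7 by simp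
      have s4: "arr ?t3 4 0 v = (if v \<in> ?U \<and> ?E ?y v then 1 else arr t 4 0 v)" if "v < N" for v
        using spread_code_correct[OF t2 assms(3), of v b] 1(2) that a1 y2 by simp
      have s5: "arr ?t3 5 0 v = (if v = ?y then 1 else arr t 5 0 v)" for v
        using c a1 by (simp add: run_arr)
      have F4: "flagged 4 N ?t3 = flagged 4 N t \<union> {x \<in> ?U. ?E ?y x}"
        using s4 by (auto simp: flagged_def members_def split: if_splits)
      have F5: "flagged 5 N ?t3 = insert ?y (flagged 5 N t)"
        using s5 1(2) by (auto simp: flagged_def split: if_splits)
      have y: "?y \<in> flagged 4 N t" "?y \<notin> flagged 5 N t"
        using 1 by (auto simp: flagged_def)
      have "flags 4 N ?t3" "flags 5 N ?t3" using It s4 s5 by (auto simp: flags_def)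
      moreover have "reached N A lab u b w (flagged 4 N ?t3)"
        using It y(1) unfolding F4 reached_def by blast
      moreover have "flagged 5 N ?t3 \<subseteq> flagged 4 N ?t3" using It y(1) unfolding F4 F5 by blast
      moreover have "\<forall>y\<in>flagged 5 N ?t3. \<forall>x\<in>?U. ?E y x \<longrightarrow> x \<in> flagged 4 N ?t3"
        using It unfolding F4 F5 by blast
      moreover have "Suc k \<le> card (flagged 5 N ?t3)"
      proof -
        have "\<not> flagged 4 N t \<subseteq> flagged 5 N t" using y by blast
        then have "k \<le> card (flagged 5 N t)" using It by blast
        moreover have "finite (flagged 5 N t)" by (simp add: flagged_def)
        ultimately show ?thesis unfolding F5 using y(2) by simp
      qed
      ultimately show ?thesis unfolding r I_def by blast
    next
      case 2
      have sub: "flagged 4 N t \<subseteq> flagged 5 N t"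
        using 2(2) It by (auto simp: flagged_def flags_def)
      have r: "run (pick_code ;; only_if (NEq 22 7) (Write 5 0 15 11 ;; spread_code b)) t = ?t1"
        using 2(1) n7 by simp
      show ?thesis using It sub unfolding r I_def fl1 by blast
    qed
  qed (use init in auto)
  moreover have "run (reach_code b) h = run (For 27 (pick_code ;; only_if (NEq 22 7) (Write 5 0 15 11 ;; spread_code b))) ?h2"
    by (simp only: reach_code_def run.simps)
  ultimately have fin: "I B (run (reach_code b) h)" by simp
  let ?D = "flagged 5 N (run (reach_code b) h)"
  have "?D \<subseteq> {..<N} - {u}"
    using fin unfolding I_def reached_def members_def by blast
  then have "card ?D \<le> card ({..<N} - {u})" by (intro card_mono) auto
  moreover have "u < N" using h(2) by (simp add: current_def)
  ultimately have "card ?D < B" using assms(3) by simp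
  then have "S \<subseteq> ?D" using fin unfolding I_def S_def by auto
  then show "reached N A lab u b w S"
    "\<forall>y\<in>S. \<forall>x\<in>members N lab (lab u) - {u}. distinguishes A u b y x \<longrightarrow> x \<in> S"
    "flags 4 N (run (reach_code b) h)"
    using fin unfolding I_def S_def by blast+
qed

lemma full_code_correct:
  assumes h: "instances N A lab h" "current N lab u h" and "N \<le> B" and fl: "flags 4 N h"
  shows "nv (run full_code h) 23 = of_bool (members N lab (lab u) - {u} \<subseteq> flagged 4 N h)"
proof -
  define I where "I = (\<lambda>k (t :: hl_state).
    nv t 23 = of_bool (\<forall>v<k. v \<in> members N lab (lab u) - {u} \<longrightarrow> v \<in> flagged 4 N h))"
  have n5: "nv (set_nv 23 1 h) 5 = N" using h by (simp add: instances_def)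
  have "I (nv (set_nv 23 1 h) 5) (run full_code h)"
    unfolding full_code_def run.simps
  proof (rule ForLess_inv, goal_cases)
    case (7 k t)
    have kN: "k < N" using 7(1) n5 by simp
    have f: "nv t 0 = 0" "nv t 6 = u" "qv t 5 = of_nat (lab u)" "qv t 10 = 0"
      "arr t 2 0 k = of_nat (lab k)" "arr t 4 0 k = arr h 4 0 k" "arr h 4 0 k = 0 \<or> arr h 4 0 k = 1"
      using 7(3) h kN fl by (auto simp: agree_def instances_def consts_ok_def current_def flags_def)
    show ?case
      using 7(2,4) f kN unfolding I_def by (auto simp: members_def flagged_def less_Suc_eq)
  qed (use assms n5 in \<open>auto simp: I_def\<close>)
  then show ?thesis unfolding n5 I_def by (auto simp: members_def subset_iff of_bool_def)
qed

lemma complement_code_correct: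
  assumes h: "instances N A lab h" "current N lab u h" and "N \<le> B"
    and fl: "flags 4 N h" "flagged 4 N h \<subseteq> members N lab (lab u) - {u}"
  shows "flagged 4 N (run complement_code h) = members N lab (lab u) - {u} - flagged 4 N h"
proof -
  define I where "I = (\<lambda>k (t :: hl_state). \<forall>v<N. arr t 4 0 v =
    (if v < k \<and> v \<in> members N lab (lab u) - {u} then 1 - arr h 4 0 v else arr h 4 0 v))"
  have n5: "nv h 5 = N" using h by (simp add: instances_def)
  have "I (nv h 5) (run complement_code h)"
    unfolding complement_code_def
  proof (rule ForLess_inv, goal_cases)
    case (7 k t)
    have kN: "k < N" using 7(1) n5 by simp
    have f: "nv t 0 = 0" "nv t 6 = u" "qv t 5 = of_nat (lab u)" "qv t 11 = 1"
      "arr t 2 0 k = of_nat (lab k)"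
      using 7(3) h kN by (auto simp: agree_def instances_def consts_ok_def current_def)
    have "arr t 4 0 k = arr h 4 0 k" using 7(4) kN by (simp add: I_def)
    then show ?case
      using 7(2,4) f kN unfolding I_def by (auto simp: members_def less_Suc_eq)
  qed (use assms n5 in \<open>auto simp: I_def\<close>)
  then have *: "arr (run complement_code h) 4 0 v =
      (if v \<in> members N lab (lab u) - {u} then 1 - arr h 4 0 v else arr h 4 0 v)" if "v < N" for v
    using that unfolding n5 I_def by (simp add: members_def)
  show ?thesis
    using * fl unfolding flags_def flagged_def members_def by (auto split: if_splits)
qed

lemma any_code_correct:
  assumes h: "instances N A lab h" and "N \<le> B"
  shows "nv (run any_code h) 23 = of_bool (flagged 4 N h \<noteq> {})"
proof -
  define I where "I = (\<lambda>k (t :: hl_state). nv t 23 = of_bool (\<exists>v<k. v \<in> flagged 4 N h))"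
  have n5: "nv (set_nv 23 0 h) 5 = N" using h by (simp add: instances_def)
  have "I (nv (set_nv 23 0 h) 5) (run any_code h)"
    unfolding any_code_def run.simps
  proof (rule ForLess_inv, goal_cases)
    case (7 k t)
    have kN: "k < N" using 7(1) n5 by simp
    have f: "nv t 0 = 0" "qv t 11 = 1" "arr t 4 0 k = arr h 4 0 k"
      using 7(3) h by (auto simp: agree_def instances_def consts_ok_def)
    show ?case
      using 7(2,4) f kN unfolding I_def by (auto simp: flagged_def less_Suc_eq)
  qed (use assms n5 in \<open>auto simp: I_def\<close>)
  moreover have "(\<exists>v<N. v \<in> flagged 4 N h) \<longleftrightarrow> flagged 4 N h \<noteq> {}" by (auto simp: flagged_def)
  ultimately show ?thesis unfolding n5 I_def by simp
qed

text \<open>Let M be a proper module with u. If w is in M, then so is everything reachable from w.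
  Otherwise the complement of M contains w and is closed under backward steps, so it consists of
  everything but u.\<close>

lemma reached_everything_imp_trivial:
  assumes "reached N A lab u True w S" "reached N A lab u False w S'"
    and S: "members N lab (lab u) - {u} \<subseteq> S" "members N lab (lab u) - {u} \<subseteq> S'"
  shows "only_trivial_modules_at A (members N lab (lab u)) u"
  unfolding only_trivial_modules_at_def
proof (intro allI impI, elim conjE)
  let ?X = "members N lab (lab u)"
  fix M assume M: "mdl A ?X M" "u \<in> M" "M \<noteq> ?X"
  have cl: "M - {u} \<subseteq> ?X - {u}"
    "\<And>y x. y \<in> M - {u} \<Longrightarrow> x \<in> ?X - {u} \<Longrightarrow> A x u \<noteq> A x y \<Longrightarrow> x \<in> M - {u}"
    using mdl_imp_closed_at[OF M(1,2)] unfolding closed_at_def by blast+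
  have MX: "M \<subseteq> ?X" using M(1) by (simp add: mdl_def)
  show "M = {u}"
  proof (cases "w \<in> M - {u}")
    case True
    have "S \<subseteq> M - {u}"
      using assms(1) True cl(2) unfolding reached_def distinguishes_def by simp
    then have "?X - {u} \<subseteq> M" using S(1) by blast
    then have "M = ?X" using MX M(2) by blast
    then show ?thesis using M(3) by simp
  next
    case False
    let ?T = "?X - {u} - (M - {u})"
    have "w \<in> ?T" using False assms(1) unfolding reached_def by blast
    moreover have "\<forall>y\<in>?T. \<forall>x\<in>?X - {u}. distinguishes A u False y x \<longrightarrow> x \<in> ?T"
    proof (intro ballI impI)
      fix y x assume yx: "y \<in> ?T" "x \<in> ?X - {u}" "distinguishes A u False y x"
      then have "A y u \<noteq> A y x" by (simp add: distinguishes_def)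
      then have "x \<notin> M - {u}" using cl(2)[of x y] yx(1) by blast
      then show "x \<in> ?T" using yx(2) by blast
    qed
    ultimately have "S' \<subseteq> ?T" using assms(2) unfolding reached_def by blast
    then have "M - {u} = {}" using S(2) cl(1) by blast
    then show ?thesis using M(2) by blast
  qed
qed

theorem find_module_correct:
  assumes h: "instances N A lab h" "nv h 6 = u" "u < N" "N \<le> B" "members N lab (lab u) - {u} \<noteq> {}"
  defines "h' \<equiv> run find_module h"
  defines "C \<equiv> flagged 4 N h'"
  shows "qv h' 5 = of_nat (lab u)"
    and "nv h' 23 = 1 \<Longrightarrow> C \<noteq> {} \<and> C \<noteq> members N lab (lab u) - {u} \<and> closed_at A (members N lab (lab u)) u C"
    and "nv h' 23 \<noteq> 1 \<Longrightarrow> only_trivial_modules_at A (members N lab (lab u)) u"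
proof -
  let ?X = "members N lab (lab u)"
  let ?h0 = "run (Read 5 2 0 6) h"
  let ?h1 = "run choose_code ?h0"
  let ?h2 = "run (reach_code True) ?h1"
  let ?h3 = "run full_code ?h2"
  have 0: "instances N A lab ?h0" "current N lab u ?h0"
    using h(1-3) by (auto simp: instances_def consts_ok_def current_def)
  have 1: "instances N A lab ?h1" "current N lab u ?h1"
    using instances_run[OF 0(1)] current_run[OF 0(2)] by auto
  define w where "w = nv ?h1 20"
  have w: "w \<in> ?X - {u}" unfolding w_def using choose_code_correct[OF 0 h(4,5)] by blast
  have 2: "instances N A lab ?h2" "current N lab u ?h2"
    using instances_run[OF 1(1)] current_run[OF 1(2)] by auto
  note R = reach_code_correct[OF 1 h(4) w_def[symmetric] w, where b = True]
  have 3: "instances N A lab ?h3" "current N lab u ?h3"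
    using instances_run[OF 2(1)] current_run[OF 2(2)] by auto
  let ?S = "flagged 4 N ?h2"
  have SU: "?S \<subseteq> ?X - {u}" using R(1) by (simp add: reached_def)
  have full: "nv ?h3 23 = of_bool (?X - {u} \<subseteq> ?S)"
    by (rule full_code_correct[OF 2 h(4) R(3)])
  have n7: "nv ?h3 7 = 1" using 3(1) by (simp add: instances_def consts_ok_def)
  have fl3: "flagged 4 N ?h3 = ?S" by (simp add: flagged_def run_arr)
  let ?h4 = "run (reach_code False) ?h3"
  let ?h5 = "run complement_code ?h4"
  have 4: "instances N A lab ?h4" "current N lab u ?h4"
    using instances_run[OF 3(1)] current_run[OF 3(2)] by auto
  have 5: "instances N A lab ?h5" "current N lab u ?h5"
    using instances_run[OF 4(1)] current_run[OF 4(2)] by auto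
  have w3: "nv ?h3 20 = w" by (simp add: w_def run_nv)
  note R' = reach_code_correct[OF 3 h(4) w3 w, where b = False]
  let ?S' = "flagged 4 N ?h4"
  have SU': "?S' \<subseteq> ?X - {u}" using R'(1) by (simp add: reached_def)
  have fl5: "flagged 4 N ?h5 = ?X - {u} - ?S'"
    by (rule complement_code_correct[OF 4 h(4) R'(3) SU'])
  have h': "h' = run any_code (if ?X - {u} \<subseteq> ?S then ?h5 else ?h3)"
    unfolding h'_def find_module_def using full n7 by simp
  let ?h6 = "if ?X - {u} \<subseteq> ?S then ?h5 else ?h3"
  have 6: "instances N A lab ?h6" "current N lab u ?h6" using 3 5 by auto
  have any: "nv h' 23 = of_bool (flagged 4 N ?h6 \<noteq> {})"
    unfolding h' by (rule any_code_correct[OF 6(1) h(4)])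
  have C: "C = flagged 4 N ?h6" unfolding C_def h' by (simp add: flagged_def run_arr)
  have any': "nv h' 23 = 1 \<longleftrightarrow> C \<noteq> {}" unfolding any C by (rule of_bool_eq_1_iff)
  show "qv h' 5 = of_nat (lab u)" unfolding h' using 6(2) by (simp add: run_qv current_def)
  show "C \<noteq> {} \<and> C \<noteq> ?X - {u} \<and> closed_at A ?X u C" if "nv h' 23 = 1"
  proof -
    have ne: "C \<noteq> {}" using that any' by blast
    show ?thesis
    proof (cases "?X - {u} \<subseteq> ?S")
      case True
      then have C': "C = ?X - {u} - ?S'" unfolding C using fl5 by simp
      have "w \<in> ?S'" using R'(1) by (simp add: reached_def)
      then have "C \<noteq> ?X - {u}" using w unfolding C' by blast
      \<comment> \<open>If x reached w, then y, from which a step leads to x, would reach w as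
        well.\<close>
      moreover have "x \<in> C" if "y \<in> C" "x \<in> ?X - {u}" "A x u \<noteq> A x y" for x y
      proof -
        have "y \<in> ?S'" if "x \<in> ?S'"
          using R'(2) that \<open>y \<in> C\<close> \<open>A x u \<noteq> A x y\<close> unfolding C' by (auto simp: distinguishes_def)
        then show ?thesis using that(1,2) unfolding C' by blast
      qed
      ultimately show ?thesis using ne unfolding closed_at_def C' by blast
    next
      case False
      then have C': "C = ?S" unfolding C using fl3 by simp
      have "x \<in> C" if "y \<in> C" "x \<in> ?X - {u}" "A x u \<noteq> A x y" for x y
        using R(2)[rule_format, of y x] that unfolding C' by (simp add: distinguishes_def)
      then show ?thesis using ne False SU unfolding closed_at_def C' by blast
    qed
  qed
  show "only_trivial_modules_at A ?X u" if "nv h' 23 \<noteq> 1"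
  proof -
    have e: "C = {}" using that any' by blast
    \<comment> \<open>The forward search always contains w, so an empty result can only come from
      the complement of the backward search.\<close>
    have full': "?X - {u} \<subseteq> ?S"
    proof (rule ccontr)
      assume "\<not> ?thesis"
      then have "C = ?S" unfolding C using fl3 by simp
      then show False using e R(1) by (simp add: reached_def)
    qed
    then have "?X - {u} \<subseteq> ?S'" using e unfolding C using fl5 by simp
    then show ?thesis using reached_everything_imp_trivial[OF R(1) R'(1) full'] by blast
  qed
qed

end

section \<open>The decomposition invariant and its preservation under a split\<close>

subsection \<open>Decompositions into pieces\<close>

definition inst_adj :: "'a ugraph \<Rightarrow> (nat \<Rightarrow> 'a) \<Rightarrow> nat \<Rightarrow> nat \<Rightarrow> bool" where
  "inst_adj G f x y \<longleftrightarrow> adjacent G (f x) (f y)"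

definition expanded :: "'a list \<Rightarrow> (nat \<Rightarrow> nat \<Rightarrow> rat) \<Rightarrow> ('a \<Rightarrow> real) \<Rightarrow> nat \<Rightarrow> real" where
  "expanded vs rep w v = (\<Sum>z<length vs. of_rat (rep v z) * w (vs ! z))"

text \<open>The instance \<open>v\<close> is a copy of the vertex \<open>f v\<close> that belongs to piece \<open>lab v\<close> and stands for
  a module of the graph; \<open>rep v\<close> is the characteristic function of a maximal independent set of
  this module, so that \<^term>\<open>expanded vs rep w v\<close> is the weight of the module.\<close>

definition decomp :: "'a ugraph \<Rightarrow> 'a list \<Rightarrow> nat \<Rightarrow> nat \<Rightarrow> (nat \<Rightarrow> 'a) \<Rightarrow> (nat \<Rightarrow> nat) \<Rightarrow> (nat \<Rightarrow> nat \<Rightarrow> rat) \<Rightarrow> bool"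
where
  "decomp G vs N P f lab rep \<longleftrightarrow>
     (\<forall>v<N. lab v < P \<and> f v \<in> verts G) \<and>
     (\<forall>c<P. inj_on f (members N lab c)) \<and>
     (\<forall>c<P. \<exists>v\<in>members N lab c. \<exists>x\<in>members N lab c. v \<noteq> x) \<and>
     N + 1 = length vs + P \<and>
     (\<forall>c<P. \<forall>c'<P. c \<noteq> c' \<longrightarrow> (\<forall>x\<in>f ` members N lab c \<inter> f ` members N lab c'.
        \<forall>y\<in>f ` members N lab c \<inter> f ` members N lab c'. x = y)) \<and>
     (\<forall>v<N. \<forall>z<length vs. rep v z \<in> {0, 1}) \<and>
     (\<forall>v<N. \<forall>x<N. lab v = lab x \<and> v \<noteq> x \<longrightarrow> (\<forall>z<length vs. rep v z * rep x z = 0)) \<and>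
     (\<forall>w. well_covered_weighting G w \<longleftrightarrow>
        (\<forall>c<P. wc (inst_adj G f) (members N lab c) (expanded vs rep w)))"

lemma finite_members [simp]: "finite (members N lab c)"
  by (simp add: members_def)

lemma decompD:
  assumes "decomp G vs N P f lab rep"
  shows "v < N \<Longrightarrow> lab v < P \<and> f v \<in> verts G"
    and "c < P \<Longrightarrow> inj_on f (members N lab c)"
    and "c < P \<Longrightarrow> \<exists>v\<in>members N lab c. \<exists>x\<in>members N lab c. v \<noteq> x"
    and "N + 1 = length vs + P"
    and "c < P \<Longrightarrow> c' < P \<Longrightarrow> c \<noteq> c' \<Longrightarrow> x \<in> f ` members N lab c \<inter> f ` members N lab c' \<Longrightarrow>
      y \<in> f ` members N lab c \<inter> f ` members N lab c' \<Longrightarrow> x = y"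
    and "v < N \<Longrightarrow> z < length vs \<Longrightarrow> rep v z \<in> {0, 1}"
    and "v < N \<Longrightarrow> i < N \<Longrightarrow> lab v = lab i \<Longrightarrow> v \<noteq> i \<Longrightarrow> z < length vs \<Longrightarrow> rep v z * rep i z = 0"
    and "well_covered_weighting G w \<longleftrightarrow>
      (\<forall>c<P. wc (inst_adj G f) (members N lab c) (expanded vs rep w))"
proof -
  note d = assms[unfolded decomp_def]
  show "v < N \<Longrightarrow> lab v < P \<and> f v \<in> verts G"
    by (rule d[THEN conjunct1, rule_format])
  show "c < P \<Longrightarrow> inj_on f (members N lab c)"
    by (rule d[THEN conjunct2, THEN conjunct1, rule_format])
  show "c < P \<Longrightarrow> \<exists>v\<in>members N lab c. \<exists>x\<in>members N lab c. v \<noteq> x"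
    by (rule d[THEN conjunct2, THEN conjunct2, THEN conjunct1, rule_format])
  show "N + 1 = length vs + P"
    by (rule d[THEN conjunct2, THEN conjunct2, THEN conjunct2, THEN conjunct1, rule_format])
  show "c < P \<Longrightarrow> c' < P \<Longrightarrow> c \<noteq> c' \<Longrightarrow> x \<in> f ` members N lab c \<inter> f ` members N lab c' \<Longrightarrow>
      y \<in> f ` members N lab c \<inter> f ` members N lab c' \<Longrightarrow> x = y"
    by (rule d[THEN conjunct2, THEN conjunct2, THEN conjunct2, THEN conjunct2, THEN conjunct1, rule_format])
  show "v < N \<Longrightarrow> z < length vs \<Longrightarrow> rep v z \<in> {0, 1}"
    by (rule d[THEN conjunct2, THEN conjunct2, THEN conjunct2, THEN conjunct2, THEN conjunct2, THEN conjunct1, rule_format])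
  show "v < N \<Longrightarrow> i < N \<Longrightarrow> lab v = lab i \<Longrightarrow> v \<noteq> i \<Longrightarrow> z < length vs \<Longrightarrow> rep v z * rep i z = 0"
    using d[THEN conjunct2, THEN conjunct2, THEN conjunct2, THEN conjunct2, THEN conjunct2, THEN conjunct2, THEN conjunct1, rule_format] by blast
  show "well_covered_weighting G w \<longleftrightarrow>
      (\<forall>c<P. wc (inst_adj G f) (members N lab c) (expanded vs rep w))"
    by (rule d[THEN conjunct2, THEN conjunct2, THEN conjunct2, THEN conjunct2, THEN conjunct2, THEN conjunct2, THEN conjunct2, rule_format])
qed

text \<open>Every piece has at least two instances, so 2 P \<le> N; with N + 1 = n + P this gives P
  \<le> n - 1 and N \<le> 2 n - 2. Here the argument 2 n of the running time originates.\<close>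

lemma decomp_bounds:
  assumes "decomp G vs N P f lab rep"
  shows "2 * P \<le> N" "P + 1 \<le> length vs" "N + 2 \<le> 2 * length vs"
proof -
  have "2 \<le> card (members N lab c)" if c: "c < P" for c
  proof -
    obtain v x where "v \<in> members N lab c" "x \<in> members N lab c" "v \<noteq> x"
      using decompD(3)[OF assms c] by blast
    then have "card {v, x} \<le> card (members N lab c)" by (intro card_mono) auto
    then show ?thesis using \<open>v \<noteq> x\<close> by simp
  qed
  then have "(\<Sum>c<P. 2) \<le> (\<Sum>c<P. card (members N lab c))" by (intro sum_mono) auto
  also have "\<dots> = card (\<Union>c<P. members N lab c)"
    by (subst card_UN_disjoint) (auto simp: members_def)
  also have "\<dots> \<le> card {..<N}" by (intro card_mono) (auto simp: members_def)
  finally show P: "2 * P \<le> N" by simp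
  have N: "N + 1 = length vs + P" by (rule decompD(4)[OF assms])
  show "P + 1 \<le> length vs" "N + 2 \<le> 2 * length vs" using P N by auto
qed

text \<open>A single piece in which each vertex stands for itself. Two vertices are demanded because
  a piece must have two different instances.\<close>

lemma decomp_init:
  assumes G: "simple_graph G" and vs: "distinct vs" "set vs = verts G" "2 \<le> length vs"
    and rep: "\<And>v z. v < length vs \<Longrightarrow> z < length vs \<Longrightarrow> rep v z = (if v = z then 1 else 0)"
  shows "decomp G vs (length vs) 1 ((!) vs) (\<lambda>_. 0) rep"
proof -
  have mem: "members (length vs) (\<lambda>_. 0) 0 = {..<length vs}" by (auto simp: members_def)
  have inj: "inj_on ((!) vs) {..<length vs}" using vs(1) by (simp add: inj_on_nth)
  have im: "(!) vs ` {..<length vs} = verts G"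
    using vs(2) by (auto simp: set_conv_nth image_def)
  have ex: "expanded vs rep w v = w (vs ! v)" if "v < length vs" for w v
  proof -
    have "expanded vs rep w v = (\<Sum>z<length vs. if v = z then w (vs ! z) else 0)"
      unfolding expanded_def using rep that by (intro sum.cong) auto
    then show ?thesis using that by simp
  qed
  have "well_covered_weighting G w \<longleftrightarrow> wc (inst_adj G ((!) vs)) {..<length vs} (expanded vs rep w)" for w
  proof -
    have "well_covered_weighting G w \<longleftrightarrow> wc (adjacent G) ((!) vs ` {..<length vs}) w"
      using wc_induced[OF G, of "verts G" w] unfolding induced_verts[OF G] im .
    also have "\<dots> \<longleftrightarrow> wc (inst_adj G ((!) vs)) {..<length vs} (\<lambda>v. w (vs ! v))"
      unfolding wc_image[OF inj] inst_adj_def ..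
    also have "\<dots> \<longleftrightarrow> wc (inst_adj G ((!) vs)) {..<length vs} (expanded vs rep w)"
      by (rule wc_cong) (simp_all add: ex)
    finally show ?thesis .
  qed
  moreover have "\<exists>v\<in>{..<length vs}. \<exists>x\<in>{..<length vs}. v \<noteq> x"
    using vs(3) by (intro bexI[of _ 0] bexI[of _ 1]) auto
  moreover have "vs ! v \<in> verts G" if "v < length vs" for v
    using nth_mem[OF that] vs(2) by simp
  ultimately show ?thesis
    unfolding decomp_def less_one using inj rep by (simp add: mem)
qed

text \<open>Disjoint indicators add up to an indicator. Applied at a fixed vertex to the expansions
  of the members of \<open>J\<close>, whose sum is the expansion of a new instance.\<close>

lemma sum_indicators:
  fixes g :: "'b \<Rightarrow> rat"
  assumes "finite J" "\<And>v. v \<in> J \<Longrightarrow> g v \<in> {0, 1}" "\<And>v x. v \<in> J \<Longrightarrow> x \<in> J \<Longrightarrow> v \<noteq> x \<Longrightarrow> g v * g x = 0"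
  shows "sum g J \<in> {0, 1}"
proof (cases "\<exists>v\<in>J. g v = 1")
  case True
  then obtain v where v: "v \<in> J" "g v = 1" by blast
  have "g x = 0" if "x \<in> J - {v}" for x using assms(3)[of v x] v that by auto
  then have "sum g J = g v" using assms(1) v(1) by (simp add: sum.remove)
  then show ?thesis using v by simp
next
  case False
  then have "g x = 0" if "x \<in> J" for x using assms(2)[OF that] that by auto
  then show ?thesis by simp
qed

text \<open>The module \<open>insert u C\<close> becomes the new piece number \<open>P\<close>. In
  the old piece it is replaced by the fresh instance \<open>N\<close>, another copy of the vertex
  \<open>f u\<close>, whose expansion is the sum of the expansions of \<open>J\<close>.\<close>

locale piece_split =
  fixes G :: "'a ugraph" and vs N P f lab rep u C J rep'
  assumes G: "simple_graph G" and dec: "decomp G vs N P f lab rep" and u_less: "u < N"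
    and C: "C \<noteq> {}" "C \<noteq> members N lab (lab u) - {u}"
      "closed_at (inst_adj G f) (members N lab (lab u)) u C"
    and J: "mis (inst_adj G f) (insert u C) J"
    and rep': "\<And>v z. v < N \<Longrightarrow> z < length vs \<Longrightarrow> rep' v z = rep v z"
      "\<And>z. z < length vs \<Longrightarrow> rep' N z = (\<Sum>v\<in>J. rep v z)"
begin

abbreviation "X \<equiv> members N lab (lab u)"
abbreviation "M \<equiv> insert u C"
definition "f' = f(N := f u)"
definition "lab' v = (if v \<in> M then P else if v = N then lab u else lab v)"

lemma CX: "C \<subseteq> X - {u}" using C(3) by (simp add: closed_at_def)
lemma uX: "u \<in> X" using u_less by (simp add: members_def)
lemma MX: "M \<subseteq> X" using CX uX by blast
lemma XN: "x \<in> X \<Longrightarrow> x < N" by (simp add: members_def)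
lemma NM: "N \<notin> M" using MX XN by blast
lemma JM: "J \<subseteq> M" using J by (simp add: mis_def)
lemma labP: "v < N \<Longrightarrow> lab v < P" using decompD(1)[OF dec] by blast
lemma finite_J: "finite J" using JM MX finite_subset[OF _ finite_members] by (meson order.trans)

lemma inst_adj': "x < N \<Longrightarrow> y < N \<Longrightarrow> inst_adj G f' x y = inst_adj G f x y"
  by (simp add: inst_adj_def f'_def)

lemma members':
  "members (Suc N) lab' P = M"
  "members (Suc N) lab' (lab u) = insert N (X - M)"
  "c < P \<Longrightarrow> c \<noteq> lab u \<Longrightarrow> members (Suc N) lab' c = members N lab c"
proof -
  have "v \<in> members (Suc N) lab' P \<longleftrightarrow> v \<in> M" for v
  proof (cases "v \<in> M")
    case True
    then have "v < N" using MX XN by blast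
    then show ?thesis using True by (simp add: members_def lab'_def)
  next
    case False
    have "lab u \<noteq> P" "v < N \<Longrightarrow> lab v \<noteq> P" using labP[OF u_less] labP[of v] by auto
    then show ?thesis using False by (auto simp: members_def lab'_def less_Suc_eq)
  qed
  then show "members (Suc N) lab' P = M" by blast
  show "members (Suc N) lab' (lab u) = insert N (X - M)"
    using labP[OF u_less] NM by (auto simp: members_def lab'_def less_Suc_eq)
  show "members (Suc N) lab' c = members N lab c" if "c < P" "c \<noteq> lab u"
    using that MX NM by (auto simp: members_def lab'_def less_Suc_eq split: if_splits)
qed

lemma split: "module_split (inst_adj G f') X M u N J"
proof
  show "\<not> inst_adj G f' x x" for x using adjacent_irrefl[OF G] by (simp add: inst_adj_def)
  show "inst_adj G f' x y \<Longrightarrow> inst_adj G f' y x" for x y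
    using adjacent_sym by (simp add: inst_adj_def) 
  have "mdl (inst_adj G f) X M" using closed_at_imp_mdl[OF C(3) uX] .
  then show "mdl (inst_adj G f') X M" using mdl_cong[of X "inst_adj G f'" "inst_adj G f" M] inst_adj' XN by blast
  show "N \<notin> X - M" using XN by blast
  show "inst_adj G f' x N = inst_adj G f' x u" for x using u_less by (simp add: inst_adj_def f'_def)
  show "mis (inst_adj G f') M J"
    using J mis_cong[of M "inst_adj G f'" "inst_adj G f" J] inst_adj' XN MX by blast
qed simp_all

lemma expanded':
  "v < N \<Longrightarrow> expanded vs rep' w v = expanded vs rep w v"
  "expanded vs rep' w N = (\<Sum>v\<in>J. expanded vs rep w v)"
proof -
  show "v < N \<Longrightarrow> expanded vs rep' w v = expanded vs rep w v"
    using rep'(1) by (simp add: expanded_def)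
  have "expanded vs rep' w N = (\<Sum>z<length vs. \<Sum>v\<in>J. of_rat (rep v z) * w (vs ! z))"
    unfolding expanded_def using rep'(2) by (intro sum.cong) (auto simp: of_rat_sum sum_distrib_right)
  then show "expanded vs rep' w N = (\<Sum>v\<in>J. expanded vs rep w v)"
    unfolding expanded_def by (subst sum.swap)
qed

text \<open>Only the piece of u changes, and there \<open>wc_split\<close> applies: by linearity of
  the expansions, the new instance has the weight of \<open>J\<close>.\<close>

lemma wc_pieces:
  "(\<forall>c<Suc P. wc (inst_adj G f') (members (Suc N) lab' c) (expanded vs rep' w)) \<longleftrightarrow>
   (\<forall>c<P. wc (inst_adj G f) (members N lab c) (expanded vs rep w))"
proof -
  interpret module_split "inst_adj G f'" X M u N J by (rule split)
  let ?w = "expanded vs rep w" and ?w' = "expanded vs rep' w"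
  have old: "wc (inst_adj G f') Y ?w' = wc (inst_adj G f) Y ?w" if "Y \<subseteq> {..<N}" for Y
    using that by (intro wc_cong) (auto simp: inst_adj' expanded' subset_iff)
  have sub: "members N lab c \<subseteq> {..<N}" for c by (auto simp: members_def)
  have "v < N" if "v \<in> J" for v using that JM MX XN by blast
  then have J': "sum ?w' J = sum ?w J" by (intro sum.cong) (simp_all add: expanded')
  have "wc (inst_adj G f') X ?w' \<longleftrightarrow> wc (inst_adj G f') M ?w' \<and> wc (inst_adj G f') (insert N (X - M)) ?w'"
    by (rule wc_split) (simp_all add: expanded' J')
  then have 1: "wc (inst_adj G f) X ?w \<longleftrightarrow>
      wc (inst_adj G f') (members (Suc N) lab' P) ?w' \<and> wc (inst_adj G f') (members (Suc N) lab' (lab u)) ?w'"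
    unfolding members' old[OF sub] .
  have 2: "wc (inst_adj G f') (members (Suc N) lab' c) ?w' = wc (inst_adj G f) (members N lab c) ?w"
    if "c < P" "c \<noteq> lab u" for c
    unfolding members'(3)[OF that] by (rule old[OF sub])
  show ?thesis
    using 1 2 labP[OF u_less] by (metis less_Suc_eq)
qed

text \<open>As sets of vertices, the new pieces are parts of old ones, so sharing is inherited
  except between the module and its contraction, which have just \<open>f u\<close> in common.
  Expansions remain disjoint because \<open>J\<close> lies in the old piece, where all expansions
  were disjoint.\<close>

lemma decomp_split: "decomp G vs (Suc N) (Suc P) f' lab' rep'"
proof -
  note d = conjunct2[OF decompD(1)[OF dec]] decompD(2-8)[OF dec]
  have f'f: "f' ` Y = f ` Y" if "Y \<subseteq> {..<N}" for Y
    using that by (intro image_cong) (auto simp: f'_def)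
  have f'u: "f' N = f u" by (simp add: f'_def)
  have subs: "members N lab c \<subseteq> {..<N}" "M \<subseteq> {..<N}" "X - M \<subseteq> {..<N}" for c
    using MX by (auto simp: members_def)
  have injX: "inj_on f X" using d(2) labP[OF u_less] by blast
  have im: "f' ` members (Suc N) lab' P = f ` M"
    "f' ` members (Suc N) lab' (lab u) = insert (f u) (f ` (X - M))"
    "c < P \<Longrightarrow> c \<noteq> lab u \<Longrightarrow> f' ` members (Suc N) lab' c = f ` members N lab c" for c
    unfolding members' using f'f[OF subs(2)] f'f[OF subs(3)] f'f[OF subs(1)] f'u by (simp_all add: members')
  have 1: "lab' v < Suc P \<and> f' v \<in> verts G" if "v < Suc N" for v
    using that labP[of v] labP[OF u_less] d(1)[of v] d(1)[OF u_less] by (auto simp: lab'_def f'_def less_Suc_eq)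
  have fu: "f u \<notin> f ` (X - M)"
    using inj_onD[OF injX, of u] uX by blast
  have inj_f': "inj_on f' Y" if "Y \<subseteq> {..<N}" "inj_on f Y" for Y
  proof -
    have "f' x = f x" if "x \<in> Y" for x using that \<open>Y \<subseteq> {..<N}\<close> by (auto simp: f'_def)
    then show ?thesis using that(2) by (simp add: inj_on_def)
  qed
  have 2: "inj_on f' (members (Suc N) lab' c)" if c: "c < Suc P" for c
  proof -
    consider "c = P" | "c = lab u" | "c < P" "c \<noteq> lab u" using c by (metis less_Suc_eq)
    then show ?thesis
    proof cases
      case 1
      then show ?thesis using inj_f'[OF subs(2) inj_on_subset[OF injX MX]] members' by simp
    next
      case 2
      have "inj_on f' (X - M)" using inj_f'[OF subs(3) inj_on_subset[OF injX Diff_subset]] .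
      moreover have "f' N \<notin> f' ` (X - M)" using fu f'f[OF subs(3)] f'u by simp
      ultimately show ?thesis unfolding 2 members'(2) inj_on_insert by blast
    next
      case 3
      then show ?thesis using inj_f'[OF subs(1) d(2)[OF 3(1)]] members' by simp
    qed
  qed
  have 3: "\<exists>v\<in>members (Suc N) lab' c. \<exists>x\<in>members (Suc N) lab' c. v \<noteq> x" if c: "c < Suc P" for c
  proof -
    consider "c = P" | "c = lab u" | "c < P" "c \<noteq> lab u" using c by (metis less_Suc_eq)
    then show ?thesis
    proof cases
      case 1
      then show ?thesis using C(1) CX unfolding 1 members'(1) by blast
    next
      case 2
      obtain x where "x \<in> X - M" using C(2) CX by blast
      moreover from this have "x \<noteq> N" using XN by blast
      ultimately show ?thesis unfolding 2 members'(2) by blast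
    next
      case 3
      then show ?thesis using d(3) members' by simp
    qed
  qed
  have share: "x = y" if "c < Suc P" "c' < c"
    "x \<in> f' ` members (Suc N) lab' c \<inter> f' ` members (Suc N) lab' c'"
    "y \<in> f' ` members (Suc N) lab' c \<inter> f' ` members (Suc N) lab' c'" for c c' x y
  proof -
    have sub: "f' ` members (Suc N) lab' k \<subseteq> f ` members N lab (if k = P then lab u else k)" if "k < Suc P" for k
    proof (cases "k = P \<or> k = lab u")
      case True
      then show ?thesis using im MX uX labP[OF u_less] by auto
    next
      case False
      then show ?thesis using im(3)[of k] that by simp
    qed
    let ?k = "\<lambda>k. if k = P then lab u else k"
    show ?thesis
    proof (cases "?k c = ?k c'")
      case True
      then have c: "c = P" "c' = lab u" using that(1,2) by (auto split: if_splits)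
      have "f ` M \<inter> insert (f u) (f ` (X - M)) \<subseteq> {f u}"
        using inj_on_image_Int[OF injX MX Diff_subset, of M] by auto
      moreover have "x \<in> f ` M \<inter> insert (f u) (f ` (X - M))" using that(3) unfolding c im(1,2) .
      moreover have "y \<in> f ` M \<inter> insert (f u) (f ` (X - M))" using that(4) unfolding c im(1,2) .
      ultimately show ?thesis by (metis singletonD subsetD)
    next
      case False
      have "?k c < P" "?k c' < P" using that(1,2) labP[OF u_less] by auto
      moreover have "x \<in> f ` members N lab (?k c) \<inter> f ` members N lab (?k c')"
        "y \<in> f ` members N lab (?k c) \<inter> f ` members N lab (?k c')"
        using subsetD[OF sub[of c]] subsetD[OF sub[of c']] that by (metis IntE IntI less_trans)+
      ultimately show ?thesis using d(5)[of "?k c" "?k c'" x y] False by blast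
    qed
  qed
  have 5: "x = y" if "c < Suc P" "c' < Suc P" "c \<noteq> c'"
    "x \<in> f' ` members (Suc N) lab' c \<inter> f' ` members (Suc N) lab' c'"
    "y \<in> f' ` members (Suc N) lab' c \<inter> f' ` members (Suc N) lab' c'" for c c' x y
    using share[of c c' x y] share[of c' c x y] that by (metis Int_commute linorder_neqE_nat)
  have JX: "v \<in> X" "v < N" if "v \<in> J" for v using that JM MX XN by blast+
  have disj: "rep v z * rep x z = 0" if "v \<in> X" "x \<in> X" "v \<noteq> x" "z < length vs" for v x z
    using d(7)[of v x z] that by (simp add: members_def)
  have 6: "rep' v z \<in> {0, 1}" if "v < Suc N" "z < length vs" for v z
  proof (cases "v = N")
    case True
    have "(\<Sum>v\<in>J. rep v z) \<in> {0, 1}"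
      using finite_J d(6) disj JX that(2) by (intro sum_indicators) auto
    then show ?thesis using True rep'(2)[OF that(2)] by simp
  next
    case False
    then have "v < N" using that(1) by simp
    then show ?thesis using rep'(1) d(6) that(2) by simp
  qed
  have new: "rep' N z * rep' x z = 0" if "x \<in> X - M" "z < length vs" for x z
  proof -
    have "rep' N z * rep' x z = (\<Sum>v\<in>J. rep v z * rep x z)"
      using rep' that XN by (simp add: sum_distrib_right)
    also have "\<dots> = 0" using disj JX that JM by (intro sum.neutral) blast
    finally show ?thesis .
  qed
  have 7: "rep' v z * rep' x z = 0"
    if vx: "v < Suc N" "x < Suc N" "lab' v = lab' x" "v \<noteq> x" "z < length vs" for v x z
  proof -
    have case_new: "rep' N z * rep' y z = 0" if "y < N" "lab' y = lab' N" for y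
    proof -
      have "lab' N = lab u" using NM by (simp add: lab'_def)
      then have "y \<in> members (Suc N) lab' (lab u)" using that by (simp add: members_def)
      then have "y \<in> X - M" using that(1) unfolding members'(2) by simp
      then show ?thesis using new \<open>z < length vs\<close> by blast
    qed
    consider "v = N" "x < N" | "x = N" "v < N" | "v < N" "x < N" using vx(1,2,4) by (metis less_Suc_eq)
    then show ?thesis
    proof cases
      case 1
      then show ?thesis using case_new[of x] vx(3) by simp
    next
      case 2
      then show ?thesis using case_new[of v] vx(3) by (simp add: mult.commute)
    next
      case 3
      have Ml: "lab y = lab u" if "y \<in> M" for y
        using subsetD[OF MX that] by (simp add: members_def)
      have "lab v = lab x"
        using 3 vx(3) Ml[of v] Ml[of x] labP[of v] labP[of x] by (simp add: lab'_def split: if_splits)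
      then show ?thesis using d(7)[OF 3 _ vx(4,5)] rep'(1) 3 vx(5) by simp
    qed
  qed
  have 8: "well_covered_weighting G w \<longleftrightarrow>
      (\<forall>c<Suc P. wc (inst_adj G f') (members (Suc N) lab' c) (expanded vs rep' w))" for w
    unfolding wc_pieces by (rule d(8))
  show ?thesis
    unfolding decomp_def
  proof (intro conjI)
    show "\<forall>v<Suc N. lab' v < Suc P \<and> f' v \<in> verts G" using 1 by blast
    show "\<forall>c<Suc P. inj_on f' (members (Suc N) lab' c)" using 2 by blast
    show "\<forall>c<Suc P. \<exists>v\<in>members (Suc N) lab' c. \<exists>x\<in>members (Suc N) lab' c. v \<noteq> x" using 3 by blast
    show "Suc N + 1 = length vs + Suc P" using d(4) by simp
    show "\<forall>c<Suc P. \<forall>c'<Suc P. c \<noteq> c' \<longrightarrow>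
      (\<forall>x\<in>f' ` members (Suc N) lab' c \<inter> f' ` members (Suc N) lab' c'.
        \<forall>y\<in>f' ` members (Suc N) lab' c \<inter> f' ` members (Suc N) lab' c'. x = y)"
      by (intro allI impI ballI 5)
    show "\<forall>v<Suc N. \<forall>z<length vs. rep' v z \<in> {0, 1}" by (intro allI impI 6)
    show "\<forall>v<Suc N. \<forall>x<Suc N. lab' v = lab' x \<and> v \<noteq> x \<longrightarrow> (\<forall>z<length vs. rep' v z * rep' x z = 0)"
      by (intro allI impI 7) blast+
    show "\<forall>w. well_covered_weighting G w \<longleftrightarrow>
      (\<forall>c<Suc P. wc (inst_adj G f') (members (Suc N) lab' c) (expanded vs rep' w))"
      by (intro allI 8)
  qed
qed

lemma trivial_modules':
  assumes "v < N" "only_trivial_modules_at (inst_adj G f) (members N lab (lab v)) v"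
  shows "only_trivial_modules_at (inst_adj G f') (members (Suc N) lab' (lab' v)) v"
proof -
  interpret module_split "inst_adj G f'" X M u N J by (rule split)
  have old: "only_trivial_modules_at (inst_adj G f') (members N lab (lab v)) v"
    using assms(2) only_trivial_modules_at_cong[of "members N lab (lab v)" "inst_adj G f'" "inst_adj G f" v]
      inst_adj' by (simp add: members_def)
  consider "v \<in> M" | "v \<in> X - M" | "v \<notin> X" by blast
  then show ?thesis
  proof cases
    case 1
    then have "lab' v = P" "lab v = lab u" using subsetD[OF MX 1] by (simp_all add: lab'_def members_def)
    then show ?thesis using trivial_modules_inside[of v] old 1 members'(1) by simp
  next
    case 2
    then have "lab' v = lab u" "lab v = lab u" using assms(1) by (auto simp: lab'_def members_def)
    then show ?thesis using trivial_modules_outside[of v] old 2 members'(2) by simp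
  next
    case 3
    then have "v \<notin> M" using MX by blast
    then have "lab' v = lab v" "lab v \<noteq> lab u"
      using assms(1) 3 by (simp_all add: lab'_def members_def)
    then show ?thesis using old members'(3)[of "lab v"] labP[OF assms(1)] by simp
  qed
qed

end

section \<open>The program for one split, and progress of the whole decomposition\<close>

subsection \<open>Splitting a piece\<close>

definition conflict_code :: cmd where
  "conflict_code = NSet 22 1 ;; ForLess 14 5 (Read 1 6 0 14 ;;
     only_if (QEq 1 11) (Read 1 1 13 14 ;; only_if (QEq 1 11) (NSet 22 0)))"

definition greedy_code :: cmd where
  "greedy_code = ForLess 13 5 (Write 6 0 13 10) ;;
     ForLess 13 5 (Read 1 4 0 13 ;; only_if (QEq 1 11) (conflict_code ;; only_if (NEq 22 7) (Write 6 0 13 11)))"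

definition sum_code :: cmd where
  "sum_code = QSet 3 0 ;;
     ForLess 13 5 (Read 1 6 0 13 ;; only_if (QEq 1 11) (Read 1 3 13 16 ;; QArith Plus 3 3 1))"

definition expand_code :: cmd where
  "expand_code = ForLess 16 1 (sum_code ;; Write 3 5 16 3)"

text \<open>The new instance has the number \<open>N\<close>, the value of variable 5, which is
  increased only afterwards. The last command makes its diagonal entry zero.\<close>

definition copy_code :: cmd where
  "copy_code = ForLess 14 5 (Read 1 1 6 14 ;; Write 1 5 14 1 ;; Read 1 1 14 6 ;; Write 1 14 5 1) ;; Write 1 5 5 10"

definition relabel_code :: cmd where
  "relabel_code = QOf 1 4 ;; ForLess 13 5 (Read 2 4 0 13 ;; only_if (QEq 2 11) (Write 2 0 13 1)) ;;
     Write 2 0 5 5"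

definition split_code :: cmd where
  "split_code = greedy_code ;; expand_code ;; copy_code ;; relabel_code ;; NAdd 5 5 7 ;; NAdd 4 4 7"

text \<open>The search leaves a closed set without u in array 4; adding u turns it into the module
  to be split off.\<close>

definition step_code :: cmd where
  "step_code = find_module ;; Cond (NEq 23 7) (Write 4 0 6 11 ;; split_code) (NAdd 6 6 7)"

text \<open>After a split the same instance is examined again in its smaller piece; variable 6
  advances only when the instance is settled.\<close>

definition decompose_code :: cmd where
  "decompose_code = For 26 (only_if (NLess 6 5) step_code)"

lemma written_conflict_code [simp]:
  "written_nv conflict_code = {14, 22}" "written_qv conflict_code = {1}"
  "written_arr conflict_code = {}" "\<not> writes_raw conflict_code"
  by (auto simp: conflict_code_def)

lemma written_greedy_code [simp]:
  "written_nv greedy_code = {13, 14, 22}" "written_qv greedy_code = {1}"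
  "written_arr greedy_code = {6}" "\<not> writes_raw greedy_code"
  by (auto simp: greedy_code_def)

lemma written_sum_code [simp]:
  "written_nv sum_code = {13}" "written_qv sum_code = {1, 3}"
  "written_arr sum_code = {}" "\<not> writes_raw sum_code"
  by (auto simp: sum_code_def)

lemma written_expand_code [simp]:
  "written_nv expand_code = {13, 16}" "written_qv expand_code = {1, 3}"
  "written_arr expand_code = {3}" "\<not> writes_raw expand_code"
  by (auto simp: expand_code_def)

lemma written_copy_code [simp]:
  "written_nv copy_code = {14}" "written_qv copy_code = {1}"
  "written_arr copy_code = {1}" "\<not> writes_raw copy_code"
  by (auto simp: copy_code_def)

lemma written_relabel_code [simp]:
  "written_nv relabel_code = {13}" "written_qv relabel_code = {1, 2}"
  "written_arr relabel_code = {2}" "\<not> writes_raw relabel_code"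
  by (auto simp: relabel_code_def)

lemma written_split_code [simp]:
  "written_nv split_code = {4, 5, 13, 14, 16, 22}" "written_qv split_code = {1, 2, 3}"
  "written_arr split_code = {1, 2, 3, 6}" "\<not> writes_raw split_code"
  by (auto simp: split_code_def)

lemma written_step_code [simp]:
  "written_nv step_code = {4, 5, 6, 13, 14, 15, 16, 20, 22, 23, 27}" "written_qv step_code = {1, 2, 3, 5}"
  "written_arr step_code = {1, 2, 3, 4, 5, 6}" "\<not> writes_raw step_code"
  by (auto simp: step_code_def)

lemma written_decompose_code [simp]:
  "written_nv decompose_code = {4, 5, 6, 13, 14, 15, 16, 20, 22, 23, 26, 27}"
  "written_qv decompose_code = {1, 2, 3, 5}"
  "written_arr decompose_code = {1, 2, 3, 4, 5, 6}" "\<not> writes_raw decompose_code"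
  by (auto simp: decompose_code_def)

lemma indicator_arr_sum:
  fixes F :: "nat \<Rightarrow> rat"
  shows "(\<Sum>v<N. if v \<in> flagged k N h then F v else 0) = (\<Sum>v\<in>flagged k N h. F v)"
proof -
  have "{v. v < N \<and> v \<in> flagged k N h} = flagged k N h" by (auto simp: flagged_def)
  then show ?thesis by (simp add: sum.If_cases Int_def)
qed

context machine
begin

lemma conflict_code_correct:
  assumes h: "instances N A lab h" and "N \<le> B" "nv h 13 < N"
  shows "nv (run conflict_code h) 22 = of_bool (\<forall>x\<in>flagged 6 N h. \<not> A (nv h 13) x)"
proof -
  define I where "I = (\<lambda>k (t :: hl_state).
    nv t 22 = of_bool (\<forall>x<k. x \<in> flagged 6 N h \<longrightarrow> \<not> A (nv h 13) x))"
  have n5: "nv (set_nv 22 1 h) 5 = N" using h by (simp add: instances_def)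
  have "I (nv (set_nv 22 1 h) 5) (run conflict_code h)"
    unfolding conflict_code_def run.simps
  proof (rule ForLess_inv, goal_cases)
    case (7 k t)
    have kN: "k < N" using 7(1) n5 by simp
    have f: "nv t 0 = 0" "nv t 13 = nv h 13" "qv t 11 = 1" "arr t 6 0 k = arr h 6 0 k"
      "arr t 1 (nv h 13) k = of_bool (A (nv h 13) k)"
      using 7(3) h kN assms(3) by (auto simp: agree_def instances_def consts_ok_def)
    show ?case
      using 7(2,4) f kN unfolding I_def by (auto simp: flagged_def less_Suc_eq)
  qed (use assms n5 in \<open>auto simp: I_def\<close>)
  moreover have "(\<forall>x<N. x \<in> flagged 6 N h \<longrightarrow> \<not> A (nv h 13) x) \<longleftrightarrow> (\<forall>x\<in>flagged 6 N h. \<not> A (nv h 13) x)"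
    by (auto simp: flagged_def)
  ultimately show ?thesis unfolding n5 I_def by simp
qed

lemma clear6_correct:
  assumes h: "instances N A lab h" and "N \<le> B"
  shows "flagged 6 N (run (ForLess 13 5 (Write 6 0 13 10)) h) = {}"
proof -
  define I where "I = (\<lambda>k (t :: hl_state). \<forall>v<k. arr t 6 0 v = 0)"
  have n5: "nv h 5 = N" using h by (simp add: instances_def)
  have "I (nv h 5) (run (ForLess 13 5 (Write 6 0 13 10)) h)"
  proof (rule ForLess_inv, goal_cases)
    case (7 k t)
    have "nv t 0 = 0" "qv t 10 = 0" using 7(3) h by (auto simp: agree_def instances_def consts_ok_def)
    then show ?case using 7(2,4) unfolding I_def by (auto simp: less_Suc_eq)
  qed (use assms n5 in \<open>auto simp: I_def\<close>)
  then show ?thesis unfolding n5 I_def by (auto simp: flagged_def)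
qed

text \<open>A rejected instance has a neighbour that was chosen earlier and stays chosen, so a
  single pass yields a maximal set.\<close>

lemma greedy_code_correct:
  assumes h: "instances N A lab h" and "N \<le> B" and irr: "\<And>x. \<not> A x x" and sym: "\<And>x y. A x y \<Longrightarrow> A y x"
  shows "mis A (flagged 4 N h) (flagged 6 N (run greedy_code h))"
proof -
  let ?M = "flagged 4 N h"
  define I where "I = (\<lambda>k (t :: hl_state). flagged 6 N t \<subseteq> ?M \<inter> {..<k} \<and>
    (\<forall>x\<in>flagged 6 N t. \<forall>y\<in>flagged 6 N t. \<not> A x y) \<and>
    (\<forall>x\<in>?M \<inter> {..<k} - flagged 6 N t. \<exists>y\<in>flagged 6 N t. A x y))"
  let ?c = "ForLess 13 5 (Write 6 0 13 10)"
  let ?h = "run ?c h"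
  have h1: "instances N A lab ?h" using instances_run[OF h, of ?c] by simp
  have n5: "nv ?h 5 = N" using h1 by (simp add: instances_def)
  have "I (nv ?h 5) (run greedy_code h)"
    unfolding greedy_code_def run.simps(11)
  proof (rule ForLess_inv, goal_cases)
    case (7 k t)
    have kN: "k < N" using 7(1) n5 by simp
    have ht: "instances N A lab t" using 7(3) h1 by (auto simp: agree_def instances_def consts_ok_def)
    have f: "nv t 0 = 0" "qv t 11 = 1" "arr t 4 0 k = arr h 4 0 k"
      using 7(3) h1 by (auto simp: agree_def instances_def consts_ok_def run_arr)
    note It = 7(4)[unfolded I_def]
    show ?case
    proof (cases "k \<in> ?M")
      case False
      then have "run (Read 1 4 0 13 ;; only_if (QEq 1 11) (conflict_code ;; only_if (NEq 22 7) (Write 6 0 13 11))) t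
          = set_qv 1 (arr t 4 0 k) t"
        using f 7(2) kN by (simp add: flagged_def)
      moreover have "flagged 6 N (set_qv 1 (arr t 4 0 k) t) = flagged 6 N t" by (simp add: flagged_def)
      moreover have "?M \<inter> {..<Suc k} = ?M \<inter> {..<k}" using False by (auto simp: less_Suc_eq)
      ultimately show ?thesis using It unfolding I_def by simp
    next
      case True
      let ?t1 = "set_qv 1 1 t"
      let ?t2 = "run conflict_code ?t1"
      have t1: "instances N A lab ?t1" using ht by (simp add: instances_def consts_ok_def)
      have "nv ?t2 22 = of_bool (\<forall>x\<in>flagged 6 N t. \<not> A k x)"
        using conflict_code_correct[OF t1 assms(2)] 7(2) kN by (simp add: flagged_def)
      moreover have c2: "nv ?t2 7 = 1" "nv ?t2 0 = 0" "nv ?t2 13 = k" "qv ?t2 11 = 1"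
        using ht 7(2) by (simp_all add: instances_def consts_ok_def run_nv run_qv)
      moreover have "arr t 4 0 k = 1" using True f by (simp add: flagged_def)
      ultimately have r: "run (Read 1 4 0 13 ;; only_if (QEq 1 11) (conflict_code ;; only_if (NEq 22 7) (Write 6 0 13 11))) t
          = (if \<forall>x\<in>flagged 6 N t. \<not> A k x then set_arr 6 0 k 1 ?t2 else ?t2)"
        using f(1,2) 7(2) by auto
      have F: "flagged 6 N (set_arr 6 0 k 1 ?t2) = insert k (flagged 6 N t)" "flagged 6 N ?t2 = flagged 6 N t"
        using kN by (auto simp: flagged_def run_arr)
      have Mk: "?M \<inter> {..<Suc k} = insert k (?M \<inter> {..<k})" using True by (auto simp: less_Suc_eq)
      show ?thesis
      proof (cases "\<forall>x\<in>flagged 6 N t. \<not> A k x")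
        case True
        then have "\<forall>x\<in>insert k (flagged 6 N t). \<forall>y\<in>insert k (flagged 6 N t). \<not> A x y"
          using It irr sym by blast
        moreover have "run (Read 1 4 0 13 ;; only_if (QEq 1 11) (conflict_code ;; only_if (NEq 22 7) (Write 6 0 13 11))) t
            = set_arr 6 0 k 1 ?t2" unfolding r using True by simp
        ultimately show ?thesis using It unfolding I_def Mk by (simp only: F) blast
      next
        case False
        then have "run (Read 1 4 0 13 ;; only_if (QEq 1 11) (conflict_code ;; only_if (NEq 22 7) (Write 6 0 13 11))) t
            = ?t2" unfolding r by (cases "\<forall>x\<in>flagged 6 N t. \<not> A k x") auto
        then show ?thesis using It False unfolding I_def Mk by (simp only: F) blast
      qed
    qed
  next
    case 5
    then show ?case by (simp add: I_def flagged_def)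
  next
    case 6
    show ?case using clear6_correct[OF h assms(2)] by (simp add: I_def)
  qed (use assms(2) n5 in auto)
  moreover have "?M \<inter> {..<N} = ?M" by (auto simp: flagged_def)
  ultimately show ?thesis unfolding n5 I_def mis_def by simp
qed

lemma sum_code_correct:
  assumes h: "instances N A lab h" and "N \<le> B"
  shows "qv (run sum_code h) 3 = (\<Sum>v\<in>flagged 6 N h. arr h 3 v (nv h 16))"
proof -
  define I where "I = (\<lambda>k (t :: hl_state).
    qv t 3 = (\<Sum>v<k. if v \<in> flagged 6 N h then arr h 3 v (nv h 16) else 0))"
  have n5: "nv (set_qv 3 0 h) 5 = N" using h by (simp add: instances_def)
  have "I (nv (set_qv 3 0 h) 5) (run sum_code h)"
    unfolding sum_code_def run.simps
  proof (rule ForLess_inv, goal_cases)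
    case (7 k t)
    have kN: "k < N" using 7(1) n5 by simp
    have f: "nv t 0 = 0" "nv t 16 = nv h 16" "qv t 11 = 1" "arr t 6 = arr h 6" "arr t 3 = arr h 3"
      using 7(3) h by (auto simp: agree_def instances_def consts_ok_def)
    show ?case
      using 7(2,4) f kN unfolding I_def by (auto simp: flagged_def)
  qed (use assms n5 in \<open>auto simp: I_def\<close>)
  then show ?thesis unfolding n5 I_def indicator_arr_sum .
qed

lemma expand_code_correct:
  assumes h: "instances N A lab h" and "N \<le> B" "nv h 1 \<le> B"
  shows "v < N \<Longrightarrow> arr (run expand_code h) 3 v z = arr h 3 v z"
    and "z < nv h 1 \<Longrightarrow> arr (run expand_code h) 3 N z = (\<Sum>v\<in>flagged 6 N h. arr h 3 v z)"
proof -
  define I where "I = (\<lambda>k (t :: hl_state). (\<forall>v<N. \<forall>z. arr t 3 v z = arr h 3 v z) \<and>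
    (\<forall>z<k. arr t 3 N z = (\<Sum>v\<in>flagged 6 N h. arr h 3 v z)))"
  have "I (nv h 1) (run expand_code h)"
    unfolding expand_code_def
  proof (rule ForLess_inv, goal_cases)
    case (7 k t)
    have ht: "instances N A lab t" using 7(3) h by (auto simp: agree_def instances_def consts_ok_def)
    have f: "nv t 5 = N" "flagged 6 N t = flagged 6 N h"
      using 7(3) h by (auto simp: agree_def instances_def flagged_def)
    let ?t1 = "run sum_code t"
    have q: "qv ?t1 3 = (\<Sum>v\<in>flagged 6 N h. arr h 3 v k)"
      using sum_code_correct[OF ht assms(2)] 7(2,4) f(2) by (simp add: I_def flagged_def)
    have "run (sum_code ;; Write 3 5 16 3) t = set_arr 3 N k (qv ?t1 3) ?t1"
      using f(1) 7(2) by (simp add: run_nv)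
    then show ?case
      using 7(4) q unfolding I_def by (auto simp: less_Suc_eq run_arr)
  qed (use assms in \<open>auto simp: I_def\<close>)
  then show "v < N \<Longrightarrow> arr (run expand_code h) 3 v z = arr h 3 v z"
    "z < nv h 1 \<Longrightarrow> arr (run expand_code h) 3 N z = (\<Sum>v\<in>flagged 6 N h. arr h 3 v z)"
    unfolding I_def by blast+
qed

lemma copy_code_correct:
  assumes h: "instances N A lab h" and "N \<le> B" "nv h 6 = u" "u < N" and i: "i < Suc N" "j < Suc N"
    and A': "\<And>x y. x < N \<Longrightarrow> y < N \<Longrightarrow> A' x y = A x y" "\<And>x. x < N \<Longrightarrow> A' N x = A u x"
      "\<And>x. x < N \<Longrightarrow> A' x N = A x u" "\<not> A' N N"
  shows "arr (run copy_code h) 1 i j = of_bool (A' i j)"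
proof -
  define I where "I = (\<lambda>k (t :: hl_state). (\<forall>x<N. \<forall>y<N. arr t 1 x y = of_bool (A x y)) \<and>
    (\<forall>x<k. arr t 1 N x = of_bool (A u x) \<and> arr t 1 x N = of_bool (A x u)))"
  let ?c = "Read 1 1 6 14 ;; Write 1 5 14 1 ;; Read 1 1 14 6 ;; Write 1 14 5 1"
  have n5: "nv h 5 = N" using h by (simp add: instances_def)
  have "I (nv h 5) (run (ForLess 14 5 ?c) h)"
  proof (rule ForLess_inv, goal_cases)
    case (7 k t)
    have kN: "k < N" using 7(1) n5 by simp
    have f: "nv t 5 = N" "nv t 6 = u" using 7(3) n5 assms(3) by (auto simp: agree_def)
    have "arr (run ?c t) 1 = (arr t 1)(N := (arr t 1 N)(k := of_bool (A u k)), k := (arr t 1 k)(N := of_bool (A k u)))"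
      using f 7(2,4) kN assms(4) unfolding I_def by (auto simp: fun_eq_iff)
    then show ?case
      using 7(4) kN unfolding I_def by (auto simp: less_Suc_eq)
  qed (use assms n5 in \<open>auto simp: I_def instances_def\<close>)
  then have *: "I N (run (ForLess 14 5 ?c) h)" unfolding n5 .
  have c: "nv (run (ForLess 14 5 ?c) h) 5 = N" "qv (run (ForLess 14 5 ?c) h) 10 = 0"
    using h by (simp_all add: run_nv run_qv instances_def consts_ok_def)
  have "arr (run copy_code h) 1 i j =
      (if i = N \<and> j = N then 0 else arr (run (ForLess 14 5 ?c) h) 1 i j)"
    unfolding copy_code_def using c by simp
  then show ?thesis
    using * i A' unfolding I_def by (auto simp: less_Suc_eq)
qed

lemma relabel_code_correct:
  assumes h: "instances N A lab h" and "N \<le> B" "nv h 4 = P" "qv h 5 = of_nat q" and v: "v < Suc N"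
    and M: "flagged 4 N h = M"
  shows "arr (run relabel_code h) 2 0 v = of_nat (if v \<in> M then P else if v = N then q else lab v)"
proof -
  define I where "I = (\<lambda>k (t :: hl_state). \<forall>v<N. arr t 2 0 v = of_nat (if v < k \<and> v \<in> M then P else lab v))"
  let ?h = "run (QOf 1 4) h"
  let ?c = "Read 2 4 0 13 ;; only_if (QEq 2 11) (Write 2 0 13 1)"
  have n5: "nv ?h 5 = N" using h by (simp add: instances_def)
  have "I (nv ?h 5) (run (ForLess 13 5 ?c) ?h)"
  proof (rule ForLess_inv, goal_cases)
    case (7 k t)
    have kN: "k < N" using 7(1) n5 by simp
    have f: "nv t 0 = 0" "qv t 1 = of_nat P" "qv t 11 = 1" "arr t 4 0 k = 1 \<longleftrightarrow> k \<in> M"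
      using 7(3) h kN assms(3) M by (auto simp: agree_def instances_def consts_ok_def flagged_def)
    show ?case
      using 7(2,4) f kN unfolding I_def by (auto simp: less_Suc_eq)
  qed (use assms n5 in \<open>auto simp: I_def instances_def\<close>)
  then have *: "I N (run (ForLess 13 5 ?c) ?h)" unfolding n5 .
  have c: "nv (run (ForLess 13 5 ?c) ?h) 5 = N" "nv (run (ForLess 13 5 ?c) ?h) 0 = 0"
    "qv (run (ForLess 13 5 ?c) ?h) 5 = of_nat q"
    using h assms(4) by (simp_all add: run_nv run_qv instances_def consts_ok_def)
  have r: "run relabel_code h = set_arr 2 0 N (of_nat q) (run (ForLess 13 5 ?c) ?h)"
    unfolding relabel_code_def run.simps(8,11) c ..
  have "N \<notin> M" using M by (auto simp: flagged_def)
  then show ?thesis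
    unfolding r using * v unfolding I_def by (auto simp: less_Suc_eq)
qed

text \<open>Each round increases \<open>nv h 6 + P\<close>, either by settling an instance or by
  creating a piece. The instances below variable 6 are settled and remain so.\<close>

definition decomposing :: "'a ugraph \<Rightarrow> 'a list \<Rightarrow> nat \<Rightarrow> hl_state \<Rightarrow> bool" where
  "decomposing G vs k h \<longleftrightarrow> nv h 1 = length vs \<and> (\<exists>N P f lab. decomp G vs N P f lab (arr h 3) \<and>
     instances N (inst_adj G f) lab h \<and> nv h 4 = P \<and> nv h 6 \<le> N \<and>
     (\<forall>v<nv h 6. only_trivial_modules_at (inst_adj G f) (members N lab (lab v)) v) \<and>
     (k < nv h 6 + P \<or> nv h 6 = N))"

lemma split_code_correct:
  assumes G: "simple_graph G" and dec: "decomp G vs N P f lab (arr h 3)"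
    and h: "instances N (inst_adj G f) lab h" "nv h 1 = length vs" "nv h 4 = P" "nv h 6 = u"
      "qv h 5 = of_nat (lab u)" "u < N" and B: "2 * length vs \<le> B"
    and C: "C \<noteq> {}" "C \<noteq> members N lab (lab u) - {u}"
      "closed_at (inst_adj G f) (members N lab (lab u)) u C" "flagged 4 N h = insert u C"
    and triv: "\<forall>v<u. only_trivial_modules_at (inst_adj G f) (members N lab (lab v)) v"
    and k: "k < u + P"
  shows "decomposing G vs (Suc k) (run split_code h)"
proof -
  let ?A = "inst_adj G f"
  have irr: "\<not> inst_adj G g x x" for g x using adjacent_irrefl[OF G] by (simp add: inst_adj_def)
  have sym: "inst_adj G g x y \<Longrightarrow> inst_adj G g y x" for g x y using adjacent_sym by (simp add: inst_adj_def)
  have NB: "N \<le> B" "nv h 1 \<le> B" using decomp_bounds[OF dec] B h(2) by auto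
  let ?h1 = "run greedy_code h"
  let ?h2 = "run expand_code ?h1"
  let ?h3 = "run copy_code ?h2"
  let ?h4 = "run relabel_code ?h3"
  let ?h5 = "run split_code h"
  have h1: "instances N ?A lab ?h1" using instances_run[OF h(1)] by simp
  have h2: "instances N ?A lab ?h2" using instances_run[OF h1] by simp
  define J where "J = flagged 6 N ?h1"
  have J: "mis ?A (insert u C) J"
    unfolding J_def C(4)[symmetric] by (rule greedy_code_correct[OF h(1) NB(1) irr sym])
  have n1: "nv ?h1 1 = length vs" using h(2) by (simp add: run_nv)
  have rep: "v < N \<Longrightarrow> z < length vs \<Longrightarrow> arr ?h5 3 v z = arr h 3 v z"
    "z < length vs \<Longrightarrow> arr ?h5 3 N z = (\<Sum>v\<in>J. arr h 3 v z)" for v z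
    using expand_code_correct(1)[OF h1 NB(1), of v z] expand_code_correct(2)[OF h1 NB(1), of z] n1 NB h(2)
    by (simp_all add: split_code_def run_arr J_def)
  interpret ps: piece_split G vs N P f lab "arr h 3" u C J "arr ?h5 3"
    by unfold_locales (fact G dec h(6) C(1-3) J rep)+
  let ?f = "ps.f'" and ?lab = "ps.lab'"
  have h3: "instances N ?A lab (run greedy_code h)" by (rule h1)
  have "nv ?h2 6 = u" using h(4) by (simp add: run_nv)
  then have adj: "arr ?h3 1 i j = of_bool (inst_adj G ?f i j)" if "i < Suc N" "j < Suc N" for i j
    using that h(6)
    by (intro copy_code_correct[OF h2 NB(1) _ h(6)])
      (auto simp: ps.inst_adj' ps.f'_def inst_adj_def irr[unfolded inst_adj_def])
  have i3: "consts_ok ?h3" "nv ?h3 5 = N" "nv ?h3 4 = P" "qv ?h3 5 = of_nat (lab u)"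
    "flagged 4 N ?h3 = insert u C" "\<forall>v<N. arr ?h3 2 0 v = of_nat (lab v)"
    using h C(4) by (auto simp: instances_def consts_ok_def run_nv run_qv run_arr flagged_def)
  have i3': "instances N (inst_adj G ?f) lab ?h3"
    using i3 adj by (simp add: instances_def)
  have lab: "arr ?h4 2 0 v = of_nat (?lab v)" if "v < Suc N" for v
    unfolding relabel_code_correct[OF i3' NB(1) i3(3,4) that i3(5)] ps.lab'_def ..
  have h5: "?h5 = set_nv 4 (Suc P) (set_nv 5 (Suc N) ?h4)"
    using i3 by (simp add: split_code_def run_nv consts_ok_def)
  have "instances (Suc N) (inst_adj G ?f) ?lab ?h5"
    unfolding h5 using i3(1,2) adj lab by (simp add: instances_def consts_ok_def run_nv run_qv run_arr)
  moreover have "nv ?h5 6 = u" "nv ?h5 1 = length vs" "nv ?h5 4 = Suc P"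
    using h i3 by (simp_all add: h5 run_nv)
  moreover have "\<forall>v<u. only_trivial_modules_at (inst_adj G ?f) (members (Suc N) ?lab (?lab v)) v"
    using ps.trivial_modules' triv h(6) by (metis less_trans)
  ultimately show ?thesis
    unfolding decomposing_def using ps.decomp_split h(6) k
    by (intro conjI exI[of _ "Suc N"] exI[of _ "Suc P"] exI[of _ ?f] exI[of _ ?lab]) simp_all
qed

lemma decompose_code_correct:
  assumes G: "simple_graph G" and B: "B = 4 * length vs" and h: "decomposing G vs 0 h"
  shows "decomposing G vs B (run decompose_code h)"
  unfolding decompose_code_def
proof (rule For_inv[where I = "decomposing G vs"], goal_cases)
  case (2 k t v)
  then show ?case by (simp add: decomposing_def instances_def consts_ok_def)
next
  case (4 k t)
  obtain N P f lab where t: "decomp G vs N P f lab (arr t 3)" "instances N (inst_adj G f) lab t"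
    "nv t 4 = P" "nv t 6 \<le> N" "nv t 1 = length vs"
    "\<forall>v<nv t 6. only_trivial_modules_at (inst_adj G f) (members N lab (lab v)) v"
    "k < nv t 6 + P \<or> nv t 6 = N"
    using 4(4) unfolding decomposing_def by blast
  have n5: "nv t 5 = N" using t(2) by (simp add: instances_def)
  show ?case
  proof (cases "nv t 6 < N")
    case False
    then have "run (only_if (NLess 6 5) step_code) t = t" "nv t 6 = N" using n5 t(4) by auto
    then show ?thesis using t unfolding decomposing_def by auto
  next
    case True
    let ?u = "nv t 6"
    have NB: "N \<le> B" using decomp_bounds[OF t(1)] B by auto
    have ne: "members N lab (lab ?u) - {?u} \<noteq> {}"
      using decompD(3)[OF t(1), of "lab ?u"] decompD(1)[OF t(1) True] by blast
    let ?t1 = "run find_module t"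
    note F = find_module_correct[OF t(2) refl True NB ne]
    have t1: "instances N (inst_adj G f) lab ?t1" using instances_run[OF t(2)] by simp
    have c1: "nv ?t1 6 = ?u" "nv ?t1 4 = P" "nv ?t1 1 = length vs" "nv ?t1 7 = 1" "nv ?t1 0 = 0" "qv ?t1 11 = 1"
      "arr ?t1 3 = arr t 3"
      using t by (simp_all add: run_nv run_qv run_arr instances_def consts_ok_def)
    have r: "run (only_if (NLess 6 5) step_code) t = (if nv ?t1 23 = 1
      then run split_code (set_arr 4 0 ?u 1 ?t1) else set_nv 6 (Suc ?u) ?t1)"
      using True n5 c1 by (simp add: step_code_def)
    show ?thesis
    proof (cases "nv ?t1 23 = 1")
      case split: True
      let ?t2 = "set_arr 4 0 ?u 1 ?t1"
      let ?C = "flagged 4 N ?t1"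
      have C: "?C \<noteq> {}" "?C \<noteq> members N lab (lab ?u) - {?u}"
        "closed_at (inst_adj G f) (members N lab (lab ?u)) ?u ?C"
        using F(2)[OF split] by auto
      have fl: "flagged 4 N ?t2 = insert ?u ?C" using True by (auto simp: flagged_def)
      have t2: "instances N (inst_adj G f) lab ?t2" using t1 by (simp add: instances_def consts_ok_def)
      have "decomposing G vs (Suc k) (run split_code ?t2)"
        by (rule split_code_correct[OF G _ t2 _ _ _ _ True _ C fl])
          (use c1 t F(1) B True in auto)
      then show ?thesis unfolding r using split by simp
    next
      case False
      have "only_trivial_modules_at (inst_adj G f) (members N lab (lab v)) v" if "v < Suc ?u" for v
        using F(3)[OF False] t(6) that by (auto simp: less_Suc_eq)
      moreover have "instances N (inst_adj G f) lab (set_nv 6 (Suc ?u) ?t1)"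
        using t1 by (simp add: instances_def consts_ok_def)
      moreover have "decomp G vs N P f lab (arr (set_nv 6 (Suc ?u) ?t1) 3)" using t(1) c1(7) by simp
      ultimately show ?thesis
        unfolding r if_not_P[OF False] decomposing_def using c1 t(7) True
        by (intro conjI exI[of _ N] exI[of _ P] exI[of _ f] exI[of _ lab]) simp_all
    qed
  qed
qed (use h in auto)

theorem decomposed:
  assumes G: "simple_graph G" and B: "B = 4 * length vs" and h: "decomposing G vs 0 h"
  shows "\<exists>N P f lab. decomp G vs N P f lab (arr (run decompose_code h) 3) \<and>
    instances N (inst_adj G f) lab (run decompose_code h) \<and> nv (run decompose_code h) 4 = P \<and>
    (\<forall>v<N. only_trivial_modules_at (inst_adj G f) (members N lab (lab v)) v)"
proof -
  let ?h = "run decompose_code h"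
  obtain N P f lab where t: "decomp G vs N P f lab (arr ?h 3)" "instances N (inst_adj G f) lab ?h"
    "nv ?h 4 = P" "nv ?h 6 \<le> N"
    "\<forall>v<nv ?h 6. only_trivial_modules_at (inst_adj G f) (members N lab (lab v)) v"
    "B < nv ?h 6 + P \<or> nv ?h 6 = N"
    using decompose_code_correct[OF assms] unfolding decomposing_def by blast
  \<comment> \<open>The measure never exceeds N + P, which is below 3 n, so after 4 n rounds every
    instance must be settled.\<close>
  have "N + P \<le> B" using decomp_bounds[OF t(1)] B by simp
  then have "nv ?h 6 = N" using t(4,6) by auto
  then show ?thesis using t by auto
qed

end

section \<open>Vertex numbers and edge lists of the pieces\<close>

subsection \<open>Presenting the pieces\<close>

definition number_code :: cmd where
  "number_code = NSet 21 0 ;; ForLess 13 5 (Read 1 2 0 13 ;;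
     only_if (QEq 1 5) (QOf 1 21 ;; Write 7 0 13 1 ;; NAdd 21 21 7))"

definition edge_out :: cmd where
  "edge_out = Read 1 7 0 13 ;; Write 0 3 24 1 ;; NAdd 24 24 7 ;;
     Read 1 7 0 14 ;; Write 0 3 24 1 ;; NAdd 24 24 7 ;; NAdd 22 22 7"

definition edge_row_code :: cmd where
  "edge_row_code = ForLess 14 13 (Read 1 2 0 14 ;; only_if (QEq 1 5) (Read 1 1 13 14 ;; only_if (QEq 1 11) edge_out))"

definition edges_code :: cmd where
  "edges_code = ForLess 13 5 (Read 1 2 0 13 ;; only_if (QEq 1 5) edge_row_code)"

definition build_piece :: cmd where
  "build_piece = QOf 5 3 ;; number_code ;; QOf 1 21 ;; Write 0 3 0 1 ;; NSet 24 2 ;; NSet 22 0 ;;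
     edges_code ;; QOf 1 22 ;; Write 0 3 7 1"

definition build_code :: cmd where
  "build_code = ForLess 3 4 build_piece"

lemma written_number_code [simp]:
  "written_nv number_code = {13, 21}" "written_qv number_code = {1}"
  "written_arr number_code = {7}" "\<not> writes_raw number_code"
  by (auto simp: number_code_def)

lemma written_edge_out [simp]:
  "written_nv edge_out = {22, 24}" "written_qv edge_out = {1}"
  "written_arr edge_out = {0}" "\<not> writes_raw edge_out"
  by (auto simp: edge_out_def)

lemma written_edge_row_code [simp]:
  "written_nv edge_row_code = {14, 22, 24}" "written_qv edge_row_code = {1}"
  "written_arr edge_row_code = {0}" "\<not> writes_raw edge_row_code"
  by (auto simp: edge_row_code_def)

lemma written_edges_code [simp]:
  "written_nv edges_code = {13, 14, 22, 24}" "written_qv edges_code = {1}"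
  "written_arr edges_code = {0}" "\<not> writes_raw edges_code"
  by (auto simp: edges_code_def)

lemma written_build_piece [simp]:
  "written_nv build_piece = {13, 14, 21, 22, 24}" "written_qv build_piece = {1, 5}"
  "written_arr build_piece = {0, 7}" "\<not> writes_raw build_piece"
  by (auto simp: build_piece_def)

lemma written_build_code [simp]:
  "written_nv build_code = {3, 13, 14, 21, 22, 24}" "written_qv build_code = {1, 5}"
  "written_arr build_code = {0, 7}" "\<not> writes_raw build_code"
  by (auto simp: build_code_def)

definition plist :: "nat \<Rightarrow> (nat \<Rightarrow> nat) \<Rightarrow> nat \<Rightarrow> nat list" where
  "plist N lab c = filter (\<lambda>v. lab v = c) [0..<N]"

text \<open>Counts the smaller members of the piece of v, which gives the position of v in
  \<open>plist N lab (lab v)\<close> for every \<open>N > v\<close>.\<close>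

definition rank :: "(nat \<Rightarrow> nat) \<Rightarrow> nat \<Rightarrow> nat" where
  "rank lab v = length (plist v lab (lab v))"

primrec pair_list :: "(nat \<Rightarrow> nat \<Rightarrow> bool) \<Rightarrow> (nat \<Rightarrow> nat) \<Rightarrow> nat \<Rightarrow> nat \<Rightarrow> (nat \<times> nat) list" where
  "pair_list A lab c 0 = []"
| "pair_list A lab c (Suc k) = pair_list A lab c k @
     (if lab k = c then map (Pair k) (filter (\<lambda>x. lab x = c \<and> A k x) [0..<k]) else [])"

definition rank_pairs :: "(nat \<Rightarrow> nat) \<Rightarrow> (nat \<times> nat) list \<Rightarrow> (nat \<times> nat) list" where
  "rank_pairs lab ps = map (\<lambda>(v, x). (rank lab v, rank lab x)) ps"

text \<open>The edge count is an argument of its own, because cell 1 is written only after all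
  edges; until then it is zero.\<close>

definition edge_memory :: "nat \<Rightarrow> nat \<Rightarrow> (nat \<times> nat) list \<Rightarrow> memory" where
  "edge_memory k m es = initial_memory
     (of_nat k # of_nat m # concat (map (\<lambda>(i, j). [of_nat i, of_nat j]) es))"

lemma length_concat_pairs: "length (concat (map (\<lambda>(i, j). [g i, g' j]) es)) = 2 * length es"
  by (induction es) auto

lemma initial_memory_snoc: "initial_memory (xs @ [q]) = (initial_memory xs)(length xs := q)"
  by (auto simp: initial_memory_def fun_eq_iff nth_append)

lemma edge_memory_snoc:
  "edge_memory k m (es @ [(i, j)]) =
     (edge_memory k m es)(2 + 2 * length es := of_nat i, 3 + 2 * length es := of_nat j)"
proof -
  let ?l = "of_nat k # of_nat m # concat (map (\<lambda>(i, j). [of_nat i, of_nat j]) es) :: rat list"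
  have "edge_memory k m (es @ [(i, j)]) = initial_memory ((?l @ [of_nat i]) @ [of_nat j])"
    by (simp add: edge_memory_def)
  also have "\<dots> = (initial_memory ?l)(length ?l := of_nat i, Suc (length ?l) := of_nat j)"
    unfolding initial_memory_snoc by simp
  finally show ?thesis by (simp add: edge_memory_def length_concat_pairs eval_nat_numeral)
qed

lemma edge_memory_Nil: "edge_memory k 0 [] = (\<lambda>_. 0)(0 := of_nat k)"
  by (auto simp: edge_memory_def initial_memory_def fun_eq_iff less_Suc_eq nth_Cons split: nat.split)

lemma edge_memory_count: "(edge_memory k m es)(Suc 0 := of_nat m') = edge_memory k m' es"
  by (auto simp: edge_memory_def initial_memory_def fun_eq_iff nth_Cons split: nat.split)

lemma plist_rank:
  assumes "v < N" "lab v = c"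
  shows "rank lab v < length (plist N lab c)" "plist N lab c ! rank lab v = v"
proof -
  have "[0..<N] = [0..<v] @ v # [Suc v..<N]"
    using assms(1) upt_add_eq_append[of 0 v "N - v"] by (simp add: upt_conv_Cons)
  then have "plist N lab c = plist v lab c @ v # filter (\<lambda>v. lab v = c) [Suc v..<N]"
    unfolding plist_def using assms(2) by simp
  then show "rank lab v < length (plist N lab c)" "plist N lab c ! rank lab v = v"
    using assms(2) by (simp_all add: rank_def nth_append)
qed

lemma set_plist: "set (plist N lab c) = members N lab c"
  by (auto simp: plist_def members_def)

lemma distinct_plist: "distinct (plist N lab c)"
  by (simp add: plist_def)

lemma plist_Suc: "plist (Suc k) lab c = plist k lab c @ (if lab k = c then [k] else [])"
  by (simp add: plist_def)

lemma rank_plist: "j < length (plist N lab c) \<Longrightarrow> rank lab (plist N lab c ! j) = j"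
proof -
  assume j: "j < length (plist N lab c)"
  then have "plist N lab c ! j \<in> members N lab c" using nth_mem set_plist by metis
  then have "rank lab (plist N lab c ! j) < length (plist N lab c)"
    "plist N lab c ! rank lab (plist N lab c ! j) = plist N lab c ! j"
    using plist_rank by (auto simp: members_def)
  then show ?thesis using j distinct_plist nth_eq_iff_index_eq by metis
qed

lemma set_pair_list:
  "set (pair_list A lab c k) = {(v, x). x < v \<and> v < k \<and> lab v = c \<and> lab x = c \<and> A v x}"
  by (induction k) (auto simp: less_Suc_eq)

lemma distinct_pair_list: "distinct (pair_list A lab c k)"
  by (induction k) (auto simp: set_pair_list distinct_map inj_on_def)

text \<open>A pair is listed with the larger instance first, so by injectivity of f no edge occurs
  twice.\<close>

lemma presents_piece:
  assumes G: "simple_graph G" and f: "inj_on f (members N lab c)"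
    and A: "\<And>v x. A v x \<longleftrightarrow> adjacent G (f v) (f x)"
  shows "presents (map f (plist N lab c)) (rank_pairs lab (pair_list A lab c N)) (induced G (f ` members N lab c))"
proof -
  let ?vs = "map f (plist N lab c)" and ?ps = "pair_list A lab c N"
  let ?g = "\<lambda>(v, x). {f v, f x}"
  have ps: "rank lab v < length ?vs" "?vs ! rank lab v = f v" if "v \<in> members N lab c" for v
    using plist_rank[of v N lab c] that by (simp_all add: members_def)
  have mem: "v \<in> members N lab c" "x \<in> members N lab c" if "(v, x) \<in> set ?ps" for v x
    using that by (auto simp: set_pair_list members_def)
  have sets: "map (\<lambda>(i, j). {?vs ! i, ?vs ! j}) (rank_pairs lab ?ps) = map ?g ?ps"
    unfolding rank_pairs_def map_map using ps mem by (intro map_cong refl) auto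
  have "inj_on ?g (set ?ps)"
  proof (rule inj_onI, clarify)
    fix v x v' x'
    assume h: "(v, x) \<in> set ?ps" "(v', x') \<in> set ?ps" "{f v, f x} = {f v', f x'}"
    then have lt: "x < v" "x' < v'" by (auto simp: set_pair_list)
    have "(f v = f v' \<and> f x = f x') \<or> (f v = f x' \<and> f x = f v')"
      using h(3) by (auto simp: doubleton_eq_iff)
    then have "(v = v' \<and> x = x') \<or> (v = x' \<and> x = v')"
      using f mem[OF h(1)] mem[OF h(2)] by (metis inj_onD)
    then show "v = v' \<and> x = x'" using lt by auto
  qed
  then have d: "distinct (map ?g ?ps)" using distinct_pair_list by (simp add: distinct_map)
  have "?g ` set ?ps = edges (induced G (f ` members N lab c))"
  proof (intro equalityI subsetI)
    fix e assume "e \<in> ?g ` set ?ps"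
    then obtain v x where "(v, x) \<in> set ?ps" "e = {f v, f x}" by auto
    then show "e \<in> edges (induced G (f ` members N lab c))"
      using mem[of v x] A[of v x] by (auto simp: set_pair_list adjacent_def)
  next
    fix e assume e: "e \<in> edges (induced G (f ` members N lab c))"
    then have "e \<in> edges G" by simp
    then obtain a b where ab: "e = {a, b}" "a \<noteq> b" using simple_edgeE[OF G] by metis
    then obtain v x where vx: "v \<in> members N lab c" "x \<in> members N lab c" "a = f v" "b = f x"
      using e by auto
    have adj: "A v x" "A x v" using e ab vx A by (auto simp: adjacent_def insert_commute)
    have "v \<noteq> x" using ab(2) vx by auto
    then have "(v, x) \<in> set ?ps \<or> (x, v) \<in> set ?ps"
      using vx adj by (auto simp: set_pair_list members_def)
    moreover have "e = {f x, f v}" using ab vx by auto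
    ultimately show "e \<in> ?g ` set ?ps" using ab vx by (metis (no_types, lifting) case_prod_conv image_eqI)
  qed
  moreover have "distinct ?vs" using f distinct_plist set_plist by (metis distinct_map)
  moreover have "set ?vs = f ` members N lab c" by (simp add: set_plist)
  moreover have "\<forall>(i, j) \<in> set (rank_pairs lab ?ps). i < length ?vs \<and> j < length ?vs"
    unfolding rank_pairs_def using ps(1) mem by fastforce
  ultimately show ?thesis
    unfolding presents_def sets using d by simp
qed

definition piece_memory :: "nat \<Rightarrow> (nat \<Rightarrow> nat \<Rightarrow> bool) \<Rightarrow> (nat \<Rightarrow> nat) \<Rightarrow> nat \<Rightarrow> memory" where
  "piece_memory N A lab c =
     edge_memory (length (plist N lab c)) (length (pair_list A lab c N)) (rank_pairs lab (pair_list A lab c N))"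

lemma piece_memory_eq:
  "piece_memory N A lab c =
     initial_memory (encode_graph (map f (plist N lab c)) (rank_pairs lab (pair_list A lab c N)))"
  by (simp add: piece_memory_def edge_memory_def encode_graph_def rank_pairs_def)

lemma piece_memory_1: "piece_memory N A lab c 1 = of_nat (length (pair_list A lab c N))"
  by (simp add: piece_memory_def edge_memory_def initial_memory_def)

context machine
begin

lemma number_code_correct:
  assumes h: "instances N A lab h" and "N \<le> B" "qv h 5 = of_nat c"
  shows "nv (run number_code h) 21 = length (plist N lab c)"
    and "v < N \<Longrightarrow> arr (run number_code h) 7 0 v = (if lab v = c then of_nat (rank lab v) else arr h 7 0 v)"
proof -
  define I where "I = (\<lambda>k (t :: hl_state). nv t 21 = length (plist k lab c) \<and>
    (\<forall>v. arr t 7 0 v = (if v < k \<and> lab v = c then of_nat (rank lab v) else arr h 7 0 v)))"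
  have n5: "nv (set_nv 21 0 h) 5 = N" using h by (simp add: instances_def)
  have "I (nv (set_nv 21 0 h) 5) (run number_code h)"
    unfolding number_code_def run.simps(2,11)
  proof (rule ForLess_inv, goal_cases)
    case (7 k t)
    have kN: "k < N" using 7(1) n5 by simp
    have f: "nv t 0 = 0" "nv t 7 = 1" "qv t 5 = of_nat c" "arr t 2 0 k = of_nat (lab k)"
      using 7(3) h kN assms(3) by (auto simp: agree_def instances_def consts_ok_def)
    show ?case
      using 7(2,4) f unfolding I_def by (auto simp: plist_Suc less_Suc_eq rank_def)
  qed (use assms n5 in \<open>auto simp: I_def plist_def\<close>)
  then show "nv (run number_code h) 21 = length (plist N lab c)"
    "v < N \<Longrightarrow> arr (run number_code h) 7 0 v = (if lab v = c then of_nat (rank lab v) else arr h 7 0 v)"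
    unfolding n5 I_def by auto
qed

definition building :: "nat \<Rightarrow> (nat \<Rightarrow> nat) \<Rightarrow> (nat \<times> nat) list \<Rightarrow> hl_state \<Rightarrow> hl_state \<Rightarrow> bool" where
  "building k lab ps h t \<longleftrightarrow> nv t 24 = 2 + 2 * length ps \<and> nv t 22 = length ps \<and>
     arr t 0 (nv h 3) = edge_memory k 0 (rank_pairs lab ps) \<and> (\<forall>i. i \<noteq> nv h 3 \<longrightarrow> arr t 0 i = arr h 0 i)"

lemma building_set_nv: "x \<notin> {22, 24} \<Longrightarrow> building k lab ps h (set_nv x v t) = building k lab ps h t"
  by (simp add: building_def)

lemma edge_out_correct:
  assumes "building k lab ps h t" "nv t 3 = nv h 3" "nv t 0 = 0" "nv t 7 = 1"
    "arr t 7 0 (nv t 13) = of_nat (rank lab v)" "arr t 7 0 (nv t 14) = of_nat (rank lab x)"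
  shows "building k lab (ps @ [(v, x)]) h (run edge_out t)"
  using assms unfolding building_def edge_out_def
  by (simp add: rank_pairs_def edge_memory_snoc eval_nat_numeral)

lemma edge_row_code_correct:
  assumes h: "instances N A lab h" and "N \<le> B" "qv h 5 = of_nat c" "nv h 13 = v" "v < N" "lab v = c"
    and rank: "\<And>x. x < N \<Longrightarrow> lab x = c \<Longrightarrow> arr h 7 0 x = of_nat (rank lab x)"
    and b: "building k lab ps h0 h" "nv h 3 = nv h0 3"
  shows "building k lab (ps @ map (Pair v) (filter (\<lambda>x. lab x = c \<and> A v x) [0..<v])) h0 (run edge_row_code h)"
proof -
  define I where "I = (\<lambda>l. building k lab (ps @ map (Pair v) (filter (\<lambda>x. lab x = c \<and> A v x) [0..<l])) h0)"
  have "I (nv h 13) (run edge_row_code h)"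
    unfolding edge_row_code_def
  proof (rule ForLess_inv, goal_cases)
    case (7 l t)
    have lN: "l < N" using 7(1) assms(4,5) by simp
    have f: "nv t 0 = 0" "nv t 7 = 1" "nv t 13 = v" "qv t 5 = of_nat c" "qv t 11 = 1"
      "arr t 2 0 l = of_nat (lab l)" "arr t 1 v l = of_bool (A v l)" "arr t 7 = arr h 7" "nv t 3 = nv h0 3"
      using 7(3) h lN assms(3-5) b(2) by (auto simp: agree_def instances_def consts_ok_def)
    have I: "building k lab (ps @ map (Pair v) (filter (\<lambda>x. lab x = c \<and> A v x) [0..<l])) h0 (set_qv 1 q t)" for q
      using 7(4) unfolding I_def building_def by simp
    show ?case
    proof (cases "lab l = c \<and> A v l")
      case True
      have "building k lab ((ps @ map (Pair v) (filter (\<lambda>x. lab x = c \<and> A v x) [0..<l])) @ [(v, l)]) h0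
          (run edge_out (set_qv 1 1 (set_qv 1 (of_nat c) t)))"
        using f rank[of v] rank[of l] True lN assms(5,6) 7(2,4) unfolding I_def
        by (intro edge_out_correct) (auto simp: building_def)
      then show ?thesis using True f 7(2) unfolding I_def by simp
    next
      case False
      have "filter (\<lambda>x. lab x = c \<and> A v x) [0..<Suc l] = filter (\<lambda>x. lab x = c \<and> A v x) [0..<l]"
        using False by auto
      then show ?thesis
        using False f 7(2,4) unfolding I_def by (auto simp: building_def)
    qed
  qed (use assms in \<open>auto simp: I_def building_set_nv\<close>)
  then show ?thesis unfolding I_def assms(4) .
qed

lemma edges_code_correct:
  assumes h: "instances N A lab h" and "N \<le> B" "qv h 5 = of_nat c"
    and rank: "\<And>x. x < N \<Longrightarrow> lab x = c \<Longrightarrow> arr h 7 0 x = of_nat (rank lab x)"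
    and b: "building k lab [] h0 h" "nv h 3 = nv h0 3"
  shows "building k lab (pair_list A lab c N) h0 (run edges_code h)"
proof -
  define I where "I = (\<lambda>l. building k lab (pair_list A lab c l) h0)"
  have n5: "nv h 5 = N" using h by (simp add: instances_def)
  have "I (nv h 5) (run edges_code h)"
    unfolding edges_code_def
  proof (rule ForLess_inv, goal_cases)
    case (7 l t)
    have lN: "l < N" using 7(1) n5 by simp
    have f: "nv t 0 = 0" "qv t 5 = of_nat c" "arr t 2 0 l = of_nat (lab l)"
      using 7(3) h lN assms(3) by (auto simp: agree_def instances_def consts_ok_def)
    show ?case
    proof (cases "lab l = c")
      case True
      let ?t = "set_qv 1 (of_nat c) t"
      have t: "instances N A lab ?t" using 7(3) h by (simp add: agree_def instances_def consts_ok_def)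
      have "building k lab (pair_list A lab c l @ map (Pair l) (filter (\<lambda>x. lab x = c \<and> A l x) [0..<l])) h0
          (run edge_row_code ?t)"
        using f 7(2-4) lN True rank b(2) unfolding I_def
        by (intro edge_row_code_correct[OF t assms(2)]) (auto simp: building_def agree_def)
      then show ?thesis using f 7(2) True unfolding I_def by simp
    next
      case False
      then show ?thesis using f 7(2,4) unfolding I_def by (simp add: building_def)
    qed
  qed (use assms n5 in \<open>auto simp: I_def building_set_nv\<close>)
  then show ?thesis unfolding I_def n5 .
qed

lemma build_piece_correct:
  assumes h: "instances N A lab h" and "N \<le> B" "nv h 3 = c" "arr h 0 c = (\<lambda>_. 0)"
  shows "arr (run build_piece h) 0 c = piece_memory N A lab c"
    and "i \<noteq> c \<Longrightarrow> arr (run build_piece h) 0 i = arr h 0 i"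
    and "v < N \<Longrightarrow> arr (run build_piece h) 7 0 v = (if lab v = c then of_nat (rank lab v) else arr h 7 0 v)"
proof -
  let ?h1 = "set_qv 5 (of_nat c) h"
  let ?h2 = "run number_code ?h1"
  let ?k = "length (plist N lab c)"
  let ?h3 = "set_nv 22 0 (set_nv 24 2 (set_arr 0 c 0 (of_nat ?k) (set_qv 1 (of_nat ?k) ?h2)))"
  let ?h4 = "run edges_code ?h3"
  have h1: "instances N A lab ?h1" using h by (simp add: instances_def consts_ok_def)
  have h2: "instances N A lab ?h2" using instances_run[OF h1] by simp
  have h3: "instances N A lab ?h3" using h2 by (simp add: instances_def consts_ok_def)
  note num = number_code_correct[OF h1 assms(2)]
  have k: "nv ?h2 21 = ?k" using num(1)[of c] by simp
  have c: "nv ?h2 3 = c" "nv ?h2 0 = 0" using assms(3) h2 by (simp_all add: run_nv instances_def consts_ok_def)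
  have n3: "nv ?h3 3 = c" "nv ?h3 3 = nv h 3" using c assms(3) by simp_all
  have "building ?k lab [] h ?h3"
    using assms(3,4) c by (simp add: building_def rank_pairs_def edge_memory_Nil run_arr)
  then have b: "building ?k lab (pair_list A lab c N) h ?h4"
    using num(2)[of c] n3 by (intro edges_code_correct[OF h3 assms(2)]) (auto simp: run_qv)
  have c4: "nv ?h4 3 = c" "nv ?h4 7 = 1" using n3 h3 by (simp_all add: run_nv instances_def consts_ok_def)
  have r: "run build_piece h = set_arr 0 c 1 (of_nat (nv ?h4 22)) (set_qv 1 (of_nat (nv ?h4 22)) ?h4)"
    using k c c4 assms(3) by (simp add: build_piece_def)
  show "arr (run build_piece h) 0 c = piece_memory N A lab c"
    unfolding r using b assms(3) by (simp add: building_def piece_memory_def edge_memory_count)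
  show "i \<noteq> c \<Longrightarrow> arr (run build_piece h) 0 i = arr h 0 i"
    unfolding r using b assms(3) by (simp add: building_def)
  show "v < N \<Longrightarrow> arr (run build_piece h) 7 0 v = (if lab v = c then of_nat (rank lab v) else arr h 7 0 v)"
    unfolding r using num(2)[of c v] by (simp add: run_arr)
qed

theorem build_code_correct:
  assumes h: "instances N A lab h" and "N \<le> B" "nv h 4 = P" "P \<le> B" "arr h 0 = (\<lambda>_ _. 0)"
    and lab: "\<forall>v<N. lab v < P"
  shows "c < P \<Longrightarrow> arr (run build_code h) 0 c = piece_memory N A lab c"
    and "v < N \<Longrightarrow> arr (run build_code h) 7 0 v = of_nat (rank lab v)"
proof -
  define I where "I = (\<lambda>k (t :: hl_state). (\<forall>c. arr t 0 c = (if c < k then piece_memory N A lab c else (\<lambda>_. 0))) \<and>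
    (\<forall>v<N. lab v < k \<longrightarrow> arr t 7 0 v = of_nat (rank lab v)))"
  have "I (nv h 4) (run build_code h)"
    unfolding build_code_def
  proof (rule ForLess_inv, goal_cases)
    case (7 k t)
    have t: "instances N A lab t" using 7(3) h by (auto simp: agree_def instances_def consts_ok_def)
    have "arr t 0 k = (\<lambda>_. 0)" using 7(4) by (simp add: I_def)
    from build_piece_correct[OF t assms(2) 7(2) this] show ?case
      using 7(4) unfolding I_def by (auto simp: less_Suc_eq)
  qed (use assms in \<open>auto simp: I_def\<close>)
  then show "c < P \<Longrightarrow> arr (run build_code h) 0 c = piece_memory N A lab c"
    "v < N \<Longrightarrow> arr (run build_code h) 7 0 v = of_nat (rank lab v)"
    using lab assms(3) unfolding I_def by auto
qed

end

section \<open>Substitution into the equations of the pieces, and Gaussian elimination\<close>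

subsection \<open>Collecting independent equations\<close>

text \<open>The instance with a given number in the piece is found by a scan, as only the map from
  instances to numbers is stored.\<close>

definition add_coef :: cmd where
  "add_coef = ForLess 13 5 (Read 1 2 0 13 ;; only_if (QEq 1 5) (Read 1 7 0 13 ;;
     only_if (QEq 1 2) (Read 1 8 0 13 ;; QArith Plus 1 1 3 ;; Write 8 0 13 1)))"

definition entry_code :: cmd where
  "entry_code = Read 2 0 3 24 ;; NAdd 24 24 7 ;; Read 3 0 3 24 ;; NAdd 24 24 7 ;; add_coef"

text \<open>The number of entries is available only as a rational, hence the loop runs to the common
  bound and compares its counter with it.\<close>

definition parse_code :: cmd where
  "parse_code = QOf 5 3 ;; ForLess 13 5 (Write 8 0 13 10) ;; Read 4 0 3 24 ;; NAdd 24 24 7 ;;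
     For 14 (QOf 1 14 ;; only_if (QLess 1 4) entry_code)"

definition combine_code :: cmd where
  "combine_code = QSet 3 0 ;;
     ForLess 13 5 (Read 1 8 0 13 ;; Read 2 3 13 16 ;; QArith Times 1 1 2 ;; QArith Plus 3 3 1)"

text \<open>The row is stored twice, since elimination destroys array 9. Its place in array 12 is
  overwritten by the next equation unless the row turns out to be independent and variable 25
  advances.\<close>

definition row_code :: cmd where
  "row_code = ForLess 16 1 (combine_code ;; Write 9 0 16 3 ;; Write 12 25 16 3)"

definition reduce_code :: cmd where
  "reduce_code = ForLess 17 1 (Read 2 10 16 17 ;; QArith Times 2 2 1 ;; Read 3 9 0 17 ;;
     QArith Minus 3 3 2 ;; Write 9 0 17 3)"

definition insert_code :: cmd where
  "insert_code = ForLess 17 1 (Read 3 9 0 17 ;; QArith Divide 3 3 1 ;; Write 10 16 17 3) ;;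
     Write 11 0 16 11 ;; NSet 22 1"

definition pivot_code :: cmd where
  "pivot_code = Read 1 9 0 16 ;; if_not (QEq 1 10) (if_not (NEq 22 7)
     (Read 2 11 0 16 ;; Cond (QEq 2 11) reduce_code insert_code))"

definition select_code :: cmd where
  "select_code = NSet 22 0 ;; ForLess 16 1 pivot_code ;; only_if (NEq 22 7) (NAdd 25 25 7)"

definition eq_code :: cmd where
  "eq_code = parse_code ;; row_code ;; select_code"

definition eq_step :: cmd where
  "eq_step = Read 4 0 3 0 ;; QOf 5 23 ;; Cond (QLess 5 4) (eq_code ;; NAdd 23 23 7)
     (NAdd 3 3 7 ;; NSet 23 0 ;; NSet 24 1)"

text \<open>A single loop over all pairs of a piece and an equation, with at most N + P productive
  rounds. Nested loops over pieces and equations would lead to depth four and exceed cubic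
  time.\<close>

definition rows_code :: cmd where
  "rows_code = NSet 3 0 ;; NSet 23 0 ;; NSet 24 1 ;; NSet 25 0 ;; For 26 (only_if (NLess 3 4) eq_step)"

lemma written_add_coef [simp]:
  "written_nv add_coef = {13}" "written_qv add_coef = {1}"
  "written_arr add_coef = {8}" "\<not> writes_raw add_coef"
  by (auto simp: add_coef_def)

lemma written_entry_code [simp]:
  "written_nv entry_code = {13, 24}" "written_qv entry_code = {1, 2, 3}"
  "written_arr entry_code = {8}" "\<not> writes_raw entry_code"
  by (auto simp: entry_code_def)

lemma written_parse_code [simp]:
  "written_nv parse_code = {13, 14, 24}" "written_qv parse_code = {1, 2, 3, 4, 5}"
  "written_arr parse_code = {8}" "\<not> writes_raw parse_code"
  by (auto simp: parse_code_def)

lemma written_combine_code [simp]: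
  "written_nv combine_code = {13}" "written_qv combine_code = {1, 2, 3}"
  "written_arr combine_code = {}" "\<not> writes_raw combine_code"
  by (auto simp: combine_code_def)

lemma written_row_code [simp]:
  "written_nv row_code = {13, 16}" "written_qv row_code = {1, 2, 3}"
  "written_arr row_code = {9, 12}" "\<not> writes_raw row_code"
  by (auto simp: row_code_def)

lemma written_reduce_code [simp]:
  "written_nv reduce_code = {17}" "written_qv reduce_code = {2, 3}"
  "written_arr reduce_code = {9}" "\<not> writes_raw reduce_code"
  by (auto simp: reduce_code_def)

lemma written_insert_code [simp]:
  "written_nv insert_code = {17, 22}" "written_qv insert_code = {3}"
  "written_arr insert_code = {10, 11}" "\<not> writes_raw insert_code"
  by (auto simp: insert_code_def)

lemma written_pivot_code [simp]:
  "written_nv pivot_code = {17, 22}" "written_qv pivot_code = {1, 2, 3}"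
  "written_arr pivot_code = {9, 10, 11}" "\<not> writes_raw pivot_code"
  by (auto simp: pivot_code_def)

lemma written_select_code [simp]:
  "written_nv select_code = {16, 17, 22, 25}" "written_qv select_code = {1, 2, 3}"
  "written_arr select_code = {9, 10, 11}" "\<not> writes_raw select_code"
  by (auto simp: select_code_def)

lemma written_eq_code [simp]:
  "written_nv eq_code = {13, 14, 16, 17, 22, 24, 25}" "written_qv eq_code = {1, 2, 3, 4, 5}"
  "written_arr eq_code = {8, 9, 10, 11, 12}" "\<not> writes_raw eq_code"
  by (auto simp: eq_code_def)

lemma written_eq_step [simp]:
  "written_nv eq_step = {3, 13, 14, 16, 17, 22, 23, 24, 25}" "written_qv eq_step = {1, 2, 3, 4, 5}"
  "written_arr eq_step = {8, 9, 10, 11, 12}" "\<not> writes_raw eq_step"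
  by (auto simp: eq_step_def)

lemma written_rows_code [simp]:
  "written_nv rows_code = {3, 13, 14, 16, 17, 22, 23, 24, 25, 26}" "written_qv rows_code = {1, 2, 3, 4, 5}"
  "written_arr rows_code = {8, 9, 10, 11, 12}" "\<not> writes_raw rows_code"
  by (auto simp: rows_code_def)

definition coef_of :: "(nat \<Rightarrow> nat) \<Rightarrow> nat \<Rightarrow> (nat \<times> rat) list \<Rightarrow> nat \<Rightarrow> rat" where
  "coef_of lab c e v = (if lab v = c then \<Sum>(i, q) \<leftarrow> e. if i = rank lab v then q else 0 else 0)"

text \<open>The equation e of piece c after the expansion of each instance v has been substituted
  for its variable.\<close>

definition xrow :: "nat \<Rightarrow> (nat \<Rightarrow> nat) \<Rightarrow> (nat \<Rightarrow> nat \<Rightarrow> rat) \<Rightarrow> nat \<Rightarrow> (nat \<times> rat) list \<Rightarrow> nat \<Rightarrow> rat" where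
  "xrow N lab rep c e z = (\<Sum>v<N. coef_of lab c e v * rep v z)"

definition dotp :: "nat \<Rightarrow> (nat \<Rightarrow> rat) \<Rightarrow> (nat \<Rightarrow> real) \<Rightarrow> real" where
  "dotp n r w = (\<Sum>z<n. of_rat (r z) * w z)"

text \<open>The basis rows are indexed by their pivot columns, so there is at most one per column
  and at most n of them altogether.\<close>

definition echelon :: "nat set \<Rightarrow> (nat \<Rightarrow> nat \<Rightarrow> rat) \<Rightarrow> bool" where
  "echelon H b \<longleftrightarrow> (\<forall>z\<in>H. b z z = 1 \<and> (\<forall>y<z. b z y = 0))"

definition solves :: "nat \<Rightarrow> nat set \<Rightarrow> (nat \<Rightarrow> nat \<Rightarrow> rat) \<Rightarrow> (nat \<Rightarrow> real) \<Rightarrow> bool" where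
  "solves n H b w \<longleftrightarrow> (\<forall>z\<in>H. dotp n (b z) w = 0)"

definition offset :: "sparse_system \<Rightarrow> nat \<Rightarrow> nat" where
  "offset E e = 1 + (\<Sum>i<e. 1 + 2 * length (E ! i))"

lemma dotp_cong: "(\<And>z. z < n \<Longrightarrow> r z = r' z) \<Longrightarrow> dotp n r w = dotp n r' w"
  by (simp add: dotp_def)

lemma concat_nth:
  assumes "i < length ls" "j < length (ls ! i)"
  shows "length (concat (take i ls)) + j < length (concat ls)"
    "concat ls ! (length (concat (take i ls)) + j) = ls ! i ! j"
proof -
  have "concat ls = concat (take i ls) @ ls ! i @ concat (drop (Suc i) ls)"
    using assms(1) by (metis append_take_drop_id concat.simps(2) concat_append Cons_nth_drop_Suc)
  then show "length (concat (take i ls)) + j < length (concat ls)"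
    "concat ls ! (length (concat (take i ls)) + j) = ls ! i ! j"
    using assms(2) by (simp_all add: nth_append)
qed

lemma pairs_nth:
  "j < length es \<Longrightarrow> concat (map (\<lambda>(i, q). [g i, g' q]) es) ! (2 * j) = g (fst (es ! j))"
  "j < length es \<Longrightarrow> concat (map (\<lambda>(i, q). [g i, g' q]) es) ! Suc (2 * j) = g' (snd (es ! j))"
proof (induction es arbitrary: j)
  case (Cons x es)
  { case 1 then show ?case using Cons.IH(1)[of "j - 1"] by (cases j; cases x) auto }
  { case 2 then show ?case using Cons.IH(2)[of "j - 1"] by (cases j; cases x) auto }
qed simp_all

lemma memory_system:
  assumes m: "memory_starts_with \<mu> (encode_system E)"
  shows "\<mu> 0 = of_nat (length E)"
    and "e < length E \<Longrightarrow> \<mu> (offset E e) = of_nat (length (E ! e))"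
    and "e < length E \<Longrightarrow> j < length (E ! e) \<Longrightarrow> \<mu> (offset E e + 1 + 2 * j) = of_nat (fst (E ! e ! j))"
    and "e < length E \<Longrightarrow> j < length (E ! e) \<Longrightarrow> \<mu> (offset E e + 2 + 2 * j) = snd (E ! e ! j)"
proof -
  define enc :: "(nat \<times> rat) list \<Rightarrow> rat list" where
    "enc = (\<lambda>e. of_nat (length e) # concat (map (\<lambda>(i, q). [of_nat i, q]) e))"
  have len: "length (enc e) = 1 + 2 * length e" for e
    using length_concat_pairs[of of_nat "\<lambda>q. q" e] by (simp add: enc_def)
  have es: "encode_system E = of_nat (length E) # concat (map enc E)"
    by (simp add: encode_system_def enc_def)
  show "\<mu> 0 = of_nat (length E)" using m unfolding es memory_starts_with_def by (metis length_greater_0_conv list.discI nth_Cons_0)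
  have lc: "length (concat (take e (map enc E))) = (\<Sum>i<e. 1 + 2 * length (E ! i))" if "e \<le> length E" for e
    using that
  proof (induction e)
    case (Suc e)
    then show ?case by (simp add: take_Suc_conv_app_nth len)
  qed simp
  have at: "\<mu> (offset E e + i) = enc (E ! e) ! i" if "e < length E" "i < 1 + 2 * length (E ! e)" for e i
  proof -
    have n: "e < length (map enc E)" "i < length (map enc E ! e)" using that by (simp_all add: len)
    have le: "e \<le> length E" using that by simp
    have "offset E e + i < length (encode_system E)"
      using concat_nth(1)[OF n] unfolding es lc[OF le] by (simp add: offset_def)
    then have "\<mu> (offset E e + i) = encode_system E ! (offset E e + i)"
      using m by (simp add: memory_starts_with_def)
    also have "\<dots> = concat (map enc E) ! (length (concat (take e (map enc E))) + i)"
      unfolding es lc[OF le] offset_def by simp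
    also have "\<dots> = enc (E ! e) ! i" using concat_nth(2)[OF n] that by simp
    finally show ?thesis .
  qed
  show "e < length E \<Longrightarrow> \<mu> (offset E e) = of_nat (length (E ! e))"
    using at[of e 0] by (simp add: enc_def)
  show "e < length E \<Longrightarrow> j < length (E ! e) \<Longrightarrow> \<mu> (offset E e + 1 + 2 * j) = of_nat (fst (E ! e ! j))"
    using at[of e "1 + 2 * j"] pairs_nth(1)[of j "E ! e" of_nat "\<lambda>q. q"] by (simp add: enc_def add.assoc)
  show "e < length E \<Longrightarrow> j < length (E ! e) \<Longrightarrow> \<mu> (offset E e + 2 + 2 * j) = snd (E ! e ! j)"
    using at[of e "2 + 2 * j"] pairs_nth(2)[of j "E ! e" of_nat "\<lambda>q. q"] by (simp add: enc_def add.assoc)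
qed

context machine
begin

lemma add_coef_correct:
  assumes h: "instances N A lab h" and "N \<le> B" "qv h 5 = of_nat c" "qv h 2 = of_nat i"
    and rank: "\<And>v. v < N \<Longrightarrow> arr h 7 0 v = of_nat (rank lab v)" and v: "v < N"
  shows "arr (run add_coef h) 8 0 v = arr h 8 0 v + (if lab v = c \<and> i = rank lab v then qv h 3 else 0)"
proof -
  define I where "I = (\<lambda>k (t :: hl_state). \<forall>v<N. arr t 8 0 v =
    arr h 8 0 v + (if v < k \<and> lab v = c \<and> i = rank lab v then qv h 3 else 0))"
  have n5: "nv h 5 = N" using h by (simp add: instances_def)
  have "I (nv h 5) (run add_coef h)"
    unfolding add_coef_def
  proof (rule ForLess_inv, goal_cases)
    case (7 k t)
    have kN: "k < N" using 7(1) n5 by simp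
    have f: "nv t 0 = 0" "qv t 5 = of_nat c" "qv t 2 = of_nat i" "qv t 3 = qv h 3"
      "arr t 2 0 k = of_nat (lab k)" "arr t 7 0 k = of_nat (rank lab k)"
      using 7(3) h kN assms(3,4) rank by (auto simp: agree_def instances_def consts_ok_def)
    have "arr t 8 0 k = arr h 8 0 k" using 7(4) kN by (simp add: I_def)
    then show ?case
      using 7(2,4) f kN unfolding I_def by (auto simp: less_Suc_eq)
  qed (use assms n5 in \<open>auto simp: I_def\<close>)
  then show ?thesis using v unfolding n5 I_def by simp
qed

lemma clear8_correct:
  assumes h: "instances N A lab h" and "N \<le> B" "v < N"
  shows "arr (run (ForLess 13 5 (Write 8 0 13 10)) h) 8 0 v = 0"
proof -
  define I where "I = (\<lambda>k (t :: hl_state). \<forall>v<k. arr t 8 0 v = 0)"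
  have n5: "nv h 5 = N" using h by (simp add: instances_def)
  have "I (nv h 5) (run (ForLess 13 5 (Write 8 0 13 10)) h)"
  proof (rule ForLess_inv, goal_cases)
    case (7 k t)
    have "nv t 0 = 0" "qv t 10 = 0" using 7(3) h by (auto simp: agree_def instances_def consts_ok_def)
    then show ?case using 7(2,4) unfolding I_def by (auto simp: less_Suc_eq)
  qed (use assms n5 in \<open>auto simp: I_def\<close>)
  then show ?thesis using assms(3) unfolding n5 I_def by simp
qed

lemma coef_of_snoc:
  "coef_of lab c (e @ [(i, q)]) v = coef_of lab c e v + (if lab v = c \<and> i = rank lab v then q else 0)"
  by (simp add: coef_of_def)

lemma parse_code_correct:
  assumes h: "instances N A lab h" and "N \<le> B" "nv h 3 = c" "nv h 24 = pos"
    and rank: "\<And>v. v < N \<Longrightarrow> arr h 7 0 v = of_nat (rank lab v)"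
    and mem: "arr h 0 c pos = of_nat (length e)"
      "\<And>j. j < length e \<Longrightarrow> arr h 0 c (pos + 1 + 2 * j) = of_nat (fst (e ! j))"
      "\<And>j. j < length e \<Longrightarrow> arr h 0 c (pos + 2 + 2 * j) = snd (e ! j)"
    and len: "length e \<le> B"
  shows "v < N \<Longrightarrow> arr (run parse_code h) 8 0 v = coef_of lab c e v"
    and "nv (run parse_code h) 24 = pos + 1 + 2 * length e"
proof -
  let ?h1 = "set_qv 5 (of_nat c) h"
  let ?h2 = "run (ForLess 13 5 (Write 8 0 13 10)) ?h1"
  let ?h3 = "set_nv 24 (Suc pos) (set_qv 4 (of_nat (length e)) ?h2)"
  have h1: "instances N A lab ?h1" using h by (simp add: instances_def consts_ok_def)
  have h2: "instances N A lab ?h2" using instances_run[OF h1] by simp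
  have h3: "instances N A lab ?h3" using h2 by (simp add: instances_def consts_ok_def)
  have s: "nv ?h2 3 = c" "nv ?h2 24 = pos" "nv ?h2 7 = 1" "arr ?h2 0 = arr h 0" "arr ?h2 7 = arr h 7" "qv ?h2 5 = of_nat c"
    using assms(3,4) h by (simp_all add: run_nv run_arr run_qv instances_def consts_ok_def)
  have r: "run parse_code h = run (For 14 (QOf 1 14 ;; only_if (QLess 1 4) entry_code)) ?h3"
    using s mem(1) assms(3) by (simp add: parse_code_def)
  define I where "I = (\<lambda>k (t :: hl_state). nv t 24 = pos + 1 + 2 * min k (length e) \<and>
    (\<forall>v<N. arr t 8 0 v = coef_of lab c (take k e) v))"
  have "I B (run (For 14 (QOf 1 14 ;; only_if (QLess 1 4) entry_code)) ?h3)"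
  proof (rule For_inv, goal_cases)
    case (2 k t v)
    then show ?case by (simp add: I_def)
  next
    case 3
    show ?case using clear8_correct[OF h1 assms(2)] by (simp add: I_def coef_of_def)
  next
    case (4 k t)
    have t: "instances N A lab t" using 4(3) h3 by (auto simp: agree_def instances_def consts_ok_def)
    have f: "qv t 4 = of_nat (length e)" "qv t 5 = of_nat c" "nv t 3 = c" "nv t 7 = 1"
      "arr t 0 = arr h 0" "arr t 7 = arr h 7"
      using 4(3) s h3 by (auto simp: agree_def instances_def consts_ok_def)
    show ?case
    proof (cases "k < length e")
      case True
      obtain i q where iq: "e ! k = (i, q)" by fastforce
      let ?t = "set_nv 24 (pos + 1 + 2 * Suc k) (set_qv 3 q (set_nv 24 (pos + 2 + 2 * k) (set_qv 2 (of_nat i) (set_qv 1 (of_nat k) t))))"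
      have p: "nv t 24 = pos + 1 + 2 * k" using 4(4) True by (simp add: I_def)
      have r': "run (QOf 1 14 ;; only_if (QLess 1 4) entry_code) t = run add_coef ?t"
        using True f p 4(2) mem(2,3)[OF True] iq by (simp add: entry_code_def)
      have t': "instances N A lab ?t" using t by (simp add: instances_def consts_ok_def)
      have "arr (run add_coef ?t) 8 0 v = arr t 8 0 v + (if lab v = c \<and> i = rank lab v then q else 0)" if "v < N" for v
        using add_coef_correct[OF t' assms(2), of c i v] f rank that by simp
      moreover have "take (Suc k) e = take k e @ [(i, q)]" using True iq by (simp add: take_Suc_conv_app_nth)
      ultimately show ?thesis
        using 4(4) True unfolding r' I_def by (simp add: coef_of_snoc run_nv)
    next
      case False
      then have "run (QOf 1 14 ;; only_if (QLess 1 4) entry_code) t = set_qv 1 (of_nat k) t"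
        using f 4(2) by simp
      then show ?thesis using 4(4) False unfolding I_def by simp
    qed
  qed simp
  then show "v < N \<Longrightarrow> arr (run parse_code h) 8 0 v = coef_of lab c e v"
    "nv (run parse_code h) 24 = pos + 1 + 2 * length e"
    using len unfolding r I_def by (auto simp: min_absorb2)
qed

lemma combine_code_correct:
  assumes h: "instances N A lab h" and "N \<le> B"
  shows "qv (run combine_code h) 3 = (\<Sum>v<N. arr h 8 0 v * arr h 3 v (nv h 16))"
proof -
  define I where "I = (\<lambda>k (t :: hl_state). qv t 3 = (\<Sum>v<k. arr h 8 0 v * arr h 3 v (nv h 16)))"
  have n5: "nv (set_qv 3 0 h) 5 = N" using h by (simp add: instances_def)
  have "I (nv (set_qv 3 0 h) 5) (run combine_code h)"
    unfolding combine_code_def run.simps(4,11)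
  proof (rule ForLess_inv, goal_cases)
    case (7 k t)
    have f: "nv t 0 = 0" "nv t 16 = nv h 16" "arr t 8 = arr h 8" "arr t 3 = arr h 3"
      using 7(3) h by (auto simp: agree_def instances_def consts_ok_def)
    show ?case
      using 7(2,4) f unfolding I_def by simp
  qed (use assms n5 in \<open>auto simp: I_def\<close>)
  then show ?thesis unfolding n5 I_def .
qed

lemma row_code_correct:
  assumes h: "instances N A lab h" and "N \<le> B" "nv h 1 \<le> B"
    and coef: "\<And>v. v < N \<Longrightarrow> arr h 8 0 v = coef_of lab c e v" and z: "z < nv h 1"
  shows "arr (run row_code h) 9 0 z = xrow N lab (arr h 3) c e z"
    and "arr (run row_code h) 12 (nv h 25) z = xrow N lab (arr h 3) c e z"
    and "i \<noteq> nv h 25 \<Longrightarrow> arr (run row_code h) 12 i = arr h 12 i"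
proof -
  define I where "I = (\<lambda>k (t :: hl_state). (\<forall>z<k. arr t 9 0 z = xrow N lab (arr h 3) c e z \<and>
    arr t 12 (nv h 25) z = xrow N lab (arr h 3) c e z) \<and> (\<forall>i. i \<noteq> nv h 25 \<longrightarrow> arr t 12 i = arr h 12 i))"
  have "I (nv h 1) (run row_code h)"
    unfolding row_code_def
  proof (rule ForLess_inv, goal_cases)
    case (7 k t)
    have ht: "instances N A lab t" using 7(3) h by (auto simp: agree_def instances_def consts_ok_def)
    have f: "nv t 25 = nv h 25" "arr t 8 = arr h 8" "arr t 3 = arr h 3" "nv t 0 = 0"
      using 7(3) h by (auto simp: agree_def instances_def consts_ok_def)
    let ?t1 = "run combine_code t"
    have q: "qv ?t1 3 = xrow N lab (arr h 3) c e k"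
      using combine_code_correct[OF ht assms(2)] 7(2) f coef by (simp add: xrow_def)
    have "run (combine_code ;; Write 9 0 16 3 ;; Write 12 25 16 3) t
        = set_arr 12 (nv h 25) k (qv ?t1 3) (set_arr 9 0 k (qv ?t1 3) ?t1)"
      using f 7(2) by (simp add: run_nv)
    then show ?case
      using 7(4) q unfolding I_def by (auto simp: less_Suc_eq run_arr)
  qed (use assms in \<open>auto simp: I_def\<close>)
  then show "arr (run row_code h) 9 0 z = xrow N lab (arr h 3) c e z"
    "arr (run row_code h) 12 (nv h 25) z = xrow N lab (arr h 3) c e z"
    "i \<noteq> nv h 25 \<Longrightarrow> arr (run row_code h) 12 i = arr h 12 i"
    using z unfolding I_def by auto
qed

lemma reduce_code_correct:
  assumes "consts_ok h" "nv h 1 = n" "n \<le> B" "z < n"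
  shows "arr (run reduce_code h) 9 0 z = arr h 9 0 z - arr h 10 (nv h 16) z * qv h 1"
proof -
  define I where "I = (\<lambda>k (t :: hl_state). \<forall>z. arr t 9 0 z =
    (if z < k then arr h 9 0 z - arr h 10 (nv h 16) z * qv h 1 else arr h 9 0 z))"
  have "I (nv h 1) (run reduce_code h)"
    unfolding reduce_code_def
  proof (rule ForLess_inv, goal_cases)
    case (7 k t)
    have f: "nv t 0 = 0" "nv t 16 = nv h 16" "arr t 10 = arr h 10" "qv t 1 = qv h 1"
      using 7(3) assms(1) by (auto simp: agree_def consts_ok_def)
    show ?case using 7(2,4) f unfolding I_def by (auto simp: less_Suc_eq)
  qed (use assms in \<open>auto simp: I_def\<close>)
  then show ?thesis using assms(2,4) unfolding I_def by simp
qed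

lemma insert_code_correct:
  assumes "consts_ok h" "nv h 1 = n" "n \<le> B"
  shows "z < n \<Longrightarrow> arr (run insert_code h) 10 (nv h 16) z = arr h 9 0 z / qv h 1"
    and "i \<noteq> nv h 16 \<Longrightarrow> arr (run insert_code h) 10 i = arr h 10 i"
    and "arr (run insert_code h) 11 = (arr h 11)(0 := (arr h 11 0)(nv h 16 := 1))"
    and "nv (run insert_code h) 22 = 1"
proof -
  let ?c = "ForLess 17 1 (Read 3 9 0 17 ;; QArith Divide 3 3 1 ;; Write 10 16 17 3)"
  define I where "I = (\<lambda>k (t :: hl_state). (\<forall>z<k. arr t 10 (nv h 16) z = arr h 9 0 z / qv h 1) \<and>
    (\<forall>i. i \<noteq> nv h 16 \<longrightarrow> arr t 10 i = arr h 10 i))"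
  have I: "I (nv h 1) (run ?c h)"
  proof (rule ForLess_inv, goal_cases)
    case (7 k t)
    have f: "nv t 0 = 0" "nv t 16 = nv h 16" "arr t 9 = arr h 9" "qv t 1 = qv h 1"
      using 7(3) assms(1) by (auto simp: agree_def consts_ok_def)
    show ?case using 7(2,4) f unfolding I_def by (auto simp: less_Suc_eq)
  qed (use assms in \<open>auto simp: I_def\<close>)
  have r: "run insert_code h = set_nv 22 1 (set_arr 11 0 (nv h 16) 1 (run ?c h))"
    using assms(1) by (simp add: insert_code_def run_nv run_qv consts_ok_def)
  show "z < n \<Longrightarrow> arr (run insert_code h) 10 (nv h 16) z = arr h 9 0 z / qv h 1"
    "i \<noteq> nv h 16 \<Longrightarrow> arr (run insert_code h) 10 i = arr h 10 i"
    "arr (run insert_code h) 11 = (arr h 11)(0 := (arr h 11 0)(nv h 16 := 1))"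
    "nv (run insert_code h) 22 = 1"
    using I assms(2) unfolding r I_def by (auto simp: run_arr)
qed

text \<open>Elimination is described by solution sets. Before insertion (variable 22 is zero) only
  multiples of basis rows have been subtracted, so the row keeps its values on the solutions of the
  basis, and its first k entries are zero. After insertion the basis has absorbed the
  equation.\<close>

definition selecting :: "nat \<Rightarrow> hl_state \<Rightarrow> nat \<Rightarrow> hl_state \<Rightarrow> bool" where
  "selecting n h k t \<longleftrightarrow> flags 11 n t \<and> echelon (flagged 11 n t) (arr t 10) \<and>
    ((nv t 22 = 0 \<and> flagged 11 n t = flagged 11 n h \<and> arr t 10 = arr h 10 \<and> (\<forall>y<k. arr t 9 0 y = 0) \<and>
       (\<forall>w. solves n (flagged 11 n h) (arr h 10) w \<longrightarrow> dotp n (arr t 9 0) w = dotp n (arr h 9 0) w)) \<or>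
     (nv t 22 = 1 \<and> card (flagged 11 n t) = Suc (card (flagged 11 n h)) \<and>
       (\<forall>w. solves n (flagged 11 n t) (arr t 10) w \<longleftrightarrow>
          solves n (flagged 11 n h) (arr h 10) w \<and> dotp n (arr h 9 0) w = 0)))"

lemma pivot_code_correct:
  assumes t: "selecting n h k t" "consts_ok t" "nv t 1 = n" "n \<le> B" "nv t 16 = k" "k < n"
  shows "selecting n h (Suc k) (run pivot_code t)"
proof -
  let ?f = "arr t 9 0 k"
  let ?t1 = "set_qv 1 ?f t"
  have c: "nv t 0 = 0" "nv t 7 = 1" "qv t 10 = 0" "qv t 11 = 1" using t(2) by (auto simp: consts_ok_def)
  have same: "selecting n h k (set_qv x q t)" for x q
    using t(1) by (simp add: selecting_def flags_def flagged_def)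
  show ?thesis
  proof (cases "?f = 0 \<or> nv t 22 = 1")
    case True
    then have r: "run pivot_code t = ?t1" using c t(5) by (auto simp: pivot_code_def)
    show ?thesis
      using same[of 1 ?f] True unfolding r selecting_def by (auto simp: less_Suc_eq)
  next
    case False
    then have n22: "nv t 22 = 0" and nz: "?f \<noteq> 0" using t(1) by (auto simp: selecting_def)
    then have S: "flags 11 n t" "echelon (flagged 11 n t) (arr t 10)" "flagged 11 n t = flagged 11 n h"
      "arr t 10 = arr h 10" "\<forall>y<k. arr t 9 0 y = 0"
      "\<And>w. solves n (flagged 11 n h) (arr h 10) w \<Longrightarrow> dotp n (arr t 9 0) w = dotp n (arr h 9 0) w"
      using t(1) by (auto simp: selecting_def)
    let ?t2 = "set_qv 2 (arr t 11 0 k) ?t1"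
    have c2: "consts_ok ?t2" "nv ?t2 1 = n" "nv ?t2 16 = k" "qv ?t2 1 = ?f"
      using t by (simp_all add: consts_ok_def)
    have r: "run pivot_code t = (if k \<in> flagged 11 n t then run reduce_code ?t2 else run insert_code ?t2)"
      using c t(5,6) n22 nz by (simp add: pivot_code_def flagged_def)
    show ?thesis
    proof (cases "k \<in> flagged 11 n t")
      case True
      let ?t3 = "run reduce_code ?t2"
      have row: "arr ?t3 9 0 z = arr t 9 0 z - arr t 10 k z * ?f" if "z < n" for z
        using reduce_code_correct[OF c2(1,2) t(4) that] c2(3,4) by simp
      have fr: "arr ?t3 11 = arr t 11" "arr ?t3 10 = arr t 10" "nv ?t3 22 = 0"
        using n22 by (simp_all add: run_arr run_nv)
      have fl: "flagged 11 n ?t3 = flagged 11 n t" "flags 11 n ?t3 = flags 11 n t"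
        using fr(1) by (simp_all add: flagged_def flags_def)
      \<comment> \<open>The basis row has a 1 in column k and zeros before it, so entry k vanishes
        and the earlier zeros are kept.\<close>
      have "arr ?t3 9 0 y = 0" if "y < Suc k" for y
        using row[of y] S(2,5) True that t(6) unfolding echelon_def by (cases "y = k") auto
      moreover have "dotp n (arr ?t3 9 0) w = dotp n (arr h 9 0) w"
        if "solves n (flagged 11 n h) (arr h 10) w" for w
      proof -
        have "dotp n (arr ?t3 9 0) w = (\<Sum>z<n. of_rat (arr t 9 0 z) * w z - of_rat ?f * (of_rat (arr t 10 k z) * w z))"
          unfolding dotp_def
        proof (intro sum.cong refl)
          fix z assume "z \<in> {..<n}"
          then have zn: "z < n" by simp
          show "of_rat (arr ?t3 9 0 z) * w z = of_rat (arr t 9 0 z) * w z - of_rat ?f * (of_rat (arr t 10 k z) * w z)"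
            unfolding row[OF zn] of_rat_diff of_rat_mult by (simp only: algebra_simps)
        qed
        also have "\<dots> = dotp n (arr t 9 0) w - of_rat ?f * dotp n (arr t 10 k) w"
          by (simp add: dotp_def sum_subtractf sum_distrib_left)
        also have "dotp n (arr t 10 k) w = 0" using that True S(3,4) by (simp add: solves_def)
        finally show ?thesis using S(6)[OF that] by simp
      qed
      ultimately show ?thesis
        unfolding r if_P[OF True] selecting_def fl fr using S by simp
    next
      case False
      let ?t3 = "run insert_code ?t2"
      note ins = insert_code_correct[OF c2(1,2) t(4)]
      have row: "arr ?t3 10 k z = arr t 9 0 z / ?f" if "z < n" for z
        using ins(1)[of z] that c2(3,4) by simp
      have oth: "arr ?t3 10 i = arr t 10 i" if "i \<noteq> k" for i using ins(2)[of i] that c2(3) by simp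
      have a11: "arr ?t3 11 = (arr t 11)(0 := (arr t 11 0)(k := 1))" using ins(3) c2(3) by simp
      have fl: "flagged 11 n ?t3 = insert k (flagged 11 n t)" "flags 11 n ?t3"
        using a11 t(6) S(1) by (auto simp: flagged_def flags_def)
      have fin: "finite (flagged 11 n t)" by (simp add: flagged_def)
      have "echelon (flagged 11 n ?t3) (arr ?t3 10)"
        unfolding echelon_def fl
      proof (intro ballI conjI allI impI)
        fix z assume z: "z \<in> insert k (flagged 11 n t)"
        show "arr ?t3 10 z z = 1"
          using row[of k] oth[of z] S(2) z t(6) nz unfolding echelon_def by (cases "z = k") auto
        \<comment> \<open>For the new row this holds because everything before column k has already
          been reduced to zero.\<close>
        show "arr ?t3 10 z y = 0" if "y < z" for y
          using row[of y] oth[of z] S(2,5) z t(6) that unfolding echelon_def by (cases "z = k") auto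
      qed
      moreover have "card (flagged 11 n ?t3) = Suc (card (flagged 11 n h))"
        unfolding fl using False fin S(3) by simp
      moreover have "solves n (flagged 11 n ?t3) (arr ?t3 10) w \<longleftrightarrow>
          solves n (flagged 11 n h) (arr h 10) w \<and> dotp n (arr h 9 0) w = 0" for w
      proof -
        have "dotp n (arr ?t3 10 k) w = (\<Sum>z<n. of_rat (arr t 9 0 z) * w z / of_rat ?f)"
          unfolding dotp_def using row by (intro sum.cong) (auto simp: of_rat_divide)
        also have "\<dots> = dotp n (arr t 9 0) w / of_rat ?f" by (simp add: dotp_def sum_divide_distrib)
        finally have d: "dotp n (arr ?t3 10 k) w = 0 \<longleftrightarrow> dotp n (arr t 9 0) w = 0" using nz by simp
        have "(\<forall>z\<in>flagged 11 n t. dotp n (arr ?t3 10 z) w = 0) \<longleftrightarrow> (\<forall>z\<in>flagged 11 n t. dotp n (arr t 10 z) w = 0)"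
          using oth False by metis
        then have "solves n (flagged 11 n ?t3) (arr ?t3 10) w \<longleftrightarrow>
          dotp n (arr t 9 0) w = 0 \<and> solves n (flagged 11 n h) (arr h 10) w"
          unfolding fl solves_def using d S(3,4) by simp
        then show ?thesis using S(6)[of w] by auto
      qed
      ultimately show ?thesis
        unfolding r if_not_P[OF False] selecting_def using fl(2) ins(4) by simp
    qed
  qed
qed

lemma select_code_correct:
  assumes h: "consts_ok h" "nv h 1 = n" "n \<le> B" "flags 11 n h" "echelon (flagged 11 n h) (arr h 10)"
  defines "h' \<equiv> run select_code h"
  shows "flags 11 n h'" "echelon (flagged 11 n h') (arr h' 10)"
    and "solves n (flagged 11 n h') (arr h' 10) w \<longleftrightarrow>
      solves n (flagged 11 n h) (arr h 10) w \<and> dotp n (arr h 9 0) w = 0"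
    and "(nv h' 25 = nv h 25 \<and> card (flagged 11 n h') = card (flagged 11 n h) \<and>
        (\<forall>w. solves n (flagged 11 n h) (arr h 10) w \<longrightarrow> dotp n (arr h 9 0) w = 0)) \<or>
      (nv h' 25 = Suc (nv h 25) \<and> card (flagged 11 n h') = Suc (card (flagged 11 n h)))"
proof -
  let ?h1 = "set_nv 22 0 h"
  let ?h2 = "run (ForLess 16 1 pivot_code) ?h1"
  have n: "nv ?h1 1 = n" using h(2) by simp
  have "selecting n ?h1 (nv ?h1 1) ?h2"
  proof (rule ForLess_inv[where I = "selecting n ?h1"], goal_cases)
    case (5 k t v)
    then show ?case by (simp add: selecting_def flags_def flagged_def)
  next
    case 6
    show ?case using h(4,5) by (simp add: selecting_def flags_def flagged_def)
  next
    case (7 k t)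
    have "consts_ok t" "nv t 1 = n" using 7(3) h(1,2) by (simp_all add: agree_def consts_ok_def)
    then show ?case using pivot_code_correct[OF 7(4) _ _ h(3) 7(2)] 7(1) h(2) by simp
  qed (use h in auto)
  then have sel: "selecting n ?h1 n ?h2" unfolding n .
  have fl1: "flagged 11 n ?h1 = flagged 11 n h" by (simp add: flagged_def)
  have c: "nv ?h2 7 = 1" "nv ?h2 25 = nv h 25" using h(1) by (simp_all add: run_nv consts_ok_def)
  have h': "h' = (if nv ?h2 22 = 1 then set_nv 25 (Suc (nv h 25)) ?h2 else ?h2)"
    using c unfolding h'_def select_code_def by simp
  have fl: "flagged 11 n h' = flagged 11 n ?h2" "flags 11 n h' = flags 11 n ?h2" "arr h' = arr ?h2"
    unfolding h' by (simp_all add: flagged_def flags_def)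
  show "flags 11 n h'" "echelon (flagged 11 n h') (arr h' 10)"
    using sel unfolding fl selecting_def by blast+
  \<comment> \<open>A row that passes all columns without being inserted has become zero, so its
    equation follows from the basis.\<close>
  have zero: "dotp n (arr h 9 0) w = 0" if "nv ?h2 22 = 0" "solves n (flagged 11 n h) (arr h 10) w" for w
  proof -
    have "dotp n (arr ?h2 9 0) w = dotp n (arr h 9 0) w" "\<forall>y<n. arr ?h2 9 0 y = 0"
      using sel that unfolding selecting_def fl1 by auto
    then show ?thesis by (simp add: dotp_def)
  qed
  show "solves n (flagged 11 n h') (arr h' 10) w \<longleftrightarrow>
      solves n (flagged 11 n h) (arr h 10) w \<and> dotp n (arr h 9 0) w = 0"
    using sel zero[of w] unfolding fl selecting_def fl1 by auto
  show "(nv h' 25 = nv h 25 \<and> card (flagged 11 n h') = card (flagged 11 n h) \<and>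
        (\<forall>w. solves n (flagged 11 n h) (arr h 10) w \<longrightarrow> dotp n (arr h 9 0) w = 0)) \<or>
      (nv h' 25 = Suc (nv h 25) \<and> card (flagged 11 n h') = Suc (card (flagged 11 n h)))"
  proof (cases "nv ?h2 22 = 1")
    case True
    then have "nv h' 25 = Suc (nv h 25)" unfolding h' by simp
    moreover have "card (flagged 11 n h') = Suc (card (flagged 11 n h))"
      using sel True unfolding fl selecting_def fl1 by auto
    ultimately show ?thesis by blast
  next
    case False
    then have "nv ?h2 22 = 0" using sel unfolding selecting_def by blast
    moreover have "nv h' 25 = nv h 25" unfolding h' using False c by simp
    moreover have "card (flagged 11 n h') = card (flagged 11 n h)"
      using sel False unfolding fl selecting_def fl1 by auto
    ultimately show ?thesis using zero by blast
  qed
qed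

end

section \<open>Output of the selected equations, and the invariant of their collection\<close>

definition emit_row :: cmd where
  "emit_row = QOf 0 1 ;; emit 0 ;; ForLess 16 1 (QOf 0 16 ;; emit 0 ;; Read 0 12 11 16 ;; emit 0)"

definition emit_code :: cmd where
  "emit_code = NSet 9 0 ;; NAdd 10 2 0 ;; QOf 0 25 ;; emit 0 ;; ForLess 11 25 emit_row"

lemma written_emit_row [simp]:
  "written_nv emit_row = {9, 10, 16}" "written_qv emit_row = {0}" "written_arr emit_row = {}"
  by (auto simp: emit_row_def)

lemma written_emit_code [simp]:
  "written_nv emit_code = {9, 10, 11, 16}" "written_qv emit_code = {0}" "written_arr emit_code = {}"
  by (auto simp: emit_code_def)

text \<open>The echelon basis, the kept original rows and all equations read so far have the same
  solutions, and there are as many kept rows as basis rows, hence at most n. The last conjunct is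
  what preserves the kind of the coefficients.\<close>

definition collected ::
  "nat \<Rightarrow> nat \<Rightarrow> nat \<Rightarrow> (nat \<Rightarrow> nat) \<Rightarrow> (nat \<Rightarrow> nat \<Rightarrow> rat) \<Rightarrow> (nat \<Rightarrow> sparse_system) \<Rightarrow> nat \<Rightarrow> nat \<Rightarrow> hl_state \<Rightarrow> bool"
where
  "collected n N P lab rep E c e t \<longleftrightarrow> flags 11 n t \<and> echelon (flagged 11 n t) (arr t 10) \<and>
     nv t 25 = card (flagged 11 n t) \<and>
     (\<forall>w. solves n (flagged 11 n t) (arr t 10) w \<longleftrightarrow>
        (\<forall>c'<c. \<forall>eq\<in>set (E c'). dotp n (xrow N lab rep c' eq) w = 0) \<and>
        (\<forall>i<e. dotp n (xrow N lab rep c (E c ! i)) w = 0)) \<and>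
     (\<forall>w. (\<forall>i<nv t 25. dotp n (arr t 12 i) w = 0) \<longleftrightarrow> solves n (flagged 11 n t) (arr t 10) w) \<and>
     (\<forall>i<nv t 25. \<exists>c'<P. \<exists>eq\<in>set (E c'). \<forall>z<n. arr t 12 i z = xrow N lab rep c' eq z)"

definition emitted :: "nat \<Rightarrow> rat list \<Rightarrow> hl_state \<Rightarrow> bool" where
  "emitted d out t \<longleftrightarrow> consts_ok t \<and> at_cell d (length out) t \<and> (\<forall>a<length out. raw t (slot d a) = out ! a)"

definition row_entries :: "(nat \<Rightarrow> rat) \<Rightarrow> nat \<Rightarrow> rat list" where
  "row_entries r k = concat (map (\<lambda>z. [of_nat z, r z]) [0..<k])"

definition rows_output :: "nat \<Rightarrow> (nat \<Rightarrow> nat \<Rightarrow> rat) \<Rightarrow> nat \<Rightarrow> rat list" where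
  "rows_output n r k = concat (map (\<lambda>i. of_nat n # row_entries (r i) n) [0..<k])"

lemma length_row_entries [simp]: "length (row_entries r k) = 2 * k"
  by (induction k) (simp_all add: row_entries_def)

lemma length_rows_output [simp]: "length (rows_output n r k) = k * (1 + 2 * n)"
  by (induction k) (simp_all add: rows_output_def)

lemma row_entries_Suc: "row_entries r (Suc k) = (row_entries r k @ [of_nat k]) @ [r k]"
  by (simp add: row_entries_def)

lemma rows_output_Suc: "rows_output n r (Suc k) = (rows_output n r k @ [of_nat n]) @ row_entries (r k) n"
  by (simp add: rows_output_def)

text \<open>Zero coefficients are listed too, which the sparse form permits; all equations then have
  the same length, and output positions are easy to count.\<close>

definition dense_system :: "nat \<Rightarrow> (nat \<Rightarrow> nat \<Rightarrow> rat) \<Rightarrow> nat \<Rightarrow> sparse_system" where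
  "dense_system n r k = map (\<lambda>i. map (\<lambda>z. (z, r i z)) [0..<n]) [0..<k]"

lemma encode_dense: "encode_system (dense_system n r k) = of_nat k # rows_output n r k"
  by (simp add: encode_system_def dense_system_def rows_output_def row_entries_def o_def)

context machine
begin

lemma eq_code_correct:
  assumes h: "instances N A lab h" and N: "N \<le> B" and n: "nv h 1 = n" "n \<le> B"
    and c: "nv h 3 = c" "nv h 24 = offset (E c) e" "e < length (E c)" "c < P"
    and rank: "\<And>v. v < N \<Longrightarrow> arr h 7 0 v = of_nat (rank lab v)"
    and mem: "memory_starts_with (arr h 0 c) (encode_system (E c))"
    and len: "length (E c ! e) \<le> B"
    and col: "collected n N P lab (arr h 3) E c e h"
  shows "collected n N P lab (arr h 3) E c (Suc e) (run eq_code h)"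
    and "nv (run eq_code h) 24 = offset (E c) (Suc e)"
proof -
  let ?e = "E c ! e"
  let ?r = "xrow N lab (arr h 3) c ?e"
  let ?h1 = "run parse_code h"
  let ?h2 = "run row_code ?h1"
  let ?h3 = "run select_code ?h2"
  let ?F = "flagged 11 n h"
  have r: "run eq_code h = ?h3" by (simp add: eq_code_def)
  note m = memory_system[OF mem]
  have parse: "arr ?h1 8 0 v = coef_of lab c ?e v" if "v < N" for v
    using parse_code_correct(1)[OF h N c(1,2) rank m(2)[OF c(3)] m(3)[OF c(3)] m(4)[OF c(3)] len that] by simp
  have pos: "nv ?h1 24 = offset (E c) e + 1 + 2 * length ?e"
    using parse_code_correct(2)[OF h N c(1,2) rank m(2)[OF c(3)] m(3)[OF c(3)] m(4)[OF c(3)] len] by simp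
  have h1: "instances N A lab ?h1" using instances_run[OF h] by simp
  have h2: "instances N A lab ?h2" using instances_run[OF h1] by simp
  have n1: "nv ?h1 1 \<le> B" "nv ?h1 1 = n" "arr ?h1 3 = arr h 3" "nv ?h1 25 = nv h 25" "arr ?h1 12 = arr h 12"
    using n by (simp_all add: run_nv run_arr)
  have row: "arr ?h2 9 0 z = ?r z" "arr ?h2 12 (nv h 25) z = ?r z" if "z < n" for z
    using row_code_correct(1,2)[OF h1 N n1(1) parse, of z] that n1 by simp_all
  \<comment> \<open>The frame part of \<open>row_code_correct\<close> is available only if there is
    a column; for n = 0 every \<open>dotp\<close> is zero anyway.\<close>
  have row': "arr ?h2 12 i = arr h 12 i" if "i \<noteq> nv h 25" "0 < n" for i
    using row_code_correct(3)[OF h1 N n1(1) parse, of 0 i] that n1 by simp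
  have s2: "consts_ok ?h2" "nv ?h2 1 = n" "flags 11 n ?h2" "flagged 11 n ?h2 = ?F" "arr ?h2 10 = arr h 10"
    "nv ?h2 25 = nv h 25"
    using h2 n1 col by (simp_all add: instances_def run_nv run_arr flags_def flagged_def collected_def)
  have ech: "echelon (flagged 11 n ?h2) (arr ?h2 10)" using col s2 by (simp add: collected_def)
  have dr: "dotp n (arr ?h2 9 0) w = dotp n ?r w" for w by (rule dotp_cong) (simp add: row)
  note sel = select_code_correct[OF s2(1,2) n(2) s2(3) ech, unfolded s2(4-6) dr]
  have a12: "arr ?h3 12 = arr ?h2 12" by (simp add: run_arr)
  let ?S = "solves n ?F (arr h 10)" and ?S' = "solves n (flagged 11 n ?h3) (arr ?h3 10)"
  have old: "\<And>w. ?S w \<longleftrightarrow>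
        (\<forall>c'<c. \<forall>eq\<in>set (E c'). dotp n (xrow N lab (arr h 3) c' eq) w = 0) \<and>
        (\<forall>i<e. dotp n (xrow N lab (arr h 3) c (E c ! i)) w = 0)"
    "\<And>w. (\<forall>i<nv h 25. dotp n (arr h 12 i) w = 0) \<longleftrightarrow> ?S w"
    "\<And>i. i < nv h 25 \<Longrightarrow> \<exists>c'<P. \<exists>eq\<in>set (E c'). \<forall>z<n. arr h 12 i z = xrow N lab (arr h 3) c' eq z"
    "nv h 25 = card ?F"
    using col unfolding collected_def by blast+
  have S': "?S' w \<longleftrightarrow> ?S w \<and> dotp n ?r w = 0" for w by (rule sel(3))
  have lt: "(\<forall>i<Suc k. Q i) \<longleftrightarrow> (\<forall>i<k. Q i) \<and> Q k" for k :: nat and Q by (auto simp: less_Suc_eq)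
  have keep: "dotp n (arr ?h3 12 i) w = dotp n (arr h 12 i) w" if "i < nv h 25" for i w
    using row'[of i] that a12 by (cases "n = 0") (auto simp: dotp_def)
  have keep': "arr ?h3 12 i z = arr h 12 i z" if "i < nv h 25" "z < n" for i z
    using row'[of i] that a12 by simp
  have new: "dotp n (arr ?h3 12 (nv h 25)) w = dotp n ?r w" for w
    unfolding a12 by (rule dotp_cong) (simp add: row)
  have new': "arr ?h3 12 (nv h 25) z = ?r z" if "z < n" for z unfolding a12 by (rule row(2)[OF that])
  have sol: "?S' w \<longleftrightarrow>
        (\<forall>c'<c. \<forall>eq\<in>set (E c'). dotp n (xrow N lab (arr h 3) c' eq) w = 0) \<and>
        (\<forall>i<Suc e. dotp n (xrow N lab (arr h 3) c (E c ! i)) w = 0)" for w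
    unfolding S' old(1) lt by blast
  have cases: "(nv ?h3 25 = nv h 25 \<and> card (flagged 11 n ?h3) = card ?F \<and> (\<forall>w. ?S w \<longrightarrow> dotp n ?r w = 0)) \<or>
      (nv ?h3 25 = Suc (nv h 25) \<and> card (flagged 11 n ?h3) = Suc (card ?F))" by (rule sel(4))
  have cnt: "nv ?h3 25 = card (flagged 11 n ?h3)" using cases old(4) by auto
  have rows: "(\<forall>i<nv ?h3 25. dotp n (arr ?h3 12 i) w = 0) \<longleftrightarrow> ?S' w" for w
  proof (cases "nv ?h3 25 = nv h 25")
    case True
    then have "(\<forall>w. ?S w \<longrightarrow> dotp n ?r w = 0)" using cases by auto
    then have "?S' w \<longleftrightarrow> ?S w" using S' by blast
    then show ?thesis unfolding True using keep old(2)[of w] by simp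
  next
    case False
    then have e: "nv ?h3 25 = Suc (nv h 25)" using cases by auto
    show ?thesis unfolding e lt S' old(2)[symmetric] new using keep by simp
  qed
  have orig: "\<exists>c'<P. \<exists>eq\<in>set (E c'). \<forall>z<n. arr ?h3 12 i z = xrow N lab (arr h 3) c' eq z" if i: "i < nv ?h3 25" for i
  proof (cases "i < nv h 25")
    case True
    obtain c' eq where "c' < P" "eq \<in> set (E c')" "\<forall>z<n. arr h 12 i z = xrow N lab (arr h 3) c' eq z"
      using old(3)[OF True] by blast
    then show ?thesis using keep'[OF True] by (intro exI[of _ c'] conjI bexI[of _ eq]) simp_all
  next
    case False
    then have "i = nv h 25" using i cases by auto
    then show ?thesis using new' c(3,4) by (intro exI[of _ c] conjI bexI[of _ ?e]) simp_all
  qed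
  show "collected n N P lab (arr h 3) E c (Suc e) (run eq_code h)"
    unfolding r collected_def using sel(1,2) cnt sol rows orig by blast
  show "nv (run eq_code h) 24 = offset (E c) (Suc e)"
    unfolding r using pos by (simp add: run_nv offset_def)
qed

lemma collected_next:
  assumes "collected n N P lab rep E c (length (E c)) t"
  shows "collected n N P lab rep E (Suc c) 0 t"
proof -
  have X: "((\<forall>c'<Suc c. \<forall>eq\<in>set (E c'). dotp n (xrow N lab rep c' eq) w = 0) \<and>
        (\<forall>i<0. dotp n (xrow N lab rep (Suc c) (E (Suc c) ! i)) w = 0)) \<longleftrightarrow>
      (\<forall>c'<c. \<forall>eq\<in>set (E c'). dotp n (xrow N lab rep c' eq) w = 0) \<and>
        (\<forall>i<length (E c). dotp n (xrow N lab rep c (E c ! i)) w = 0)" for w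
    unfolding all_set_conv_all_nth by (auto simp: less_Suc_eq)
  show ?thesis using assms unfolding collected_def X .
qed

lemma collected_cong:
  assumes "arr t 10 = arr t' 10" "arr t 11 = arr t' 11" "arr t 12 = arr t' 12" "nv t 25 = nv t' 25"
  shows "collected n N P lab rep E c e t = collected n N P lab rep E c e t'"
  using assms by (simp add: collected_def flags_def flagged_def)

text \<open>The rounds are bounded by the number of equations read plus the number of pieces left
  behind, since the end of a piece takes a round of its own.\<close>

definition row_state ::
  "nat \<Rightarrow> nat \<Rightarrow> nat \<Rightarrow> (nat \<Rightarrow> nat) \<Rightarrow> (nat \<Rightarrow> nat \<Rightarrow> rat) \<Rightarrow> (nat \<Rightarrow> sparse_system) \<Rightarrow> nat \<Rightarrow> nat \<Rightarrow> nat \<Rightarrow> hl_state \<Rightarrow> bool"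
where
  "row_state n N P lab rep E k c e t \<longleftrightarrow> nv t 3 = c \<and> nv t 23 = e \<and> c \<le> P \<and>
     (c < P \<longrightarrow> e \<le> length (E c) \<and> nv t 24 = offset (E c) e) \<and> (c = P \<longrightarrow> e = 0) \<and>
     (k \<le> (\<Sum>c'<c. length (E c') + 1) + e \<or> c = P) \<and> collected n N P lab rep E c e t"

lemma row_state_cong:
  assumes "row_state n N P lab rep E k c e t" "arr t 10 = arr t' 10" "arr t 11 = arr t' 11" "arr t 12 = arr t' 12"
    "nv t 25 = nv t' 25" "nv t 3 = nv t' 3" "nv t 23 = nv t' 23" "nv t 24 = nv t' 24"
  shows "row_state n N P lab rep E k c e t'"
  using assms collected_cong[OF assms(2-5)] by (simp add: row_state_def)

theorem rows_code_correct:
  assumes h: "instances N A lab h" and N: "N \<le> B" and n: "nv h 1 = n" "n \<le> B" and P: "nv h 4 = P"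
    and rank: "\<And>v. v < N \<Longrightarrow> arr h 7 0 v = of_nat (rank lab v)"
    and mem: "\<And>c. c < P \<Longrightarrow> memory_starts_with (arr h 0 c) (encode_system (E c))"
    and len: "\<And>c e. c < P \<Longrightarrow> e \<in> set (E c) \<Longrightarrow> length e \<le> B"
    and steps: "(\<Sum>c<P. length (E c) + 1) \<le> B"
    and zero: "arr h 11 = (\<lambda>_ _. 0)"
  shows "collected n N P lab (arr h 3) E P 0 (run rows_code h)"
proof -
  let ?h = "set_nv 25 0 (set_nv 24 1 (set_nv 23 0 (set_nv 3 0 h)))"
  define I where "I = (\<lambda>k t. \<exists>c e. row_state n N P lab (arr h 3) E k c e t)"
  have r: "run rows_code h = run (For 26 (only_if (NLess 3 4) eq_step)) ?h"
    by (simp add: rows_code_def)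
  have "flagged 11 n ?h = {}" using zero by (simp add: flagged_def)
  then have "collected n N P lab (arr h 3) E 0 0 ?h"
    using zero by (simp add: collected_def flags_def echelon_def solves_def)
  then have init: "I 0 ?h" unfolding I_def row_state_def
    by (intro exI[of _ 0]) (simp add: offset_def)
  have "I B (run (For 26 (only_if (NLess 3 4) eq_step)) ?h)"
  proof (rule For_inv, goal_cases)
    case (2 k t v)
    then obtain c e where "row_state n N P lab (arr h 3) E k c e t" unfolding I_def by blast
    then have "row_state n N P lab (arr h 3) E k c e (set_nv 26 v t)" by (rule row_state_cong) simp_all
    then show ?case unfolding I_def by blast
  next
    case (4 k t)
    obtain c e where st: "row_state n N P lab (arr h 3) E k c e t" using 4(4) unfolding I_def by blast
    have t: "instances N A lab t" "nv t 1 = n" "nv t 4 = P" "arr t 0 = arr h 0" "arr t 7 = arr h 7" "arr t 3 = arr h 3"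
      "nv t 0 = 0" "nv t 7 = 1"
      using 4(3) h n P by (auto simp: agree_def instances_def consts_ok_def)
    have c: "nv t 3 = c" "nv t 23 = e" "c \<le> P" using st by (auto simp: row_state_def)
    show ?case
    proof (cases "c < P")
      case False
      then have "run (only_if (NLess 3 4) eq_step) t = t" using c t(3) by simp
      moreover have "row_state n N P lab (arr h 3) E (Suc k) c e t"
        using st False unfolding row_state_def by auto
      ultimately show ?thesis unfolding I_def by metis
    next
      case True
      have s: "e \<le> length (E c)" "nv t 24 = offset (E c) e" "k \<le> (\<Sum>c'<c. length (E c') + 1) + e"
        "collected n N P lab (arr h 3) E c e t"
        using st True unfolding row_state_def by auto
      let ?t1 = "set_qv 5 (of_nat e) (set_qv 4 (of_nat (length (E c))) t)"
      have "arr t 0 c 0 = of_nat (length (E c))" using memory_system(1)[OF mem[OF True]] t(4) by simp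
      then have r1: "run (only_if (NLess 3 4) eq_step) t =
          (if e < length (E c) then set_nv 23 (Suc e) (run eq_code ?t1)
           else set_nv 24 1 (set_nv 23 0 (set_nv 3 (Suc c) ?t1)))"
        using c t True by (simp add: eq_step_def run_nv)
      have t1: "instances N A lab ?t1" using t(1) by (simp add: instances_def consts_ok_def)
      have col1: "collected n N P lab (arr ?t1 3) E c e ?t1"
        using s(4) t(6) collected_cong[of ?t1 t] by simp
      show ?thesis
      proof (cases "e < length (E c)")
        case less: True
        have le: "length (E c ! e) \<le> B" using len[OF True] less by simp
        have m1: "memory_starts_with (arr ?t1 0 c) (encode_system (E c))" using mem[OF True] t(4) by simp
        have rk: "arr ?t1 7 0 v = of_nat (rank lab v)" if "v < N" for v using rank[OF that] t(5) by simp
        have pre: "nv ?t1 1 = n" "nv ?t1 3 = c" "nv ?t1 24 = offset (E c) e" using t c s by simp_all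
        note ec = eq_code_correct[OF t1 N pre(1) n(2) pre(2,3) less True rk m1 le col1]
        let ?t2 = "set_nv 23 (Suc e) (run eq_code ?t1)"
        have "collected n N P lab (arr h 3) E c (Suc e) ?t2"
          using ec(1) t(6) collected_cong[of ?t2 "run eq_code ?t1"] by simp
        then have "row_state n N P lab (arr h 3) E (Suc k) c (Suc e) ?t2"
          unfolding row_state_def using ec(2) s(3) c True less by (simp add: run_nv)
        then show ?thesis unfolding r1 if_P[OF less] I_def by blast
      next
        case False
        then have e: "e = length (E c)" using s(1) by simp
        let ?t2 = "set_nv 24 1 (set_nv 23 0 (set_nv 3 (Suc c) ?t1))"
        have "collected n N P lab (arr h 3) E (Suc c) 0 ?t1"
          using collected_next col1 t(6) unfolding e by simp
        then have "collected n N P lab (arr h 3) E (Suc c) 0 ?t2"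
          using collected_cong[of ?t2 ?t1] by simp
        then have "row_state n N P lab (arr h 3) E (Suc k) (Suc c) 0 ?t2"
          unfolding row_state_def using s(3) True e by (simp add: offset_def)
        then show ?thesis unfolding r1 if_not_P[OF False] I_def by blast
      qed
    qed
  qed (use init in auto)
  then obtain c e where st: "row_state n N P lab (arr h 3) E B c e (run rows_code h)"
    unfolding r I_def by blast
  \<comment> \<open>An unfinished piece has consumed less than its share
    \<open>length (E c) + 1\<close>, which contradicts the bound on the total.\<close>
  have "c = P"
  proof (rule ccontr)
    assume "c \<noteq> P"
    then have c: "c < P" "e \<le> length (E c)" "B \<le> (\<Sum>c'<c. length (E c') + 1) + e"
      using st by (auto simp: row_state_def)
    have "(\<Sum>c'<Suc c. length (E c') + 1) \<le> (\<Sum>c'<P. length (E c') + 1)"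
      using c(1) by (intro sum_mono2) auto
    then show False using c(2,3) steps by simp
  qed
  then show ?thesis using st by (auto simp: row_state_def)
qed

text \<open>Different positions have different slots, so earlier output is not overwritten.\<close>

lemma emit_emitted:
  assumes e: "emitted d out t" and d: "reg_count \<le> d" "D = d * 2 ^ reg_count" and l: "length out < d"
  shows "emitted d (out @ [qv t x]) (run (emit x) t)"
proof -
  have c: "consts_ok t" "at_cell d (length out) t" using e by (auto simp: emitted_def)
  note em = emit_correct[OF c d(1) l d(2), of x]
  have "consts_ok (run (emit x) t)" using c(1) by (simp add: consts_ok_def run_nv run_qv)
  moreover have "raw (run (emit x) t) (slot d a) = (out @ [qv t x]) ! a" if a: "a < Suc (length out)" for a
  proof (cases "a = length out")
    case True
    then show ?thesis unfolding em(1) by simp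
  next
    case False
    then have "a < length out" using a by simp
    moreover from this have "slot d a \<noteq> slot d (length out)" using slot_inject[of a d "length out"] l by auto
    ultimately show ?thesis using e unfolding em(1) by (simp add: nth_append emitted_def)
  qed
  ultimately show ?thesis using em(2) by (simp add: emitted_def)
qed

lemma emitted_set: "emitted d out (set_qv 0 q t) = emitted d out t"
  "x \<notin> {0, 7, 8, 9, 10} \<Longrightarrow> emitted d out (set_nv x v t) = emitted d out t"
  by (simp_all add: emitted_def consts_ok_def at_cell_def)

lemma emit_row_correct:
  assumes e: "emitted d out t" and d: "reg_count \<le> d" "D = d * 2 ^ reg_count"
    and n: "nv t 1 = n" "n \<le> B" and l: "length out + 1 + 2 * n \<le> d"
  shows "emitted d ((out @ [of_nat n]) @ row_entries (arr t 12 (nv t 11)) n) (run emit_row t)"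
proof -
  let ?r = "arr t 12 (nv t 11)"
  let ?t1 = "run (emit 0) (set_qv 0 (of_nat n) t)"
  have "emitted d out (set_qv 0 (of_nat n) t)" using e by (simp add: emitted_set)
  then have e1: "emitted d (out @ [of_nat n]) ?t1"
    using emit_emitted[OF _ d, of out "set_qv 0 (of_nat n) t" 0] l by simp
  have n1: "nv ?t1 1 = n" using n by (simp add: run_nv)
  define I where "I = (\<lambda>k. emitted d ((out @ [of_nat n]) @ row_entries ?r k))"
  let ?c = "QOf 0 16 ;; emit 0 ;; Read 0 12 11 16 ;; emit 0"
  have "I (nv ?t1 1) (run (ForLess 16 1 ?c) ?t1)"
  proof (rule ForLess_inv, goal_cases)
    case (5 k t' v)
    then show ?case unfolding I_def by (simp add: emitted_set)
  next
    case 6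
    then show ?case using e1 unfolding I_def by (simp add: row_entries_def)
  next
    case (7 k t')
    have kn: "k < n" using 7(1) n1 by simp
    have f: "nv t' 11 = nv t 11" "arr t' 12 = arr t 12"
      using 7(3) by (auto simp: agree_def run_nv run_arr)
    let ?o = "(out @ [of_nat n]) @ row_entries ?r k"
    let ?t2 = "run (emit 0) (set_qv 0 (of_nat k) t')"
    have "emitted d (?o @ [of_nat k]) ?t2"
      using emit_emitted[OF _ d, of ?o "set_qv 0 (of_nat k) t'" 0] 7(4) l kn unfolding I_def by (simp add: emitted_set)
    then have "emitted d (?o @ [of_nat k]) (set_qv 0 (?r k) ?t2)" by (simp only: emitted_set)
    then have "emitted d ((?o @ [of_nat k]) @ [?r k]) (run (emit 0) (set_qv 0 (?r k) ?t2))"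
      using emit_emitted[OF _ d, of "?o @ [of_nat k]" "set_qv 0 (?r k) ?t2" 0] l kn by simp
    moreover have "run ?c t' = run (emit 0) (set_qv 0 (?r k) ?t2)"
      using f 7(2) by (simp add: run_nv run_arr)
    ultimately show ?case unfolding I_def row_entries_Suc by simp
  qed (use n n1 in auto)
  moreover have "run emit_row t = run (ForLess 16 1 ?c) ?t1"
    unfolding emit_row_def using n(1) by simp
  ultimately show ?thesis unfolding I_def n1 by simp
qed

theorem emit_code_correct:
  assumes h: "consts_ok h" "nv h 2 = d" and d: "reg_count \<le> d" "D = d * 2 ^ reg_count"
    and n: "nv h 1 = n" "n \<le> B" and r: "nv h 25 = r" "r \<le> B" and l: "1 + r * (1 + 2 * n) \<le> d"
  shows "emitted d (encode_system (dense_system n (arr h 12) r)) (run emit_code h)"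
proof -
  let ?h1 = "set_qv 0 (of_nat r) (set_nv 10 d (set_nv 9 0 h))"
  let ?h2 = "run (emit 0) ?h1"
  have z: "nv h 0 = 0" using h(1) by (simp add: consts_ok_def)
  have "emitted d [] ?h1" using h by (simp add: emitted_def consts_ok_def at_cell_def)
  moreover have "0 < d" using d(1) by (simp add: reg_count_def)
  ultimately have e2: "emitted d [of_nat r] ?h2"
    using emit_emitted[OF _ d, of "[]" ?h1 0] by simp
  have n2: "nv ?h2 25 = r" using r by (simp add: run_nv)
  define I where "I = (\<lambda>k. emitted d (of_nat r # rows_output n (arr h 12) k))"
  have "I (nv ?h2 25) (run (ForLess 11 25 emit_row) ?h2)"
  proof (rule ForLess_inv, goal_cases)
    case (5 k t v)
    then show ?case unfolding I_def by (simp add: emitted_set)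
  next
    case 6
    then show ?case using e2 unfolding I_def by (simp add: rows_output_def)
  next
    case (7 k t)
    have kr: "Suc k \<le> r" using 7(1) n2 by simp
    have f: "nv t 1 = n" "arr t 12 = arr h 12"
      using 7(3) n by (auto simp: agree_def run_nv run_arr)
    have "Suc k * (1 + 2 * n) \<le> r * (1 + 2 * n)" using kr by (rule mult_le_mono1)
    then have "length (of_nat r # rows_output n (arr h 12) k) + 1 + 2 * n \<le> d" using l by simp
    from emit_row_correct[OF 7(4)[unfolded I_def] d f(1) n(2) this]
    show ?case unfolding I_def rows_output_Suc f 7(2) by simp
  qed (use r n2 in auto)
  moreover have "run emit_code h = run (ForLess 11 25 emit_row) ?h2"
    unfolding emit_code_def using h(2) r(1) z by simp
  ultimately show ?thesis unfolding I_def n2 encode_dense by simp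
qed

end

section \<open>Meaning of the substituted equations, and sums of superadditive functions\<close>

subsection \<open>Systems of the pieces\<close>

definition piece_graph :: "'a ugraph \<Rightarrow> nat \<Rightarrow> (nat \<Rightarrow> 'a) \<Rightarrow> (nat \<Rightarrow> nat) \<Rightarrow> nat \<Rightarrow> 'a ugraph" where
  "piece_graph G N f lab c = induced G (f ` members N lab c)"

text \<open>In the presentation of the piece, the vertex \<open>f v\<close> has the number
  \<open>rank lab v\<close> and no other, so the coefficient denoted at this vertex is the one
  collected for the instance v.\<close>

lemma denoted_piece:
  assumes inj: "inj_on f (members N lab c)" and e: "fst ` set e \<subseteq> {..<length (plist N lab c)}"
    and v: "v \<in> members N lab c"
  shows "(\<Sum>(i, q) \<leftarrow> e. if map f (plist N lab c) ! i = f v then of_rat q else 0) = (of_rat (coef_of lab c e v) :: real)"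
proof -
  have vl: "v < N" "lab v = c" using v by (auto simp: members_def)
  have "map f (plist N lab c) ! i = f v \<longleftrightarrow> i = rank lab v" if "i < length (plist N lab c)" for i
  proof -
    have "plist N lab c ! i \<in> members N lab c" using nth_mem[OF that] set_plist by metis
    then have "f (plist N lab c ! i) = f v \<longleftrightarrow> plist N lab c ! i = v" using inj v by (meson inj_onD)
    also have "\<dots> \<longleftrightarrow> i = rank lab v"
      using rank_plist[OF that] plist_rank(2)[of v N lab c] vl by metis
    finally show ?thesis using that by simp
  qed
  then have "(\<Sum>(i, q) \<leftarrow> e. if map f (plist N lab c) ! i = f v then of_rat q else 0) =
      (\<Sum>(i, q) \<leftarrow> e. if i = rank lab v then of_rat q else 0 :: real)"
    using e by (intro arg_cong[where f = sum_list] map_cong refl) auto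
  also have "\<dots> = of_rat (\<Sum>(i, q) \<leftarrow> e. if i = rank lab v then q else 0)"
    by (induction e) (auto simp: of_rat_add)
  finally show ?thesis using vl(2) by (simp add: coef_of_def)
qed

lemma dotp_xrow:
  "dotp (length vs) (xrow N lab rep c e) (\<lambda>z. w (vs ! z)) =
     (\<Sum>v\<in>members N lab c. of_rat (coef_of lab c e v) * expanded vs rep w v)"
proof -
  have "dotp (length vs) (xrow N lab rep c e) (\<lambda>z. w (vs ! z)) =
      (\<Sum>z<length vs. \<Sum>v<N. of_rat (coef_of lab c e v) * (of_rat (rep v z) * w (vs ! z)))"
    unfolding dotp_def xrow_def by (intro sum.cong) (auto simp: of_rat_sum of_rat_mult sum_distrib_right mult.assoc)
  also have "\<dots> = (\<Sum>v<N. of_rat (coef_of lab c e v) * expanded vs rep w v)"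
    unfolding expanded_def sum_distrib_left by (rule sum.swap)
  also have "\<dots> = (\<Sum>v\<in>members N lab c. of_rat (coef_of lab c e v) * expanded vs rep w v)"
    by (intro sum.mono_neutral_right) (auto simp: members_def coef_of_def)
  finally show ?thesis .
qed

lemma piece_system:
  assumes G: "simple_graph G" and inj: "inj_on f (members N lab c)"
    and sp: "sparse_for (length (plist N lab c)) E"
    and sys: "well_covering_system (piece_graph G N f lab c) (denoted_system (map f (plist N lab c)) E)"
  shows "wc (inst_adj G f) (members N lab c) (expanded vs rep w) \<longleftrightarrow>
    (\<forall>eq\<in>set E. dotp (length vs) (xrow N lab rep c eq) (\<lambda>z. w (vs ! z)) = 0)"
proof -
  let ?X = "members N lab c"
  \<comment> \<open>Weights of instances become weights of vertices through the inverse of f on this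
    piece.\<close>
  define W where "W = (\<lambda>x. expanded vs rep w (the_inv_into ?X f x))"
  have W: "W (f v) = expanded vs rep w v" if "v \<in> ?X" for v
    using that inj by (simp add: W_def the_inv_into_f_f)
  have "wc (inst_adj G f) ?X (expanded vs rep w) \<longleftrightarrow> wc (inst_adj G f) ?X (\<lambda>v. W (f v))"
    by (rule wc_cong) (simp_all add: W)
  also have "\<dots> \<longleftrightarrow> well_covered_weighting (piece_graph G N f lab c) W"
    unfolding piece_graph_def wc_induced[OF G] wc_image[OF inj] inst_adj_def ..
  also have "\<dots> \<longleftrightarrow> (\<forall>a\<in>set (denoted_system (map f (plist N lab c)) E). (\<Sum>x\<in>f ` ?X. a x * W x) = 0)"
    using sys by (simp add: well_covering_system_def piece_graph_def)
  also have "\<dots> \<longleftrightarrow> (\<forall>eq\<in>set E. dotp (length vs) (xrow N lab rep c eq) (\<lambda>z. w (vs ! z)) = 0)"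
  proof -
    have "(\<Sum>x\<in>f ` ?X. (\<Sum>(i, q) \<leftarrow> eq. if map f (plist N lab c) ! i = x then of_rat q else 0) * W x) =
        dotp (length vs) (xrow N lab rep c eq) (\<lambda>z. w (vs ! z))" if "eq \<in> set E" for eq
    proof -
      have "fst ` set eq \<subseteq> {..<length (plist N lab c)}" using sp that by (simp add: sparse_for_def)
      from denoted_piece[OF inj this] show ?thesis
        unfolding dotp_xrow sum.reindex[OF inj] o_def by (intro sum.cong refl) (simp add: W)
    qed
    then show ?thesis unfolding denoted_system_def set_map ball_simps by simp
  qed
  finally show ?thesis .
qed

text \<open>The whole set is the only maximal independent set.\<close>

lemma edgeless_wc:
  assumes "\<And>x y. x \<in> X \<Longrightarrow> y \<in> X \<Longrightarrow> \<not> A x y"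
  shows "wc A X w"
proof -
  have "I = X" if "mis A X I" for I using that assms unfolding mis_def by blast
  then show ?thesis unfolding wc_def by metis
qed

text \<open>If no expansion in the piece contains z, the value is zero; otherwise a single summand
  survives, and its second factor is 1.\<close>

lemma xrow_value:
  assumes dec: "decomp G vs N P f lab rep" and z: "z < length vs"
  shows "xrow N lab rep c e z = 0 \<or> (\<exists>v\<in>members N lab c. xrow N lab rep c e z = coef_of lab c e v)"
proof (cases "\<exists>v\<in>members N lab c. rep v z = 1")
  case True
  then obtain v where v: "v \<in> members N lab c" "rep v z = 1" by blast
  have "coef_of lab c e x * rep x z = 0" if "x \<in> {..<N} - {v}" for x
  proof (cases "lab x = c")
    case True
    then have "rep v z * rep x z = 0" using decompD(7)[OF dec, of v x z] v that z by (auto simp: members_def)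
    then show ?thesis using v by simp
  qed (simp add: coef_of_def)
  then have "(\<Sum>x\<in>{..<N} - {v}. coef_of lab c e x * rep x z) = 0" by (rule sum.neutral[OF ballI])
  then have "xrow N lab rep c e z = coef_of lab c e v * rep v z"
    unfolding xrow_def using v(1) by (simp add: sum.remove[of "{..<N}" v] members_def)
  then show ?thesis using v by auto
next
  case False
  have "coef_of lab c e x * rep x z = 0" if "x \<in> {..<N}" for x
  proof (cases "lab x = c")
    case True
    then have "rep x z = 0" using decompD(6)[OF dec, of x z] False that z by (auto simp: members_def)
    then show ?thesis by simp
  qed (simp add: coef_of_def)
  then have "(\<Sum>x<N. coef_of lab c e x * rep x z) = 0" by (rule sum.neutral[OF ballI])
  then show ?thesis by (simp add: xrow_def)
qed

lemma length_plist: "length (plist N lab c) = card (members N lab c)"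
  using distinct_card[OF distinct_plist, of N lab c] by (simp add: set_plist)

lemma sum_card_members:
  assumes "decomp G vs N P f lab rep"
  shows "(\<Sum>c<P. card (members N lab c)) = N"
proof -
  have "(\<Sum>c<P. card (members N lab c)) = card (\<Union>c<P. members N lab c)"
    by (subst card_UN_disjoint) (auto simp: members_def)
  also have "(\<Union>c<P. members N lab c) = {..<N}"
    using decompD(1)[OF assms] by (auto simp: members_def)
  finally show ?thesis by simp
qed

text \<open>The difference of the arguments has a nonnegative value, so superadditivity implies
  monotonicity.\<close>

lemma superadditive_mono:
  assumes "superadditive f" "\<forall>x\<ge>0. \<forall>y\<ge>0. 0 \<le> f x y" "0 \<le> x" "x \<le> x'" "0 \<le> y" "y \<le> y'"
  shows "f x y \<le> f x' y'"
proof -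
  have "f x y + f (x' - x) (y' - y) \<le> f (x + (x' - x)) (y + (y' - y))"
    using assms unfolding superadditive_def by (metis diff_ge_0_iff_ge)
  moreover have "0 \<le> f (x' - x) (y' - y)" using assms by simp
  ultimately show ?thesis by simp
qed

lemma superadditive_sum:
  assumes "superadditive f" "\<forall>x\<ge>0. \<forall>y\<ge>0. 0 \<le> f x y" "finite C"
    "\<And>c. c \<in> C \<Longrightarrow> 0 \<le> a c" "\<And>c. c \<in> C \<Longrightarrow> 0 \<le> b c"
  shows "(\<Sum>c\<in>C. f (a c) (b c)) \<le> f (\<Sum>c\<in>C. a c) (\<Sum>c\<in>C. b c)"
  using assms(3-5)
proof (induction C rule: finite_induct)
  case empty
  then show ?case using assms(2) by simp
next
  case (insert c C)
  have nn: "0 \<le> sum a C" "0 \<le> sum b C" using insert by (auto intro!: sum_nonneg)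
  have "(\<Sum>c\<in>insert c C. f (a c) (b c)) \<le> f (a c) (b c) + f (sum a C) (sum b C)"
    using insert by simp
  also have "\<dots> \<le> f (a c + sum a C) (b c + sum b C)"
    using assms(1) nn insert.prems unfolding superadditive_def by simp
  finally show ?case using insert by simp
qed

text \<open>Treats the three kinds at once: each of them confines the coefficients to a set of reals
  that contains zero.\<close>

lemma kind_values:
  assumes "kind \<in> {rational_system, integer_system, unit_system}"
  obtains K :: "real set" where "0 \<in> K" "\<And>(G :: 'a ugraph) S. kind G S \<longleftrightarrow> (\<forall>a\<in>set S. \<forall>v\<in>verts G. a v \<in> K)"
proof -
  consider "kind = rational_system" | "kind = integer_system" | "kind = unit_system" using assms by blast
  then show ?thesis
  proof cases
    case 1
    show ?thesis by (rule that[of \<rat>]) (simp_all add: 1 rational_system_def)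
  next
    case 2
    show ?thesis by (rule that[of \<int>]) (simp_all add: 2 integer_system_def)
  next
    case 3
    show ?thesis by (rule that[of "{-1, 0, 1}"]) (simp_all add: 3 unit_system_def)
  qed
qed

lemma length_pair_list:
  assumes "simple_graph G" "inj_on f (members N lab c)"
  shows "length (pair_list (inst_adj G f) lab c N) = card (edges (piece_graph G N f lab c))"
proof -
  have "presents (map f (plist N lab c)) (rank_pairs lab (pair_list (inst_adj G f) lab c N)) (piece_graph G N f lab c)"
    unfolding piece_graph_def by (rule presents_piece[OF assms]) (simp add: inst_adj_def)
  then show ?thesis
    unfolding presents_def by (metis distinct_card length_map rank_pairs_def)
qed

definition piece_result ::
  "'a ugraph \<Rightarrow> 'a list \<Rightarrow> nat \<Rightarrow> (nat \<Rightarrow> 'a) \<Rightarrow> (nat \<Rightarrow> nat) \<Rightarrow> (nat \<Rightarrow> nat \<Rightarrow> rat) \<Rightarrow> real set \<Rightarrow> nat \<Rightarrow> sparse_system \<Rightarrow> bool"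
where
  "piece_result G vs N f lab rep K c E \<longleftrightarrow>
     (\<forall>w. wc (inst_adj G f) (members N lab c) (expanded vs rep w) \<longleftrightarrow>
        (\<forall>eq\<in>set E. dotp (length vs) (xrow N lab rep c eq) (\<lambda>z. w (vs ! z)) = 0)) \<and>
     (\<forall>eq\<in>set E. \<forall>v\<in>members N lab c. of_rat (coef_of lab c eq v) \<in> K) \<and>
     length E \<le> card (members N lab c) \<and> (\<forall>eq\<in>set E. length eq \<le> card (members N lab c))"

text \<open>With an edge, the piece is a prime induced subgraph to which the hypothesis applies.
  Without edges every weighting is well covered, the result is the empty system and the run counts
  as zero steps.\<close>

lemma piece_run:
  fixes G :: "'a ugraph" and g :: "real \<Rightarrow> real \<Rightarrow> real"
  assumes G: "simple_graph G" "G \<in> \<G>" and dec: "decomp G vs N P f lab rep" and c: "c < P"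
    and triv: "\<forall>v<N. only_trivial_modules_at (inst_adj G f) (members N lab (lab v)) v"
    and K: "0 \<in> K" "\<And>(G :: 'a ugraph) S. kind G S \<longleftrightarrow> (\<forall>a\<in>set S. \<forall>v\<in>verts G. a v \<in> K)"
    and p: "computes_well_covering_systems p {G \<in> prime_induced_subgraphs \<G>. 1 \<le> card (edges G)} kind
           (\<lambda>n m. g (real n) (real m))"
    and g: "\<forall>x\<ge>0. \<forall>y\<ge>0. 0 \<le> g x y"
  shows "\<exists>t \<mu> E. call_result p (piece_memory N (inst_adj G f) lab c) t \<mu> \<and>
    real t \<le> g (card (members N lab c)) (card (edges (piece_graph G N f lab c))) \<and>
    memory_starts_with \<mu> (encode_system E) \<and> piece_result G vs N f lab rep K c E"
proof -
  let ?X = "members N lab c" and ?H = "piece_graph G N f lab c"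
  let ?vs = "map f (plist N lab c)" and ?es = "rank_pairs lab (pair_list (inst_adj G f) lab c N)"
  have inj: "inj_on f ?X" by (rule decompD(2)[OF dec c])
  have fX: "f ` ?X \<subseteq> verts G" using decompD(1)[OF dec] by (auto simp: members_def)
  have m1: "piece_memory N (inst_adj G f) lab c 1 = of_nat (card (edges ?H))"
    unfolding piece_memory_1 length_pair_list[OF G(1) inj] ..
  have gn: "0 \<le> g (card ?X) (card (edges ?H))" using g by simp
  show ?thesis
  proof (cases "card (edges ?H) = 0")
    case True
    then have "pair_list (inst_adj G f) lab c N = []" using length_pair_list[OF G(1) inj] by simp
    then have none: "{(v, x). x < v \<and> v < N \<and> lab v = c \<and> lab x = c \<and> inst_adj G f v x} = {}"
      using set_pair_list[of "inst_adj G f" lab c N] by simp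
    have nadj: "\<not> inst_adj G f x y" if "x \<in> ?X" "y \<in> ?X" for x y
    proof
      assume a: "inst_adj G f x y"
      then have "inst_adj G f y x" using adjacent_sym by (simp add: inst_adj_def)
      moreover have "x \<noteq> y" using a adjacent_irrefl[OF G(1)] by (auto simp: inst_adj_def)
      ultimately show False using none that a by (auto simp: members_def dest: linorder_neqE_nat)
    qed
    have "wc (inst_adj G f) ?X W" for W by (rule edgeless_wc) (rule nadj)
    then have "piece_result G vs N f lab rep K c []"
      by (simp add: piece_result_def)
    moreover have "call_result p (piece_memory N (inst_adj G f) lab c) 0
        ((piece_memory N (inst_adj G f) lab c)(0 := 0))"
      using m1 True by (simp add: call_result_def)
    moreover have "memory_starts_with ((piece_memory N (inst_adj G f) lab c)(0 := 0)) (encode_system [])"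
      by (simp add: memory_starts_with_def encode_system_def)
    ultimately show ?thesis using gn by (intro exI conjI) auto
  next
    case False
    have "prime_graph ?H"
      unfolding piece_graph_def
    proof (rule prime_graph_induced[OF fX])
      fix x assume "x \<in> f ` ?X"
      then obtain v where v: "v \<in> ?X" "x = f v" by blast
      then have "only_trivial_modules_at (\<lambda>x y. adjacent G (f x) (f y)) ?X v"
        using triv by (auto simp: members_def inst_adj_def[abs_def])
      then show "only_trivial_modules_at (adjacent G) (f ` ?X) x"
        using only_trivial_modules_at_image[OF inj] v by blast
    qed
    moreover have "induced_subgraph ?H G" unfolding piece_graph_def by (rule induced_subgraph_induced[OF fX])
    ultimately have H: "?H \<in> {G \<in> prime_induced_subgraphs \<G>. 1 \<le> card (edges G)}"
      using False G(2) by (auto simp: prime_induced_subgraphs_def)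
    have pres: "presents ?vs ?es ?H"
      unfolding piece_graph_def by (rule presents_piece[OF G(1) inj]) (simp add: inst_adj_def)
    have verts: "verts ?H = f ` ?X" by (simp add: piece_graph_def)
    have cX: "card (verts ?H) = card ?X" unfolding verts by (rule card_image[OF inj])
    obtain t \<mu> E where r: "exec p (initial_memory (encode_graph ?vs ?es)) t \<mu>"
      "real t \<le> g (real (card ?X)) (real (card (edges ?H)))" "sparse_for (card ?X) E"
      "memory_starts_with \<mu> (encode_system E)" "well_covering_system ?H (denoted_system ?vs E)"
      "kind ?H (denoted_system ?vs E)" "length (denoted_system ?vs E) \<le> card ?X"
      using p[unfolded computes_well_covering_systems_def, THEN bspec, OF H, THEN spec, THEN spec, THEN mp, OF pres]
      unfolding cX by blast
    have sp: "sparse_for (length (plist N lab c)) E" using r(3) by (simp add: length_plist)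
    have "of_rat (coef_of lab c eq v) \<in> K" if "eq \<in> set E" "v \<in> ?X" for eq v
    proof -
      have "fst ` set eq \<subseteq> {..<length (plist N lab c)}" using sp that by (simp add: sparse_for_def)
      from denoted_piece[OF inj this that(2)] show ?thesis
        using r(6) that unfolding K(2) verts denoted_system_def set_map ball_simps by (metis imageI)
    qed
    moreover have "length eq \<le> card ?X" if "eq \<in> set E" for eq
    proof -
      have d: "distinct (map fst eq)" "fst ` set eq \<subseteq> {..<card ?X}" using r(3) that by (auto simp: sparse_for_def)
      have "length eq = card (fst ` set eq)" using distinct_card[OF d(1)] by simp
      also have "\<dots> \<le> card {..<card ?X}" using d(2) by (intro card_mono) auto
      finally show ?thesis by simp
    qed
    moreover have "length E \<le> card ?X" using r(7) by (simp add: denoted_system_def)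
    ultimately have "piece_result G vs N f lab rep K c E"
      unfolding piece_result_def using piece_system[OF G(1) inj sp r(5)] by blast
    moreover have "piece_memory N (inst_adj G f) lab c = initial_memory (encode_graph ?vs ?es)"
      by (rule piece_memory_eq)
    then have "call_result p (piece_memory N (inst_adj G f) lab c) t \<mu>"
      using m1 False r(1) by (simp add: call_result_def)
    ultimately show ?thesis using r(2,4) by blast
  qed
qed

lemma dense_sparse: "sparse_for n (dense_system n r k)"
  by (auto simp: sparse_for_def dense_system_def o_def)

lemma denoted_dense:
  assumes "distinct vs"
  shows "denoted_system vs (dense_system (length vs) r k) =
    map (\<lambda>i v. \<Sum>z<length vs. if vs ! z = v then of_rat (r i z) else 0) [0..<k]"
  unfolding denoted_system_def dense_system_def map_map
  by (intro map_cong refl) (auto simp: o_def fun_eq_iff sum_list_distinct_conv_sum_set atLeast0LessThan)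

lemma dense_row_value:
  assumes "distinct vs" "z < length vs"
  shows "(\<Sum>y<length vs. if vs ! y = vs ! z then of_rat (r y) else 0) = (of_rat (r z) :: real)"
proof -
  have "(\<Sum>y<length vs. if vs ! y = vs ! z then of_rat (r y) else 0) =
      (\<Sum>y<length vs. if z = y then of_rat (r y) else 0 :: real)"
    using assms by (intro sum.cong) (auto simp: nth_eq_iff_index_eq)
  then show ?thesis using assms(2) by simp
qed

lemma dense_row_dotp:
  assumes "distinct vs"
  shows "(\<Sum>v\<in>set vs. (\<Sum>z<length vs. if vs ! z = v then of_rat (r z) else 0) * w v) =
    dotp (length vs) r (\<lambda>z. w (vs ! z))"
proof -
  have "set vs = (!) vs ` {..<length vs}" by (auto simp: set_conv_nth image_def)
  moreover have "inj_on ((!) vs) {..<length vs}" using assms by (simp add: inj_on_nth)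
  ultimately have "(\<Sum>v\<in>set vs. (\<Sum>z<length vs. if vs ! z = v then of_rat (r z) else 0) * w v) =
      (\<Sum>z<length vs. (\<Sum>y<length vs. if vs ! y = vs ! z then of_rat (r y) else 0) * w (vs ! z))"
    by (simp add: sum.reindex)
  then show ?thesis
    unfolding dotp_def using dense_row_value[OF assms] by simp
qed

section \<open>Assembly of the phases and the total running time\<close>

subsection \<open>The complete program\<close>

definition phase1 :: cmd where
  "phase1 = init_code ;; read_code ;; rep_init ;; decompose_code ;; build_code"

text \<open>The correctness statement of \<open>calls\<close> makes no promise about rational
  variables, so the constants 0 and 1 are restored first.\<close>

definition phase3 :: cmd where
  "phase3 = QSet 10 0 ;; QSet 11 1 ;; rows_code ;; emit_code"

definition main_program :: "program \<Rightarrow> program" where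
  "main_program p = Seq prologue (Seq (compile phase1) (Seq (calls p) (Seq (compile phase3) epilogue)))"

text \<open>Cells 2 and 3 contain the different ends of the first edge if there is one, and zero otherwise.\<close>

definition full_program :: "program \<Rightarrow> program" where
  "full_program p = Branch (Equal 2 3) (Const 0 0) (main_program p)"

text \<open>The depth three of both phases is what makes the overhead cubic.\<close>

lemma phase1_ok: "cmd_ok phase1" "depth phase1 = 3"
  by (simp_all add: phase1_def init_code_def read_code_def read_edge_def next_in_def find_code_def rep_init_def
      decompose_code_def step_code_def find_module_def choose_code_def reach_code_def clear_code_def
      pick_code_def spread_code_def edge_rd_def full_code_def complement_code_def any_code_def
      split_code_def greedy_code_def conflict_code_def expand_code_def sum_code_def copy_code_def
      relabel_code_def build_code_def build_piece_def number_code_def edges_code_def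
      edge_row_code_def edge_out_def)

lemma phase3_ok: "cmd_ok phase3" "depth phase3 = 3"
  by (simp_all add: phase3_def rows_code_def eq_step_def eq_code_def parse_code_def entry_code_def
      add_coef_def row_code_def combine_code_def select_code_def pivot_code_def reduce_code_def
      insert_code_def emit_code_def emit_row_def emit_def)

text \<open>The factor 125 comes from (4 n + 1)^3 \<le> 125 n^3 for the two compiled phases. The
  rest covers 500 steps each for prologue and epilogue, 40 steps per piece for the calls, and a
  small remainder.\<close>

definition time_factor :: nat where
  "time_factor = 125 * (cost phase1 + cost phase3) + 1050"

lemma input_cells:
  fixes vs :: "'a list" and es :: "(nat \<times> nat) list"
  defines "s0 \<equiv> initial_memory (encode_graph vs es)"
  shows "s0 0 = of_nat (length vs)" "s0 1 = of_nat (length es)"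
    and "q < length es \<Longrightarrow> s0 (2 + 2 * q) = of_nat (fst (es ! q))"
    and "q < length es \<Longrightarrow> s0 (3 + 2 * q) = of_nat (snd (es ! q))"
    and "2 * length es + 2 \<le> a \<Longrightarrow> s0 a = 0"
proof -
  have len: "length (encode_graph vs es) = 2 + 2 * length es"
    by (simp add: encode_graph_def length_concat_pairs)
  show "s0 0 = of_nat (length vs)" "s0 1 = of_nat (length es)"
    by (simp_all add: s0_def initial_memory_def encode_graph_def)
  show "q < length es \<Longrightarrow> s0 (2 + 2 * q) = of_nat (fst (es ! q))"
    using pairs_nth(1)[of q es of_nat of_nat] len by (simp add: s0_def initial_memory_def encode_graph_def)
  show "q < length es \<Longrightarrow> s0 (3 + 2 * q) = of_nat (snd (es ! q))"
    using pairs_nth(2)[of q es of_nat of_nat] len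
    by (simp add: s0_def initial_memory_def encode_graph_def eval_nat_numeral)
  show "2 * length es + 2 \<le> a \<Longrightarrow> s0 a = 0" using len by (simp add: s0_def initial_memory_def)
qed

lemma presentation:
  assumes G: "simple_graph G" and pr: "presents vs es G"
  shows "distinct vs" "set vs = verts G" "card (verts G) = length vs" "card (edges G) = length es"
    and "\<forall>(i, j) \<in> set es. i < length vs \<and> j < length vs \<and> i \<noteq> j"
    and "length es \<le> length vs * length vs"
    and "i < length vs \<Longrightarrow> j < length vs \<Longrightarrow>
      adjacent G (vs ! i) (vs ! j) \<longleftrightarrow> (\<exists>q < length es. es ! q = (i, j) \<or> es ! q = (j, i))"
proof -
  let ?g = "\<lambda>(i, j). {vs ! i, vs ! j}"
  have p: "distinct vs" "set vs = verts G" "\<forall>(i, j) \<in> set es. i < length vs \<and> j < length vs"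
    "distinct (map ?g es)" "?g ` set es = edges G"
    using pr by (auto simp: presents_def)
  show "distinct vs" "set vs = verts G" by (fact p)+
  show "card (verts G) = length vs" using distinct_card[OF p(1)] p(2) by simp
  show "card (edges G) = length es" using distinct_card[OF p(4)] p(5) by simp
  have "i \<noteq> j" if "(i, j) \<in> set es" for i j
  proof
    assume "i = j"
    then have "{vs ! i} \<in> edges G" using that p(5) by force
    then show False using G by (auto simp: simple_graph_def nsets_def)
  qed
  then show "\<forall>(i, j) \<in> set es. i < length vs \<and> j < length vs \<and> i \<noteq> j" using p(3) by fastforce
  have "distinct es" using p(4) by (simp add: distinct_map)
  then have "length es = card (set es)" by (simp add: distinct_card)
  also have "\<dots> \<le> card ({..<length vs} \<times> {..<length vs})" using p(3) by (intro card_mono) auto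
  finally show "length es \<le> length vs * length vs" by simp
  show "adjacent G (vs ! i) (vs ! j) \<longleftrightarrow> (\<exists>q < length es. es ! q = (i, j) \<or> es ! q = (j, i))"
    if ij: "i < length vs" "j < length vs"
  proof
    assume "adjacent G (vs ! i) (vs ! j)"
    then have "{vs ! i, vs ! j} \<in> ?g ` set es" using p(5) by (simp add: adjacent_def)
    then obtain a b where ab: "(a, b) \<in> set es" "{vs ! i, vs ! j} = {vs ! a, vs ! b}" by auto
    then have "a < length vs" "b < length vs" using p(3) by auto
    then have "(i = a \<and> j = b) \<or> (i = b \<and> j = a)"
      using ab(2) ij p(1) by (auto simp: doubleton_eq_iff nth_eq_iff_index_eq)
    moreover obtain q where "q < length es" "es ! q = (a, b)" using ab(1) by (metis in_set_conv_nth)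
    ultimately show "\<exists>q < length es. es ! q = (i, j) \<or> es ! q = (j, i)" by auto
  next
    assume "\<exists>q < length es. es ! q = (i, j) \<or> es ! q = (j, i)"
    then have "(i, j) \<in> set es \<or> (j, i) \<in> set es" by (metis nth_mem)
    then have "{vs ! i, vs ! j} \<in> edges G" using p(5) by (force simp: insert_commute)
    then show "adjacent G (vs ! i) (vs ! j)" by (simp add: adjacent_def)
  qed
qed

lemma main_program_correct:
  fixes G :: "'a ugraph" and g :: "real \<Rightarrow> real \<Rightarrow> real"
  assumes G: "simple_graph G" "G \<in> \<G>" and pr: "presents vs es G" and ne: "es \<noteq> []"
    and K: "0 \<in> K" "\<And>(G :: 'a ugraph) S. kind G S \<longleftrightarrow> (\<forall>a\<in>set S. \<forall>v\<in>verts G. a v \<in> K)"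
    and p: "computes_well_covering_systems p {G \<in> prime_induced_subgraphs \<G>. 1 \<le> card (edges G)} kind
           (\<lambda>n m. g (real n) (real m))"
    and g: "\<forall>x\<ge>0. \<forall>y\<ge>0. 0 \<le> g x y" "superadditive g"
  shows "\<exists>t s E. exec (main_program p) (initial_memory (encode_graph vs es)) t s \<and>
    real t \<le> 60 * g (2 * real (length vs)) (real (length es)) + real time_factor * real (length vs) ^ 3 \<and>
    sparse_for (length vs) E \<and> memory_starts_with s (encode_system E) \<and>
    well_covering_system G (denoted_system vs E) \<and> kind G (denoted_system vs E) \<and>
    length (denoted_system vs E) \<le> length vs"
proof -
  define n where "n = length vs"
  define m where "m = length es"
  define B where "B = 4 * n"
  define d where "d = m * n * n * 2 ^ reg_count"
  define D where "D = d * 2 ^ reg_count"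
  let ?s0 = "initial_memory (encode_graph vs es)"
  note P = presentation[OF G(1) pr]
  have es: "\<forall>(i, j) \<in> set es. i < B \<and> j < B \<and> i \<noteq> j" using P(5) unfolding B_def n_def by fastforce
  obtain i j where "(i, j) \<in> set es" using ne by (cases es) auto
  then have "i < n" "j < n" "i \<noteq> j" using P(5) by (auto simp: n_def)
  then have n2: "2 \<le> n" by simp
  have m1: "1 \<le> m" using ne by (cases es) (auto simp: m_def)
  have mn: "m \<le> n * n" using P(6) by (simp add: m_def n_def)
  note I = input_cells[where vs = vs and es = es, folded m_def n_def]
  have n1: "1 \<le> n" using n2 by simp
  have s0: "?s0 0 = of_nat n" "?s0 1 = of_nat m" "\<And>a. 2 * m + 2 \<le> a \<Longrightarrow> ?s0 a = 0"
    by (rule I(1), rule I(2), rule I(5))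
  note pro = prologue_correct[OF s0 n1 m1 d_def, folded D_def B_def]
  interpret machine B D by (rule pro(1))
  have "2 ^ reg_count * (1 * (n * n)) \<le> 2 ^ reg_count * (m * (n * n))"
    using m1 by (intro mult_le_mono) auto
  then have dnn: "2 ^ reg_count * (n * n) \<le> d" by (simp add: d_def algebra_simps)
  \<comment> \<open>The factor \<open>2 ^ reg_count\<close> makes \<open>d\<close> exceed the
    roughly 32 n^2 cells visited while reading and the roughly 2 n^2 cells of the output, so both
    stay clear of the slots.\<close>
  have big: "1000 * (n * n) \<le> d"
  proof -
    have "1000 * (n * n) \<le> 2 ^ reg_count * (n * n)" by (intro mult_le_mono1) (simp add: reg_count_def)
    then show ?thesis using dnn by linarith
  qed
  have nn: "n \<le> n * n" "1 \<le> n * n" using n1 by auto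
  have dR: "reg_count \<le> d" unfolding reg_count_def using big nn(2) by linarith
  have dm: "2 * m + 2 \<le> d" using big mn nn(2) by linarith
  have "B * B = 16 * (n * n)" by (simp add: B_def)
  then have dB: "3 + 2 * (B * B) < d" using big nn(2) by linarith
  obtain t1 s1 where s1: "exec prologue ?s0 t1 s1" "t1 \<le> 500"
    "rel \<lparr>nv = (\<lambda>_. 0)(1 := n, 2 := d), qv = \<lambda>_. 0, arr = \<lambda>_ _ _. 0, raw = s1\<rparr> s1"
    "\<And>a. 2 \<le> a \<Longrightarrow> a < d \<Longrightarrow> s1 (slot d a) = ?s0 a"
    using pro(2) by blast
  define h0 where "h0 = \<lparr>nv = (\<lambda>_. 0)(1 := n, 2 := d), qv = \<lambda>_. 0, arr = \<lambda>_ _ _. 0, raw = s1\<rparr>"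
  define h1 where "h1 = run init_code h0"
  define h2 where "h2 = run read_code h1"
  define h3 where "h3 = run rep_init h2"
  define h4 where "h4 = run decompose_code h3"
  define h5 where "h5 = run build_code h4"
  have h5: "run phase1 h0 = h5"
    unfolding h5_def h4_def h3_def h2_def h1_def by (simp add: phase1_def)
  have f1: "consts_ok h1" "nv h1 1 = n" "nv h1 2 = d" "at_cell d 2 h1" "nv h1 5 = n" "nv h1 4 = 1" "nv h1 6 = 0"
    "arr h1 = (\<lambda>_ _ _. 0)" "raw h1 = s1"
    by (auto simp: h1_def h0_def init_code_def consts_ok_def at_cell_def reg_count_def fun_eq_iff)
  have "reading d es 0 h1" using f1 by (simp add: reading_def edge_adj_def)
  then have read: "reading d es (B * B) h2"
    unfolding h2_def
  proof (rule read_code_correct[OF _ dR D_def dB es])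
    fix q assume q: "q < length es"
    then have qm: "q < m" by (simp add: m_def)
    then have "2 + 2 * q < d" "3 + 2 * q < d" using dm by simp_all
    then show "raw h1 (slot d (2 + 2 * q)) = of_nat (fst (es ! q))"
      "raw h1 (slot d (3 + 2 * q)) = of_nat (snd (es ! q))"
      unfolding f1(9) I(3)[OF qm, symmetric] I(4)[OF qm, symmetric] by (intro s1(4); simp)+
  next
    fix a assume "2 + 2 * length es \<le> a" "a < d"
    then show "raw h1 (slot d a) = 0" using s1(4)[of a] s0(3)[of a] f1(9) unfolding m_def by simp
  qed
  have f2: "nv h2 1 = n" "nv h2 2 = d" "nv h2 5 = n" "nv h2 4 = 1" "nv h2 6 = 0" "consts_ok h2"
    "\<And>k. k \<noteq> 1 \<Longrightarrow> arr h2 k = (\<lambda>_ _. 0)"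
    using f1 read by (auto simp: h2_def run_nv run_arr reading_def)
  have rep3: "arr h3 3 = (\<lambda>v z. if v = z \<and> v < n then 1 else 0)"
    unfolding h3_def using rep_init_correct[of h2] f2 by (simp add: B_def consts_ok_def)
  have f3: "nv h3 1 = n" "nv h3 2 = d" "nv h3 5 = n" "nv h3 4 = 1" "nv h3 6 = 0" "consts_ok h3"
    "arr h3 1 = arr h2 1" "\<And>k. k \<noteq> 1 \<Longrightarrow> k \<noteq> 3 \<Longrightarrow> arr h3 k = (\<lambda>_ _. 0)"
    using f2 by (auto simp: h3_def run_nv run_arr run_qv consts_ok_def)
  have mB: "length es \<le> B * B" using mn by (simp add: m_def B_def)
  have adj3: "arr h3 1 i j = of_bool (inst_adj G ((!) vs) i j)" if "i < n" "j < n" for i j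
  proof -
    have "(\<exists>q < B * B. q < length es \<and> (es ! q = (i, j) \<or> es ! q = (j, i))) \<longleftrightarrow> adjacent G (vs ! i) (vs ! j)"
      using P(7)[of i j] that mB unfolding n_def by (meson less_le_trans)
    then show ?thesis using read f3(7) by (simp add: reading_def edge_adj_def inst_adj_def)
  qed
  have dec0: "decomp G vs n 1 ((!) vs) (\<lambda>_. 0) (arr h3 3)"
    unfolding n_def by (rule decomp_init[OF G(1) P(1,2)]) (use n2 rep3 in \<open>auto simp: n_def\<close>)
  have "instances n (inst_adj G ((!) vs)) (\<lambda>_. 0) h3"
    using f3 adj3 by (simp add: instances_def)
  then have "decomposing G vs 0 h3"
    unfolding decomposing_def using dec0 f3
    by (intro conjI exI[of _ n] exI[of _ 1] exI[of _ "(!) vs"] exI[of _ "\<lambda>_. 0"]) (simp_all add: n_def)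
  then obtain N Q f lab where t4: "decomp G vs N Q f lab (arr h4 3)" "instances N (inst_adj G f) lab h4"
    "nv h4 4 = Q" "\<forall>v<N. only_trivial_modules_at (inst_adj G f) (members N lab (lab v)) v"
    using decomposed[OF G(1), of vs h3] unfolding h4_def B_def n_def by blast
  let ?rep = "arr h4 3"
  have bounds: "2 * Q \<le> N" "Q + 1 \<le> n" "N + 2 \<le> 2 * n" using decomp_bounds[OF t4(1)] by (simp_all add: n_def)
  have NB: "N \<le> B" "Q \<le> B" "n \<le> B" "N + Q \<le> B" using bounds by (simp_all add: B_def)
  have labQ: "\<forall>v<N. lab v < Q" using decompD(1)[OF t4(1)] by blast
  have z4: "arr h4 0 = (\<lambda>_ _. 0)" "arr h4 11 = (\<lambda>_ _. 0)" "nv h4 1 = n" "nv h4 2 = d"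
    using f3 by (simp_all add: h4_def run_arr run_nv)
  have h5i: "instances N (inst_adj G f) lab h5" unfolding h5_def by (rule instances_run[OF t4(2)]) auto
  have f5: "nv h5 4 = Q" "nv h5 1 = n" "nv h5 2 = d" "arr h5 3 = ?rep" "arr h5 11 = (\<lambda>_ _. 0)"
    using t4(3) z4 by (simp_all add: h5_def run_nv run_arr)
  have mem5: "arr h5 0 c = piece_memory N (inst_adj G f) lab c" if "c < Q" for c
    unfolding h5_def by (rule build_code_correct(1)[OF t4(2) NB(1) t4(3) NB(2) z4(1) labQ that])
  have rank5: "arr h5 7 0 v = of_nat (rank lab v)" if "v < N" for v
    unfolding h5_def by (rule build_code_correct(2)[OF t4(2) NB(1) t4(3) NB(2) z4(1) labQ that])
  obtain t2 s2 where s2: "exec (compile phase1) s1 t2 s2" "rel h5 s2" "t2 \<le> cost phase1 * (B + 1) ^ 3"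
    using compile_correct[OF phase1_ok(1) s1(3)[folded h0_def]] unfolding h5 phase1_ok(2) by blast
  have "\<forall>c\<in>{..<Q}. \<exists>r. case r of (t, \<mu>, E) \<Rightarrow>
      call_result p (piece_memory N (inst_adj G f) lab c) t \<mu> \<and>
      real t \<le> g (card (members N lab c)) (card (edges (piece_graph G N f lab c))) \<and>
      memory_starts_with \<mu> (encode_system E) \<and> piece_result G vs N f lab ?rep K c E"
    using piece_run[OF G t4(1) _ t4(4) K p g(1)] by fastforce
  from bchoice[OF this] obtain r where r: "\<forall>c\<in>{..<Q}. case r c of (t, \<mu>, E) \<Rightarrow>
      call_result p (piece_memory N (inst_adj G f) lab c) t \<mu> \<and>
      real t \<le> g (card (members N lab c)) (card (edges (piece_graph G N f lab c))) \<and>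
      memory_starts_with \<mu> (encode_system E) \<and> piece_result G vs N f lab ?rep K c E" by blast
  define T where "T c = fst (r c)" for c
  define \<mu> where "\<mu> c = fst (snd (r c))" for c
  define E where "E c = snd (snd (r c))" for c
  have R: "call_result p (piece_memory N (inst_adj G f) lab c) (T c) (\<mu> c)"
    "real (T c) \<le> g (card (members N lab c)) (card (edges (piece_graph G N f lab c)))"
    "memory_starts_with (\<mu> c) (encode_system (E c))" "piece_result G vs N f lab ?rep K c (E c)"
    if "c < Q" for c
    using bspec[OF r, of c] that by (simp_all add: T_def \<mu>_def E_def split_beta)
  have "call_result p (arr h5 0 c) (T c) (\<mu> c)" if "c < nv h5 4" for c
    using R(1) mem5 that f5(1) by simp
  from calls_correct[OF this s2(2)] obtain t3 s3 h6 where s3: "exec (calls p) s2 t3 s3" "rel h6 s3"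
    "\<forall>x. x \<noteq> 3 \<longrightarrow> nv h6 x = nv h5 x" "\<forall>l. l \<noteq> 0 \<longrightarrow> arr h6 l = arr h5 l"
    "\<forall>c<Q. arr h6 0 c = \<mu> c" "t3 \<le> 60 * (\<Sum>c<Q. T c) + 40 * Q + 2"
    unfolding f5(1) by blast
  define h7 where "h7 = set_qv 11 1 (set_qv 10 0 h6)"
  define h8 where "h8 = run rows_code h7"
  define h9 where "h9 = run emit_code h8"
  have h9: "run phase3 h6 = h9" by (simp add: phase3_def h9_def h8_def h7_def)
  have h7i: "instances N (inst_adj G f) lab h7"
    using h5i s3(3,4) by (simp add: instances_def consts_ok_def h7_def)
  have f7: "nv h7 1 = n" "nv h7 2 = d" "nv h7 4 = Q" "arr h7 3 = ?rep" "arr h7 11 = (\<lambda>_ _. 0)"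
    "\<And>v. v < N \<Longrightarrow> arr h7 7 0 v = of_nat (rank lab v)" "\<And>c. c < Q \<Longrightarrow> arr h7 0 c = \<mu> c"
    using s3(3-5) f5 rank5 by (simp_all add: h7_def)
  have lenE: "length e \<le> B" if "c < Q" "e \<in> set (E c)" for c e
  proof -
    have "length e \<le> card (members N lab c)" using R(4)[OF that(1)] that(2) by (simp add: piece_result_def)
    also have "\<dots> \<le> card {..<N}" by (intro card_mono) (auto simp: members_def)
    finally show ?thesis using NB(1) by simp
  qed
  \<comment> \<open>A system has at most as many equations as its piece has instances, so the rounds
    for equations and for ends of pieces number at most N + Q.\<close>
  have "(\<Sum>c<Q. length (E c) + 1) \<le> (\<Sum>c<Q. card (members N lab c) + 1)"
    using R(4) by (intro sum_mono) (auto simp: piece_result_def)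
  also have "\<dots> = N + Q" unfolding sum.distrib sum_card_members[OF t4(1)] by simp
  finally have steps: "(\<Sum>c<Q. length (E c) + 1) \<le> B" using NB(4) by simp
  have mem7: "memory_starts_with (arr h7 0 c) (encode_system (E c))" if "c < Q" for c
    using R(3)[OF that] f7(7)[OF that] by simp
  have col: "collected n N Q lab ?rep E Q 0 h8"
    using rows_code_correct[OF h7i NB(1) f7(1) NB(3) f7(3) f7(6) mem7 lenE steps f7(5)]
    unfolding h8_def f7(4) .
  define k where "k = nv h8 25"
  have "k = card (flagged 11 n h8)" using col by (simp add: k_def collected_def)
  also have "\<dots> \<le> card {..<n}" by (intro card_mono) (auto simp: flagged_def)
  finally have kn: "k \<le> n" by simp
  have f8: "consts_ok h8" "nv h8 2 = d" "nv h8 1 = n"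
    using h7i f7 by (simp_all add: h8_def instances_def consts_ok_def run_nv run_qv)
  have "k * (1 + 2 * n) \<le> n * (1 + 2 * n)" using kn by (rule mult_le_mono1)
  also have "\<dots> = n + 2 * (n * n)" by (simp add: algebra_simps)
  finally have out_len: "1 + k * (1 + 2 * n) \<le> d" using big nn by linarith
  let ?E = "dense_system n (arr h8 12) k"
  have kB: "k \<le> B" using kn NB(3) by simp
  have em: "emitted d (encode_system ?E) h9"
    unfolding h9_def by (rule emit_code_correct[OF f8(1,2) dR D_def f8(3) NB(3) k_def[symmetric] kB out_len])
  obtain t4' s4 where s4: "exec (compile phase3) s3 t4' s4" "rel h9 s4" "t4' \<le> cost phase3 * (B + 1) ^ 3"
    using compile_correct[OF phase3_ok(1) s3(2)] unfolding h9 phase3_ok(2) by blast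
  have "nv h9 2 = d" using f8(2) by (simp add: h9_def run_nv)
  then have "s4 (ncell 2) = of_nat d" using relD(4)[OF s4(2), of 2] by simp
  then obtain t5 s5 where s5: "exec epilogue s4 t5 s5" "t5 \<le> 500" "\<And>a. s5 a = s4 (slot d a)"
    using epilogue_correct[OF _ dR] by blast
  have start: "memory_starts_with s5 (encode_system ?E)"
    unfolding memory_starts_with_def
  proof (intro allI impI)
    fix a assume a: "a < length (encode_system ?E)"
    have "length (encode_system ?E) \<le> d" using out_len unfolding encode_dense by simp
    then have "a < d" using a by simp
    from slot_bounds[OF dR this D_def] have "s4 (slot d a) = raw h9 (slot d a)" using relD(7)[OF s4(2)] by blast
    then show "s5 a = encode_system ?E ! a" using em a s5(3) by (simp add: emitted_def)
  qed
  let ?t = "t1 + (t2 + (t3 + (t4' + t5)))"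
  have ex: "exec (main_program p) ?s0 ?t s5"
    unfolding main_program_def by (intro exec_Seq[OF s1(1)] exec_Seq[OF s2(1)] exec_Seq[OF s3(1)] exec_Seq[OF s4(1)] s5(1))
  have sys: "well_covering_system G (denoted_system vs ?E)"
    unfolding well_covering_system_def
  proof
    fix w :: "'a \<Rightarrow> real"
    let ?w = "\<lambda>z. w (vs ! z)"
    have "well_covered_weighting G w \<longleftrightarrow> (\<forall>c<Q. wc (inst_adj G f) (members N lab c) (expanded vs ?rep w))"
      by (rule decompD(8)[OF t4(1)])
    also have "\<dots> \<longleftrightarrow> (\<forall>c<Q. \<forall>eq\<in>set (E c). dotp n (xrow N lab ?rep c eq) ?w = 0)"
      using R(4) unfolding piece_result_def n_def by blast
    also have "\<dots> \<longleftrightarrow> (\<forall>i<k. dotp n (arr h8 12 i) ?w = 0)"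
      using col unfolding collected_def k_def by (metis less_nat_zero_code)
    also have "\<dots> \<longleftrightarrow> (\<forall>a\<in>set (denoted_system vs ?E). (\<Sum>v\<in>verts G. a v * w v) = 0)"
      unfolding n_def denoted_dense[OF P(1)] P(2)[symmetric] set_map ball_simps dense_row_dotp[OF P(1)]
      by (simp add: atLeast0LessThan Ball_def)
    finally show "well_covered_weighting G w \<longleftrightarrow> (\<forall>a\<in>set (denoted_system vs ?E). (\<Sum>v\<in>verts G. a v * w v) = 0)" .
  qed
  have kindE: "kind G (denoted_system vs ?E)"
    unfolding K(2)
  proof (intro ballI)
    fix a v assume a: "a \<in> set (denoted_system vs ?E)" and v: "v \<in> verts G"
    obtain i where i: "i < k" "a = (\<lambda>v. \<Sum>z<length vs. if vs ! z = v then of_rat (arr h8 12 i z) else 0)"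
      using a unfolding n_def denoted_dense[OF P(1)] by auto
    obtain z where z: "z < length vs" "v = vs ! z" using v P(2) by (metis in_set_conv_nth)
    have av: "a v = of_rat (arr h8 12 i z)" unfolding i(2) z(2) by (rule dense_row_value[OF P(1) z(1)])
    obtain c eq where ceq: "c < Q" "eq \<in> set (E c)" "\<forall>z<n. arr h8 12 i z = xrow N lab ?rep c eq z"
      using col i(1) unfolding collected_def k_def by blast
    then have "arr h8 12 i z = xrow N lab ?rep c eq z" using z(1) by (simp add: n_def)
    then show "a v \<in> K"
      unfolding av using xrow_value[OF t4(1) z(1), of c eq] K(1) R(4)[OF ceq(1)] ceq(2)
      by (auto simp: piece_result_def)
  qed
  have lenD: "length (denoted_system vs ?E) \<le> n" using kn by (simp add: denoted_system_def dense_system_def)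
  have time: "real ?t \<le> 60 * g (2 * real n) (real m) + real time_factor * real n ^ 3"
  proof -
    have "real (\<Sum>c<Q. T c) \<le> (\<Sum>c<Q. g (card (members N lab c)) (card (edges (piece_graph G N f lab c))))"
      unfolding of_nat_sum using R(2) by (intro sum_mono) simp
    also have "\<dots> \<le> g (\<Sum>c<Q. card (members N lab c)) (\<Sum>c<Q. card (edges (piece_graph G N f lab c)))"
      using superadditive_sum[OF g(2,1), of "{..<Q}" "\<lambda>c. real (card (members N lab c))"
          "\<lambda>c. real (card (edges (piece_graph G N f lab c)))"] by simp
    also have "\<dots> \<le> g (2 * real n) (real m)"
    proof (rule superadditive_mono[OF g(2,1)])
      have "(\<Sum>c<Q. card (members N lab c)) \<le> 2 * n" using sum_card_members[OF t4(1)] bounds(3) by simp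
      then show "real (\<Sum>c<Q. card (members N lab c)) \<le> 2 * real n" by linarith
      have "(\<Sum>c<Q. card (edges (induced G (f ` members N lab c)))) \<le> card (edges G)"
        using decompD(5)[OF t4(1)] by (intro sum_card_edges_pieces[OF G(1)]) blast+
      then show "real (\<Sum>c<Q. card (edges (piece_graph G N f lab c))) \<le> real m"
        unfolding piece_graph_def m_def P(4) of_nat_le_iff .
    qed (simp_all add: sum_nonneg)
    finally have ST: "real (\<Sum>c<Q. T c) \<le> g (2 * real n) (real m)" .
    have "(B + 1) ^ 3 \<le> (5 * n) ^ 3" using n1 by (intro power_mono) (auto simp: B_def)
    then have B3: "(B + 1) ^ 3 \<le> 125 * n ^ 3" by (simp add: power_mult_distrib)
    have "t2 + t4' \<le> cost phase1 * (125 * n ^ 3) + cost phase3 * (125 * n ^ 3)"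
      using s2(3) s4(3) B3 by (meson add_mono le_trans mult_le_mono2)
    also have "\<dots> = 125 * (cost phase1 + cost phase3) * n ^ 3" by (simp add: algebra_simps)
    finally have c13: "t2 + t4' \<le> 125 * (cost phase1 + cost phase3) * n ^ 3" .
    have n3: "n \<le> n ^ 3" "1 \<le> n ^ 3" using n1 by (simp_all add: self_le_power)
    have "?t \<le> 60 * (\<Sum>c<Q. T c) + time_factor * n ^ 3"
      using c13 n3 s1(2) s3(6) s5(2) bounds(2) unfolding time_factor_def add_mult_distrib by linarith
    then have "real ?t \<le> real (60 * (\<Sum>c<Q. T c) + time_factor * n ^ 3)" using of_nat_le_iff by blast
    then show ?thesis using ST by simp
  qed
  show ?thesis
    using ex time dense_sparse[of n "arr h8 12" k] start sys kindE lenD unfolding n_def m_def by blast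
qed

theorem theorem3p6:
  fixes \<G> :: "'a ugraph set"
    and f :: "real \<Rightarrow> real \<Rightarrow> real"
    and kind :: "'a ugraph \<Rightarrow> 'a lin_system \<Rightarrow> bool"
  assumes "\<forall>G\<in>\<G>. simple_graph G"
    and "kind \<in> {rational_system, integer_system, unit_system}"
    and "\<forall>x\<ge>0. \<forall>y\<ge>0. 0 \<le> f x y"
    and "superadditive f"
    and "\<exists>p. computes_well_covering_systems p
           {G \<in> prime_induced_subgraphs \<G>. 1 \<le> card (edges G)} kind
           (\<lambda>n m. f (real n) (real m))"
  shows "\<exists>p T. computes_well_covering_systems p \<G> kind T \<and>
           (\<exists>C. \<forall>n\<ge>1. \<forall>m. T n m \<le> C * (f (2 * real n) (real m) + real n powr (\<omega> + 1)))"
proof -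
  obtain p where p: "computes_well_covering_systems p
           {G \<in> prime_induced_subgraphs \<G>. 1 \<le> card (edges G)} kind
           (\<lambda>n m. f (real n) (real m))" using assms(5) by blast
  obtain K where K: "0 \<in> K" "\<And>(G :: 'a ugraph) S. kind G S \<longleftrightarrow> (\<forall>a\<in>set S. \<forall>v\<in>verts G. a v \<in> K)"
    using kind_values[OF assms(2)] by blast
  \<comment> \<open>The 2 leaves room for the edgeless case; the additional 1 in the next claim pays
    for the initial test of cells 2 and 3.\<close>
  define T where "T n m = 2 + (60 * f (2 * real n) (real m) + real time_factor * real n ^ 3)" for n m :: nat
  have "computes_well_covering_systems (full_program p) \<G> kind (\<lambda>n m. 1 + T n m)"
    unfolding computes_well_covering_systems_def
  proof (intro ballI allI impI)
    fix G vs es assume G: "G \<in> \<G>" and pr: "presents vs es G"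
    have sG: "simple_graph G" using assms(1) G by blast
    note P = presentation[OF sG pr]
    let ?s0 = "initial_memory (encode_graph vs es)"
    have nonneg: "0 \<le> 60 * f (2 * real (length vs)) (real (length es)) + real time_factor * real (length vs) ^ 3"
      using assms(3) by simp
    show "\<exists>t s E. exec (full_program p) ?s0 t s \<and> real t \<le> 1 + T (card (verts G)) (card (edges G)) \<and>
          sparse_for (card (verts G)) E \<and> memory_starts_with s (encode_system E) \<and>
          well_covering_system G (denoted_system vs E) \<and> kind G (denoted_system vs E) \<and>
          length (denoted_system vs E) \<le> card (verts G)"
    \<comment> \<open>Edgeless graphs, among them all with fewer than two vertices, are answered
      directly: the initial decomposition demands two vertices, and the prologue a positive m to
      obtain a nonzero \<open>d\<close>.\<close>
    proof (cases "es = []")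
      case True
      have "?s0 2 = 0" "?s0 3 = 0" using input_cells(5)[of es _ vs] True by simp_all
      then have "test (Equal 2 3) ?s0" by simp
      from exec_BranchTrue[OF this exec_Const] have ex: "exec (full_program p) ?s0 (Suc 1) (?s0(0 := 0))"
        unfolding full_program_def .
      have "\<not> adjacent G x y" if xy: "x \<in> verts G" "y \<in> verts G" for x y
      proof -
        obtain i j where "i < length vs" "x = vs ! i" "j < length vs" "y = vs ! j"
          using xy unfolding P(2)[symmetric] in_set_conv_nth by blast
        then show ?thesis using P(7)[of i j] True by simp
      qed
      then have "wc (adjacent G) (verts G) w" for w by (intro edgeless_wc)
      then have "well_covered_weighting G w" for w
        using wc_induced[OF sG, of "verts G" w] unfolding induced_verts[OF sG] by blast
      then have "well_covering_system G (denoted_system vs [])"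
        by (simp add: well_covering_system_def denoted_system_def)
      moreover have "kind G (denoted_system vs [])" unfolding K(2) by (simp add: denoted_system_def)
      moreover have "memory_starts_with (?s0(0 := 0)) (encode_system [])"
        by (simp add: memory_starts_with_def encode_system_def)
      moreover have "real (Suc 1) \<le> 1 + T (card (verts G)) (card (edges G))"
        using nonneg unfolding T_def P(3,4) by simp
      ultimately show ?thesis
        using ex by (intro exI[of _ "Suc 1"] exI[of _ "?s0(0 := 0)"] exI[of _ "[]"])
          (simp add: sparse_for_def denoted_system_def)
    next
      case False
      obtain t s E where r: "exec (main_program p) ?s0 t s"
        "real t \<le> 60 * f (2 * real (length vs)) (real (length es)) + real time_factor * real (length vs) ^ 3"
        "sparse_for (length vs) E" "memory_starts_with s (encode_system E)"
        "well_covering_system G (denoted_system vs E)" "kind G (denoted_system vs E)"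
        "length (denoted_system vs E) \<le> length vs"
        using main_program_correct[OF sG G pr False K p assms(3,4)] by blast
      have q: "0 < length es" using False by simp
      then have "es ! 0 \<in> set es" by simp
      then have "fst (es ! 0) \<noteq> snd (es ! 0)" using P(5) by (auto simp: split_beta)
      then have "\<not> test (Equal 2 3) ?s0"
        using input_cells(3,4)[of 0 es vs, OF q] by simp
      from exec_BranchFalse[OF this r(1)] have "exec (full_program p) ?s0 (Suc t) s"
        unfolding full_program_def .
      moreover have "real (Suc t) \<le> 1 + T (card (verts G)) (card (edges G))"
        using r(2) unfolding T_def P(3,4) by simp
      ultimately show ?thesis using r(3-7) unfolding P(3) by blast
    qed
  qed
  \<comment> \<open>The left side is 3 plus 60 times the value of f plus \<open>time_factor\<close>
    times n^3; it is bounded termwise, using 1 \<le> n^3 \<le> n^(\<omega> + 1).\<close>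
  moreover have "1 + T n m \<le> real (63 + time_factor) * (f (2 * real n) (real m) + real n powr (\<omega> + 1))"
    if n: "1 \<le> n" for n m
  proof -
    have f0: "0 \<le> f (2 * real n) (real m)" using assms(3) by simp
    have n3: "real n ^ 3 \<le> real n powr (\<omega> + 1)" using cube_le_powr_exponent[OF n] .
    have "1 \<le> real n ^ 3" using n by simp
    then have n1: "1 \<le> real n powr (\<omega> + 1)" using n3 by linarith
    have "real time_factor * real n ^ 3 \<le> real time_factor * real n powr (\<omega> + 1)"
      using n3 by (intro mult_left_mono) auto
    moreover have "0 \<le> real time_factor * f (2 * real n) (real m)" using f0 by simp
    ultimately show ?thesis
      unfolding T_def of_nat_add distrib_left distrib_right of_nat_numeral using f0 n1 by linarith
  qed
  ultimately show ?thesis by blast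
qed

end
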